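(* Let $p$ be an odd prime and $\Lambda=\mathbb{Z}[G(p,p-1)]$. Then the $\Lambda$-module $R(2)\oplus[y-1)$ is full.
   Context: Modules are right modules. For an odd prime $p$, $G(p,p-1)=\langle x,y\mid x^p=1,\ y^{p-1}=1,\ yx=x^my\rangle$, where $m$ is an integer of multiplicative order $p-1$ modulo $p$, and $\Lambda=\mathbb{Z}[G(p,p-1)]$. The symbol $[y-1)$ denotes the right ideal $(y-1)\Lambda$. Let $\mathcal{T}_{p-1}=\{(a_{i,j})\in M_{p-1}(\mathbb{Z})\mid a_{i,j}\in p\mathbb{Z}\text{ if }i>j\}$. There is a surjective ring homomorphism $\tilde\lambda:\Lambda\to\mathcal{T}_{p-1}$, realized as follows. Let $\zeta=e^{2\pi i/p}$ and let $\sigma$ be the automorphism of $\mathbb{Z}[\zeta]$ with $\sigma(\zeta)=\zeta^m$. Let $\Lambda$ act on the right on the ideal $(\zeta-1)\mathbb{Z}[\zeta]$ by $v\cdot x=v\zeta$, $v\cdot y=\sigma^{-1}(v)$; $\tilde\lambda(a)$ is the matrix of $v\mapsto v\cdot a$ acting on row vectors with respect to the $\mathbb{Z}$-basis $(\zeta-1)^j$, $1\le j\le p-1$. Then $\mathcal{T}_{p-1}$ is a right $\Lambda$-module via $t\cdot a=t\,\tilde\lambda(a)$, and $R(i)$ denotes its $i$-th row, i.e. $R(i)=\{(r_1,\dots,r_{p-1})\in\mathbb{Z}^{p-1}\mid r_j\in p\mathbb{Z}\text{ for }j<i\}$. Thus $\mathcal{T}_{p-1}\cong\bigoplus_{i=1}^{p-1}R(i)$,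 and $R(i)$ is isomorphic to the ideal $(\zeta-1)^i\mathbb{Z}[\zeta]$ with the right $\Lambda$-action $v\cdot x=v\zeta$, $v\cdot y=\sigma^{-1}(v)$. Derived module category: $\mathrm{Hom}_{\mathcal{D}er}(M,N)$ is the quotient of $\mathrm{Hom}_\Lambda(M,N)$ by the subgroup of homomorphisms factoring through a projective module; $\mathrm{Aut}_{\mathcal{D}er}(M)$ is the unit group of $\mathrm{End}_{\mathcal{D}er}(M)$, and $v^M:\mathrm{Aut}_\Lambda(M)\to\mathrm{Aut}_{\mathcal{D}er}(M)$ is the natural map. Swan homomorphism: for a $\Lambda$-lattice $J$ (finitely generated, $\mathbb{Z}$-free), choose an injection $i:J\to F$ with $F$ finitely generated free and $F/i(J)$ torsion free. If $\alpha\in\mathrm{End}_\Lambda(J)$ represents an element $\overline\alpha\in\mathrm{Aut}_{\mathcal{D}er}(J)$, the pushout $\varinjlim(\alpha,i)$ of $\alpha$ and $i$ is projective, and $S_J(\overline\alpha)\in\tilde K_0(\Lambda)$ is its class in the reduced projective class group. This gives a homomorphism $S_J:\mathrm{Aut}_{\mathcal{D}er}(J)\to\tilde K_0(\Lambda)$. The module $J$ is full if $\mathrm{Im}(v^J)=\mathrm{Ker}(S_J)$. *)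

theory Defs
  imports
    "HOL-Algebra.QuotRing"
    "HOL-Number_Theory.Number_Theory"
    "HOL-Computational_Algebra.Polynomial"
    Complex_Main
begin

section \<open>Right modules over a ring\<close>

text \<open>
  The locale \<open>module\<close> of the library is about commutative rings only. For right modules,
  only the additive structure and the action are used; the fields \<open>mult\<close> and \<open>one\<close>
  inherited from \<open>ring\<close> carry no information.
\<close>

record ('a, 'b) rmodule = "'b ring" +
  act :: "'b \<Rightarrow> 'a \<Rightarrow> 'b"  (infixl "\<triangleleft>\<index>" 70)

locale right_module = R?: ring R + M?: abelian_group M
  for R :: "('a, 'd) ring_scheme" (structure)
    and M :: "('a, 'b, 'c) rmodule_scheme" (structure) +
  assumes act_closed: "\<lbrakk>v \<in> carrier M; a \<in> carrier R\<rbrakk> \<Longrightarrow> v \<triangleleft>\<^bsub>M\<^esub> a \<in> carrier M"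
    and act_add_left: "\<lbrakk>v \<in> carrier M; w \<in> carrier M; a \<in> carrier R\<rbrakk>
      \<Longrightarrow> (v \<oplus>\<^bsub>M\<^esub> w) \<triangleleft>\<^bsub>M\<^esub> a = v \<triangleleft>\<^bsub>M\<^esub> a \<oplus>\<^bsub>M\<^esub> w \<triangleleft>\<^bsub>M\<^esub> a"
    and act_add_right: "\<lbrakk>v \<in> carrier M; a \<in> carrier R; b \<in> carrier R\<rbrakk>
      \<Longrightarrow> v \<triangleleft>\<^bsub>M\<^esub> (a \<oplus>\<^bsub>R\<^esub> b) = v \<triangleleft>\<^bsub>M\<^esub> a \<oplus>\<^bsub>M\<^esub> v \<triangleleft>\<^bsub>M\<^esub> b"
    and act_assoc: "\<lbrakk>v \<in> carrier M; a \<in> carrier R; b \<in> carrier R\<rbrakk>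
      \<Longrightarrow> v \<triangleleft>\<^bsub>M\<^esub> (a \<otimes>\<^bsub>R\<^esub> b) = (v \<triangleleft>\<^bsub>M\<^esub> a) \<triangleleft>\<^bsub>M\<^esub> b"
    and act_one: "v \<in> carrier M \<Longrightarrow> v \<triangleleft>\<^bsub>M\<^esub> \<one>\<^bsub>R\<^esub> = v"

definition rmod_of ::
    "'b set \<Rightarrow> 'b \<Rightarrow> ('b \<Rightarrow> 'b \<Rightarrow> 'b) \<Rightarrow> ('b \<Rightarrow> 'a \<Rightarrow> 'b) \<Rightarrow> ('a, 'b) rmodule"
  where "rmod_of C z ad ac =
    \<lparr>carrier = C, monoid.mult = undefined, one = undefined, zero = z, add = ad, act = ac\<rparr>"

definition dsum :: "('a, 'b) rmodule \<Rightarrow> ('a, 'c) rmodule \<Rightarrow> ('a, 'b \<times> 'c) rmodule"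
  where "dsum M N = rmod_of (carrier M \<times> carrier N) (\<zero>\<^bsub>M\<^esub>, \<zero>\<^bsub>N\<^esub>)
    (\<lambda>(v, w) (v', w'). (v \<oplus>\<^bsub>M\<^esub> v', w \<oplus>\<^bsub>N\<^esub> w'))
    (\<lambda>(v, w) a. (v \<triangleleft>\<^bsub>M\<^esub> a, w \<triangleleft>\<^bsub>N\<^esub> a))"

definition free_rmod :: "'a ring \<Rightarrow> 'i set \<Rightarrow> ('a, 'i \<Rightarrow> 'a) rmodule"
  where "free_rmod R I = rmod_of
    {f. (\<forall>i\<in>I. f i \<in> carrier R) \<and> (\<forall>i. i \<notin> I \<longrightarrow> f i = \<zero>\<^bsub>R\<^esub>) \<and> finite {i. f i \<noteq> \<zero>\<^bsub>R\<^esub>}}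
    (\<lambda>i. \<zero>\<^bsub>R\<^esub>) (\<lambda>f g i. f i \<oplus>\<^bsub>R\<^esub> g i) (\<lambda>f a i. f i \<otimes>\<^bsub>R\<^esub> a)"

definition quot_rmod :: "('a, 'b) rmodule \<Rightarrow> 'b set \<Rightarrow> ('a, 'b set) rmodule"
  where "quot_rmod M N = rmod_of (a_rcosets\<^bsub>M\<^esub> N) N (set_add M)
    (\<lambda>X a. \<Union>v\<in>X. N +>\<^bsub>M\<^esub> (v \<triangleleft>\<^bsub>M\<^esub> a))"

definition right_ideal :: "'a ring \<Rightarrow> 'a \<Rightarrow> ('a, 'a) rmodule"
  where "right_ideal R r =
    rmod_of {r \<otimes>\<^bsub>R\<^esub> a | a. a \<in> carrier R} \<zero>\<^bsub>R\<^esub> (add R) (monoid.mult R)"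

text \<open>Homomorphisms are extensional, so that equality of homomorphisms is equality in HOL.\<close>

definition rhom :: "'a ring \<Rightarrow> ('a, 'b) rmodule \<Rightarrow> ('a, 'c) rmodule \<Rightarrow> ('b \<Rightarrow> 'c) set"
  where "rhom R M N = {f \<in> carrier M \<rightarrow>\<^sub>E carrier N.
    (\<forall>v\<in>carrier M. \<forall>w\<in>carrier M. f (v \<oplus>\<^bsub>M\<^esub> w) = f v \<oplus>\<^bsub>N\<^esub> f w) \<and>
    (\<forall>v\<in>carrier M. \<forall>a\<in>carrier R. f (v \<triangleleft>\<^bsub>M\<^esub> a) = f v \<triangleleft>\<^bsub>N\<^esub> a)}"

definition rmod_iso :: "'a ring \<Rightarrow> ('a, 'b) rmodule \<Rightarrow> ('a, 'c) rmodule \<Rightarrow> bool"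
  where "rmod_iso R M N \<longleftrightarrow> (\<exists>f\<in>rhom R M N. bij_betw f (carrier M) (carrier N))"

definition rend :: "'a ring \<Rightarrow> ('a, 'b) rmodule \<Rightarrow> ('b \<Rightarrow> 'b) ring"
  where "rend R M =
    \<lparr>carrier = rhom R M M,
     monoid.mult = (\<lambda>f g. compose (carrier M) f g),
     one = (\<lambda>v\<in>carrier M. v),
     zero = (\<lambda>v\<in>carrier M. \<zero>\<^bsub>M\<^esub>),
     add = (\<lambda>f g. \<lambda>v\<in>carrier M. f v \<oplus>\<^bsub>M\<^esub> g v)\<rparr>"

definition fin_gen :: "'a ring \<Rightarrow> ('a, 'b) rmodule \<Rightarrow> bool"
  where "fin_gen R M \<longleftrightarrow> (\<exists>S. finite S \<and> S \<subseteq> carrier M \<and>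
    (\<forall>v\<in>carrier M. \<exists>c\<in>S \<rightarrow> carrier R. v = (\<Oplus>\<^bsub>M\<^esub>s\<in>S. s \<triangleleft>\<^bsub>M\<^esub> c s)))"

text \<open>
  Projective: direct summand of a free module. The types are no restriction: a projective
  module \<open>P\<close> is a summand of the free module on the set \<open>carrier P\<close>, and a complement can be
  found inside that free module.
\<close>

definition projective :: "'a ring \<Rightarrow> ('a, 'b) rmodule \<Rightarrow> bool"
  where "projective R P \<longleftrightarrow> right_module R P \<and>
    (\<exists>(Q :: ('a, 'b \<Rightarrow> 'a) rmodule) (I :: 'b set).
       right_module R Q \<and> rmod_iso R (dsum P Q) (free_rmod R I))"

definition torsion_free :: "('a, 'b) rmodule \<Rightarrow> bool"
  where "torsion_free M \<longleftrightarrow>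
    (\<forall>(k::int) v. v \<in> carrier M \<and> [k] \<cdot>\<^bsub>M\<^esub> v = \<zero>\<^bsub>M\<^esub> \<longrightarrow> k = 0 \<or> v = \<zero>\<^bsub>M\<^esub>)"


section \<open>The derived module category\<close>

text \<open>
  The intermediate projective module ranges over all projective modules with elements in
  \<open>nat \<Rightarrow> 'a\<close>. If \<open>M\<close> is finitely generated, then a homomorphism from \<open>M\<close> factoring through any
  projective module also factors through some \<open>free_rmod R {..<n}\<close>, which lives in this type.
\<close>

definition null_homs ::
    "'a ring \<Rightarrow> ('a, 'b) rmodule \<Rightarrow> ('a, 'c) rmodule \<Rightarrow> ('b \<Rightarrow> 'c) set"
  where "null_homs R M N = {f \<in> rhom R M N.
    \<exists>P :: ('a, nat \<Rightarrow> 'a) rmodule. projective R P \<and>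
      (\<exists>g\<in>rhom R M P. \<exists>h\<in>rhom R P N. f = compose (carrier M) h g)}"

definition der_end :: "'a ring \<Rightarrow> ('a, 'b) rmodule \<Rightarrow> ('b \<Rightarrow> 'b) set ring"
  where "der_end R M = rend R M Quot null_homs R M M"

definition der_aut :: "'a ring \<Rightarrow> ('a, 'b) rmodule \<Rightarrow> ('b \<Rightarrow> 'b) set monoid"
  where "der_aut R M = units_of (der_end R M)"

definition rmod_aut :: "'a ring \<Rightarrow> ('a, 'b) rmodule \<Rightarrow> ('b \<Rightarrow> 'b) monoid"
  where "rmod_aut R M = units_of (rend R M)"

definition der_map :: "'a ring \<Rightarrow> ('a, 'b) rmodule \<Rightarrow> ('b \<Rightarrow> 'b) \<Rightarrow> ('b \<Rightarrow> 'b) set"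
  where "der_map R M f = null_homs R M M +>\<^bsub>rend R M\<^esub> f"


section \<open>The reduced projective class group and the Swan homomorphism\<close>

text \<open>
  The elements of the reduced projective class group are the stable classes of finitely
  generated projective modules, where \<open>P\<close> and \<open>Q\<close> are stably equivalent if
  \<open>P \<oplus> R\<^sup>m\<close> and \<open>Q \<oplus> R\<^sup>n\<close> are isomorphic for some \<open>m\<close> and \<open>n\<close>; the operation is the direct
  sum. A class is represented by its members among the modules with elements in \<open>nat \<Rightarrow> 'a\<close>;
  every finitely generated projective module is isomorphic to one of these.
\<close>

definition fg_projective :: "'a ring \<Rightarrow> ('a, 'b) rmodule \<Rightarrow> bool"
  where "fg_projective R P \<longleftrightarrow> projective R P \<and> fin_gen R P"

definition stable_class ::
    "'a ring \<Rightarrow> ('a, 'b) rmodule \<Rightarrow> ('a, nat \<Rightarrow> 'a) rmodule set"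
  where "stable_class R P = {Q. fg_projective R Q \<and>
    (\<exists>(m :: nat) (n :: nat). rmod_iso R (dsum P (free_rmod R {..<m})) (dsum Q (free_rmod R {..<n})))}"

definition reduced_K0 :: "'a ring \<Rightarrow> ('a, nat \<Rightarrow> 'a) rmodule set monoid"
  where "reduced_K0 R =
    \<lparr>carrier = {stable_class R P | P :: ('a, nat \<Rightarrow> 'a) rmodule. fg_projective R P},
     monoid.mult = (\<lambda>A B. \<Union>P\<in>A. \<Union>Q\<in>B. stable_class R (dsum P Q)),
     one = stable_class R (free_rmod R ({} :: nat set))\<rparr>"

definition pushout ::
    "('a, 'b) rmodule \<Rightarrow> ('a, 'c) rmodule \<Rightarrow> ('a, 'd) rmodule \<Rightarrow>
     ('b \<Rightarrow> 'c) \<Rightarrow> ('b \<Rightarrow> 'd) \<Rightarrow> ('a, ('c \<times> 'd) set) rmodule"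
  where "pushout J M N f g =
    quot_rmod (dsum M N) {(f v, \<ominus>\<^bsub>N\<^esub> g v) | v. v \<in> carrier J}"

definition swan_embedding ::
    "'a ring \<Rightarrow> ('a, 'b) rmodule \<Rightarrow> nat \<Rightarrow> ('b \<Rightarrow> nat \<Rightarrow> 'a) \<Rightarrow> bool"
  where "swan_embedding R J n i \<longleftrightarrow>
    i \<in> rhom R J (free_rmod R {..<n}) \<and> inj_on i (carrier J) \<and>
    torsion_free (quot_rmod (free_rmod R {..<n}) (i ` carrier J))"

text \<open>
  For a lattice \<open>J\<close> over an integral group ring, the value does not depend on the choice of the
  embedding into a finitely generated free module or of the representative \<open>\<alpha>\<close>.
\<close>

definition swan ::
    "'a ring \<Rightarrow> ('a, 'b) rmodule \<Rightarrow> ('b \<Rightarrow> 'b) set \<Rightarrow> ('a, nat \<Rightarrow> 'a) rmodule set"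
  where "swan R J c = (SOME k. \<exists>n i \<alpha>. swan_embedding R J n i \<and> \<alpha> \<in> c \<and>
    k = stable_class R (pushout J J (free_rmod R {..<n}) \<alpha> i))"

definition full :: "'a ring \<Rightarrow> ('a, 'b) rmodule \<Rightarrow> bool"
  where "full R J \<longleftrightarrow>
    der_map R J ` carrier (rmod_aut R J) = kernel (der_aut R J) (reduced_K0 R) (swan R J)"


section \<open>Groups given by generators and relations; group rings\<close>

text \<open>
  In a word, \<open>(s, True)\<close> is the generator \<open>s\<close> and \<open>(s, False)\<close> its formal inverse. A relation
  \<open>u = v\<close> is given as the pair \<open>(u, v)\<close>.
\<close>

type_synonym 's word = "('s \<times> bool) list"

inductive word_eq :: "('s word \<times> 's word) set \<Rightarrow> 's word \<Rightarrow> 's word \<Rightarrow> bool"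
  for rels where
  word_eq_refl: "word_eq rels u u"
| word_eq_sym: "word_eq rels u v \<Longrightarrow> word_eq rels v u"
| word_eq_trans: "\<lbrakk>word_eq rels u v; word_eq rels v w\<rbrakk> \<Longrightarrow> word_eq rels u w"
| word_eq_append: "\<lbrakk>word_eq rels u u'; word_eq rels v v'\<rbrakk> \<Longrightarrow> word_eq rels (u @ v) (u' @ v')"
| word_eq_cancel: "word_eq rels [(s, b), (s, \<not> b)] []"
| word_eq_rel: "(u, v) \<in> rels \<Longrightarrow> word_eq rels u v"

definition word_class :: "('s word \<times> 's word) set \<Rightarrow> 's word \<Rightarrow> 's word set"
  where "word_class rels u = {v. word_eq rels u v}"

definition presented_group :: "('s word \<times> 's word) set \<Rightarrow> 's word set monoid"
  where "presented_group rels =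
    \<lparr>carrier = range (word_class rels),
     monoid.mult = (\<lambda>A B. \<Union>u\<in>A. \<Union>v\<in>B. word_class rels (u @ v)),
     one = word_class rels []\<rparr>"

definition word_pow :: "'s \<Rightarrow> int \<Rightarrow> 's word"
  where "word_pow s k = replicate (nat \<bar>k\<bar>) (s, k \<ge> 0)"

definition group_ring :: "'g monoid \<Rightarrow> ('g \<Rightarrow> int) ring"
  where "group_ring G =
    \<lparr>carrier = {f. finite {g. f g \<noteq> 0} \<and> {g. f g \<noteq> 0} \<subseteq> carrier G},
     monoid.mult = (\<lambda>f h g. \<Sum>(a, b)\<in>{(a, b). f a \<noteq> 0 \<and> h b \<noteq> 0 \<and> a \<otimes>\<^bsub>G\<^esub> b = g}. f a * h b),
     one = (\<lambda>g. if g = \<one>\<^bsub>G\<^esub> then 1 else 0),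
     zero = (\<lambda>g. 0),
     add = (\<lambda>f h g. f g + h g)\<rparr>"

definition group_ring_elem :: "'g \<Rightarrow> 'g \<Rightarrow> int"
  where "group_ring_elem g = (\<lambda>h. if h = g then 1 else 0)"


section \<open>The group \<open>G(p, p - 1)\<close> and its integral group ring\<close>

datatype gen = X | Y

definition metacyclic_rels :: "nat \<Rightarrow> int \<Rightarrow> (gen word \<times> gen word) set"
  where "metacyclic_rels p m =
    {(word_pow X (int p), []),
     (word_pow Y (int p - 1), []),
     (word_pow Y 1 @ word_pow X 1, word_pow X m @ word_pow Y 1)}"

definition G_group :: "nat \<Rightarrow> int \<Rightarrow> gen word set monoid"
  where "G_group p m = presented_group (metacyclic_rels p m)"

definition Lam :: "nat \<Rightarrow> int \<Rightarrow> (gen word set \<Rightarrow> int) ring"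
  where "Lam p m = group_ring (G_group p m)"

definition y_elem :: "nat \<Rightarrow> int \<Rightarrow> gen word set \<Rightarrow> int"
  where "y_elem p m = group_ring_elem (word_class (metacyclic_rels p m) (word_pow Y 1))"


section \<open>The action on \<open>\<int>[\<zeta>]\<close> and the row modules\<close>

definition zeta :: "nat \<Rightarrow> complex"
  where "zeta p = cis (2 * pi / real p)"

definition Z_zeta :: "nat \<Rightarrow> complex ring"
  where "Z_zeta p =
    \<lparr>carrier = range (\<lambda>q :: int poly. poly (map_poly of_int q) (zeta p)),
     monoid.mult = (*), one = 1, zero = 0, add = (+)\<rparr>"

definition sigma :: "nat \<Rightarrow> int \<Rightarrow> complex \<Rightarrow> complex"
  where "sigma p m = (THE s. s \<in> ring_iso (Z_zeta p) (Z_zeta p) \<and>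
    s \<in> extensional (carrier (Z_zeta p)) \<and> s (zeta p) = zeta p powi m)"

fun letter_act :: "nat \<Rightarrow> int \<Rightarrow> complex \<Rightarrow> gen \<times> bool \<Rightarrow> complex"
  where
    "letter_act p m v (X, True) = v * zeta p"
  | "letter_act p m v (X, False) = v * inverse (zeta p)"
  | "letter_act p m v (Y, True) = inv_into (carrier (Z_zeta p)) (sigma p m) v"
  | "letter_act p m v (Y, False) = sigma p m v"

text \<open>
  Being a right action, a word acts by its letters from left to right; the result depends only
  on the class of the word.
\<close>

definition group_act :: "nat \<Rightarrow> int \<Rightarrow> complex \<Rightarrow> gen word set \<Rightarrow> complex"
  where "group_act p m v g = foldl (letter_act p m) v (SOME w. w \<in> g)"

definition Lam_act :: "nat \<Rightarrow> int \<Rightarrow> complex \<Rightarrow> (gen word set \<Rightarrow> int) \<Rightarrow> complex"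
  where "Lam_act p m v a = (\<Sum>g\<in>{g. a g \<noteq> 0}. of_int (a g) * group_act p m v g)"

text \<open>
  Row vectors and square matrices of size \<open>p - 1\<close> are indexed by \<open>{1..p - 1}\<close> and are zero
  outside this range. The matrix below belongs to the action on \<open>(\<zeta> - 1)\<int>[\<zeta>]\<close>: its \<open>j\<close>-th row
  consists of the coordinates of \<open>(\<zeta> - 1)\<^sup>j \<cdot> a\<close>.
\<close>

definition lam_mat :: "nat \<Rightarrow> int \<Rightarrow> (gen word set \<Rightarrow> int) \<Rightarrow> nat \<Rightarrow> nat \<Rightarrow> int"
  where "lam_mat p m a = (THE L.
    (\<forall>j k. j \<notin> {1..p - 1} \<or> k \<notin> {1..p - 1} \<longrightarrow> L j k = 0) \<and>
    (\<forall>j\<in>{1..p - 1}. Lam_act p m ((zeta p - 1) ^ j) a =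
       (\<Sum>k\<in>{1..p - 1}. of_int (L j k) * (zeta p - 1) ^ k)))"

text \<open>
  The \<open>i\<close>-th row of the ring of integral matrices whose entries below the diagonal are divisible
  by \<open>p\<close>; an element \<open>a\<close> of the group ring acts by right multiplication by \<open>lam_mat p m a\<close>.
\<close>

definition R_row :: "nat \<Rightarrow> int \<Rightarrow> nat \<Rightarrow> (gen word set \<Rightarrow> int, nat \<Rightarrow> int) rmodule"
  where "R_row p m i = rmod_of
    {r. (\<forall>j. j \<notin> {1..p - 1} \<longrightarrow> r j = 0) \<and> (\<forall>j<i. int p dvd r j)}
    (\<lambda>k. 0) (\<lambda>r s k. r k + s k)
    (\<lambda>r a k. \<Sum>j\<in>{1..p - 1}. r j * lam_mat p m a j k)"

end

theory Submission
  imports Defs "Jordan_Normal_Form.Char_Poly"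
begin

text \<open>
  Write \<open>B = [y - 1)\<close>, \<open>J = R(2) \<oplus> B\<close> and \<open>N = p - 1\<close>. Multiplication by \<open>p\<close> is null on \<open>R(2)\<close>
  and multiplication by \<open>N\<close> is null on \<open>B\<close>; as \<open>p - N = 1\<close>, all homomorphisms between \<open>R(2)\<close> and \<open>B\<close>
  are null. The endomorphisms of \<open>R(2)\<close> are integers, and an endomorphism of \<open>B\<close> is an integer up to
  null maps. A unit of \<open>\<int>/N\<close> is realised on \<open>B\<close> by left multiplication by
  \<open>1 + y + \<dots> + y\<^bsup>r-1\<^esup>\<close>, which is an automorphism. So every element of \<open>Aut(J)\<close> in the derived
  category is represented by some \<open>diag(a, \<tau>)\<close> with \<open>\<tau>\<close> an automorphism of \<open>B\<close>, and it lifts to an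
  automorphism of \<open>J\<close> if \<open>a \<equiv> \<plusminus>1\<close> modulo \<open>p\<close>.

  If its Swan class vanishes, there is an exact sequence \<open>0 \<rightarrow> J \<rightarrow> J \<oplus> \<Lambda>\<^sup>l \<rightarrow> \<Lambda>\<^sup>n \<rightarrow> 0\<close> whose first
  map is \<open>(diag(a, \<tau>), - i)\<close>. Apply \<open>Hom(-, W)\<close> to \<open>\<Lambda>\<^sup>l \<rightarrow> \<Lambda>\<^sup>n\<close>. For \<open>W = \<int>[\<langle>y\<rangle>]\<close>, realised as the
  right ideal generated by \<open>1 + x + \<dots> + x\<^bsup>p-1\<^esup>\<close>, there are no maps from \<open>R(2)\<close> to \<open>W\<close>, and the
  resulting matrix is invertible. For \<open>W = R(1)\<close> the maps from \<open>R(2)\<close> are the multiples of the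
  inclusion, which is null, and the determinant is \<open>\<plusminus>a\<close>. Modulo \<open>p\<close> the two matrices become block
  triangular with the same diagonal blocks: the simple constituents of \<open>W/p\<close> are in both cases the
  \<open>N\<close> characters of \<open>\<langle>y\<rangle>\<close>. Hence \<open>a \<equiv> \<plusminus>1\<close> modulo \<open>p\<close>.

  Conversely, the class of an automorphism \<open>f\<close> has a free pushout, because a null map extends along
  \<open>i\<close> and so changes \<open>(f, - i)\<close> only by a shear.
\<close>

section \<open>Linear maps between right modules\<close>

text \<open>The obstacle is the factor R(2): its automorphisms are \<plusminus>1, but its derived
  endomorphism ring is \<int>/p. So the Swan class has to be shown to detect a unit of \<int>/p up
  to sign. The invariant comes from the pullback square of \<Lambda> whose corners are the quotient
  by 1 + x + ... + x^(p-1), which is the matrix ring T, and the quotient by x - 1, which is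
  \<int>[<y>]; they are glued over the group ring of <y> over the field with p elements. R(1) is a
  row of the first corner and W = \<int>[<y>] is the second, so comparing determinants modulo p
  reads off the gluing without building the square. R(1) is a better target than R(2) itself: R(2)
  is not projective, so its identity is not null, whereas the null inclusion into R(1) extends along
  i and supplies the column that completes the matrix for R(1) to a unimodular one. Nullness on the
  side of R(2) rests on one trace identity: summing a coordinate functional over the group produces
  exactly the factor p, because the Galois trace of a p-th root of unity is p - 1 or -1.\<close>

lemma rmod_of_simps [simp]:
  "carrier (rmod_of C z ad ac) = C" "\<zero>\<^bsub>rmod_of C z ad ac\<^esub> = z"
  "add (rmod_of C z ad ac) = ad" "act (rmod_of C z ad ac) = ac"
  by (simp_all add: rmod_of_def)

lemma right_moduleI:
  assumes R: "ring R"
    and zero: "\<zero>\<^bsub>M\<^esub> \<in> carrier M"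
    and add: "\<And>v w. v \<in> carrier M \<Longrightarrow> w \<in> carrier M \<Longrightarrow> v \<oplus>\<^bsub>M\<^esub> w \<in> carrier M"
    and assoc: "\<And>u v w. u \<in> carrier M \<Longrightarrow> v \<in> carrier M \<Longrightarrow> w \<in> carrier M
      \<Longrightarrow> (u \<oplus>\<^bsub>M\<^esub> v) \<oplus>\<^bsub>M\<^esub> w = u \<oplus>\<^bsub>M\<^esub> (v \<oplus>\<^bsub>M\<^esub> w)"
    and comm: "\<And>v w. v \<in> carrier M \<Longrightarrow> w \<in> carrier M \<Longrightarrow> v \<oplus>\<^bsub>M\<^esub> w = w \<oplus>\<^bsub>M\<^esub> v"
    and l_zero: "\<And>v. v \<in> carrier M \<Longrightarrow> \<zero>\<^bsub>M\<^esub> \<oplus>\<^bsub>M\<^esub> v = v"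
    and inv: "\<And>v. v \<in> carrier M \<Longrightarrow> \<exists>w\<in>carrier M. w \<oplus>\<^bsub>M\<^esub> v = \<zero>\<^bsub>M\<^esub>"
    and "\<And>v a. v \<in> carrier M \<Longrightarrow> a \<in> carrier R \<Longrightarrow> v \<triangleleft>\<^bsub>M\<^esub> a \<in> carrier M"
    and "\<And>v w a. v \<in> carrier M \<Longrightarrow> w \<in> carrier M \<Longrightarrow> a \<in> carrier R
      \<Longrightarrow> (v \<oplus>\<^bsub>M\<^esub> w) \<triangleleft>\<^bsub>M\<^esub> a = v \<triangleleft>\<^bsub>M\<^esub> a \<oplus>\<^bsub>M\<^esub> w \<triangleleft>\<^bsub>M\<^esub> a"
    and "\<And>v a b. v \<in> carrier M \<Longrightarrow> a \<in> carrier R \<Longrightarrow> b \<in> carrier R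
      \<Longrightarrow> v \<triangleleft>\<^bsub>M\<^esub> (a \<oplus>\<^bsub>R\<^esub> b) = v \<triangleleft>\<^bsub>M\<^esub> a \<oplus>\<^bsub>M\<^esub> v \<triangleleft>\<^bsub>M\<^esub> b"
    and "\<And>v a b. v \<in> carrier M \<Longrightarrow> a \<in> carrier R \<Longrightarrow> b \<in> carrier R
      \<Longrightarrow> v \<triangleleft>\<^bsub>M\<^esub> (a \<otimes>\<^bsub>R\<^esub> b) = (v \<triangleleft>\<^bsub>M\<^esub> a) \<triangleleft>\<^bsub>M\<^esub> b"
    and "\<And>v. v \<in> carrier M \<Longrightarrow> v \<triangleleft>\<^bsub>M\<^esub> \<one>\<^bsub>R\<^esub> = v"
  shows "right_module R M"
proof -
  have "abelian_group M"
    by (rule abelian_groupI) (use assms in auto)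
  with assms show ?thesis
    unfolding right_module_def right_module_axioms_def by auto
qed

text \<open>The condition of \<open>rhom\<close> without extensionality, so that sums and composites
  of maps are plain lambda terms; \<open>restrict_rhom\<close> leads back to
  \<open>rhom\<close>.\<close>

definition linear :: "'a ring \<Rightarrow> ('a, 'b) rmodule \<Rightarrow> ('a, 'c) rmodule \<Rightarrow> ('b \<Rightarrow> 'c) \<Rightarrow> bool"
  where "linear R M N f \<longleftrightarrow>
    (\<forall>v\<in>carrier M. f v \<in> carrier N) \<and>
    (\<forall>v\<in>carrier M. \<forall>w\<in>carrier M. f (v \<oplus>\<^bsub>M\<^esub> w) = f v \<oplus>\<^bsub>N\<^esub> f w) \<and>
    (\<forall>v\<in>carrier M. \<forall>a\<in>carrier R. f (v \<triangleleft>\<^bsub>M\<^esub> a) = f v \<triangleleft>\<^bsub>N\<^esub> a)"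

lemma linearI:
  assumes "\<And>v. v \<in> carrier M \<Longrightarrow> f v \<in> carrier N"
    and "\<And>v w. v \<in> carrier M \<Longrightarrow> w \<in> carrier M \<Longrightarrow> f (v \<oplus>\<^bsub>M\<^esub> w) = f v \<oplus>\<^bsub>N\<^esub> f w"
    and "\<And>v a. v \<in> carrier M \<Longrightarrow> a \<in> carrier R \<Longrightarrow> f (v \<triangleleft>\<^bsub>M\<^esub> a) = f v \<triangleleft>\<^bsub>N\<^esub> a"
  shows "linear R M N f"
  using assms by (simp add: linear_def)

lemma linear_closed: "linear R M N f \<Longrightarrow> v \<in> carrier M \<Longrightarrow> f v \<in> carrier N"
  and linear_add: "linear R M N f \<Longrightarrow> v \<in> carrier M \<Longrightarrow> w \<in> carrier M \<Longrightarrow> f (v \<oplus>\<^bsub>M\<^esub> w) = f v \<oplus>\<^bsub>N\<^esub> f w"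
  and linear_act: "linear R M N f \<Longrightarrow> v \<in> carrier M \<Longrightarrow> a \<in> carrier R \<Longrightarrow> f (v \<triangleleft>\<^bsub>M\<^esub> a) = f v \<triangleleft>\<^bsub>N\<^esub> a"
  by (simp_all add: linear_def)

lemma rhom_iff: "f \<in> rhom R M N \<longleftrightarrow> linear R M N f \<and> f \<in> extensional (carrier M)"
  by (auto simp: rhom_def linear_def PiE_def Pi_def)

lemma rhom_linear: "f \<in> rhom R M N \<Longrightarrow> linear R M N f"
  by (simp add: rhom_iff)

context right_module
begin

lemma ring_R: "ring R" ..

lemma abelian_group_M: "abelian_group M" ..

lemma act_zero_left: assumes "a \<in> carrier R" shows "\<zero>\<^bsub>M\<^esub> \<triangleleft>\<^bsub>M\<^esub> a = \<zero>\<^bsub>M\<^esub>"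
proof -
  have "\<zero>\<^bsub>M\<^esub> \<triangleleft>\<^bsub>M\<^esub> a \<oplus>\<^bsub>M\<^esub> \<zero>\<^bsub>M\<^esub> \<triangleleft>\<^bsub>M\<^esub> a = \<zero>\<^bsub>M\<^esub> \<triangleleft>\<^bsub>M\<^esub> a"
    using act_add_left[of "\<zero>\<^bsub>M\<^esub>" "\<zero>\<^bsub>M\<^esub>" a] assms by simp
  then show ?thesis
    by (metis M.add.r_cancel_one' M.zero_closed act_closed assms)
qed

lemma act_zero_right: assumes "v \<in> carrier M" shows "v \<triangleleft>\<^bsub>M\<^esub> \<zero>\<^bsub>R\<^esub> = \<zero>\<^bsub>M\<^esub>"
proof -
  have "v \<triangleleft>\<^bsub>M\<^esub> \<zero>\<^bsub>R\<^esub> \<oplus>\<^bsub>M\<^esub> v \<triangleleft>\<^bsub>M\<^esub> \<zero>\<^bsub>R\<^esub> = v \<triangleleft>\<^bsub>M\<^esub> \<zero>\<^bsub>R\<^esub>"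
    using act_add_right[of v "\<zero>\<^bsub>R\<^esub>" "\<zero>\<^bsub>R\<^esub>"] assms by simp
  then show ?thesis
    by (metis M.add.r_cancel_one' R.zero_closed act_closed assms)
qed

lemma act_neg_left:
  assumes "v \<in> carrier M" "a \<in> carrier R" shows "(\<ominus>\<^bsub>M\<^esub> v) \<triangleleft>\<^bsub>M\<^esub> a = \<ominus>\<^bsub>M\<^esub> (v \<triangleleft>\<^bsub>M\<^esub> a)"
  by (metis M.a_inv_closed M.l_neg M.minus_equality act_add_left act_closed act_zero_left assms)

end

lemma linear_cong:
  assumes "right_module R M" "linear R M N f" "\<And>v. v \<in> carrier M \<Longrightarrow> g v = f v"
  shows "linear R M N g"
proof -
  interpret right_module R M by fact
  show ?thesis using assms(2,3) by (auto simp: linear_def act_closed)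
qed

lemma restrict_rhom:
  "right_module R M \<Longrightarrow> linear R M N f \<Longrightarrow> restrict f (carrier M) \<in> rhom R M N"
  by (auto simp: rhom_iff intro: linear_cong)

lemma linear_id: "linear R M M (\<lambda>v. v)"
  by (simp add: linear_def)

lemma linear_comp: "linear R M N f \<Longrightarrow> linear R N L g \<Longrightarrow> linear R M L (\<lambda>v. g (f v))"
  by (simp add: linear_def)

lemma linear_zero_map:
  assumes "right_module R N" shows "linear R M N (\<lambda>v. \<zero>\<^bsub>N\<^esub>)"
proof -
  interpret right_module R N by fact
  show ?thesis by (simp add: linear_def act_zero_left)
qed

lemma linear_plus:
  assumes "right_module R N" "linear R M N f" "linear R M N g"
  shows "linear R M N (\<lambda>v. f v \<oplus>\<^bsub>N\<^esub> g v)"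
proof -
  interpret right_module R N by fact
  show ?thesis using assms(2,3)
    by (auto simp: linear_def act_add_left M.add.m_ac)
qed

lemma linear_minus:
  assumes "right_module R N" "linear R M N f" shows "linear R M N (\<lambda>v. \<ominus>\<^bsub>N\<^esub> f v)"
proof -
  interpret right_module R N by fact
  show ?thesis using assms(2)
    by (auto simp: linear_def act_neg_left M.minus_add)
qed

lemma linear_zero:
  assumes "right_module R M" "right_module R N" "linear R M N f" shows "f \<zero>\<^bsub>M\<^esub> = \<zero>\<^bsub>N\<^esub>"
proof -
  interpret M: right_module R M by fact
  interpret N: right_module R N by fact
  have "f \<zero>\<^bsub>M\<^esub> \<oplus>\<^bsub>N\<^esub> f \<zero>\<^bsub>M\<^esub> = f \<zero>\<^bsub>M\<^esub>"
    using linear_add[OF assms(3), of "\<zero>\<^bsub>M\<^esub>" "\<zero>\<^bsub>M\<^esub>"] by simp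
  then show ?thesis
    by (metis N.M.add.r_cancel_one' M.M.zero_closed assms(3) linear_closed)
qed

lemma linear_neg:
  assumes "right_module R M" "right_module R N" "linear R M N f" "v \<in> carrier M"
  shows "f (\<ominus>\<^bsub>M\<^esub> v) = \<ominus>\<^bsub>N\<^esub> f v"
proof -
  interpret M: right_module R M by fact
  interpret N: right_module R N by fact
  have "f (\<ominus>\<^bsub>M\<^esub> v) \<oplus>\<^bsub>N\<^esub> f v = \<zero>\<^bsub>N\<^esub>"
    using linear_add[OF assms(3), of "\<ominus>\<^bsub>M\<^esub> v" v] assms linear_zero[OF assms(1-3)]
    by (simp add: M.M.l_neg)
  from N.M.minus_equality[OF this] show ?thesis
    using assms(4) linear_closed[OF assms(3)] by simp
qed

text \<open>Each axiom for \<open>N\<close> is an equation or a closure property that is checked on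
  preimages in \<open>M\<close>. Quotients and right ideals obtain their module structure in this
  way.\<close>

lemma right_module_surj:
  assumes M: "right_module R M" and q: "linear R M N q"
    and surj: "carrier N \<subseteq> q ` carrier M" and zero: "\<zero>\<^bsub>N\<^esub> = q \<zero>\<^bsub>M\<^esub>"
  shows "right_module R N"
proof -
  interpret M: right_module R M by fact
  have ex: "\<exists>w. w \<in> carrier M \<and> v = q w" if "v \<in> carrier N" for v
    using surj that by auto
  note q' = linear_add[OF q, symmetric] linear_act[OF q, symmetric] linear_closed[OF q]
  show ?thesis
  proof (rule right_moduleI)
    show "ring R" by (rule M.ring_R)
    show "\<zero>\<^bsub>N\<^esub> \<in> carrier N" using zero q' by simp
    fix v assume v: "v \<in> carrier N"
    then obtain v' where v': "v' \<in> carrier M" "v = q v'" using ex by blast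
    show "\<zero>\<^bsub>N\<^esub> \<oplus>\<^bsub>N\<^esub> v = v" using v' by (simp add: q' zero)
    show "v \<triangleleft>\<^bsub>N\<^esub> \<one>\<^bsub>R\<^esub> = v" using v' by (simp add: q' M.act_one)
    show "\<exists>w\<in>carrier N. w \<oplus>\<^bsub>N\<^esub> v = \<zero>\<^bsub>N\<^esub>"
      using v' by (intro bexI[of _ "q (\<ominus>\<^bsub>M\<^esub> v')"]) (simp_all add: q' zero M.M.l_neg)
    { fix a assume a: "a \<in> carrier R"
      then show "v \<triangleleft>\<^bsub>N\<^esub> a \<in> carrier N" using v' by (simp add: q' M.act_closed)
      fix b assume b: "b \<in> carrier R"
      show "v \<triangleleft>\<^bsub>N\<^esub> (a \<oplus>\<^bsub>R\<^esub> b) = v \<triangleleft>\<^bsub>N\<^esub> a \<oplus>\<^bsub>N\<^esub> v \<triangleleft>\<^bsub>N\<^esub> b"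
        using v' a b by (simp add: q' M.act_closed M.act_add_right)
      show "v \<triangleleft>\<^bsub>N\<^esub> (a \<otimes>\<^bsub>R\<^esub> b) = (v \<triangleleft>\<^bsub>N\<^esub> a) \<triangleleft>\<^bsub>N\<^esub> b"
        using v' a b by (simp add: q' M.act_closed M.act_assoc) }
    fix w assume "w \<in> carrier N"
    then obtain w' where w': "w' \<in> carrier M" "w = q w'" using ex by blast
    show "v \<oplus>\<^bsub>N\<^esub> w \<in> carrier N" using v' w' by (simp add: q')
    show "v \<oplus>\<^bsub>N\<^esub> w = w \<oplus>\<^bsub>N\<^esub> v" using v' w' by (simp add: q' M.M.a_comm)
    { fix a assume a: "a \<in> carrier R"
      show "(v \<oplus>\<^bsub>N\<^esub> w) \<triangleleft>\<^bsub>N\<^esub> a = v \<triangleleft>\<^bsub>N\<^esub> a \<oplus>\<^bsub>N\<^esub> w \<triangleleft>\<^bsub>N\<^esub> a"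
        using v' w' a by (simp add: q' M.act_closed M.act_add_left) }
    fix u assume "u \<in> carrier N"
    then obtain u' where u': "u' \<in> carrier M" "u = q u'" using ex by blast
    show "(v \<oplus>\<^bsub>N\<^esub> w) \<oplus>\<^bsub>N\<^esub> u = v \<oplus>\<^bsub>N\<^esub> (w \<oplus>\<^bsub>N\<^esub> u)"
      using v' w' u' by (simp add: q' M.M.a_assoc)
  qed
qed

subsection \<open>Direct sums and free modules\<close>

lemma dsum_simps [simp]:
  "carrier (dsum M N) = carrier M \<times> carrier N" "\<zero>\<^bsub>dsum M N\<^esub> = (\<zero>\<^bsub>M\<^esub>, \<zero>\<^bsub>N\<^esub>)"
  "(v, w) \<oplus>\<^bsub>dsum M N\<^esub> (v', w') = (v \<oplus>\<^bsub>M\<^esub> v', w \<oplus>\<^bsub>N\<^esub> w')"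
  "(v, w) \<triangleleft>\<^bsub>dsum M N\<^esub> a = (v \<triangleleft>\<^bsub>M\<^esub> a, w \<triangleleft>\<^bsub>N\<^esub> a)"
  by (simp_all add: dsum_def)

lemma right_module_dsum:
  assumes "right_module R M" "right_module R N" shows "right_module R (dsum M N)"
proof -
  interpret M: right_module R M by fact
  interpret N: right_module R N by fact
  show ?thesis
  proof (rule right_moduleI)
    fix v assume "v \<in> carrier (dsum M N)"
    then show "\<exists>w\<in>carrier (dsum M N). w \<oplus>\<^bsub>dsum M N\<^esub> v = \<zero>\<^bsub>dsum M N\<^esub>"
      by (intro bexI[of _ "(\<ominus>\<^bsub>M\<^esub> fst v, \<ominus>\<^bsub>N\<^esub> snd v)"]) (auto simp: M.M.l_neg N.M.l_neg)
  qed (auto simp: M.ring_R M.M.a_ac N.M.a_ac M.act_closed N.act_closed M.act_add_left N.act_add_left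
      M.act_add_right N.act_add_right M.act_assoc N.act_assoc M.act_one N.act_one)
qed

lemma dsum_neg:
  assumes "right_module R M" "right_module R N" "v \<in> carrier M" "w \<in> carrier N"
  shows "\<ominus>\<^bsub>dsum M N\<^esub> (v, w) = (\<ominus>\<^bsub>M\<^esub> v, \<ominus>\<^bsub>N\<^esub> w)"
proof -
  interpret M: right_module R M by fact
  interpret N: right_module R N by fact
  interpret S: right_module R "dsum M N" by (rule right_module_dsum) fact+
  show ?thesis
    by (rule S.M.minus_equality) (use assms in \<open>auto simp: M.M.l_neg N.M.l_neg\<close>)
qed

lemma linear_fst: "linear R (dsum M N) M fst" and linear_snd: "linear R (dsum M N) N snd"
  by (auto simp: linear_def)

lemma linear_Pair:
  "linear R L M f \<Longrightarrow> linear R L N g \<Longrightarrow> linear R L (dsum M N) (\<lambda>v. (f v, g v))"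
  by (auto simp: linear_def)

lemma linear_inl:
  "right_module R N \<Longrightarrow> linear R M (dsum M N) (\<lambda>v. (v, \<zero>\<^bsub>N\<^esub>))"
  by (intro linear_Pair linear_id linear_zero_map)

lemma linear_inr:
  "right_module R M \<Longrightarrow> linear R N (dsum M N) (\<lambda>v. (\<zero>\<^bsub>M\<^esub>, v))"
  by (intro linear_Pair linear_id linear_zero_map)

definition reg :: "'a ring \<Rightarrow> ('a, 'a) rmodule"
  where "reg R = rmod_of (carrier R) \<zero>\<^bsub>R\<^esub> (add R) (monoid.mult R)"

lemma reg_simps [simp]:
  "carrier (reg R) = carrier R" "\<zero>\<^bsub>reg R\<^esub> = \<zero>\<^bsub>R\<^esub>" "add (reg R) = add R" "act (reg R) = monoid.mult R"
  by (simp_all add: reg_def)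

lemma right_module_reg: assumes "ring R" shows "right_module R (reg R)"
proof -
  interpret ring R by fact
  show ?thesis
    by (rule right_moduleI) (auto simp: assms a_ac m_assoc l_distr r_distr intro: add.l_inv_ex)
qed

lemma linear_act_map:
  assumes "right_module R M" "v \<in> carrier M" shows "linear R (reg R) M (\<lambda>a. v \<triangleleft>\<^bsub>M\<^esub> a)"
proof -
  interpret right_module R M by fact
  show ?thesis using assms by (auto simp: linear_def act_closed act_add_right act_assoc)
qed

lemma free_rmod_simps [simp]:
  "\<zero>\<^bsub>free_rmod R I\<^esub> = (\<lambda>i. \<zero>\<^bsub>R\<^esub>)"
  "f \<oplus>\<^bsub>free_rmod R I\<^esub> g = (\<lambda>i. f i \<oplus>\<^bsub>R\<^esub> g i)"
  "f \<triangleleft>\<^bsub>free_rmod R I\<^esub> a = (\<lambda>i. f i \<otimes>\<^bsub>R\<^esub> a)"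
  by (simp_all add: free_rmod_def)

lemma free_rmod_carrier: "f \<in> carrier (free_rmod R I) \<longleftrightarrow>
    (\<forall>i\<in>I. f i \<in> carrier R) \<and> (\<forall>i. i \<notin> I \<longrightarrow> f i = \<zero>\<^bsub>R\<^esub>) \<and> finite {i. f i \<noteq> \<zero>\<^bsub>R\<^esub>}"
  by (simp add: free_rmod_def)

lemma free_rmod_carrier_finite: "finite I \<Longrightarrow> f \<in> carrier (free_rmod R I) \<longleftrightarrow>
    (\<forall>i\<in>I. f i \<in> carrier R) \<and> (\<forall>i. i \<notin> I \<longrightarrow> f i = \<zero>\<^bsub>R\<^esub>)"
  by (auto simp: free_rmod_carrier intro: finite_subset[of _ I])

lemma free_rmod_in_ring: "ring R \<Longrightarrow> f \<in> carrier (free_rmod R I) \<Longrightarrow> f i \<in> carrier R"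
  by (metis free_rmod_carrier ring.ring_simprules(2))

lemma right_module_free: assumes "ring R" shows "right_module R (free_rmod R I)"
proof -
  interpret ring R by fact
  have c: "f i \<in> carrier R" if "f \<in> carrier (free_rmod R I)" for f i
    by (rule free_rmod_in_ring[OF assms that])
  have add: "(\<lambda>i. f i \<oplus>\<^bsub>R\<^esub> g i) \<in> carrier (free_rmod R I)"
    if f: "f \<in> carrier (free_rmod R I)" and g: "g \<in> carrier (free_rmod R I)" for f g
  proof -
    have "{i. f i \<oplus>\<^bsub>R\<^esub> g i \<noteq> \<zero>\<^bsub>R\<^esub>} \<subseteq> {i. f i \<noteq> \<zero>\<^bsub>R\<^esub>} \<union> {i. g i \<noteq> \<zero>\<^bsub>R\<^esub>}" by auto
    moreover have "finite ({i. f i \<noteq> \<zero>\<^bsub>R\<^esub>} \<union> {i. g i \<noteq> \<zero>\<^bsub>R\<^esub>})"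
      using f g by (simp add: free_rmod_carrier)
    ultimately have "finite {i. f i \<oplus>\<^bsub>R\<^esub> g i \<noteq> \<zero>\<^bsub>R\<^esub>}" by (rule finite_subset)
    with f g show ?thesis by (auto simp: free_rmod_carrier)
  qed
  have act: "(\<lambda>i. f i \<otimes>\<^bsub>R\<^esub> a) \<in> carrier (free_rmod R I)"
    if f: "f \<in> carrier (free_rmod R I)" and a: "a \<in> carrier R" for f a
  proof -
    have "{i. f i \<otimes>\<^bsub>R\<^esub> a \<noteq> \<zero>\<^bsub>R\<^esub>} \<subseteq> {i. f i \<noteq> \<zero>\<^bsub>R\<^esub>}" using a by auto
    then have "finite {i. f i \<otimes>\<^bsub>R\<^esub> a \<noteq> \<zero>\<^bsub>R\<^esub>}"
      using f finite_subset by (auto simp: free_rmod_carrier)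
    with f a show ?thesis by (auto simp: free_rmod_carrier)
  qed
  have neg: "(\<lambda>i. \<ominus>\<^bsub>R\<^esub> f i) \<in> carrier (free_rmod R I)" if f: "f \<in> carrier (free_rmod R I)" for f
  proof -
    have "{i. \<ominus>\<^bsub>R\<^esub> f i \<noteq> \<zero>\<^bsub>R\<^esub>} \<subseteq> {i. f i \<noteq> \<zero>\<^bsub>R\<^esub>}" by auto
    then have "finite {i. \<ominus>\<^bsub>R\<^esub> f i \<noteq> \<zero>\<^bsub>R\<^esub>}"
      using f finite_subset by (auto simp: free_rmod_carrier)
    with f show ?thesis by (auto simp: free_rmod_carrier)
  qed
  show ?thesis
  proof (rule right_moduleI)
    show "\<zero>\<^bsub>free_rmod R I\<^esub> \<in> carrier (free_rmod R I)" by (simp add: free_rmod_carrier)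
    fix f assume f: "f \<in> carrier (free_rmod R I)"
    show "\<exists>w\<in>carrier (free_rmod R I). w \<oplus>\<^bsub>free_rmod R I\<^esub> f = \<zero>\<^bsub>free_rmod R I\<^esub>"
      using f by (intro bexI[OF _ neg[OF f]]) (simp add: c l_neg)
  qed (simp_all add: assms add act c a_ac m_assoc l_distr r_distr)
qed

lemma free_rmod_neg:
  assumes "ring R" "f \<in> carrier (free_rmod R I)"
  shows "\<ominus>\<^bsub>free_rmod R I\<^esub> f = (\<lambda>i. \<ominus>\<^bsub>R\<^esub> f i)"
proof -
  interpret ring R by fact
  interpret F: right_module R "free_rmod R I" by (rule right_module_free) fact
  let ?g = "\<ominus>\<^bsub>free_rmod R I\<^esub> f"
  have g: "?g \<in> carrier (free_rmod R I)" using assms by simp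
  have "?g \<oplus>\<^bsub>free_rmod R I\<^esub> f = \<zero>\<^bsub>free_rmod R I\<^esub>" using F.M.l_neg[OF assms(2)] .
  then have "?g i \<oplus>\<^bsub>R\<^esub> f i = \<zero>\<^bsub>R\<^esub>" for i by (simp add: fun_eq_iff)
  then have "?g i = \<ominus>\<^bsub>R\<^esub> f i" for i
    using minus_equality[of "?g i" "f i"] free_rmod_in_ring[OF assms(1) assms(2)]
      free_rmod_in_ring[OF assms(1) g] by simp
  then show ?thesis by blast
qed

lemma linear_coord: "ring R \<Longrightarrow> linear R (free_rmod R I) (reg R) (\<lambda>f. f i)"
  by (auto simp: linear_def free_rmod_in_ring)

lemma linear_into_free:
  assumes "ring R" "finite I"
    and "\<And>i. i \<in> I \<Longrightarrow> linear R M (reg R) (\<lambda>v. g v i)" "\<And>v i. v \<in> carrier M \<Longrightarrow> i \<notin> I \<Longrightarrow> g v i = \<zero>\<^bsub>R\<^esub>"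
    and "right_module R M"
  shows "linear R M (free_rmod R I) g"
proof -
  interpret ring R by fact
  interpret M: right_module R M by fact
  show ?thesis
  proof (rule linearI)
    fix v assume v: "v \<in> carrier M"
    then show "g v \<in> carrier (free_rmod R I)"
      using assms(4) linear_closed[OF assms(3)] by (auto simp: free_rmod_carrier_finite[OF assms(2)])
    { fix w assume w: "w \<in> carrier M"
      have "g (v \<oplus>\<^bsub>M\<^esub> w) i = g v i \<oplus>\<^bsub>R\<^esub> g w i" for i
        using v w assms(4) linear_add[OF assms(3), of i v w] by (cases "i \<in> I") auto
      then show "g (v \<oplus>\<^bsub>M\<^esub> w) = g v \<oplus>\<^bsub>free_rmod R I\<^esub> g w" by auto }
    { fix a assume a: "a \<in> carrier R"
      have "g (v \<triangleleft>\<^bsub>M\<^esub> a) i = g v i \<otimes>\<^bsub>R\<^esub> a" for i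
        using v a assms(4) linear_act[OF assms(3), of i v a] M.act_closed by (cases "i \<in> I") auto
      then show "g (v \<triangleleft>\<^bsub>M\<^esub> a) = g v \<triangleleft>\<^bsub>free_rmod R I\<^esub> a" by auto }
  qed
qed

subsection \<open>Isomorphisms\<close>

lemma rmod_isoI:
  assumes "right_module R M" "linear R M N f" "bij_betw f (carrier M) (carrier N)"
  shows "rmod_iso R M N"
proof -
  interpret right_module R M by fact
  show ?thesis
    unfolding rmod_iso_def
    using restrict_rhom[OF assms(1,2)] assms(3) by (intro bexI[of _ "restrict f (carrier M)"]) auto
qed

lemma rmod_isoE:
  assumes "rmod_iso R M N"
  obtains f where "linear R M N f" "bij_betw f (carrier M) (carrier N)"
  using assms by (auto simp: rmod_iso_def rhom_iff)

lemma linear_inv: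
  assumes "right_module R M" "linear R M N f" "bij_betw f (carrier M) (carrier N)"
  shows "linear R N M (inv_into (carrier M) f)"
proof -
  interpret right_module R M by fact
  let ?g = "inv_into (carrier M) f"
  have g: "?g v \<in> carrier M" "f (?g v) = v" if "v \<in> carrier N" for v
    using assms(3) that by (auto simp: bij_betw_def inv_into_into f_inv_into_f)
  have f: "?g (f v) = v" if "v \<in> carrier M" for v
    using assms(3) that by (auto simp: bij_betw_def)
  show ?thesis
  proof (rule linearI)
    fix v assume v: "v \<in> carrier N"
    show "?g v \<in> carrier M" using g v by blast
    show "?g (v \<oplus>\<^bsub>N\<^esub> w) = ?g v \<oplus>\<^bsub>M\<^esub> ?g w" if "w \<in> carrier N" for w
      using f[of "?g v \<oplus>\<^bsub>M\<^esub> ?g w"] g v that by (simp add: linear_add[OF assms(2)])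
    show "?g (v \<triangleleft>\<^bsub>N\<^esub> a) = ?g v \<triangleleft>\<^bsub>M\<^esub> a" if "a \<in> carrier R" for a
      using f[of "?g v \<triangleleft>\<^bsub>M\<^esub> a"] g v that by (simp add: linear_act[OF assms(2)] act_closed)
  qed
qed

text \<open>\<open>rmod_iso\<close> does not say that its target is a module, but the extensional
  inverse in \<open>rmod_iso_sym\<close> is evaluated at sums and multiples taken there. Closure is
  inherited through the bijection.\<close>

lemma rmod_iso_closed:
  assumes "right_module R M" "linear R M N f" "bij_betw f (carrier M) (carrier N)"
  shows "v \<in> carrier N \<Longrightarrow> w \<in> carrier N \<Longrightarrow> v \<oplus>\<^bsub>N\<^esub> w \<in> carrier N"
    and "v \<in> carrier N \<Longrightarrow> a \<in> carrier R \<Longrightarrow> v \<triangleleft>\<^bsub>N\<^esub> a \<in> carrier N"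
proof -
  interpret right_module R M by fact
  have ex: "\<exists>w. w \<in> carrier M \<and> v = f w" if "v \<in> carrier N" for v
    using assms(3) that by (auto simp: bij_betw_def)
  show "v \<in> carrier N \<Longrightarrow> w \<in> carrier N \<Longrightarrow> v \<oplus>\<^bsub>N\<^esub> w \<in> carrier N"
    using ex[of v] ex[of w] linear_add[OF assms(2), symmetric] linear_closed[OF assms(2)] by auto
  show "v \<in> carrier N \<Longrightarrow> a \<in> carrier R \<Longrightarrow> v \<triangleleft>\<^bsub>N\<^esub> a \<in> carrier N"
    using ex[of v] linear_act[OF assms(2), symmetric] linear_closed[OF assms(2)] act_closed by auto
qed

lemma rmod_iso_sym:
  assumes "right_module R M" "rmod_iso R M N" shows "rmod_iso R N M"
proof -
  obtain f where f: "linear R M N f" "bij_betw f (carrier M) (carrier N)"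
    using assms rmod_isoE by blast
  let ?g = "restrict (inv_into (carrier M) f) (carrier N)"
  have "?g \<in> rhom R N M"
    using linear_inv[OF assms(1) f] rmod_iso_closed[OF assms(1) f]
    by (simp add: rhom_iff linear_def)
  moreover have "bij_betw ?g (carrier N) (carrier M)"
    using bij_betw_inv_into[OF f(2)] by simp
  ultimately show ?thesis unfolding rmod_iso_def by (intro bexI[of _ ?g])
qed

lemma rmod_iso_trans:
  assumes "right_module R M" "rmod_iso R M N" "rmod_iso R N L" shows "rmod_iso R M L"
proof -
  obtain f where f: "linear R M N f" "bij_betw f (carrier M) (carrier N)"
    using assms rmod_isoE by blast
  obtain g where g: "linear R N L g" "bij_betw g (carrier N) (carrier L)"
    using assms rmod_isoE by blast
  show ?thesis
    using rmod_isoI[OF assms(1) linear_comp[OF f(1) g(1)]] bij_betw_trans[OF f(2) g(2)]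
    by (simp add: comp_def)
qed

lemma rmod_iso_refl: "right_module R M \<Longrightarrow> rmod_iso R M M"
  by (rule rmod_isoI[OF _ linear_id]) (auto simp: bij_betw_def)

lemma rmod_iso_dsum:
  assumes "right_module R M" "right_module R M'" "rmod_iso R M N" "rmod_iso R M' N'"
  shows "rmod_iso R (dsum M M') (dsum N N')"
proof -
  obtain f where f: "linear R M N f" "bij_betw f (carrier M) (carrier N)"
    using assms rmod_isoE by blast
  obtain g where g: "linear R M' N' g" "bij_betw g (carrier M') (carrier N')"
    using assms rmod_isoE by blast
  show ?thesis
  proof (rule rmod_isoI[OF right_module_dsum[OF assms(1,2)]])
    show "linear R (dsum M M') (dsum N N') (map_prod f g)"
      using f(1) g(1) by (auto simp: linear_def)
    show "bij_betw (map_prod f g) (carrier (dsum M M')) (carrier (dsum N N'))"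
      using bij_betw_map_prod[OF f(2) g(2)] by simp
  qed
qed

lemma rmod_iso_dsum_assoc:
  assumes "right_module R L" "right_module R M" "right_module R N"
  shows "rmod_iso R (dsum (dsum L M) N) (dsum L (dsum M N))"
  by (rule rmod_isoI[where f = "\<lambda>((u, v), w). (u, v, w)"])
    (auto simp: right_module_dsum assms linear_def bij_betw_def inj_on_def image_iff)

lemma rmod_iso_free_add:
  assumes "ring R"
  shows "rmod_iso R (dsum (free_rmod R {..<m::nat}) (free_rmod R {..<n::nat})) (free_rmod R {..<m + n})"
proof (rule rmod_isoI)
  interpret ring R by fact
  let ?M = "dsum (free_rmod R {..<m}) (free_rmod R {..<n})"
  let ?f = "\<lambda>(f, g) i. if i < m then f i else g (i - m)"
  show "right_module R ?M" by (intro right_module_dsum right_module_free assms)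
  show "linear R ?M (free_rmod R {..<m + n}) ?f"
    by (rule linearI) (auto simp: free_rmod_carrier_finite)
  show "bij_betw ?f (carrier ?M) (carrier (free_rmod R {..<m + n}))"
  proof (rule bij_betw_byWitness[where f' = "\<lambda>h. (\<lambda>i. if i < m then h i else \<zero>\<^bsub>R\<^esub>, \<lambda>i. h (i + m))"])
    show "\<forall>a\<in>carrier ?M. (\<lambda>i. if i < m then ?f a i else \<zero>\<^bsub>R\<^esub>, \<lambda>i. ?f a (i + m)) = a"
      by (auto simp: free_rmod_carrier_finite fun_eq_iff)
  qed (auto simp: free_rmod_carrier_finite fun_eq_iff)
qed

lemma rmod_iso_free_zero:
  assumes "ring R"
    and "right_module R M"
  shows "rmod_iso R (dsum (free_rmod R ({} :: nat set)) M) M"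
proof -
  interpret ring R by fact
  have "carrier (free_rmod R ({} :: nat set)) = {\<lambda>i. \<zero>\<^bsub>R\<^esub>}"
    by (auto simp: free_rmod_carrier)
  then show ?thesis
    by (intro rmod_isoI[where f = snd])
      (auto simp: right_module_dsum right_module_free assms linear_snd bij_betw_def inj_on_def image_iff)
qed

section \<open>Quotients and pushouts\<close>

lemma (in abelian_group) eq_if_minus_eq_zero:
  assumes "x \<in> carrier G" "y \<in> carrier G" "x \<ominus> y = \<zero>" shows "x = y"
proof -
  have "x = x \<ominus> y \<oplus> y" using assms(1,2) by (simp add: minus_eq a_assoc l_neg)
  then show ?thesis using assms by simp
qed

definition submod :: "'a ring \<Rightarrow> ('a, 'b) rmodule \<Rightarrow> 'b set \<Rightarrow> bool"
  where "submod R M S \<longleftrightarrow> S \<subseteq> carrier M \<and> \<zero>\<^bsub>M\<^esub> \<in> S \<and> (\<forall>v\<in>S. \<forall>w\<in>S. v \<oplus>\<^bsub>M\<^esub> w \<in> S) \<and>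
    (\<forall>v\<in>S. \<ominus>\<^bsub>M\<^esub> v \<in> S) \<and> (\<forall>v\<in>S. \<forall>a\<in>carrier R. v \<triangleleft>\<^bsub>M\<^esub> a \<in> S)"

lemma submod_image:
  assumes "right_module R M" "right_module R N" "linear R M N f"
  shows "submod R N (f ` carrier M)"
proof -
  interpret M: right_module R M by fact
  interpret N: right_module R N by fact
  have "f v \<oplus>\<^bsub>N\<^esub> f w \<in> f ` carrier M" if "v \<in> carrier M" "w \<in> carrier M" for v w
    using linear_add[OF assms(3) that] that by (metis M.M.a_closed image_eqI)
  moreover have "\<ominus>\<^bsub>N\<^esub> f v \<in> f ` carrier M" if "v \<in> carrier M" for v
    using linear_neg[OF assms that] that by (metis M.M.a_inv_closed image_eqI)
  moreover have "f v \<triangleleft>\<^bsub>N\<^esub> a \<in> f ` carrier M" if "v \<in> carrier M" "a \<in> carrier R" for v a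
    using linear_act[OF assms(3) that] that by (metis M.act_closed image_eqI)
  moreover have "\<zero>\<^bsub>N\<^esub> \<in> f ` carrier M"
    using linear_zero[OF assms] by (metis M.M.zero_closed image_eqI)
  ultimately show ?thesis
    using linear_closed[OF assms(3)] by (auto simp: submod_def)
qed

lemma submod_abelian_subgroup:
  assumes "right_module R M" "submod R M S" shows "abelian_subgroup S M"
proof -
  interpret right_module R M by fact
  have "subgroup S (add_monoid M)"
    by (rule add.subgroupI) (use assms(2) in \<open>auto simp: submod_def a_inv_def[symmetric]\<close>)
  then show ?thesis
    by (intro abelian_subgroupI3 additive_subgroup.intro) (simp_all add: abelian_group_M)
qed

lemma quot_rmod_carrier: "carrier (quot_rmod M S) = (\<lambda>v. S +>\<^bsub>M\<^esub> v) ` carrier M"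
  by (auto simp: quot_rmod_def A_RCOSETS_def' a_r_coset_def')

lemma
  assumes M: "right_module R M" and S: "submod R M S"
  shows linear_quot: "linear R M (quot_rmod M S) (\<lambda>v. S +>\<^bsub>M\<^esub> v)"
    and right_module_quot: "right_module R (quot_rmod M S)"
    and quot_eq_iff: "\<And>v w. v \<in> carrier M \<Longrightarrow> w \<in> carrier M \<Longrightarrow>
      S +>\<^bsub>M\<^esub> v = S +>\<^bsub>M\<^esub> w \<longleftrightarrow> v \<ominus>\<^bsub>M\<^esub> w \<in> S"
    and quot_zero: "\<zero>\<^bsub>quot_rmod M S\<^esub> = S +>\<^bsub>M\<^esub> \<zero>\<^bsub>M\<^esub>"
proof -
  interpret right_module R M by fact
  interpret S: abelian_subgroup S M by (rule submod_abelian_subgroup) fact+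
  show eq: "S +>\<^bsub>M\<^esub> v = S +>\<^bsub>M\<^esub> w \<longleftrightarrow> v \<ominus>\<^bsub>M\<^esub> w \<in> S"
    if "v \<in> carrier M" "w \<in> carrier M" for v w
  proof -
    have "S +>\<^bsub>M\<^esub> v = S +>\<^bsub>M\<^esub> w \<longleftrightarrow> v \<in> S +>\<^bsub>M\<^esub> w"
      using S.a_rcos_self[OF that(1)] S.a_repr_independence'[OF _ that(2), of v] by blast
    then show ?thesis
      using S.a_rcos_module[OF that(2,1)] by (simp add: M.minus_eq)
  qed
  have act: "(\<Union>w\<in>S +>\<^bsub>M\<^esub> v. S +>\<^bsub>M\<^esub> (w \<triangleleft>\<^bsub>M\<^esub> a)) = S +>\<^bsub>M\<^esub> (v \<triangleleft>\<^bsub>M\<^esub> a)"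
    if v: "v \<in> carrier M" and a: "a \<in> carrier R" for v a
  proof -
    have "S +>\<^bsub>M\<^esub> (w \<triangleleft>\<^bsub>M\<^esub> a) = S +>\<^bsub>M\<^esub> (v \<triangleleft>\<^bsub>M\<^esub> a)" if w: "w \<in> S +>\<^bsub>M\<^esub> v" for w
    proof -
      obtain s where s: "s \<in> S" "w = s \<oplus>\<^bsub>M\<^esub> v" using w by (auto simp: a_r_coset_def')
      have sM: "s \<in> carrier M" "s \<triangleleft>\<^bsub>M\<^esub> a \<in> S" using s S a by (auto simp: submod_def)
      have "w \<triangleleft>\<^bsub>M\<^esub> a \<ominus>\<^bsub>M\<^esub> v \<triangleleft>\<^bsub>M\<^esub> a = s \<triangleleft>\<^bsub>M\<^esub> a"
        using sM s(2) v a by (simp add: act_add_left act_closed M.minus_eq M.a_assoc M.r_neg)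
      then show ?thesis using sM s v a by (subst eq) (auto simp: act_closed)
    qed
    moreover have "v \<in> S +>\<^bsub>M\<^esub> v" by (rule S.a_rcos_self[OF v])
    ultimately show ?thesis by blast
  qed
  show lin: "linear R M (quot_rmod M S) (\<lambda>v. S +>\<^bsub>M\<^esub> v)"
  proof (rule linearI)
    show "S +>\<^bsub>M\<^esub> v \<in> carrier (quot_rmod M S)" if "v \<in> carrier M" for v
      using that by (simp add: quot_rmod_carrier)
    show "S +>\<^bsub>M\<^esub> (v \<oplus>\<^bsub>M\<^esub> w) = (S +>\<^bsub>M\<^esub> v) \<oplus>\<^bsub>quot_rmod M S\<^esub> (S +>\<^bsub>M\<^esub> w)"
      if "v \<in> carrier M" "w \<in> carrier M" for v w
      using S.a_rcos_sum[OF that] by (simp add: quot_rmod_def)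
    show "S +>\<^bsub>M\<^esub> (v \<triangleleft>\<^bsub>M\<^esub> a) = (S +>\<^bsub>M\<^esub> v) \<triangleleft>\<^bsub>quot_rmod M S\<^esub> a"
      if "v \<in> carrier M" "a \<in> carrier R" for v a
      using act[OF that] by (simp add: quot_rmod_def)
  qed
  show zero: "\<zero>\<^bsub>quot_rmod M S\<^esub> = S +>\<^bsub>M\<^esub> \<zero>\<^bsub>M\<^esub>"
    by (simp add: quot_rmod_def S.a_subset)
  show "right_module R (quot_rmod M S)"
    by (rule right_module_surj[OF M lin _ zero]) (simp add: quot_rmod_carrier)
qed

lemma quot_eq_zero_iff:
  assumes "right_module R M" "submod R M S" "v \<in> carrier M"
  shows "S +>\<^bsub>M\<^esub> v = \<zero>\<^bsub>quot_rmod M S\<^esub> \<longleftrightarrow> v \<in> S"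
proof -
  interpret right_module R M by fact
  have "\<ominus>\<^bsub>M\<^esub> \<zero>\<^bsub>M\<^esub> = \<zero>\<^bsub>M\<^esub>" by (rule M.minus_equality) simp_all
  then have "v \<ominus>\<^bsub>M\<^esub> \<zero>\<^bsub>M\<^esub> = v" using assms(3) M.r_zero by (metis M.minus_eq)
  then show ?thesis
    using quot_eq_iff[OF assms(1,2,3), of "\<zero>\<^bsub>M\<^esub>"] quot_zero[OF assms(1,2)] M.zero_closed
    by metis
qed

text \<open>The value at a point is that of \<open>f\<close> at a chosen preimage; two preimages
  differ by an element of the kernel of \<open>s\<close>, on which \<open>f\<close>
  vanishes.\<close>

lemma factor_through_surj:
  assumes M: "right_module R M" and L: "right_module R L" and N: "right_module R N"
    and s: "linear R M L s" and surj: "s ` carrier M = carrier L" and f: "linear R M N f"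
    and ker: "\<And>v. v \<in> carrier M \<Longrightarrow> s v = \<zero>\<^bsub>L\<^esub> \<Longrightarrow> f v = \<zero>\<^bsub>N\<^esub>"
  obtains h where "linear R L N h" "\<And>v. v \<in> carrier M \<Longrightarrow> h (s v) = f v"
proof -
  interpret M: right_module R M by fact
  interpret L: right_module R L by fact
  interpret N: right_module R N by fact
  have eq: "f v = f w" if vw: "v \<in> carrier M" "w \<in> carrier M" "s v = s w" for v w
  proof -
    have "s (v \<ominus>\<^bsub>M\<^esub> w) = \<zero>\<^bsub>L\<^esub>"
      using vw linear_closed[OF s]
      by (simp add: M.M.minus_eq linear_add[OF s] linear_neg[OF M L s] L.M.r_neg)
    then have "f (v \<ominus>\<^bsub>M\<^esub> w) = \<zero>\<^bsub>N\<^esub>" using vw ker by simp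
    then have "f v \<ominus>\<^bsub>N\<^esub> f w = \<zero>\<^bsub>N\<^esub>"
      using vw by (simp add: M.M.minus_eq linear_add[OF f] linear_neg[OF M N f] N.M.minus_eq)
    then show ?thesis using vw linear_closed[OF f] N.M.eq_if_minus_eq_zero by blast
  qed
  define g where "g u = inv_into (carrier M) s u" for u
  have g: "g u \<in> carrier M" "s (g u) = u" if "u \<in> carrier L" for u
    using that surj by (auto simp: g_def inv_into_into f_inv_into_f)
  show thesis
  proof
    show h: "f (g (s v)) = f v" if "v \<in> carrier M" for v
      using eq g that linear_closed[OF s] by blast
    show "linear R L N (\<lambda>u. f (g u))"
    proof (rule linearI)
      fix u assume u: "u \<in> carrier L"
      show "f (g u) \<in> carrier N" using g u linear_closed[OF f] by blast
      show "f (g (u \<oplus>\<^bsub>L\<^esub> w)) = f (g u) \<oplus>\<^bsub>N\<^esub> f (g w)" if "w \<in> carrier L" for w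
        using h[of "g u \<oplus>\<^bsub>M\<^esub> g w"] g u that by (simp add: linear_add[OF s] linear_add[OF f])
      show "f (g (u \<triangleleft>\<^bsub>L\<^esub> a)) = f (g u) \<triangleleft>\<^bsub>N\<^esub> a" if "a \<in> carrier R" for a
        using h[of "g u \<triangleleft>\<^bsub>M\<^esub> a"] g u that
        by (simp add: linear_act[OF s] linear_act[OF f] M.act_closed)
    qed
  qed
qed

lemma quot_iso:
  assumes M: "right_module R M" and L: "right_module R L"
    and t: "linear R M L t" and surj: "t ` carrier M = carrier L"
    and S: "S = {v \<in> carrier M. t v = \<zero>\<^bsub>L\<^esub>}" and sub: "submod R M S"
  shows "rmod_iso R (quot_rmod M S) L"
proof -
  interpret M: right_module R M by fact
  interpret L: right_module R L by fact
  let ?q = "\<lambda>v. S +>\<^bsub>M\<^esub> v"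
  note Q = right_module_quot[OF M sub]
  have surjq: "?q ` carrier M = carrier (quot_rmod M S)" by (simp add: quot_rmod_carrier)
  obtain h where h: "linear R (quot_rmod M S) L h" "\<And>v. v \<in> carrier M \<Longrightarrow> h (?q v) = t v"
  proof (rule factor_through_surj[OF M Q L linear_quot[OF M sub] surjq t])
    show "t v = \<zero>\<^bsub>L\<^esub>" if "v \<in> carrier M" "?q v = \<zero>\<^bsub>quot_rmod M S\<^esub>" for v
      using quot_eq_zero_iff[OF M sub that(1)] that S by auto
  qed blast
  have "inj_on h (carrier (quot_rmod M S))"
  proof (rule inj_onI)
    fix X Y assume "X \<in> carrier (quot_rmod M S)" "Y \<in> carrier (quot_rmod M S)" and e: "h X = h Y"
    then obtain v w where vw: "v \<in> carrier M" "w \<in> carrier M" "X = ?q v" "Y = ?q w"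
      unfolding quot_rmod_carrier by blast
    then have "t v = t w" using h e by simp
    then have "t (v \<ominus>\<^bsub>M\<^esub> w) = \<zero>\<^bsub>L\<^esub>"
      using vw linear_closed[OF t]
      by (simp add: M.M.minus_eq linear_add[OF t] linear_neg[OF M L t] L.M.r_neg)
    then have "v \<ominus>\<^bsub>M\<^esub> w \<in> S" using S vw by simp
    then show "X = Y" using quot_eq_iff[OF M sub] vw by simp
  qed
  moreover have "h ` carrier (quot_rmod M S) = carrier L"
    unfolding quot_rmod_carrier image_image surj[symmetric] using h(2) by (rule image_cong[OF refl])
  ultimately show ?thesis
    by (intro rmod_isoI[OF Q h(1)]) (simp add: bij_betw_def)
qed

subsection \<open>Stable classes\<close>

lemma rmod_iso_free_free:
  assumes "ring R" "finite I" "inj_on u I"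
  shows "rmod_iso R (free_rmod R I) (free_rmod R (u ` I))"
proof (rule rmod_isoI)
  let ?v = "inv_into I u"
  let ?f = "\<lambda>f j. if j \<in> u ` I then f (?v j) else \<zero>\<^bsub>R\<^esub>"
  interpret ring R by fact
  have v: "?v (u i) = i" if "i \<in> I" for i using that assms(3) by simp
  show "right_module R (free_rmod R I)" by (rule right_module_free) fact
  show "linear R (free_rmod R I) (free_rmod R (u ` I)) ?f"
    by (rule linearI) (auto simp: free_rmod_carrier_finite assms v)
  show "bij_betw ?f (carrier (free_rmod R I)) (carrier (free_rmod R (u ` I)))"
    by (rule bij_betw_byWitness[where f' = "\<lambda>h i. if i \<in> I then h (u i) else \<zero>\<^bsub>R\<^esub>"])
      (auto simp: free_rmod_carrier_finite assms v fun_eq_iff)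
qed

lemma rmod_iso_dsum_zero:
  assumes "ring R" "right_module R M"
  shows "rmod_iso R (dsum M (free_rmod R {})) M"
proof -
  interpret ring R by fact
  have "carrier (free_rmod R {}) = {\<lambda>i. \<zero>\<^bsub>R\<^esub>}"
    by (auto simp: free_rmod_carrier)
  then show ?thesis
    by (intro rmod_isoI[where f = fst])
      (auto simp: right_module_dsum right_module_free assms linear_fst bij_betw_def inj_on_def image_iff)
qed

text \<open>In \<open>projective\<close> the index set of the ambient free module consists of
  elements of the module's own type, here \<open>nat \<Rightarrow> 'a\<close>. The indices below
  \<open>n\<close> are therefore coded as unit vectors, which are distinct because
  \<open>\<one> \<noteq> \<zero>\<close>. The complement is the zero module.\<close>

lemma projective_free:
  assumes R: "ring R" and ne: "\<one>\<^bsub>R\<^esub> \<noteq> \<zero>\<^bsub>R\<^esub>"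
  shows "projective R (free_rmod R {..<n::nat})"
proof -
  let ?u = "\<lambda>k::nat. \<lambda>j::nat. if j = k then \<one>\<^bsub>R\<^esub> else \<zero>\<^bsub>R\<^esub>"
  let ?I = "?u ` {..<n}"
  note F = right_module_free[OF R]
  have inj: "inj_on ?u {..<n}" by (rule inj_onI) (metis ne)
  have "rmod_iso R (dsum (free_rmod R {..<n}) (free_rmod R ({} :: (nat \<Rightarrow> 'a) set))) (free_rmod R ?I)"
    by (rule rmod_iso_trans[OF right_module_dsum[OF F F] rmod_iso_dsum_zero[OF R F]
          rmod_iso_free_free[OF R _ inj]]) simp
  then show ?thesis
    unfolding projective_def using right_module_free[OF R, of "{..<n}"] right_module_free[OF R, of "{} :: (nat \<Rightarrow> 'a) set"]
    by blast
qed

lemma fg_projective_zero: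
  assumes R: "ring R" and ne: "\<one>\<^bsub>R\<^esub> \<noteq> \<zero>\<^bsub>R\<^esub>"
  shows "fg_projective R (free_rmod R ({} :: nat set))"
proof -
  interpret ring R by fact
  have "projective R (free_rmod R ({} :: nat set))"
    using projective_free[OF assms, of 0] by simp
  moreover have "fin_gen R (free_rmod R ({} :: nat set))"
  proof -
    interpret F: right_module R "free_rmod R ({} :: nat set)" by (rule right_module_free[OF R])
    have "carrier (free_rmod R ({} :: nat set)) = {\<zero>\<^bsub>free_rmod R ({} :: nat set)\<^esub>}"
      by (auto simp: free_rmod_carrier)
    then show ?thesis unfolding fin_gen_def by (intro exI[of _ "{}"]) simp
  qed
  ultimately show ?thesis by (simp add: fg_projective_def)
qed

lemma fg_projective_right_module: "fg_projective R P \<Longrightarrow> right_module R P"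
  by (simp add: fg_projective_def projective_def)

text \<open>A free module of rank \<open>n\<close> is absorbed by the free summands that
  stabilisation allows on both sides, so the two classes have the same members.\<close>

lemma stable_class_free:
  assumes R: "ring R" and P: "right_module R P" and iso: "rmod_iso R P (free_rmod R {..<n::nat})"
  shows "stable_class R P = stable_class R (free_rmod R ({} :: nat set))"
proof -
  note F = right_module_free[OF R]
  let ?F = "\<lambda>n::nat. free_rmod R {..<n}"
  let ?O = "free_rmod R ({} :: nat set)"
  have PF: "rmod_iso R (dsum P (?F m)) (?F (n + m))" for m
    by (rule rmod_iso_trans[OF right_module_dsum[OF P F] rmod_iso_dsum[OF P F iso rmod_iso_refl[OF F]]
          rmod_iso_free_add[OF R]])
  have OF: "rmod_iso R (dsum ?O (?F m)) (?F m)" for m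
    by (rule rmod_iso_free_zero[OF R F])
  have "(\<exists>m k. rmod_iso R (dsum P (?F m)) (dsum Q (?F k))) \<longleftrightarrow>
        (\<exists>m k. rmod_iso R (dsum ?O (?F m)) (dsum Q (?F k)))"
    if Q: "right_module R Q" for Q :: "('a, nat \<Rightarrow> 'a) rmodule"
  proof
    assume "\<exists>m k. rmod_iso R (dsum P (?F m)) (dsum Q (?F k))"
    then obtain m k where 1: "rmod_iso R (dsum P (?F m)) (dsum Q (?F k))" by blast
    have "rmod_iso R (dsum ?O (?F (n + m))) (dsum P (?F m))"
      by (rule rmod_iso_trans[OF right_module_dsum[OF F F] OF
            rmod_iso_sym[OF right_module_dsum[OF P F] PF]])
    from rmod_iso_trans[OF right_module_dsum[OF F F] this 1]
    show "\<exists>m k. rmod_iso R (dsum ?O (?F m)) (dsum Q (?F k))" by blast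
  next
    assume "\<exists>m k. rmod_iso R (dsum ?O (?F m)) (dsum Q (?F k))"
    then obtain m k where 1: "rmod_iso R (dsum ?O (?F m)) (dsum Q (?F k))" by blast
    have 2: "rmod_iso R (?F m) (dsum Q (?F k))"
      by (rule rmod_iso_trans[OF F rmod_iso_sym[OF right_module_dsum[OF F F] OF] 1])
    have 3: "rmod_iso R (?F (m + n)) (dsum (?F m) (?F n))"
      by (rule rmod_iso_sym[OF right_module_dsum[OF F F] rmod_iso_free_add[OF R]])
    have 4: "rmod_iso R (dsum (?F m) (?F n)) (dsum (dsum Q (?F k)) (?F n))"
      by (rule rmod_iso_dsum[OF F F 2 rmod_iso_refl[OF F]])
    have 5: "rmod_iso R (dsum Q (dsum (?F k) (?F n))) (dsum Q (?F (k + n)))"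
      by (rule rmod_iso_dsum[OF Q right_module_dsum[OF F F] rmod_iso_refl[OF Q] rmod_iso_free_add[OF R]])
    have 6: "rmod_iso R (dsum (dsum Q (?F k)) (?F n)) (dsum Q (?F (k + n)))"
      by (rule rmod_iso_trans[OF right_module_dsum[OF right_module_dsum[OF Q F] F]
            rmod_iso_dsum_assoc[OF Q F F] 5])
    have 7: "rmod_iso R (?F (m + n)) (dsum Q (?F (k + n)))"
      by (rule rmod_iso_trans[OF F 3 rmod_iso_trans[OF right_module_dsum[OF F F] 4 6]])
    have 8: "rmod_iso R (dsum P (?F m)) (dsum Q (?F (k + n)))"
      by (rule rmod_iso_trans[OF right_module_dsum[OF P F] PF[of m, unfolded add.commute[of n]] 7])
    then show "\<exists>m k. rmod_iso R (dsum P (?F m)) (dsum Q (?F k))" by blast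
  qed
  then show ?thesis
    unfolding stable_class_def using fg_projective_right_module by blast
qed

text \<open>The zero module belongs to its own class, hence to that of \<open>P\<close>; this
  membership is the isomorphism sought.\<close>

lemma stable_class_eq_freeD:
  assumes R: "ring R" and ne: "\<one>\<^bsub>R\<^esub> \<noteq> \<zero>\<^bsub>R\<^esub>" and P: "right_module R P"
    and eq: "stable_class R P = stable_class R (free_rmod R ({} :: nat set))"
  obtains m n :: nat where "rmod_iso R (dsum P (free_rmod R {..<m})) (free_rmod R {..<n})"
proof -
  note F = right_module_free[OF R]
  let ?O = "free_rmod R ({} :: nat set)"
  have "?O \<in> stable_class R ?O"
    unfolding stable_class_def using fg_projective_zero[OF R ne] rmod_iso_refl[OF right_module_dsum[OF F F]]
    by blast
  then have "?O \<in> stable_class R P" using eq by simp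
  then obtain m n :: nat where "rmod_iso R (dsum P (free_rmod R {..<m})) (dsum ?O (free_rmod R {..<n}))"
    unfolding stable_class_def by blast
  from rmod_iso_trans[OF right_module_dsum[OF P F] this rmod_iso_free_zero[OF R F]]
  show thesis by (rule that)
qed

section \<open>Null maps and the derived endomorphism ring\<close>

text \<open>Factorisation through finite free modules only, and without extensionality. For modules
  with two generators it agrees with \<open>null_homs\<close>, see
  \<open>mem_null_iff\<close>.\<close>

definition nullmap :: "'a ring \<Rightarrow> ('a, 'b) rmodule \<Rightarrow> ('a, 'c) rmodule \<Rightarrow> ('b \<Rightarrow> 'c) \<Rightarrow> bool"
  where "nullmap R M N f \<longleftrightarrow> (\<exists>(n::nat) G H. linear R M (free_rmod R {..<n}) G \<and>
    linear R (free_rmod R {..<n}) N H \<and> (\<forall>v\<in>carrier M. f v = H (G v)))"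

lemma nullmapE:
  assumes "nullmap R M N f"
  obtains n :: nat and G H where "linear R M (free_rmod R {..<n}) G"
    "linear R (free_rmod R {..<n}) N H" "\<And>v. v \<in> carrier M \<Longrightarrow> f v = H (G v)"
  using assms by (auto simp: nullmap_def)

lemma nullmap_cong:
  "nullmap R M N f \<Longrightarrow> (\<And>v. v \<in> carrier M \<Longrightarrow> g v = f v) \<Longrightarrow> nullmap R M N g"
  unfolding nullmap_def by metis

lemma nullmap_linear:
  assumes "right_module R M" "nullmap R M N f" shows "linear R M N f"
proof -
  obtain n :: nat and G H where "linear R M (free_rmod R {..<n}) G"
    "linear R (free_rmod R {..<n}) N H" and e: "\<And>v. v \<in> carrier M \<Longrightarrow> f v = H (G v)"
    using assms(2) by (rule nullmapE) blast
  from linear_cong[OF assms(1) linear_comp[OF this(1,2)] e] show ?thesis .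
qed

lemma nullmap_comp_left:
  assumes "nullmap R M N f" "linear R N L g" shows "nullmap R M L (\<lambda>v. g (f v))"
proof -
  obtain n :: nat and G H where "linear R M (free_rmod R {..<n}) G"
    "linear R (free_rmod R {..<n}) N H" "\<And>v. v \<in> carrier M \<Longrightarrow> f v = H (G v)"
    using assms(1) by (rule nullmapE) blast
  then show ?thesis
    unfolding nullmap_def using linear_comp[of R "free_rmod R {..<n}" N H L g] assms(2)
    by (intro exI[of _ n] exI[of _ G] exI[of _ "\<lambda>v. g (H v)"]) simp
qed

lemma nullmap_comp_right:
  assumes "nullmap R M N f" "linear R L M g" shows "nullmap R L N (\<lambda>v. f (g v))"
proof -
  obtain n :: nat and G H where "linear R M (free_rmod R {..<n}) G"
    "linear R (free_rmod R {..<n}) N H" "\<And>v. v \<in> carrier M \<Longrightarrow> f v = H (G v)"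
    using assms(1) by (rule nullmapE) blast
  then show ?thesis
    unfolding nullmap_def
    using linear_comp[OF assms(2), of "free_rmod R {..<n}" G] linear_closed[OF assms(2)]
    by (intro exI[of _ n] exI[of _ "\<lambda>v. G (g v)"] exI[of _ H]) simp
qed

lemma nullmap_zero:
  assumes "ring R" "right_module R N" shows "nullmap R M N (\<lambda>v. \<zero>\<^bsub>N\<^esub>)"
  unfolding nullmap_def
  using linear_zero_map[OF right_module_free[OF assms(1)], of M] linear_zero_map[OF assms(2)]
  by blast

text \<open>The two factorisations are run in parallel through the direct sum of the two free
  modules.\<close>

lemma nullmap_plus:
  assumes R: "ring R" and N: "right_module R N"
    and f: "nullmap R M N f1" "nullmap R M N f2"
  shows "nullmap R M N (\<lambda>v. f1 v \<oplus>\<^bsub>N\<^esub> f2 v)"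
proof -
  obtain n1 :: nat and G1 H1 where 1: "linear R M (free_rmod R {..<n1}) G1"
    "linear R (free_rmod R {..<n1}) N H1" "\<And>v. v \<in> carrier M \<Longrightarrow> f1 v = H1 (G1 v)"
    using f(1) by (rule nullmapE) blast
  obtain n2 :: nat and G2 H2 where 2: "linear R M (free_rmod R {..<n2}) G2"
    "linear R (free_rmod R {..<n2}) N H2" "\<And>v. v \<in> carrier M \<Longrightarrow> f2 v = H2 (G2 v)"
    using f(2) by (rule nullmapE) blast
  note F = right_module_free[OF R]
  let ?D = "dsum (free_rmod R {..<n1}) (free_rmod R {..<n2})"
  obtain e where e: "linear R ?D (free_rmod R {..<n1 + n2}) e"
    "bij_betw e (carrier ?D) (carrier (free_rmod R {..<n1 + n2}))"
    using rmod_iso_free_add[OF R, of n1 n2] by (rule rmod_isoE) blast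
  let ?e = "inv_into (carrier ?D) e"
  have H: "linear R ?D N (\<lambda>w. H1 (fst w) \<oplus>\<^bsub>N\<^esub> H2 (snd w))"
    by (intro linear_plus[OF N] linear_comp[OF linear_fst 1(2)] linear_comp[OF linear_snd 2(2)])
  have G: "linear R M ?D (\<lambda>v. (G1 v, G2 v))"
    by (rule linear_Pair[OF 1(1) 2(1)])
  have inv: "?e (e w) = w" if "w \<in> carrier ?D" for w
    using e(2) that by (auto simp: bij_betw_def)
  show ?thesis
    unfolding nullmap_def
  proof (intro exI conjI ballI)
    show "linear R M (free_rmod R {..<n1 + n2}) (\<lambda>v. e (G1 v, G2 v))"
      by (rule linear_comp[OF G e(1)])
    show "linear R (free_rmod R {..<n1 + n2}) N (\<lambda>w. H1 (fst (?e w)) \<oplus>\<^bsub>N\<^esub> H2 (snd (?e w)))"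
      by (rule linear_comp[OF linear_inv[OF right_module_dsum[OF F F] e] H])
    show "f1 v \<oplus>\<^bsub>N\<^esub> f2 v = H1 (fst (?e (e (G1 v, G2 v)))) \<oplus>\<^bsub>N\<^esub> H2 (snd (?e (e (G1 v, G2 v))))"
      if v: "v \<in> carrier M" for v
      using inv[OF linear_closed[OF G v]] 1(3)[OF v] 2(3)[OF v] by simp
  qed
qed

lemma nullmap_minus:
  assumes "right_module R N" "nullmap R M N f" shows "nullmap R M N (\<lambda>v. \<ominus>\<^bsub>N\<^esub> f v)"
  by (rule nullmap_comp_left[OF assms(2) linear_minus[OF assms(1) linear_id]])

lemma nullmap_reg:
  assumes R: "ring R" and M: "right_module R M" and f: "linear R M (reg R) f" and h: "linear R (reg R) N h"
  shows "nullmap R M N (\<lambda>v. h (f v))"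
  unfolding nullmap_def
proof (intro exI conjI ballI)
  let ?G = "\<lambda>v (k::nat). if k = 0 then f v else \<zero>\<^bsub>R\<^esub>"
  show "linear R M (free_rmod R {..<1}) ?G"
    by (rule linear_into_free[OF R _ _ _ M]) (use f in auto)
  show "linear R (free_rmod R {..<1}) N (\<lambda>w. h (w (0::nat)))"
    by (rule linear_comp[OF linear_coord[OF R] h])
qed simp

text \<open>
  A map out of a finitely generated module that factors through a summand of a free module only
  sees finitely many coordinates of the latter.
\<close>

lemma null_homs_nullmap:
  assumes R: "ring R" and M: "right_module R M" and N: "right_module R N"
    and v12: "v1 \<in> carrier M" "v2 \<in> carrier M"
    and gen: "\<forall>v\<in>carrier M. \<exists>a\<in>carrier R. \<exists>b\<in>carrier R. v = v1 \<triangleleft>\<^bsub>M\<^esub> a \<oplus>\<^bsub>M\<^esub> v2 \<triangleleft>\<^bsub>M\<^esub> b"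
    and f: "f \<in> null_homs R M N"
  shows "nullmap R M N f"
proof -
  interpret R: ring R by fact
  interpret M: right_module R M by fact
  obtain P :: "('a, nat \<Rightarrow> 'a) rmodule" and g h where P: "projective R P"
    and g: "g \<in> rhom R M P" and h: "h \<in> rhom R P N" and fgh: "f = compose (carrier M) h g"
    using f unfolding null_homs_def by blast
  obtain Q :: "('a, (nat \<Rightarrow> 'a) \<Rightarrow> 'a) rmodule" and I :: "(nat \<Rightarrow> 'a) set" where P: "right_module R P"
    and Q: "right_module R Q" and iso: "rmod_iso R (dsum P Q) (free_rmod R I)"
    using P unfolding projective_def by blast
  note D = right_module_dsum[OF P Q]
  obtain e where e: "linear R (dsum P Q) (free_rmod R I) e"
    "bij_betw e (carrier (dsum P Q)) (carrier (free_rmod R I))"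
    using iso by (rule rmod_isoE) blast
  define G0 where "G0 v = e (g v, \<zero>\<^bsub>Q\<^esub>)" for v
  have G0: "linear R M (free_rmod R I) G0"
    unfolding G0_def by (rule linear_comp[OF linear_comp[OF rhom_linear[OF g] linear_inl[OF Q]] e(1)])
  define I0 where "I0 = {i. G0 v1 i \<noteq> \<zero>\<^bsub>R\<^esub>} \<union> {i. G0 v2 i \<noteq> \<zero>\<^bsub>R\<^esub>}"
  have fin: "finite I0"
    using linear_closed[OF G0 v12(1)] linear_closed[OF G0 v12(2)] by (simp add: I0_def free_rmod_carrier)
  have I0I: "I0 \<subseteq> I"
    using linear_closed[OF G0 v12(1)] linear_closed[OF G0 v12(2)] by (auto simp: I0_def free_rmod_carrier)
  have supp: "G0 v i = \<zero>\<^bsub>R\<^esub>" if v: "v \<in> carrier M" and i: "i \<notin> I0" for v i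
  proof -
    obtain a b where ab: "a \<in> carrier R" "b \<in> carrier R" "v = v1 \<triangleleft>\<^bsub>M\<^esub> a \<oplus>\<^bsub>M\<^esub> v2 \<triangleleft>\<^bsub>M\<^esub> b"
      using gen v by blast
    have "G0 v = G0 v1 \<triangleleft>\<^bsub>free_rmod R I\<^esub> a \<oplus>\<^bsub>free_rmod R I\<^esub> G0 v2 \<triangleleft>\<^bsub>free_rmod R I\<^esub> b"
      unfolding ab(3) by (simp only: linear_add[OF G0] linear_act[OF G0] v12 ab M.act_closed)
    then show ?thesis using i ab by (simp add: I0_def)
  qed
  \<comment> \<open>The relevant coordinates form a finite set of functions; they are renumbered
    because \<open>nullmap\<close> wants the indices below some natural number.\<close>
  obtain b where b: "bij_betw b {0..<card I0} I0" using ex_bij_betw_nat_finite[OF fin] by blast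
  let ?n = "card I0"
  let ?c = "inv_into {0..<?n} b"
  have bI: "b k \<in> I0" if "k < ?n" for k using bij_betwE[OF b] that by simp
  have bc: "b (?c i) = i" if "i \<in> I0" for i using b that by (simp add: bij_betw_def f_inv_into_f)
  have cn: "?c i < ?n" if "i \<in> I0" for i
    using b that inv_into_into[of i b "{0..<?n}"] by (simp add: bij_betw_def)
  let ?G = "\<lambda>v k. if k < ?n then G0 v (b k) else \<zero>\<^bsub>R\<^esub>"
  let ?T = "\<lambda>w i. if i \<in> I0 then w (?c i) else \<zero>\<^bsub>R\<^esub>"
  have G: "linear R M (free_rmod R {..<?n}) ?G"
    by (rule linear_into_free[OF R _ _ _ M]) (use linear_comp[OF G0 linear_coord[OF R]] in auto)
  have T: "linear R (free_rmod R {..<?n}) (free_rmod R I) ?T"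
  proof -
    have "linear R (free_rmod R {..<?n}) (free_rmod R I0) ?T"
      by (rule linear_into_free[OF R fin _ _ right_module_free[OF R]]) (simp_all add: linear_coord[OF R])
    moreover have "x \<in> carrier (free_rmod R I)" if x: "x \<in> carrier (free_rmod R I0)" for x
      using x I0I free_rmod_in_ring[OF R x] by (auto simp: free_rmod_carrier)
    ultimately show ?thesis by (auto simp: linear_def)
  qed
  have TG: "?T (?G v) = G0 v" if "v \<in> carrier M" for v
    using supp[OF that] by (intro ext) (auto simp: cn bc)
  let ?H = "\<lambda>w. h (fst (inv_into (carrier (dsum P Q)) e (?T w)))"
  have H: "linear R (free_rmod R {..<?n}) N ?H"
    by (rule linear_comp[OF linear_comp[OF linear_comp[OF T linear_inv[OF D e]] linear_fst] rhom_linear[OF h]])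
  have "f v = ?H (?G v)" if v: "v \<in> carrier M" for v
  proof -
    have "(g v, \<zero>\<^bsub>Q\<^esub>) \<in> carrier (dsum P Q)"
      by (rule linear_closed[OF linear_comp[OF rhom_linear[OF g] linear_inl[OF Q]] v])
    then have "inv_into (carrier (dsum P Q)) e (G0 v) = (g v, \<zero>\<^bsub>Q\<^esub>)"
      unfolding G0_def using e(2) by (simp add: bij_betw_def)
    then show ?thesis unfolding TG[OF v] using v by (simp add: fgh compose_def)
  qed
  with G H show ?thesis unfolding nullmap_def by blast
qed

lemma nullmap_null_homs:
  assumes R: "ring R" and ne: "\<one>\<^bsub>R\<^esub> \<noteq> \<zero>\<^bsub>R\<^esub>" and M: "right_module R M"
    and f: "f \<in> rhom R M N" "nullmap R M N f"
  shows "f \<in> null_homs R M N"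
proof -
  obtain n :: nat and G H where G: "linear R M (free_rmod R {..<n}) G"
    and H: "linear R (free_rmod R {..<n}) N H" and e: "\<And>v. v \<in> carrier M \<Longrightarrow> f v = H (G v)"
    using f(2) by (rule nullmapE) blast
  let ?P = "free_rmod R {..<n}"
  have "f = compose (carrier M) (restrict H (carrier ?P)) (restrict G (carrier M))"
  proof (rule extensionalityI[of _ "carrier M"])
    show "f \<in> extensional (carrier M)" using f(1) by (simp add: rhom_iff)
    show "f v = compose (carrier M) (restrict H (carrier ?P)) (restrict G (carrier M)) v"
      if "v \<in> carrier M" for v
      using that e[OF that] linear_closed[OF G that] by (simp add: compose_def)
  qed simp
  then show ?thesis
    unfolding null_homs_def
    using f(1) projective_free[OF R ne] restrict_rhom[OF M G] restrict_rhom[OF right_module_free[OF R] H]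
    by blast
qed

section \<open>The endomorphism ring and its ideal of null maps\<close>

lemma rend_simps [simp]:
  "carrier (rend R M) = rhom R M M" "\<one>\<^bsub>rend R M\<^esub> = (\<lambda>v\<in>carrier M. v)"
  "\<zero>\<^bsub>rend R M\<^esub> = (\<lambda>v\<in>carrier M. \<zero>\<^bsub>M\<^esub>)" "f \<otimes>\<^bsub>rend R M\<^esub> g = compose (carrier M) f g"
  "f \<oplus>\<^bsub>rend R M\<^esub> g = (\<lambda>v\<in>carrier M. f v \<oplus>\<^bsub>M\<^esub> g v)"
  by (simp_all add: rend_def)

lemma rhom_eqI:
  assumes "f \<in> rhom R M N" "g \<in> rhom R M N" "\<And>v. v \<in> carrier M \<Longrightarrow> f v = g v"
  shows "f = g"
  by (rule extensionalityI[of _ "carrier M"]) (use assms in \<open>auto simp: rhom_iff\<close>)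

lemma ring_rend:
  assumes M: "right_module R M" shows "ring (rend R M)"
proof -
  interpret M: right_module R M by fact
  note r = restrict_rhom[OF M]
  have c: "f v \<in> carrier M" if "f \<in> rhom R M M" "v \<in> carrier M" for f v
    using linear_closed[OF rhom_linear] that .
  have add: "f (v \<oplus>\<^bsub>M\<^esub> w) = f v \<oplus>\<^bsub>M\<^esub> f w" if "f \<in> rhom R M M" "v \<in> carrier M" "w \<in> carrier M" for f v w
    using linear_add[OF rhom_linear] that .
  have comp: "compose (carrier M) f g \<in> rhom R M M" if "f \<in> rhom R M M" "g \<in> rhom R M M" for f g
    unfolding compose_def by (rule r[OF linear_comp[OF that(2,1)[THEN rhom_linear]]])
  have plus: "(\<lambda>v\<in>carrier M. f v \<oplus>\<^bsub>M\<^esub> g v) \<in> rhom R M M" if "f \<in> rhom R M M" "g \<in> rhom R M M" for f g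
    by (rule r[OF linear_plus[OF M that[THEN rhom_linear]]])
  have neg: "(\<lambda>v\<in>carrier M. \<ominus>\<^bsub>M\<^esub> f v) \<in> rhom R M M" if "f \<in> rhom R M M" for f
    by (rule r[OF linear_minus[OF M that[THEN rhom_linear]]])
  have zero: "(\<lambda>v\<in>carrier M. \<zero>\<^bsub>M\<^esub>) \<in> rhom R M M"
    by (rule r[OF linear_zero_map[OF M]])
  have id: "(\<lambda>v\<in>carrier M. v) \<in> rhom R M M"
    by (rule r[OF linear_id])
  show ?thesis
  proof (rule ringI)
    show "abelian_group (rend R M)"
    proof (rule abelian_groupI)
      fix f assume f: "f \<in> carrier (rend R M)"
      show "\<exists>g\<in>carrier (rend R M). g \<oplus>\<^bsub>rend R M\<^esub> f = \<zero>\<^bsub>rend R M\<^esub>"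
        using f neg[of f]
        by (intro bexI[of _ "\<lambda>v\<in>carrier M. \<ominus>\<^bsub>M\<^esub> f v"]) (auto simp: M.M.l_neg fun_eq_iff c)
      show "\<zero>\<^bsub>rend R M\<^esub> \<oplus>\<^bsub>rend R M\<^esub> f = f"
        using f plus[OF zero, of f] by (intro rhom_eqI[of _ R M M]) (auto simp: c)
      fix g assume g: "g \<in> carrier (rend R M)"
      show "f \<oplus>\<^bsub>rend R M\<^esub> g = g \<oplus>\<^bsub>rend R M\<^esub> f"
        using f g by (auto simp: M.M.a_comm fun_eq_iff c)
      fix h assume h: "h \<in> carrier (rend R M)"
      show "f \<oplus>\<^bsub>rend R M\<^esub> g \<oplus>\<^bsub>rend R M\<^esub> h = f \<oplus>\<^bsub>rend R M\<^esub> (g \<oplus>\<^bsub>rend R M\<^esub> h)"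
        using f g h by (auto simp: M.M.a_assoc fun_eq_iff c)
    qed (use plus zero in auto)
    show "Group.monoid (rend R M)"
    proof (rule monoidI)
      fix f assume f: "f \<in> carrier (rend R M)"
      show "\<one>\<^bsub>rend R M\<^esub> \<otimes>\<^bsub>rend R M\<^esub> f = f"
        using f comp[OF id, of f] by (intro rhom_eqI[of _ R M M]) (auto simp: c compose_def)
      show "f \<otimes>\<^bsub>rend R M\<^esub> \<one>\<^bsub>rend R M\<^esub> = f"
        using f comp[OF _ id, of f] by (intro rhom_eqI[of _ R M M]) (auto simp: c compose_def)
      fix g assume g: "g \<in> carrier (rend R M)"
      fix h assume h: "h \<in> carrier (rend R M)"
      show "f \<otimes>\<^bsub>rend R M\<^esub> g \<otimes>\<^bsub>rend R M\<^esub> h = f \<otimes>\<^bsub>rend R M\<^esub> (g \<otimes>\<^bsub>rend R M\<^esub> h)"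
        using f g h by (auto simp: compose_def fun_eq_iff c add)
    qed (use comp id in auto)
    fix f g h
    assume f: "f \<in> carrier (rend R M)" and g: "g \<in> carrier (rend R M)" and h: "h \<in> carrier (rend R M)"
    show "(f \<oplus>\<^bsub>rend R M\<^esub> g) \<otimes>\<^bsub>rend R M\<^esub> h = f \<otimes>\<^bsub>rend R M\<^esub> h \<oplus>\<^bsub>rend R M\<^esub> g \<otimes>\<^bsub>rend R M\<^esub> h"
      using f g h by (auto simp: compose_def fun_eq_iff c add)
    show "h \<otimes>\<^bsub>rend R M\<^esub> (f \<oplus>\<^bsub>rend R M\<^esub> g) = h \<otimes>\<^bsub>rend R M\<^esub> f \<oplus>\<^bsub>rend R M\<^esub> h \<otimes>\<^bsub>rend R M\<^esub> g"
      using f g h       by (auto simp: compose_def fun_eq_iff c add)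
  qed
qed

lemma rend_neg:
  assumes M: "right_module R M" and f: "f \<in> rhom R M M"
  shows "\<ominus>\<^bsub>rend R M\<^esub> f = (\<lambda>v\<in>carrier M. \<ominus>\<^bsub>M\<^esub> f v)"
proof -
  interpret M: right_module R M by fact
  interpret E: ring "rend R M" by (rule ring_rend[OF M])
  show ?thesis
  proof (rule E.minus_equality)
    show "(\<lambda>v\<in>carrier M. \<ominus>\<^bsub>M\<^esub> f v) \<in> carrier (rend R M)"
      using restrict_rhom[OF M linear_minus[OF M rhom_linear[OF f]]] by simp
    show "(\<lambda>v\<in>carrier M. \<ominus>\<^bsub>M\<^esub> f v) \<oplus>\<^bsub>rend R M\<^esub> f = \<zero>\<^bsub>rend R M\<^esub>"
      using linear_closed[OF rhom_linear[OF f]] by (auto simp: fun_eq_iff M.M.l_neg)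
  qed (use f in simp)
qed

text \<open>Two generators fit R(2) \<oplus> [y - 1), which has one from each summand. Finite
  generation is what reduces arbitrary projective modules in \<open>null_homs\<close> to finite free
  ones.\<close>

locale gen_module =
  fixes R :: "'a ring" and M :: "('a, 'b) rmodule" and v1 v2 :: 'b
  assumes R: "ring R" and one_neq_zero: "\<one>\<^bsub>R\<^esub> \<noteq> \<zero>\<^bsub>R\<^esub>" and M: "right_module R M"
    and v1: "v1 \<in> carrier M" and v2: "v2 \<in> carrier M"
    and gen: "\<forall>v\<in>carrier M. \<exists>a\<in>carrier R. \<exists>b\<in>carrier R. v = v1 \<triangleleft>\<^bsub>M\<^esub> a \<oplus>\<^bsub>M\<^esub> v2 \<triangleleft>\<^bsub>M\<^esub> b"
begin

abbreviation null where "null \<equiv> null_homs R M M"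

lemma mem_null_iff: "f \<in> null \<longleftrightarrow> f \<in> rhom R M M \<and> nullmap R M M f"
proof -
  have "f \<in> null \<Longrightarrow> f \<in> rhom R M M" by (simp add: null_homs_def)
  then show ?thesis
    using null_homs_nullmap[OF R M M v1 v2 gen] nullmap_null_homs[OF R one_neq_zero M] by blast
qed

lemma ideal_null: "ideal null (rend R M)"
proof (rule idealI[OF ring_rend[OF M]])
  interpret E: ring "rend R M" by (rule ring_rend[OF M])
  note N = mem_null_iff and r = restrict_rhom[OF M nullmap_linear[OF M]]
  have cong: "nullmap R M M (restrict f (carrier M))" if "nullmap R M M f" for f
    by (rule nullmap_cong[OF that]) simp
  show "subgroup null (add_monoid (rend R M))"
  proof (rule E.add.subgroupI)
    show "null \<subseteq> carrier (rend R M)" using N by auto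
    have "(\<lambda>v\<in>carrier M. \<zero>\<^bsub>M\<^esub>) \<in> null"
      using r[OF nullmap_zero[OF R M]] cong[OF nullmap_zero[OF R M]] by (simp add: N)
    then show "null \<noteq> {}" by blast
    fix f assume f: "f \<in> null"
    show "\<ominus>\<^bsub>rend R M\<^esub> f \<in> null"
      using f r[OF nullmap_minus[OF M]] cong[OF nullmap_minus[OF M]] by (auto simp: N rend_neg[OF M])
    fix g assume g: "g \<in> null"
    show "f \<oplus>\<^bsub>rend R M\<^esub> g \<in> null"
      using f g r[OF nullmap_plus[OF R M]] cong[OF nullmap_plus[OF R M]] by (auto simp: N)
  qed
  fix f g assume f: "f \<in> null" and g: "g \<in> carrier (rend R M)"
  show "g \<otimes>\<^bsub>rend R M\<^esub> f \<in> null"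
    using f g r[OF nullmap_comp_left[of R M M f M g]] cong[OF nullmap_comp_left[of R M M f M g]]
    by (simp add: N compose_def rhom_linear)
  show "f \<otimes>\<^bsub>rend R M\<^esub> g \<in> null"
    using f g r[OF nullmap_comp_right[of R M M f M g]] cong[OF nullmap_comp_right[of R M M f M g]]
    by (simp add: N compose_def rhom_linear)
qed

lemma rend_minus_mem_null:
  assumes "f \<in> rhom R M M" "g \<in> rhom R M M"
  shows "f \<oplus>\<^bsub>rend R M\<^esub> \<ominus>\<^bsub>rend R M\<^esub> g \<in> null \<longleftrightarrow> nullmap R M M (\<lambda>v. f v \<ominus>\<^bsub>M\<^esub> g v)"
proof -
  interpret M: right_module R M by (rule M)
  interpret E: ring "rend R M" by (rule ring_rend[OF M])
  have "f \<oplus>\<^bsub>rend R M\<^esub> \<ominus>\<^bsub>rend R M\<^esub> g = (\<lambda>v\<in>carrier M. f v \<ominus>\<^bsub>M\<^esub> g v)"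
    by (auto simp: rend_neg[OF M] assms M.M.minus_eq fun_eq_iff)
  moreover have "f \<oplus>\<^bsub>rend R M\<^esub> \<ominus>\<^bsub>rend R M\<^esub> g \<in> rhom R M M"
    using assms E.a_closed E.a_inv_closed by (metis rend_simps(1))
  ultimately show ?thesis
    unfolding mem_null_iff using nullmap_cong[of R M M] by (smt (verit) restrict_apply')
qed

lemma der_map_eq_iff:
  assumes "f \<in> rhom R M M" "g \<in> rhom R M M"
  shows "der_map R M f = der_map R M g \<longleftrightarrow> nullmap R M M (\<lambda>v. f v \<ominus>\<^bsub>M\<^esub> g v)"
proof -
  interpret I: ideal null "rend R M" by (rule ideal_null)
  have "der_map R M f = der_map R M g \<longleftrightarrow> f \<in> null +>\<^bsub>rend R M\<^esub> g"
    unfolding der_map_def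
    using I.a_rcos_self[of f] I.a_repr_independence'[of f g] assms by auto
  then show ?thesis
    using I.a_rcos_module[of g f] assms rend_minus_mem_null by simp
qed

lemma mem_der_map_iff:
  assumes "g \<in> rhom R M M"
  shows "f \<in> der_map R M g \<longleftrightarrow> f \<in> rhom R M M \<and> nullmap R M M (\<lambda>v. f v \<ominus>\<^bsub>M\<^esub> g v)"
proof -
  interpret I: ideal null "rend R M" by (rule ideal_null)
  have "f \<in> rhom R M M" if "f \<in> der_map R M g"
    using that I.a_elemrcos_carrier[of g f] assms unfolding der_map_def by simp
  then show ?thesis
    using I.a_rcos_module[of g f] assms rend_minus_mem_null unfolding der_map_def by auto
qed

lemma der_autD:
  assumes "c \<in> carrier (der_aut R M)"
  obtains f g where "f \<in> rhom R M M" "g \<in> rhom R M M" "c = der_map R M f"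
    "nullmap R M M (\<lambda>v. g (f v) \<ominus>\<^bsub>M\<^esub> v)"
proof -
  interpret M: right_module R M by (rule M)
  interpret I: ideal null "rend R M" by (rule ideal_null)
  interpret E: ring "rend R M" by (rule ring_rend[OF M])
  have carr: "carrier (der_end R M) = der_map R M ` rhom R M M"
    by (auto simp: der_end_def FactRing_def der_map_def A_RCOSETS_def' a_r_coset_def')
  have "c \<in> Units (der_end R M)" using assms by (simp add: der_aut_def units_of_def)
  then obtain d where c: "c \<in> carrier (der_end R M)" and d: "d \<in> carrier (der_end R M)"
    and dc: "d \<otimes>\<^bsub>der_end R M\<^esub> c = \<one>\<^bsub>der_end R M\<^esub>"
    unfolding Units_def by blast
  obtain f where f: "f \<in> rhom R M M" "c = der_map R M f"
    using c by (auto simp: carr)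
  obtain g where g: "g \<in> rhom R M M" "d = der_map R M g"
    using d by (auto simp: carr)
  have "der_map R M (g \<otimes>\<^bsub>rend R M\<^esub> f) = der_map R M \<one>\<^bsub>rend R M\<^esub>"
    using dc f g I.rcoset_mult_add[of g f] by (simp add: der_end_def FactRing_def der_map_def)
  then have "nullmap R M M (\<lambda>v. (g \<otimes>\<^bsub>rend R M\<^esub> f) v \<ominus>\<^bsub>M\<^esub> \<one>\<^bsub>rend R M\<^esub> v)"
    using der_map_eq_iff f g I.m_closed[of g f] I.one_closed by simp
  then have "nullmap R M M (\<lambda>v. g (f v) \<ominus>\<^bsub>M\<^esub> v)"
    by (rule nullmap_cong) (simp add: compose_def)
  with f g show thesis by (intro that)
qed

lemma der_map_aut:
  assumes "f \<in> carrier (rmod_aut R M)"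
  shows "der_map R M f \<in> carrier (der_aut R M)"
proof -
  interpret I: ideal null "rend R M" by (rule ideal_null)
  interpret E: ring "rend R M" by (rule ring_rend[OF M])
  obtain g where f: "f \<in> rhom R M M" and g: "g \<in> rhom R M M"
    "g \<otimes>\<^bsub>rend R M\<^esub> f = \<one>\<^bsub>rend R M\<^esub>" "f \<otimes>\<^bsub>rend R M\<^esub> g = \<one>\<^bsub>rend R M\<^esub>"
    using assms by (auto simp: rmod_aut_def units_of_def Units_def)
  have "der_map R M h \<in> carrier (der_end R M)" if "h \<in> rhom R M M" for h
    using that ring_hom_closed[OF I.rcos_ring_hom, of h] by (simp add: der_map_def der_end_def)
  moreover have "der_map R M g \<otimes>\<^bsub>der_end R M\<^esub> der_map R M f = \<one>\<^bsub>der_end R M\<^esub>"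
    using ring_hom_mult[OF I.rcos_ring_hom, of g f] ring_hom_one[OF I.rcos_ring_hom] f g
    by (simp add: der_map_def der_end_def)
  moreover have "der_map R M f \<otimes>\<^bsub>der_end R M\<^esub> der_map R M g = \<one>\<^bsub>der_end R M\<^esub>"
    using ring_hom_mult[OF I.rcos_ring_hom, of f g] ring_hom_one[OF I.rcos_ring_hom] f g
    by (simp add: der_map_def der_end_def)
  ultimately show ?thesis using f g by (auto simp: der_aut_def units_of_def Units_def)
qed

lemma rmod_autD:
  assumes "f \<in> carrier (rmod_aut R M)"
  obtains g where "f \<in> rhom R M M" "linear R M M g"
    "\<And>v. v \<in> carrier M \<Longrightarrow> g (f v) = v" "\<And>v. v \<in> carrier M \<Longrightarrow> f (g v) = v"
proof -
  obtain g where f: "f \<in> rhom R M M" and g: "g \<in> rhom R M M"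
    "g \<otimes>\<^bsub>rend R M\<^esub> f = \<one>\<^bsub>rend R M\<^esub>" "f \<otimes>\<^bsub>rend R M\<^esub> g = \<one>\<^bsub>rend R M\<^esub>"
    using assms by (auto simp: rmod_aut_def units_of_def Units_def)
  show thesis
  proof (rule that[OF f rhom_linear[OF g(1)]])
    fix v assume v: "v \<in> carrier M"
    show "g (f v) = v" using fun_cong[OF g(2), of v] v by (simp add: compose_def)
    show "f (g v) = v" using fun_cong[OF g(3), of v] v by (simp add: compose_def)
  qed
qed

lemma rmod_autI:
  assumes f: "linear R M M f" and g: "linear R M M g"
    and gf: "\<And>v. v \<in> carrier M \<Longrightarrow> g (f v) = v" "\<And>v. v \<in> carrier M \<Longrightarrow> f (g v) = v"
  shows "restrict f (carrier M) \<in> carrier (rmod_aut R M)"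
proof -
  let ?f = "restrict f (carrier M)" and ?g = "restrict g (carrier M)"
  have "?g \<otimes>\<^bsub>rend R M\<^esub> ?f = \<one>\<^bsub>rend R M\<^esub>" "?f \<otimes>\<^bsub>rend R M\<^esub> ?g = \<one>\<^bsub>rend R M\<^esub>"
    using gf linear_closed[OF f] linear_closed[OF g] by (auto simp: compose_def fun_eq_iff)
  then show ?thesis
    using restrict_rhom[OF M f] restrict_rhom[OF M g]
    by (auto simp: rmod_aut_def units_of_def Units_def)
qed

end

section \<open>Integral group rings of finite groups\<close>

locale fin_group = group G for G :: "'g monoid" (structure) +
  assumes fin: "finite (carrier G)"
begin

abbreviation ZG :: "('g \<Rightarrow> int) ring" where "ZG \<equiv> group_ring G"

abbreviation \<delta> :: "'g \<Rightarrow> 'g \<Rightarrow> int" where "\<delta> \<equiv> group_ring_elem"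

lemma ZG_carrier: "f \<in> carrier ZG \<longleftrightarrow> (\<forall>g. g \<notin> carrier G \<longrightarrow> f g = 0)"
proof -
  have "{g. f g \<noteq> 0} \<subseteq> carrier G \<Longrightarrow> finite {g. f g \<noteq> 0}"
    using fin finite_subset by blast
  then show ?thesis by (auto simp: group_ring_def)
qed

lemma ZG_simps [simp]:
  "\<one>\<^bsub>ZG\<^esub> = \<delta> \<one>" "\<zero>\<^bsub>ZG\<^esub> = (\<lambda>g. 0)" "f \<oplus>\<^bsub>ZG\<^esub> h = (\<lambda>g. f g + h g)"
  by (simp_all add: group_ring_def group_ring_elem_def)

lemma ZG_outside: "f \<in> carrier ZG \<Longrightarrow> g \<notin> carrier G \<Longrightarrow> f g = 0"
  by (simp add: ZG_carrier)

lemma ZG_mult: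
  assumes f: "f \<in> carrier ZG" and h: "h \<in> carrier ZG"
  shows "f \<otimes>\<^bsub>ZG\<^esub> h = (\<lambda>g. if g \<in> carrier G then \<Sum>a\<in>carrier G. f a * h (inv a \<otimes> g) else 0)"
proof
  fix g
  let ?S = "{(a, b). f a \<noteq> 0 \<and> h b \<noteq> 0 \<and> a \<otimes> b = g}"
  have G: "a \<in> carrier G" "b \<in> carrier G" if "(a, b) \<in> ?S" for a b
    using that ZG_outside[OF f, of a] ZG_outside[OF h, of b] by auto
  have l: "(f \<otimes>\<^bsub>ZG\<^esub> h) g = (\<Sum>(a, b)\<in>?S. f a * h b)"
    by (simp add: group_ring_def)
  show "(f \<otimes>\<^bsub>ZG\<^esub> h) g = (if g \<in> carrier G then \<Sum>a\<in>carrier G. f a * h (inv a \<otimes> g) else 0)"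
  proof (cases "g \<in> carrier G")
    case True
    have "(\<Sum>(a, b)\<in>?S. f a * h b) = (\<Sum>(a, b)\<in>(\<lambda>a. (a, inv a \<otimes> g)) ` carrier G. f a * h b)"
    proof (rule sum.mono_neutral_left)
      show "?S \<subseteq> (\<lambda>a. (a, inv a \<otimes> g)) ` carrier G"
      proof clarify
        fix a b assume *: "f a \<noteq> 0" "h b \<noteq> 0" "g = a \<otimes> b"
        then have "a \<in> carrier G" "b \<in> carrier G" using G[of a b] by auto
        then show "(a, b) \<in> (\<lambda>x. (x, inv x \<otimes> (a \<otimes> b))) ` carrier G"
          by (intro image_eqI[of _ _ a]) (simp_all add: m_assoc[symmetric])
      qed
      show "\<forall>i\<in>(\<lambda>a. (a, inv a \<otimes> g)) ` carrier G - ?S. (case i of (a, b) \<Rightarrow> f a * h b) = 0"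
        using True by (auto simp: m_assoc[symmetric])
    qed (use fin in simp)
    also have "\<dots> = (\<Sum>a\<in>carrier G. f a * h (inv a \<otimes> g))"
      by (subst sum.reindex) (auto simp: inj_on_def)
    finally show ?thesis using True l by simp
  next
    case False
    then have "(a, b) \<notin> ?S" for a b using G[of a b] by (auto simp del: prod.case)
    then have "x \<notin> ?S" for x by (cases x) blast
    then have "?S = {}" by blast
    then show ?thesis unfolding l using False by (simp only: sum.empty if_False)
  qed
qed

lemma ZG_mult_closed: "f \<in> carrier ZG \<Longrightarrow> h \<in> carrier ZG \<Longrightarrow> f \<otimes>\<^bsub>ZG\<^esub> h \<in> carrier ZG"
  by (simp add: ZG_mult) (simp add: ZG_carrier)

lemma \<delta>_closed [simp]: "g \<in> carrier G \<Longrightarrow> \<delta> g \<in> carrier ZG"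
  by (auto simp: ZG_carrier group_ring_elem_def)

lemma \<delta>_mult:
  assumes "g \<in> carrier G" "f \<in> carrier ZG" "h \<in> carrier G"
  shows "(\<delta> g \<otimes>\<^bsub>ZG\<^esub> f) h = f (inv g \<otimes> h)"
proof -
  have "(\<delta> g \<otimes>\<^bsub>ZG\<^esub> f) h = (\<Sum>a\<in>carrier G. if a = g then f (inv a \<otimes> h) else 0)"
    unfolding ZG_mult[OF \<delta>_closed[OF assms(1)] assms(2)]
    using assms(3) by (auto simp: group_ring_elem_def intro!: sum.cong)
  then show ?thesis using assms fin by simp
qed

lemma mult_\<delta>:
  assumes "g \<in> carrier G" "f \<in> carrier ZG" "h \<in> carrier G"
  shows "(f \<otimes>\<^bsub>ZG\<^esub> \<delta> g) h = f (h \<otimes> inv g)"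
proof -
  have eq: "inv a \<otimes> h = g \<longleftrightarrow> a = h \<otimes> inv g" if "a \<in> carrier G" for a
    using assms(1,3) that by (metis inv_closed inv_solve_left inv_solve_right')
  have "(f \<otimes>\<^bsub>ZG\<^esub> \<delta> g) h = (\<Sum>a\<in>carrier G. if a = h \<otimes> inv g then f a else 0)"
    unfolding ZG_mult[OF assms(2) \<delta>_closed[OF assms(1)]]
    using assms(3) eq by (auto simp: group_ring_elem_def intro!: sum.cong)
  then show ?thesis using assms fin by simp
qed

lemma \<delta>_\<delta>: "g \<in> carrier G \<Longrightarrow> h \<in> carrier G \<Longrightarrow> \<delta> g \<otimes>\<^bsub>ZG\<^esub> \<delta> h = \<delta> (g \<otimes> h)"
proof
  fix k assume gh: "g \<in> carrier G" "h \<in> carrier G"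
  show "(\<delta> g \<otimes>\<^bsub>ZG\<^esub> \<delta> h) k = \<delta> (g \<otimes> h) k"
  proof (cases "k \<in> carrier G")
    case True
    have "inv g \<otimes> k = h \<longleftrightarrow> k = g \<otimes> h"
      using gh True by (metis inv_closed inv_inv inv_solve_left)
    then have "\<delta> h (inv g \<otimes> k) = \<delta> (g \<otimes> h) k" by (simp add: group_ring_elem_def)
    then show ?thesis using True gh \<delta>_mult[of g "\<delta> h" k] by simp
  next
    case False
    then show ?thesis
      using ZG_outside[OF ZG_mult_closed[of "\<delta> g" "\<delta> h"]] gh ZG_outside[of "\<delta> (g \<otimes> h)"] by simp
  qed
qed

lemma sum_left_translate:
  "b \<in> carrier G \<Longrightarrow> (\<Sum>a\<in>carrier G. u (b \<otimes> a)) = (\<Sum>a\<in>carrier G. u a)"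
  by (rule sum.reindex_bij_witness[of _ "\<lambda>a. inv b \<otimes> a" "\<lambda>a. b \<otimes> a"]) (auto simp: m_assoc[symmetric])

lemma sum_inverse: "(\<Sum>a\<in>carrier G. u (inv a)) = (\<Sum>a\<in>carrier G. u a)"
  by (rule sum.reindex_bij_witness[of _ "\<lambda>a. inv a" "\<lambda>a. inv a"]) auto

lemma ring_ZG: "ring ZG"
proof (rule ringI)
  show "abelian_group ZG"
  proof (rule abelian_groupI)
    show "\<exists>y\<in>carrier ZG. y \<oplus>\<^bsub>ZG\<^esub> f = \<zero>\<^bsub>ZG\<^esub>" if "f \<in> carrier ZG" for f
      using that by (intro bexI[of _ "\<lambda>g. - f g"]) (auto simp: ZG_carrier)
  qed (auto simp: ZG_carrier)
  show "Group.monoid ZG"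
  proof (rule monoidI)
    fix f assume f: "f \<in> carrier ZG"
    show "\<one>\<^bsub>ZG\<^esub> \<otimes>\<^bsub>ZG\<^esub> f = f"
    proof
      show "(\<one>\<^bsub>ZG\<^esub> \<otimes>\<^bsub>ZG\<^esub> f) g = f g" for g
        using f \<delta>_mult[of \<one> f g] ZG_outside[OF f] ZG_outside[OF ZG_mult_closed[of "\<delta> \<one>" f]]
        by (cases "g \<in> carrier G") simp_all
    qed
    show "f \<otimes>\<^bsub>ZG\<^esub> \<one>\<^bsub>ZG\<^esub> = f"
    proof
      show "(f \<otimes>\<^bsub>ZG\<^esub> \<one>\<^bsub>ZG\<^esub>) g = f g" for g
        using f mult_\<delta>[of \<one> f g] ZG_outside[OF f] ZG_outside[OF ZG_mult_closed[of f "\<delta> \<one>"]]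
        by (cases "g \<in> carrier G") simp_all
    qed
    fix h assume h: "h \<in> carrier ZG"
    show "f \<otimes>\<^bsub>ZG\<^esub> h \<in> carrier ZG" using f h by (rule ZG_mult_closed)
    fix k assume k: "k \<in> carrier ZG"
    have fh: "f \<otimes>\<^bsub>ZG\<^esub> h \<in> carrier ZG" and hk: "h \<otimes>\<^bsub>ZG\<^esub> k \<in> carrier ZG"
      using f h k ZG_mult_closed by auto
    show "f \<otimes>\<^bsub>ZG\<^esub> h \<otimes>\<^bsub>ZG\<^esub> k = f \<otimes>\<^bsub>ZG\<^esub> (h \<otimes>\<^bsub>ZG\<^esub> k)"
    proof
      fix g
      show "(f \<otimes>\<^bsub>ZG\<^esub> h \<otimes>\<^bsub>ZG\<^esub> k) g = (f \<otimes>\<^bsub>ZG\<^esub> (h \<otimes>\<^bsub>ZG\<^esub> k)) g"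
      proof (cases "g \<in> carrier G")
        case True
        have "(f \<otimes>\<^bsub>ZG\<^esub> h \<otimes>\<^bsub>ZG\<^esub> k) g =
            (\<Sum>a\<in>carrier G. \<Sum>b\<in>carrier G. f b * h (inv b \<otimes> a) * k (inv a \<otimes> g))"
          unfolding ZG_mult[OF fh k] using True by (simp add: ZG_mult[OF f h] sum_distrib_right)
        also have "\<dots> = (\<Sum>b\<in>carrier G. \<Sum>a\<in>carrier G. f b * h (inv b \<otimes> a) * k (inv a \<otimes> g))"
          by (rule sum.swap)
        also have "\<dots> = (\<Sum>b\<in>carrier G. f b * (\<Sum>c\<in>carrier G. h c * k (inv c \<otimes> (inv b \<otimes> g))))"
        proof (rule sum.cong[OF refl])
          fix b assume b: "b \<in> carrier G"
          have "(\<Sum>a\<in>carrier G. f b * h (inv b \<otimes> a) * k (inv a \<otimes> g)) =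
              (\<Sum>c\<in>carrier G. f b * h (inv b \<otimes> (b \<otimes> c)) * k (inv (b \<otimes> c) \<otimes> g))"
            by (rule sum_left_translate[OF b, symmetric])
          also have "\<dots> = (\<Sum>c\<in>carrier G. f b * (h c * k (inv c \<otimes> (inv b \<otimes> g))))"
            using b True by (intro sum.cong refl) (simp add: m_assoc[symmetric] inv_mult_group)
          finally show "(\<Sum>a\<in>carrier G. f b * h (inv b \<otimes> a) * k (inv a \<otimes> g)) =
              f b * (\<Sum>c\<in>carrier G. h c * k (inv c \<otimes> (inv b \<otimes> g)))"
            by (simp add: sum_distrib_left)
        qed
        also have "\<dots> = (f \<otimes>\<^bsub>ZG\<^esub> (h \<otimes>\<^bsub>ZG\<^esub> k)) g"
          unfolding ZG_mult[OF f hk] using True by (simp add: ZG_mult[OF h k])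
        finally show ?thesis .
      next
        case False
        then show ?thesis
          using ZG_outside[OF ZG_mult_closed[OF fh k]] ZG_outside[OF ZG_mult_closed[OF f hk]] by simp
      qed
    qed
  qed simp
  fix f h k assume f: "f \<in> carrier ZG" and h: "h \<in> carrier ZG" and k: "k \<in> carrier ZG"
  have fh: "(\<lambda>g. f g + h g) \<in> carrier ZG" using f h by (simp add: ZG_carrier)
  show "(f \<oplus>\<^bsub>ZG\<^esub> h) \<otimes>\<^bsub>ZG\<^esub> k = f \<otimes>\<^bsub>ZG\<^esub> k \<oplus>\<^bsub>ZG\<^esub> h \<otimes>\<^bsub>ZG\<^esub> k"
    by (simp add: ZG_mult[OF fh k] ZG_mult[OF f k] ZG_mult[OF h k] distrib_right sum.distrib fun_eq_iff)
  show "k \<otimes>\<^bsub>ZG\<^esub> (f \<oplus>\<^bsub>ZG\<^esub> h) = k \<otimes>\<^bsub>ZG\<^esub> f \<oplus>\<^bsub>ZG\<^esub> k \<otimes>\<^bsub>ZG\<^esub> h"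
    by (simp add: ZG_mult[OF k fh] ZG_mult[OF k f] ZG_mult[OF k h] distrib_left sum.distrib fun_eq_iff)
qed

sublocale ZG: ring ZG by (rule ring_ZG)

lemma ZG_one_neq_zero: "\<one>\<^bsub>ZG\<^esub> \<noteq> \<zero>\<^bsub>ZG\<^esub>"
  by (auto simp: group_ring_elem_def fun_eq_iff)

lemma ZG_neg: "f \<in> carrier ZG \<Longrightarrow> \<ominus>\<^bsub>ZG\<^esub> f = (\<lambda>g. - f g)"
  by (rule ZG.minus_equality) (auto simp: ZG_carrier)

lemma ZG_minus: "f \<in> carrier ZG \<Longrightarrow> h \<in> carrier ZG \<Longrightarrow> f \<ominus>\<^bsub>ZG\<^esub> h = (\<lambda>g. f g - h g)"
  by (simp add: ZG.minus_eq ZG_neg)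

text \<open>An additive map is \<int>-linear, so it is determined by the group elements. The
  codomain is kept general because both integral and complex values occur.\<close>

lemma additive_ZG:
  fixes T :: "('g \<Rightarrow> int) \<Rightarrow> 'c :: comm_ring_1"
  assumes T: "\<And>a b. a \<in> carrier ZG \<Longrightarrow> b \<in> carrier ZG \<Longrightarrow> T (\<lambda>g. a g + b g) = T a + T b"
    and a: "a \<in> carrier ZG"
  shows "T a = (\<Sum>g\<in>carrier G. of_int (a g) * T (\<delta> g))"
proof -
  have T0: "T (\<lambda>g. 0) = 0" using T[of "\<lambda>g. 0" "\<lambda>g. 0"] by (simp add: ZG_carrier)
  have mult: "T (\<lambda>h. n * \<delta> g h) = of_int n * T (\<delta> g)" if g: "g \<in> carrier G" for n g
  proof (induction n rule: int_induct[of _ 0])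
    case base then show ?case by (simp add: T0)
  next
    case (step1 n)
    then show ?case using T[of "\<lambda>h. n * \<delta> g h" "\<delta> g"] g
      by (simp add: ZG_carrier group_ring_elem_def distrib_right)
  next
    case (step2 n)
    then show ?case using T[of "\<lambda>h. (n - 1) * \<delta> g h" "\<delta> g"] g
      by (simp add: ZG_carrier group_ring_elem_def algebra_simps)
  qed
  have "T a = (\<Sum>g\<in>S. of_int (a g) * T (\<delta> g))"
    if "finite S" "S \<subseteq> carrier G" "\<forall>g. g \<notin> S \<longrightarrow> a g = 0" for S a
    using that
  proof (induction S arbitrary: a)
    case empty
    then have "a = (\<lambda>g. 0)" by auto
    then show ?case by (simp add: T0)
  next
    case (insert s S)
    let ?b = "a(s := 0)" and ?c = "\<lambda>h. a s * \<delta> s h"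
    have b: "?b \<in> carrier ZG" "?c \<in> carrier ZG"
      using insert.prems by (auto simp: ZG_carrier group_ring_elem_def)
    have "a = (\<lambda>g. ?b g + ?c g)" by (auto simp: group_ring_elem_def)
    then have "T a = T ?b + T ?c" using T[OF b] by simp
    also have "T ?b = (\<Sum>g\<in>S. of_int (?b g) * T (\<delta> g))"
      by (rule insert.IH) (use insert.prems in auto)
    also have "\<dots> = (\<Sum>g\<in>S. of_int (a g) * T (\<delta> g))"
      using insert.hyps by (intro sum.cong) auto
    also have "T ?c = of_int (a s) * T (\<delta> s)" using mult insert.prems by simp
    finally show ?case using insert.hyps by simp
  qed
  from this[OF fin subset_refl] a show ?thesis by (simp add: ZG_carrier)
qed

section \<open>Homomorphisms into the group ring\<close>

definition hat :: "('g \<Rightarrow> int, 'b) rmodule \<Rightarrow> ('b \<Rightarrow> int) \<Rightarrow> 'b \<Rightarrow> 'g \<Rightarrow> int"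
  where "hat M \<phi> v = (\<lambda>g. if g \<in> carrier G then \<phi> (v \<triangleleft>\<^bsub>M\<^esub> \<delta> (inv g)) else 0)"

text \<open>Frobenius reciprocity: v goes to the sum of \<phi>(v g^-1) g over the group, the
  \<Lambda>-linear map whose coefficient at the identity is \<phi>. Integral functionals thus
  produce homomorphisms into \<Lambda>.\<close>

lemma linear_hat:
  assumes M: "right_module ZG M"
    and \<phi>: "\<And>v w. v \<in> carrier M \<Longrightarrow> w \<in> carrier M \<Longrightarrow> \<phi> (v \<oplus>\<^bsub>M\<^esub> w) = \<phi> v + \<phi> w"
  shows "linear ZG M (reg ZG) (hat M \<phi>)"
proof (rule linearI)
  interpret M: right_module ZG M by (rule M)
  fix v assume v: "v \<in> carrier M"
  show closed: "hat M \<phi> v \<in> carrier (reg ZG)" by (simp add: hat_def ZG_carrier)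
  show "hat M \<phi> (v \<oplus>\<^bsub>M\<^esub> w) = hat M \<phi> v \<oplus>\<^bsub>reg ZG\<^esub> hat M \<phi> w" if w: "w \<in> carrier M" for w
    using v w by (auto simp: hat_def M.act_add_left \<phi> M.act_closed)
  fix a assume a: "a \<in> carrier ZG"
  have T: "\<phi> (v \<triangleleft>\<^bsub>M\<^esub> c) = (\<Sum>h\<in>carrier G. c h * \<phi> (v \<triangleleft>\<^bsub>M\<^esub> \<delta> h))" if c: "c \<in> carrier ZG" for c
  proof -
    have add: "\<phi> (v \<triangleleft>\<^bsub>M\<^esub> (\<lambda>g. b g + d g)) = \<phi> (v \<triangleleft>\<^bsub>M\<^esub> b) + \<phi> (v \<triangleleft>\<^bsub>M\<^esub> d)"
      if "b \<in> carrier ZG" "d \<in> carrier ZG" for b d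
      using M.act_add_right[OF v that] \<phi> v that by (simp add: M.act_closed)
    have "\<phi> (v \<triangleleft>\<^bsub>M\<^esub> c) = (\<Sum>h\<in>carrier G. of_int (c h) * \<phi> (v \<triangleleft>\<^bsub>M\<^esub> \<delta> h))"
      by (rule additive_ZG[of "\<lambda>c. \<phi> (v \<triangleleft>\<^bsub>M\<^esub> c)", OF add c])
    then show ?thesis by simp
  qed
  show "hat M \<phi> (v \<triangleleft>\<^bsub>M\<^esub> a) = hat M \<phi> v \<triangleleft>\<^bsub>reg ZG\<^esub> a"
  proof
    fix g
    show "hat M \<phi> (v \<triangleleft>\<^bsub>M\<^esub> a) g = (hat M \<phi> v \<triangleleft>\<^bsub>reg ZG\<^esub> a) g"
    proof (cases "g \<in> carrier G")
      case g: True
      have "hat M \<phi> (v \<triangleleft>\<^bsub>M\<^esub> a) g = \<phi> (v \<triangleleft>\<^bsub>M\<^esub> (a \<otimes>\<^bsub>ZG\<^esub> \<delta> (inv g)))"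
        using g v a by (simp add: hat_def M.act_assoc)
      also have "\<dots> = (\<Sum>h\<in>carrier G. a (h \<otimes> g) * \<phi> (v \<triangleleft>\<^bsub>M\<^esub> \<delta> h))"
        using g a by (subst T) (auto simp: mult_\<delta> intro!: sum.cong)
      also have "\<dots> = (\<Sum>h\<in>carrier G. a (inv h \<otimes> g) * \<phi> (v \<triangleleft>\<^bsub>M\<^esub> \<delta> (inv h)))"
        by (rule sum_inverse[symmetric])
      also have "\<dots> = (hat M \<phi> v \<otimes>\<^bsub>ZG\<^esub> a) g"
        using closed a g by (auto simp: ZG_mult hat_def mult.commute intro!: sum.cong)
      finally show ?thesis by simp
    next
      case False
      then show ?thesis using ZG_outside[OF ZG_mult_closed[OF _ a]] closed by (simp add: hat_def)
    qed
  qed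
qed

lemma hat_one: "right_module ZG M \<Longrightarrow> v \<in> carrier M \<Longrightarrow> hat M \<phi> v \<one> = \<phi> v"
  using right_module.act_one[of ZG M v] by (simp add: hat_def)

text \<open>The coefficient of \<open>k v\<close> at g is the coefficient of
  \<open>k (v g^-1)\<close> at the identity, so the coefficients at the identity determine a
  homomorphism.\<close>

lemma linear_reg_eqI:
  assumes M: "right_module ZG M" and f: "linear ZG M (reg ZG) f" and h: "linear ZG M (reg ZG) h"
    and eq: "\<And>v. v \<in> carrier M \<Longrightarrow> f v \<one> = h v \<one>" and v: "v \<in> carrier M"
  shows "f v = h v"
proof
  interpret M: right_module ZG M by (rule M)
  fix g
  have *: "k v g = k (v \<triangleleft>\<^bsub>M\<^esub> \<delta> (inv g)) \<one>" if "linear ZG M (reg ZG) k" "g \<in> carrier G" for k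
    using linear_act[OF that(1) v, of "\<delta> (inv g)"] linear_closed[OF that(1) v] that(2)
      mult_\<delta>[of "inv g" "k v" \<one>] by simp
  show "f v g = h v g"
  proof (cases "g \<in> carrier G")
    case True
    then show ?thesis using *[OF f] *[OF h] eq[of "v \<triangleleft>\<^bsub>M\<^esub> \<delta> (inv g)"] v by (simp add: M.act_closed)
  next
    case False
    then show ?thesis
      using ZG_outside[OF _ False, of "f v"] ZG_outside[OF _ False, of "h v"]
        linear_closed[OF f v] linear_closed[OF h v] by simp
  qed
qed

end

section \<open>Extension of functionals from pure subgroups\<close>

lemma bezout_finite:
  fixes v :: "'s \<Rightarrow> int"
  assumes "finite S"
  obtains c d where "(\<Sum>s\<in>S. c s * v s) = d" "\<And>s. s \<in> S \<Longrightarrow> d dvd v s"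
proof -
  have "\<exists>c d. (\<Sum>s\<in>S. c s * v s) = d \<and> (\<forall>s\<in>S. d dvd v s)"
    using assms
  proof (induction S)
    case (insert t S)
    then obtain c d where cd: "(\<Sum>s\<in>S. c s * v s) = d" "\<forall>s\<in>S. d dvd v s" by blast
    obtain x y where xy: "x * v t + y * d = gcd (v t) d" using bezout_int by blast
    let ?c = "\<lambda>s. if s = t then x else y * c s"
    have "(\<Sum>s\<in>S. ?c s * v s) = (\<Sum>s\<in>S. y * (c s * v s))"
      using insert.hyps by (intro sum.cong) auto
    then have "(\<Sum>s\<in>insert t S. ?c s * v s) = gcd (v t) d"
      using insert.hyps xy cd(1) by (simp add: sum_distrib_left[symmetric])
    moreover have "\<forall>s\<in>insert t S. gcd (v t) d dvd v s"
      using cd(2) by (auto intro: dvd_trans[of _ d])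
    ultimately show ?case by (intro exI[of _ ?c] exI[of _ "gcd (v t) d"] conjI)
  qed simp
  then show thesis using that by blast
qed

text \<open>
  A primitive vector \<open>u\<close> of the pure subgroup \<open>L\<close> splits off as a direct summand; its complement in
  \<open>L\<close> has fewer elements modulo 2.
\<close>

lemma pure_functional_extend:
  fixes L :: "('s \<Rightarrow> int) set" and f :: "('s \<Rightarrow> int) \<Rightarrow> int"
  assumes S: "finite S"
    and lin: "\<And>u v a b. u \<in> L \<Longrightarrow> v \<in> L \<Longrightarrow> (\<lambda>s. a * u s + b * v s) \<in> L"
    and supp: "\<And>v s. v \<in> L \<Longrightarrow> s \<notin> S \<Longrightarrow> v s = 0"
    and pure: "\<And>v k. k \<noteq> 0 \<Longrightarrow> (\<lambda>s. k * v s) \<in> L \<Longrightarrow> v \<in> L"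
    and f: "\<And>u v. u \<in> L \<Longrightarrow> v \<in> L \<Longrightarrow> f (\<lambda>s. u s + v s) = f u + f v"
  shows "\<exists>c. \<forall>v\<in>L. f v = (\<Sum>s\<in>S. c s * v s)"
  using lin supp pure f
proof (induction "card ((\<lambda>v s. v s mod 2) ` L)" arbitrary: L rule: less_induct)
  case less
  note lin = less.prems(1) and supp = less.prems(2) and pure = less.prems(3) and f = less.prems(4)
  let ?B = "\<lambda>L :: ('s \<Rightarrow> int) set. (\<lambda>v s. v s mod 2) ` L"
  show ?case
  proof (cases "\<forall>v\<in>L. v = (\<lambda>s. 0)")
    case True
    have "f v = 0" if v: "v \<in> L" for v
      using f[OF v v] v True by auto
    then show ?thesis using True by (intro exI[of _ "\<lambda>s. 0"]) simp
  next
    case False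
    then obtain v where v: "v \<in> L" "v \<noteq> (\<lambda>s. 0)" by blast
    obtain c d where cd: "(\<Sum>s\<in>S. c s * v s) = d" "\<And>s. s \<in> S \<Longrightarrow> d dvd v s"
      using bezout_finite[OF S, of v] by blast
    have "d \<noteq> 0"
    proof
      assume "d = 0"
      then have "v s = 0" for s using cd(2)[of s] supp[OF v(1), of s] by (cases "s \<in> S") auto
      then show False using v(2) by blast
    qed
    \<comment> \<open>Division by the greatest common divisor makes the vector primitive: the Bezout
      functional \<open>c\<close> takes the value 1 on it, and purity keeps it in
      \<open>L\<close>.\<close>
    define u where "u s = v s div d" for s
    have vu: "v s = d * u s" for s
      using cd(2)[of s] supp[OF v(1), of s] by (cases "s \<in> S") (auto simp: u_def)
    then have "(\<lambda>s. d * u s) = v" by auto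
    then have u: "u \<in> L" using pure[OF \<open>d \<noteq> 0\<close>, of u] v(1) by simp
    have "d * (\<Sum>s\<in>S. c s * u s) = d * 1"
      using cd(1) by (simp add: sum_distrib_left vu mult.left_commute)
    then have cu: "(\<Sum>s\<in>S. c s * u s) = 1" using \<open>d \<noteq> 0\<close> by simp
    define L' where "L' = {w \<in> L. (\<Sum>s\<in>S. c s * w s) = 0}"
    have fin: "finite (?B L)"
    proof (rule finite_subset)
      show "?B L \<subseteq> {h. \<forall>s. (s \<in> S \<longrightarrow> h s \<in> {0, 1}) \<and> (s \<notin> S \<longrightarrow> h s = 0)}"
        by (auto dest: supp)
      show "finite {h. \<forall>s. (s \<in> S \<longrightarrow> h s \<in> {0, 1 :: int}) \<and> (s \<notin> S \<longrightarrow> h s = 0)}"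
        by (rule finite_set_of_finite_funs[OF S]) simp
    qed
    have "?B L' \<subset> ?B L"
    proof
      show "?B L' \<subseteq> ?B L" by (auto simp: L'_def)
      \<comment> \<open>\<open>c\<close> is 1 on \<open>u\<close> and 0 on \<open>L'\<close>, which
        is incompatible with a congruence modulo 2 between \<open>u\<close> and a member of
        \<open>L'\<close>.\<close>
      have "(\<lambda>s. u s mod 2) \<notin> ?B L'"
      proof
        assume "(\<lambda>s. u s mod 2) \<in> ?B L'"
        then obtain w where w: "w \<in> L'" "\<And>s. u s mod 2 = w s mod 2" by (auto simp: fun_eq_iff)
        have "2 dvd (\<Sum>s\<in>S. c s * (u s - w s))"
          using w(2) by (intro dvd_sum dvd_mult) (simp add: mod_eq_dvd_iff)
        then have "2 dvd (\<Sum>s\<in>S. c s * u s) - (\<Sum>s\<in>S. c s * w s)"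
          by (simp add: right_diff_distrib sum_subtractf)
        then show False using cu w(1) by (simp add: L'_def)
      qed
      then show "?B L' \<noteq> ?B L" using u by blast
    qed
    then have "card (?B L') < card (?B L)" by (rule psubset_card_mono[OF fin])
    then have "\<exists>c. \<forall>w\<in>L'. f w = (\<Sum>s\<in>S. c s * w s)"
    proof (rule less.hyps)
      show "(\<lambda>s. a * w s + b * x s) \<in> L'" if "w \<in> L'" "x \<in> L'" for w x a b
        using that lin[of w x a b]
        by (auto simp: L'_def distrib_left sum.distrib mult.left_commute sum_distrib_left[symmetric])
      show "w \<in> L'" if "k \<noteq> 0" "(\<lambda>s. k * w s) \<in> L'" for w k
        using that pure[of k w]
        by (auto simp: L'_def mult.left_commute sum_distrib_left[symmetric])
    qed (use supp f in \<open>auto simp: L'_def\<close>)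
    then obtain c' where c': "\<And>w. w \<in> L' \<Longrightarrow> f w = (\<Sum>s\<in>S. c' s * w s)" by blast
    have scale: "f (\<lambda>s. k * w s) = k * f w" if w: "w \<in> L" for k w
    proof (induction k rule: int_induct[of _ 0])
      case base
      show ?case using f[of "\<lambda>s. 0" "\<lambda>s. 0"] lin[OF w w, of 0 0] by simp
    next
      case (step1 k)
      then show ?case using f[of "\<lambda>s. k * w s" w] lin[OF w w, of k 0] w by (simp add: distrib_right)
    next
      case (step2 k)
      then show ?case using f[of "\<lambda>s. (k - 1) * w s" w] lin[OF w w, of "k - 1" 0] w
        by (simp add: algebra_simps)
    qed
    show ?thesis
    proof (intro exI ballI)
      fix w assume w: "w \<in> L"
      define t where "t = (\<Sum>s\<in>S. c s * w s)"
      let ?w = "\<lambda>s. 1 * w s + (- t) * u s"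
      have comb: "(\<Sum>s\<in>S. e s * ?w s) = (\<Sum>s\<in>S. e s * w s) - t * (\<Sum>s\<in>S. e s * u s)" for e
        by (simp add: algebra_simps sum_subtractf sum_distrib_left)
      have "?w \<in> L'"
        using lin[OF w u, of 1 "- t"] cu comb[of c] by (simp add: L'_def t_def[symmetric])
      then have fw': "f ?w = (\<Sum>s\<in>S. c' s * w s) - t * (\<Sum>s\<in>S. c' s * u s)"
        using c'[of ?w] comb[of c'] by simp
      have fw: "f w = f ?w + t * f u"
        using f[of ?w "\<lambda>s. t * u s"] lin[OF w u, of 1 "- t"] lin[OF u u, of t 0] scale[OF u] by simp
      have comb': "(\<Sum>s\<in>S. (c' s + k * c s) * w s) = (\<Sum>s\<in>S. c' s * w s) + k * t" for k
        by (simp add: t_def algebra_simps sum.distrib sum_distrib_left)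
      \<comment> \<open>Adding a multiple of \<open>c\<close> to \<open>c'\<close> changes nothing
        on \<open>L'\<close>; the multiple is chosen to give the right value at
        \<open>u\<close>.\<close>
      show "f w = (\<Sum>s\<in>S. (c' s + (f u - (\<Sum>s\<in>S. c' s * u s)) * c s) * w s)"
        unfolding comb' fw fw' by (simp add: left_diff_distrib right_diff_distrib mult.commute)
    qed
  qed
qed

section \<open>Swan embeddings and the Swan homomorphism of lattices\<close>

context fin_group
begin

text \<open>The integer k as an element of the group ring, so that integral multiples become
  instances of the action and commute with every linear map.\<close>

definition zs :: "int \<Rightarrow> 'g \<Rightarrow> int"
  where "zs k = (\<lambda>g. k * \<delta> \<one> g)"

lemma zs_closed [simp]: "zs k \<in> carrier ZG"
  by (auto simp: zs_def ZG_carrier group_ring_elem_def)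

lemma mult_zs: "f \<in> carrier ZG \<Longrightarrow> f \<otimes>\<^bsub>ZG\<^esub> zs k = (\<lambda>g. k * f g)"
proof
  fix g assume f: "f \<in> carrier ZG"
  show "(f \<otimes>\<^bsub>ZG\<^esub> zs k) g = k * f g"
  proof (cases "g \<in> carrier G")
    case True
    have eq: "inv a \<otimes> g = \<one> \<longleftrightarrow> a = g" if "a \<in> carrier G" for a
    proof -
      have "a \<otimes> (inv a \<otimes> g) = g" using True that by (simp add: m_assoc[symmetric])
      then show ?thesis by (metis True that l_inv r_one)
    qed
    have "(f \<otimes>\<^bsub>ZG\<^esub> zs k) g = (\<Sum>a\<in>carrier G. if a = g then k * f a else 0)"
      unfolding ZG_mult[OF f zs_closed] using True eq
      by (auto simp: zs_def group_ring_elem_def intro!: sum.cong)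
    then show ?thesis using True fin by simp
  next
    case False
    then show ?thesis using ZG_outside[OF f] ZG_outside[OF ZG_mult_closed[OF f zs_closed]] by simp
  qed
qed

lemma add_pow_eq_zs:
  assumes M: "right_module ZG M" and v: "v \<in> carrier M"
  shows "[(k::int)] \<cdot>\<^bsub>M\<^esub> v = v \<triangleleft>\<^bsub>M\<^esub> zs k"
proof -
  interpret M: right_module ZG M by (rule M)
  have zs1: "zs 1 = \<one>\<^bsub>ZG\<^esub>" and zs0: "zs 0 = \<zero>\<^bsub>ZG\<^esub>" by (auto simp: zs_def)
  have zs_add: "v \<triangleleft>\<^bsub>M\<^esub> zs (k + l) = v \<triangleleft>\<^bsub>M\<^esub> zs k \<oplus>\<^bsub>M\<^esub> v \<triangleleft>\<^bsub>M\<^esub> zs l" for k l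
  proof -
    have "zs (k + l) = zs k \<oplus>\<^bsub>ZG\<^esub> zs l" by (auto simp: zs_def distrib_right)
    then show ?thesis using M.act_add_right[OF v, of "zs k" "zs l"] by (simp only: zs_closed)
  qed
  have pow_add: "[(k + l)] \<cdot>\<^bsub>M\<^esub> v = [k] \<cdot>\<^bsub>M\<^esub> v \<oplus>\<^bsub>M\<^esub> [l] \<cdot>\<^bsub>M\<^esub> v" for k l :: int
    by (rule M.M.add.int_pow_mult[OF v])
  have pow_1: "[(1::int)] \<cdot>\<^bsub>M\<^esub> v = v" by (rule M.M.add.int_pow_1[OF v])
  show ?thesis
  proof (induction k rule: int_induct[of _ 0])
    case base
    show ?case unfolding zs0 using M.act_zero_right[OF v] by (simp add: add_pow_def int_pow_def nat_pow_def)
  next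
    case (step1 k)
    then show ?case using pow_add[of k 1] zs_add[of k 1] pow_1 zs1 M.act_one[OF v] by simp
  next
    case (step2 k)
    have "[k] \<cdot>\<^bsub>M\<^esub> v = [(k - 1)] \<cdot>\<^bsub>M\<^esub> v \<oplus>\<^bsub>M\<^esub> v" using pow_add[of "k - 1" 1] pow_1 by simp
    moreover have "v \<triangleleft>\<^bsub>M\<^esub> zs k = v \<triangleleft>\<^bsub>M\<^esub> zs (k - 1) \<oplus>\<^bsub>M\<^esub> v"
      using zs_add[of "k - 1" 1] zs1 M.act_one[OF v] by simp
    ultimately have "[(k - 1)] \<cdot>\<^bsub>M\<^esub> v \<oplus>\<^bsub>M\<^esub> v = v \<triangleleft>\<^bsub>M\<^esub> zs (k - 1) \<oplus>\<^bsub>M\<^esub> v" using step2 by simp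
    moreover have "[(k - 1)] \<cdot>\<^bsub>M\<^esub> v \<in> carrier M" by (rule M.M.add.int_pow_closed[OF v])
    ultimately show ?case using v M.act_closed[OF v zs_closed] by (simp add: M.M.add.right_cancel)
  qed
qed

text \<open>Translates torsion-freeness of the quotient into purity of the submodule, the form in
  which \<open>pure_functional_extend\<close> uses it.\<close>

lemma torsion_free_quot_iff:
  assumes M: "right_module ZG M" and S: "submod ZG M S"
  shows "torsion_free (quot_rmod M S) \<longleftrightarrow>
    (\<forall>(k::int) w. w \<in> carrier M \<and> w \<triangleleft>\<^bsub>M\<^esub> zs k \<in> S \<longrightarrow> k = 0 \<or> w \<in> S)"
proof -
  interpret M: right_module ZG M by (rule M)
  have "[k] \<cdot>\<^bsub>quot_rmod M S\<^esub> (S +>\<^bsub>M\<^esub> w) = \<zero>\<^bsub>quot_rmod M S\<^esub> \<longleftrightarrow> w \<triangleleft>\<^bsub>M\<^esub> zs k \<in> S"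
    if w: "w \<in> carrier M" for k :: int and w
  proof -
    have "[k] \<cdot>\<^bsub>quot_rmod M S\<^esub> (S +>\<^bsub>M\<^esub> w) = S +>\<^bsub>M\<^esub> (w \<triangleleft>\<^bsub>M\<^esub> zs k)"
      using add_pow_eq_zs[OF right_module_quot[OF M S] linear_closed[OF linear_quot[OF M S] w]]
        linear_act[OF linear_quot[OF M S] w zs_closed] by simp
    then show ?thesis using quot_eq_zero_iff[OF M S M.act_closed[OF w zs_closed]] by simp
  qed
  note pow = this and zero = quot_eq_zero_iff[OF M S]
  show ?thesis
    unfolding torsion_free_def quot_rmod_carrier
  proof (intro iffI allI impI; elim conjE)
    fix k :: int and w
    assume *: "\<forall>(k::int) v. v \<in> (+>\<^bsub>M\<^esub>) S ` carrier M \<and> [k] \<cdot>\<^bsub>quot_rmod M S\<^esub> v = \<zero>\<^bsub>quot_rmod M S\<^esub> \<longrightarrow>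
        k = 0 \<or> v = \<zero>\<^bsub>quot_rmod M S\<^esub>"
      and w: "w \<in> carrier M" "w \<triangleleft>\<^bsub>M\<^esub> zs k \<in> S"
    show "k = 0 \<or> w \<in> S"
      using *[rule_format, of "S +>\<^bsub>M\<^esub> w" k] pow[OF w(1), of k] zero[OF w(1)] w by blast
  next
    fix k :: int and X
    assume *: "\<forall>k w. w \<in> carrier M \<and> w \<triangleleft>\<^bsub>M\<^esub> zs k \<in> S \<longrightarrow> k = 0 \<or> w \<in> S"
      and X: "X \<in> (+>\<^bsub>M\<^esub>) S ` carrier M" "[k] \<cdot>\<^bsub>quot_rmod M S\<^esub> X = \<zero>\<^bsub>quot_rmod M S\<^esub>"
    obtain w where w: "w \<in> carrier M" "X = S +>\<^bsub>M\<^esub> w" using X(1) by blast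
    show "k = 0 \<or> X = \<zero>\<^bsub>quot_rmod M S\<^esub>"
      using *[rule_format, of w k] pow[OF w(1), of k] zero[OF w(1)] w X(2) by blast
  qed
qed

lemma free_act_zs:
  "w \<in> carrier (free_rmod ZG I) \<Longrightarrow> w \<triangleleft>\<^bsub>free_rmod ZG I\<^esub> zs k = (\<lambda>j g. k * w j g)"
  by (auto simp: mult_zs free_rmod_in_ring[OF ring_ZG])

lemma swan_embedding_pure:
  assumes J: "right_module ZG J" and i: "swan_embedding ZG J n i"
    and w: "w \<in> carrier (free_rmod ZG {..<n})" and k: "k \<noteq> 0" "(\<lambda>j g. k * w j g) \<in> i ` carrier J"
  shows "w \<in> i ` carrier J"
proof -
  have lin: "linear ZG J (free_rmod ZG {..<n}) i"
    using i by (simp add: swan_embedding_def rhom_linear)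
  note F = right_module_free[OF ring_ZG]
  show ?thesis
    using i torsion_free_quot_iff[OF F submod_image[OF J F lin]] w k free_act_zs[OF w]
    unfolding swan_embedding_def by metis
qed

text \<open>By Frobenius reciprocity \<theta> is an integral functional on \<open>J\<close>. The
  image of \<open>i\<close> is a pure subgroup of the integral vectors indexed by
  \<open>{..<n} \<times> carrier G\<close>, so the functional extends to the whole free module, and
  \<open>hat\<close> turns the extension back into a homomorphism.\<close>

lemma swan_embedding_extend:
  assumes J: "right_module ZG J" and i: "swan_embedding ZG J n i" and \<theta>: "linear ZG J (reg ZG) \<theta>"
  obtains \<Theta> where "linear ZG (free_rmod ZG {..<n}) (reg ZG) \<Theta>" "\<And>v. v \<in> carrier J \<Longrightarrow> \<Theta> (i v) = \<theta> v"
proof -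
  interpret J: right_module ZG J by (rule J)
  let ?F = "free_rmod ZG {..<n}"
  have lin: "linear ZG J ?F i" and inj: "inj_on i (carrier J)"
    using i by (simp_all add: swan_embedding_def rhom_linear)
  note F = right_module_free[OF ring_ZG]
  \<comment> \<open>The image of \<open>i\<close>, uncurried to a single index set; \<open>f\<close>
    is the coefficient of \<theta> at the identity, transported to this image.\<close>
  define L where "L = (\<lambda>v. \<lambda>(j, g). i v j g) ` carrier J"
  define f where "f u = \<theta> (inv_into (carrier J) i (curry u)) \<one>" for u
  have f: "f (\<lambda>(j, g). i v j g) = \<theta> v \<one>" if "v \<in> carrier J" for v
    using inv_into_f_f[OF inj that] by (simp add: f_def curry_def)
  have i_zero: "i v j g = 0" if "v \<in> carrier J" "j \<ge> n \<or> g \<notin> carrier G" for v j g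
  proof -
    have "i v \<in> carrier ?F" by (rule linear_closed[OF lin that(1)])
    then show ?thesis
      using that(2) ZG_outside[OF free_rmod_in_ring[OF ring_ZG], of "i v" "{..<n}" g j]
      by (auto simp: free_rmod_carrier_finite)
  qed
  have "\<exists>c. \<forall>u\<in>L. f u = (\<Sum>s\<in>{..<n} \<times> carrier G. c s * u s)"
  proof (rule pure_functional_extend)
    show "finite ({..<n} \<times> carrier G)" using fin by simp
    show "u s = 0" if "u \<in> L" "s \<notin> {..<n} \<times> carrier G" for u s
      using that i_zero by (cases s) (auto simp: L_def)
    show "(\<lambda>s. a * u s + b * v s) \<in> L" if uv: "u \<in> L" "v \<in> L" for u v a b
    proof -
      obtain x y where x: "x \<in> carrier J" "u = (\<lambda>(j, g). i x j g)" and y: "y \<in> carrier J" "v = (\<lambda>(j, g). i y j g)"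
        using uv by (auto simp: L_def)
      let ?z = "x \<triangleleft>\<^bsub>J\<^esub> zs a \<oplus>\<^bsub>J\<^esub> y \<triangleleft>\<^bsub>J\<^esub> zs b"
      have z: "?z \<in> carrier J" using x y by (simp add: J.act_closed)
      have "i ?z = i x \<triangleleft>\<^bsub>?F\<^esub> zs a \<oplus>\<^bsub>?F\<^esub> i y \<triangleleft>\<^bsub>?F\<^esub> zs b"
        using x y by (simp only: linear_add[OF lin] linear_act[OF lin] J.act_closed zs_closed)
      also have "\<dots> = (\<lambda>j g. a * i x j g + b * i y j g)"
        unfolding free_act_zs[OF linear_closed[OF lin x(1)]] free_act_zs[OF linear_closed[OF lin y(1)]]
        by simp
      finally have "(\<lambda>s. a * u s + b * v s) = (\<lambda>(j, g). i ?z j g)" using x y by auto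
      then show ?thesis unfolding L_def using z by blast
    qed
    show "u \<in> L" if k: "k \<noteq> 0" "(\<lambda>s. k * u s) \<in> L" for u k
    proof -
      obtain x where x: "x \<in> carrier J" "(\<lambda>s. k * u s) = (\<lambda>(j, g). i x j g)"
        using k(2) by (auto simp: L_def)
      have e: "(\<lambda>j g. k * curry u j g) = i x" using x(2) by (auto simp: fun_eq_iff)
      have "k * u (j, g) = i x j g" for j g using e by (auto simp: fun_eq_iff)
      then have z: "u (j, g) = 0" if "j \<ge> n \<or> g \<notin> carrier G" for j g
        using i_zero[OF x(1) that] k(1) by (metis mult_eq_0_iff)
      have "curry u \<in> carrier ?F"
        using z by (auto simp: free_rmod_carrier_finite ZG_carrier fun_eq_iff)
      then have "curry u \<in> i ` carrier J"
        using swan_embedding_pure[OF J i _ k(1), of "curry u"] x(1) e by simp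
      then obtain y where y: "y \<in> carrier J" "curry u = i y" by blast
      have "u = (\<lambda>(j, g). i y j g)" using y(2) by (auto simp: fun_eq_iff)
      then show ?thesis unfolding L_def using y(1) by blast
    qed
    show "f (\<lambda>s. u s + v s) = f u + f v" if uv: "u \<in> L" "v \<in> L" for u v
    proof -
      obtain x y where x: "x \<in> carrier J" "u = (\<lambda>(j, g). i x j g)" and y: "y \<in> carrier J" "v = (\<lambda>(j, g). i y j g)"
        using uv by (auto simp: L_def)
      have "(\<lambda>s. u s + v s) = (\<lambda>(j, g). i (x \<oplus>\<^bsub>J\<^esub> y) j g)"
        using x y by (auto simp: linear_add[OF lin])
      then show ?thesis using x y f linear_add[OF \<theta>] by simp
    qed
  qed
  then obtain c where c: "\<And>u. u \<in> L \<Longrightarrow> f u = (\<Sum>s\<in>{..<n} \<times> carrier G. c s * u s)" by blast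
  define \<phi> where "\<phi> w = (\<Sum>(j, g)\<in>{..<n} \<times> carrier G. c (j, g) * w j g)" for w :: "nat \<Rightarrow> 'g \<Rightarrow> int"
  have add: "\<phi> (v \<oplus>\<^bsub>?F\<^esub> w) = \<phi> v + \<phi> w" for v w
    by (simp add: \<phi>_def distrib_left sum.distrib case_prod_unfold)
  have lin_hat: "linear ZG ?F (reg ZG) (hat ?F \<phi>)" by (rule linear_hat[OF F]) (rule add)
  show thesis
  proof (rule that[OF lin_hat])
    fix v assume v: "v \<in> carrier J"
    show "hat ?F \<phi> (i v) = \<theta> v"
    proof (rule linear_reg_eqI[OF J linear_comp[OF lin lin_hat] \<theta> _ v])
      fix u assume u: "u \<in> carrier J"
      have "hat ?F \<phi> (i u) \<one> = \<phi> (i u)" by (rule hat_one[OF F linear_closed[OF lin u]])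
      also have "\<dots> = f (\<lambda>(j, g). i u j g)"
        using c[of "\<lambda>(j, g). i u j g"] u by (auto simp: L_def \<phi>_def case_prod_unfold)
      finally show "hat ?F \<phi> (i u) \<one> = \<theta> u \<one>" using f[OF u] by simp
    qed
  qed
qed

text \<open>Each coordinate of the first factor of a null map is a homomorphism into \<Lambda>, and
  as such extends along \<open>i\<close>.\<close>

lemma nullmap_extend:
  assumes J: "right_module ZG J" and i: "swan_embedding ZG J n i" and f: "nullmap ZG J N f"
  obtains \<rho> where "linear ZG (free_rmod ZG {..<n}) N \<rho>" "\<And>v. v \<in> carrier J \<Longrightarrow> \<rho> (i v) = f v"
proof -
  obtain l :: nat and A B where A: "linear ZG J (free_rmod ZG {..<l}) A"
    and B: "linear ZG (free_rmod ZG {..<l}) N B" and e: "\<And>v. v \<in> carrier J \<Longrightarrow> f v = B (A v)"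
    using f by (rule nullmapE) blast
  let ?F = "free_rmod ZG {..<n}"
  have "\<exists>\<Theta>. linear ZG ?F (reg ZG) \<Theta> \<and> (\<forall>v\<in>carrier J. \<Theta> (i v) = A v j)" for j
    by (rule swan_embedding_extend[OF J i linear_comp[OF A linear_coord[OF ring_ZG, of _ j]]]) blast
  then obtain \<Theta> where \<Theta>: "\<And>j. linear ZG ?F (reg ZG) (\<Theta> j)"
    "\<And>j v. v \<in> carrier J \<Longrightarrow> \<Theta> j (i v) = A v j"
    by metis
  let ?A = "\<lambda>w j. if j < l then \<Theta> j w else \<zero>\<^bsub>ZG\<^esub>"
  have lin: "linear ZG ?F (free_rmod ZG {..<l}) ?A"
    by (rule linear_into_free[OF ring_ZG _ _ _ right_module_free[OF ring_ZG]]) (simp_all add: \<Theta>)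
  have "?A (i v) = A v" if v: "v \<in> carrier J" for v
    using linear_closed[OF A v] \<Theta>(2)[OF v] by (auto simp: free_rmod_carrier_finite fun_eq_iff)
  then show thesis using that[OF linear_comp[OF lin B]] e by simp
qed

text \<open>The functionals embed \<open>J\<close> as a pure subgroup of \<int>^n. Their hats form
  an equivariant embedding whose coefficients at the identity are the functionals themselves, so
  injectivity and purity can be tested there.\<close>

lemma swan_embedding_exists:
  assumes J: "right_module ZG J"
    and \<phi>: "\<And>k v w. v \<in> carrier J \<Longrightarrow> w \<in> carrier J \<Longrightarrow> \<phi> k (v \<oplus>\<^bsub>J\<^esub> w) = \<phi> k v + \<phi> k w"
    and inj: "\<And>v. v \<in> carrier J \<Longrightarrow> (\<And>k. k < n \<Longrightarrow> \<phi> k v = 0) \<Longrightarrow> v = \<zero>\<^bsub>J\<^esub>"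
    and pure: "\<And>v d. v \<in> carrier J \<Longrightarrow> d \<noteq> 0 \<Longrightarrow> (\<And>k. k < n \<Longrightarrow> d dvd \<phi> k v) \<Longrightarrow>
      \<exists>u\<in>carrier J. v = u \<triangleleft>\<^bsub>J\<^esub> zs d"
  shows "\<exists>i. swan_embedding ZG J n i"
proof -
  interpret J: right_module ZG J by (rule J)
  let ?F = "free_rmod ZG {..<n}"
  note F = right_module_free[OF ring_ZG]
  let ?h = "\<lambda>v k. if k < n then hat J (\<phi> k) v else \<zero>\<^bsub>ZG\<^esub>"
  have lin: "linear ZG J ?F ?h"
    by (rule linear_into_free[OF ring_ZG _ _ _ J]) (simp_all add: linear_hat[OF J \<phi>])
  have at_one: "?h v k \<one> = \<phi> k v" if "v \<in> carrier J" "k < n" for v k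
    using that hat_one[OF J] by simp
  let ?i = "restrict ?h (carrier J)"
  have img: "?i ` carrier J = ?h ` carrier J" by simp
  have "inj_on ?h (carrier J)"
  proof (rule inj_onI)
    fix v w assume v: "v \<in> carrier J" and w: "w \<in> carrier J" and e: "?h v = ?h w"
    have "\<phi> k (v \<ominus>\<^bsub>J\<^esub> w) = 0" if k: "k < n" for k
    proof -
      have "\<phi> k v = \<phi> k w" using at_one[OF v k] at_one[OF w k] fun_cong[OF e, of k] by metis
      moreover have "\<phi> k (v \<ominus>\<^bsub>J\<^esub> w \<oplus>\<^bsub>J\<^esub> w) = \<phi> k (v \<ominus>\<^bsub>J\<^esub> w) + \<phi> k w"
        using v w by (intro \<phi>) auto
      moreover have "v \<ominus>\<^bsub>J\<^esub> w \<oplus>\<^bsub>J\<^esub> w = v" using v w by (simp add: J.M.minus_eq J.M.a_assoc J.M.l_neg)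
      ultimately show ?thesis by simp
    qed
    then have "v \<ominus>\<^bsub>J\<^esub> w = \<zero>\<^bsub>J\<^esub>" using v w by (intro inj) auto
    then show "v = w" using v w J.M.eq_if_minus_eq_zero by blast
  qed
  moreover have "torsion_free (quot_rmod ?F (?h ` carrier J))"
    unfolding torsion_free_quot_iff[OF F submod_image[OF J F lin]]
  proof (intro allI impI, elim conjE)
    fix d w assume w: "w \<in> carrier ?F" and wd: "w \<triangleleft>\<^bsub>?F\<^esub> zs d \<in> ?h ` carrier J"
    show "d = 0 \<or> w \<in> ?h ` carrier J"
    proof (cases "d = 0")
      case False
      obtain v where v: "v \<in> carrier J" "w \<triangleleft>\<^bsub>?F\<^esub> zs d = ?h v" using wd by blast
      then have wv: "(\<lambda>j g. d * w j g) = ?h v" using free_act_zs[OF w] by simp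
      have "d dvd \<phi> k v" if "k < n" for k
        using at_one[OF v(1) that] fun_cong[OF fun_cong[OF wv, of k], of \<one>] by (metis dvd_triv_left)
      then obtain u where u: "u \<in> carrier J" "v = u \<triangleleft>\<^bsub>J\<^esub> zs d" using pure[OF v(1) False] by blast
      have "?h v = ?h u \<triangleleft>\<^bsub>?F\<^esub> zs d" unfolding u(2) by (rule linear_act[OF lin u(1) zs_closed])
      then have "(\<lambda>j g. d * w j g) = (\<lambda>j g. d * ?h u j g)"
        using wv free_act_zs[OF linear_closed[OF lin u(1)]] by simp
      then have "w = ?h u" using False by (simp add: fun_eq_iff)
      then show ?thesis using u(1) by blast
    qed simp
  qed
  ultimately have "swan_embedding ZG J n ?i"
    unfolding swan_embedding_def img using restrict_rhom[OF J lin] by simp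
  then show ?thesis by blast
qed

end

section \<open>Swan classes of lattices with two generators\<close>

locale swan_lattice = fin_group G + gen_module "group_ring G" J v1 v2
  for G :: "'g monoid" and J :: "('g \<Rightarrow> int, 'b) rmodule" and v1 v2 +
  assumes embeds: "\<exists>n i. swan_embedding (group_ring G) J n i"
begin

text \<open>The value of \<open>swan\<close> is obtained by choice; all that is known of it is that
  some embedding and some representative produce it. What follows is therefore proved for an
  arbitrary such pair.\<close>

lemma swan_spec:
  assumes "c \<noteq> {}"
  obtains n i \<alpha> where "swan_embedding ZG J n i" "\<alpha> \<in> c"
    "swan ZG J c = stable_class ZG (pushout J J (free_rmod ZG {..<n}) \<alpha> i)"
proof -
  have "\<exists>k n i \<alpha>. swan_embedding ZG J n i \<and> \<alpha> \<in> c \<and>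
      k = stable_class ZG (pushout J J (free_rmod ZG {..<n}) \<alpha> i)"
    using assms embeds by blast
  from someI_ex[OF this] show thesis unfolding swan_def[symmetric] using that by blast
qed

lemma der_map_self: "f \<in> rhom ZG J J \<Longrightarrow> f \<in> der_map ZG J f"
proof -
  interpret J: right_module ZG J by (rule M)
  assume f: "f \<in> rhom ZG J J"
  have "nullmap ZG J J (\<lambda>v. f v \<ominus>\<^bsub>J\<^esub> f v)"
    by (rule nullmap_cong[OF nullmap_zero[OF ring_ZG M]])
      (simp add: J.M.minus_eq J.M.r_neg linear_closed[OF rhom_linear[OF f]])
  then show ?thesis using mem_der_map_iff[OF f, of f] f by simp
qed

lemma pushout_submod:
  assumes "swan_embedding ZG J n i" "\<alpha> \<in> rhom ZG J J"
  shows "submod ZG (dsum J (free_rmod ZG {..<n})) {(\<alpha> v, \<ominus>\<^bsub>free_rmod ZG {..<n}\<^esub> i v) | v. v \<in> carrier J}"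
proof -
  note F = right_module_free[OF ring_ZG]
  have "linear ZG J (dsum J (free_rmod ZG {..<n})) (\<lambda>v. (\<alpha> v, \<ominus>\<^bsub>free_rmod ZG {..<n}\<^esub> i v))"
    using assms by (intro linear_Pair linear_minus[OF F]) (auto simp: swan_embedding_def rhom_linear)
  from submod_image[OF M right_module_dsum[OF M F] this] show ?thesis
    by (simp add: image_def Collect_conj_eq[symmetric] conj_commute) (metis (no_types, lifting))
qed

lemma swan_der_map_aut:
  assumes f: "f \<in> carrier (rmod_aut ZG J)"
  shows "swan ZG J (der_map ZG J f) = stable_class ZG (free_rmod ZG ({} :: nat set))"
proof -
  interpret J: right_module ZG J by (rule M)
  obtain g where fJ: "f \<in> rhom ZG J J" and g: "linear ZG J J g"
    "\<And>v. v \<in> carrier J \<Longrightarrow> g (f v) = v" "\<And>v. v \<in> carrier J \<Longrightarrow> f (g v) = v"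
    using rmod_autD[OF f] by blast
  have "der_map ZG J f \<noteq> {}" using der_map_self[OF fJ] by blast
  then obtain n i \<alpha> where i: "swan_embedding ZG J n i" and \<alpha>: "\<alpha> \<in> der_map ZG J f"
    and sw: "swan ZG J (der_map ZG J f) = stable_class ZG (pushout J J (free_rmod ZG {..<n}) \<alpha> i)"
    by (rule swan_spec) blast
  have \<alpha>J: "\<alpha> \<in> rhom ZG J J" and null: "nullmap ZG J J (\<lambda>v. \<alpha> v \<ominus>\<^bsub>J\<^esub> f v)"
    using \<alpha> mem_der_map_iff[OF fJ] by auto
  let ?F = "free_rmod ZG {..<n}"
  note F = right_module_free[OF ring_ZG]
  interpret F: right_module ZG ?F by (rule F)
  obtain \<rho> where \<rho>: "linear ZG ?F J \<rho>" "\<And>v. v \<in> carrier J \<Longrightarrow> \<rho> (i v) = \<alpha> v \<ominus>\<^bsub>J\<^esub> f v"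
    using nullmap_extend[OF M i null] by blast
  have lin: "linear ZG J ?F i" using i by (simp add: swan_embedding_def rhom_linear)
  note cl = linear_closed[OF lin] linear_closed[OF \<rho>(1)] linear_closed[OF g(1)]
    linear_closed[OF rhom_linear[OF fJ]] linear_closed[OF rhom_linear[OF \<alpha>J]]
  let ?D = "dsum J ?F"
  \<comment> \<open>Composite of the shear \<open>(v, w) \<mapsto> (v + \<rho> w, w)\<close>, which
    carries \<open>(\<alpha> u, - i u)\<close> to \<open>(f u, - i u)\<close>, with
    \<open>(v, w) \<mapsto> i (g v) + w\<close>, whose kernel consists of the pairs
    \<open>(f u, - i u)\<close> because \<open>g\<close> inverts \<open>f\<close>.\<close>
  let ?t = "\<lambda>x. i (g (fst x \<oplus>\<^bsub>J\<^esub> \<rho> (snd x))) \<oplus>\<^bsub>?F\<^esub> snd x"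
  let ?S = "{(\<alpha> v, \<ominus>\<^bsub>?F\<^esub> i v) | v. v \<in> carrier J}"
  have t: "linear ZG ?D ?F ?t"
    by (intro linear_plus[OF F] linear_snd linear_comp[OF _ lin] linear_comp[OF _ g(1)]
        linear_plus[OF M] linear_fst linear_comp[OF linear_snd \<rho>(1)])
  have surj: "?t ` carrier ?D = carrier ?F"
  proof
    show "?t ` carrier ?D \<subseteq> carrier ?F" using linear_closed[OF t] by blast
    show "carrier ?F \<subseteq> ?t ` carrier ?D"
    proof
      fix w assume w: "w \<in> carrier ?F"
      have "i (g \<zero>\<^bsub>J\<^esub>) = \<zero>\<^bsub>?F\<^esub>" using linear_zero[OF M F linear_comp[OF g(1) lin]] .
      then have a: "?t (\<ominus>\<^bsub>J\<^esub> \<rho> w, w) = w"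
        using w cl F.M.l_zero[OF w] by (simp only: fst_conv snd_conv J.M.l_neg)
      have b: "(\<ominus>\<^bsub>J\<^esub> \<rho> w, w) \<in> carrier ?D" using w cl by simp
      show "w \<in> ?t ` carrier ?D" by (rule image_eqI[of w ?t, OF a[symmetric] b])
    qed
  qed
  have ker: "?S = {x \<in> carrier ?D. ?t x = \<zero>\<^bsub>?F\<^esub>}"
  proof (intro equalityI subsetI)
    fix x assume "x \<in> ?S"
    then obtain u where u: "u \<in> carrier J" "x = (\<alpha> u, \<ominus>\<^bsub>?F\<^esub> i u)" by blast
    have "\<alpha> u \<oplus>\<^bsub>J\<^esub> \<rho> (\<ominus>\<^bsub>?F\<^esub> i u) = f u"
      using u cl linear_neg[OF F M \<rho>(1) cl(1)[OF u(1)]] \<rho>(2)[OF u(1)]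
      by (simp only: J.M.minus_eq J.M.minus_add J.M.minus_minus J.M.a_inv_closed J.M.r_neg2)
    then show "x \<in> {x \<in> carrier ?D. ?t x = \<zero>\<^bsub>?F\<^esub>}"
      using u cl g(2)[OF u(1)] F.M.r_neg[OF cl(1)[OF u(1)]] F.M.a_inv_closed[OF cl(1)[OF u(1)]]
      by (simp del: free_rmod_simps)
  next
    fix x assume x: "x \<in> {x \<in> carrier ?D. ?t x = \<zero>\<^bsub>?F\<^esub>}"
    obtain v w where vw: "x = (v, w)" "v \<in> carrier J" "w \<in> carrier ?F" using x by auto
    define u where "u = g (v \<oplus>\<^bsub>J\<^esub> \<rho> w)"
    have u: "u \<in> carrier J" unfolding u_def using vw cl by simp
    have "i u \<oplus>\<^bsub>?F\<^esub> w = \<zero>\<^bsub>?F\<^esub>" using x vw u_def by (simp del: free_rmod_simps)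
    then have w: "w = \<ominus>\<^bsub>?F\<^esub> i u"
      using F.M.minus_equality[of w "i u"] vw cl(1)[OF u] F.M.a_comm by metis
    have "f u = v \<oplus>\<^bsub>J\<^esub> \<rho> w" unfolding u_def using vw cl by (simp add: g(3))
    also have "\<rho> w = \<ominus>\<^bsub>J\<^esub> (\<alpha> u \<ominus>\<^bsub>J\<^esub> f u)"
      unfolding w using linear_neg[OF F M \<rho>(1) cl(1)[OF u]] \<rho>(2)[OF u] by simp
    finally have fu: "f u = v \<oplus>\<^bsub>J\<^esub> \<ominus>\<^bsub>J\<^esub> (\<alpha> u \<ominus>\<^bsub>J\<^esub> f u)" .
    have "y = v \<oplus>\<^bsub>J\<^esub> \<ominus>\<^bsub>J\<^esub> x \<Longrightarrow> y \<oplus>\<^bsub>J\<^esub> x = v" if "x \<in> carrier J" for x y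
      using vw that by (simp add: J.M.a_assoc J.M.l_neg)
    from this[OF _ fu] have "f u \<oplus>\<^bsub>J\<^esub> (\<alpha> u \<ominus>\<^bsub>J\<^esub> f u) = v" using u cl by simp
    moreover have "f u \<oplus>\<^bsub>J\<^esub> (\<alpha> u \<ominus>\<^bsub>J\<^esub> f u) = \<alpha> u"
      using u cl by (simp add: J.M.minus_eq J.M.a_comm[of "f u"] J.M.a_assoc J.M.l_neg)
    ultimately have "v = \<alpha> u" by simp
    then show "x \<in> ?S" using vw w u by blast
  qed
  have "rmod_iso ZG (pushout J J ?F \<alpha> i) ?F"
    unfolding pushout_def
    by (rule quot_iso[OF right_module_dsum[OF M F] F t surj ker pushout_submod[OF i \<alpha>J]])
  moreover have "right_module ZG (pushout J J ?F \<alpha> i)"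
    unfolding pushout_def by (rule right_module_quot[OF right_module_dsum[OF M F] pushout_submod[OF i \<alpha>J]])
  ultimately show ?thesis
    unfolding sw by (intro stable_class_free[OF ring_ZG])
qed

text \<open>
  The homomorphism \<open>s\<close> presents \<open>P \<oplus> \<Lambda>\<^sup>m \<cong> \<Lambda>\<^sup>n\<close> for the pushout \<open>P\<close>. Changing the representative
  by a null map \<open>\<rho> \<circ> i\<close> amounts to a shear of \<open>J \<oplus> \<Lambda>\<^sup>l\<close>.
\<close>

lemma swan_trivialD:
  assumes c: "c = der_map ZG J f" and f: "f \<in> rhom ZG J J"
    and triv: "swan ZG J c = stable_class ZG (free_rmod ZG ({} :: nat set))"
    and \<beta>: "\<beta> \<in> c"
  obtains l n :: nat and i s where
    "linear ZG J (free_rmod ZG {..<l}) i"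
    "\<And>\<theta>. linear ZG J (reg ZG) \<theta> \<Longrightarrow> \<exists>\<Theta>. linear ZG (free_rmod ZG {..<l}) (reg ZG) \<Theta> \<and> (\<forall>v\<in>carrier J. \<Theta> (i v) = \<theta> v)"
    "linear ZG (dsum J (free_rmod ZG {..<l})) (free_rmod ZG {..<n}) s"
    "s ` carrier (dsum J (free_rmod ZG {..<l})) = carrier (free_rmod ZG {..<n})"
    "\<And>v w. v \<in> carrier J \<Longrightarrow> w \<in> carrier (free_rmod ZG {..<l}) \<Longrightarrow>
      s (v, w) = \<zero>\<^bsub>free_rmod ZG {..<n}\<^esub> \<longleftrightarrow> (\<exists>u\<in>carrier J. v = \<beta> u \<and> w = \<ominus>\<^bsub>free_rmod ZG {..<l}\<^esub> i u)"
proof -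
  interpret J: right_module ZG J by (rule M)
  have "c \<noteq> {}" using \<beta> by blast
  then obtain k i \<alpha> where i: "swan_embedding ZG J k i" and \<alpha>: "\<alpha> \<in> c"
    and sw: "swan ZG J c = stable_class ZG (pushout J J (free_rmod ZG {..<k}) \<alpha> i)"
    by (rule swan_spec) blast
  have \<alpha>J: "\<alpha> \<in> rhom ZG J J" and \<alpha>f: "nullmap ZG J J (\<lambda>v. \<alpha> v \<ominus>\<^bsub>J\<^esub> f v)"
    using \<alpha> mem_der_map_iff[OF f] c by auto
  have \<beta>J: "\<beta> \<in> rhom ZG J J" and \<beta>f: "nullmap ZG J J (\<lambda>v. \<beta> v \<ominus>\<^bsub>J\<^esub> f v)"
    using \<beta> mem_der_map_iff[OF f] c by auto
  have cJ: "\<alpha> v \<in> carrier J" "\<beta> v \<in> carrier J" if "v \<in> carrier J" for v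
    using that linear_closed[OF rhom_linear[OF \<alpha>J]] linear_closed[OF rhom_linear[OF \<beta>J]] by auto
  have "der_map ZG J \<alpha> = der_map ZG J \<beta>"
    using der_map_eq_iff[OF \<alpha>J f] der_map_eq_iff[OF \<beta>J f] \<alpha>f \<beta>f by simp
  then have null: "nullmap ZG J J (\<lambda>v. \<beta> v \<ominus>\<^bsub>J\<^esub> \<alpha> v)"
    using der_map_eq_iff[OF \<beta>J \<alpha>J] by simp
  let ?F = "\<lambda>n::nat. free_rmod ZG {..<n}"
  note F = right_module_free[OF ring_ZG]
  define S where "S = {(\<alpha> v, \<ominus>\<^bsub>?F k\<^esub> i v) | v. v \<in> carrier J}"
  let ?D = "dsum J (?F k)"
  note D = right_module_dsum[OF M F[of "{..<k}"]]
  have S: "submod ZG ?D S" unfolding S_def by (rule pushout_submod[OF i \<alpha>J])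
  define P where "P = pushout J J (?F k) \<alpha> i"
  have P_quot: "P = quot_rmod ?D S" by (simp add: P_def pushout_def S_def)
  have P: "right_module ZG P"
    unfolding P_quot by (rule right_module_quot[OF D S])
  have lin: "linear ZG J (?F k) i" using i by (simp add: swan_embedding_def rhom_linear)
  obtain \<rho> where \<rho>: "linear ZG (?F k) J \<rho>" "\<And>v. v \<in> carrier J \<Longrightarrow> \<rho> (i v) = \<beta> v \<ominus>\<^bsub>J\<^esub> \<alpha> v"
    using nullmap_extend[OF M i null] by blast
  obtain m n :: nat where iso: "rmod_iso ZG (dsum P (?F m)) (?F n)"
    using stable_class_eq_freeD[OF ring_ZG ZG_one_neq_zero P] sw triv unfolding P_def by metis
  note PF = right_module_dsum[OF P F[of "{..<m}"]]
  obtain \<psi> where \<psi>: "linear ZG (dsum P (?F m)) (?F n) \<psi>"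
    "bij_betw \<psi> (carrier (dsum P (?F m))) (carrier (?F n))"
    using iso by (rule rmod_isoE) blast
  \<comment> \<open>The free summand added to the pushout is absorbed into the target of the
    embedding: \<open>l\<close> will be \<open>k + m\<close>, and \<open>i'\<close> is
    \<open>i\<close> padded by zeros.\<close>
  obtain e where e: "linear ZG (dsum (?F k) (?F m)) (?F (k + m)) e"
    "bij_betw e (carrier (dsum (?F k) (?F m))) (carrier (?F (k + m)))"
    using rmod_iso_free_add[OF ring_ZG, of k m] by (rule rmod_isoE) blast
  define e' where "e' = inv_into (carrier (dsum (?F k) (?F m))) e"
  note KM = right_module_dsum[OF F[of "{..<k}"] F[of "{..<m}"]]
  have e': "linear ZG (?F (k + m)) (dsum (?F k) (?F m)) e'"
    unfolding e'_def by (rule linear_inv[OF KM e])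
  have e'e: "e' (e x) = x" if "x \<in> carrier (dsum (?F k) (?F m))" for x
    unfolding e'_def using e(2) that by (simp add: bij_betw_def)
  have ee': "e (e' x) = x" if "x \<in> carrier (?F (k + m))" for x
    unfolding e'_def using e(2) that by (simp add: bij_betw_def f_inv_into_f)
  define q where "q x = S +>\<^bsub>?D\<^esub> x" for x
  have q: "linear ZG ?D P q" unfolding P_quot q_def by (rule linear_quot[OF D S])
  have q_surj: "q ` carrier ?D = carrier P" unfolding P_quot q_def by (simp only: quot_rmod_carrier)
  have q0: "q x = \<zero>\<^bsub>P\<^esub> \<longleftrightarrow> x \<in> S" if "x \<in> carrier ?D" for x
    unfolding P_quot q_def by (rule quot_eq_zero_iff[OF D S that])
  define i' where "i' v = e (i v, \<zero>\<^bsub>?F m\<^esub>)" for v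
  have i': "linear ZG J (?F (k + m)) i'"
    unfolding i'_def by (rule linear_comp[OF linear_comp[OF lin linear_inl[OF F]] e(1)])
  define a where "a w = fst (e' w)" for w
  define b where "b w = snd (e' w)" for w
  have a: "linear ZG (?F (k + m)) (?F k) a" unfolding a_def by (rule linear_comp[OF e' linear_fst])
  have b: "linear ZG (?F (k + m)) (?F m) b" unfolding b_def by (rule linear_comp[OF e' linear_snd])
  have iin: "(i v, \<zero>\<^bsub>?F m\<^esub>) \<in> carrier (dsum (?F k) (?F m))" if "v \<in> carrier J" for v
    by (rule linear_closed[OF linear_comp[OF lin linear_inl[OF F]] that])
  have ai': "a (i' v) = i v" "b (i' v) = \<zero>\<^bsub>?F m\<^esub>" if "v \<in> carrier J" for v
    unfolding a_def b_def i'_def using e'e[OF iin[OF that]] by simp_all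
  \<comment> \<open>As \<open>\<alpha> u = \<beta> u - \<rho> (i u)\<close>, this shear carries
    \<open>(\<beta> u, - i' u)\<close> to \<open>(\<alpha> u, - i u)\<close>, and so exchanges the
    chosen representative for the prescribed one.\<close>
  define r where "r x = (fst x \<oplus>\<^bsub>J\<^esub> \<rho> (a (snd x)), a (snd x))" for x
  let ?D' = "dsum J (?F (k + m))"
  have r: "linear ZG ?D' ?D r"
    unfolding r_def by (intro linear_Pair linear_plus[OF M] linear_fst linear_comp[OF _ \<rho>(1)] linear_comp[OF linear_snd a])
  define s where "s x = \<psi> (q (r x), b (snd x))" for x
  have s_in: "linear ZG ?D' (dsum P (?F m)) (\<lambda>x. (q (r x), b (snd x)))"
    by (intro linear_Pair linear_comp[OF r q] linear_comp[OF linear_snd b])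
  have s: "linear ZG ?D' (?F n) s"
    unfolding s_def by (rule linear_comp[OF s_in \<psi>(1)])
  have neg0: "\<ominus>\<^bsub>?F m\<^esub> \<zero>\<^bsub>?F m\<^esub> = \<zero>\<^bsub>?F m\<^esub>"
    using free_rmod_neg[OF ring_ZG, of "\<lambda>j. \<zero>\<^bsub>ZG\<^esub>" "{..<m}"] by (simp add: free_rmod_carrier ZG_neg ZG_carrier)
  interpret PF: right_module ZG "dsum P (?F m)" by (rule PF)
  interpret FK: right_module ZG "?F k" by (rule F)
  interpret FKM: right_module ZG "?F (k + m)" by (rule F)
  have surj: "s ` carrier ?D' = carrier (?F n)"
  proof
    show "s ` carrier ?D' \<subseteq> carrier (?F n)" using linear_closed[OF s] by blast
    show "carrier (?F n) \<subseteq> s ` carrier ?D'"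
    proof
      fix y assume "y \<in> carrier (?F n)"
      then obtain X z where Xz: "X \<in> carrier P" "z \<in> carrier (?F m)" "y = \<psi> (X, z)"
      proof -
        have "y \<in> \<psi> ` (carrier P \<times> carrier (?F m))"
          using \<psi>(2) \<open>y \<in> carrier (?F n)\<close> by (simp add: bij_betw_def)
        then show ?thesis using that by blast
      qed
      obtain v w where vw: "v \<in> carrier J" "w \<in> carrier (?F k)" "X = q (v, w)"
      proof -
        have "X \<in> q ` (carrier J \<times> carrier (?F k))" using Xz(1) q_surj by simp
        then show ?thesis using that by blast
      qed
      have wz: "(w, z) \<in> carrier (dsum (?F k) (?F m))" using vw Xz by simp
      let ?x = "(v \<ominus>\<^bsub>J\<^esub> \<rho> w, e (w, z))"
      have "r ?x = (v, w)" "b (snd ?x) = z"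
        using e'e[OF wz] vw linear_closed[OF \<rho>(1) vw(2)]
        by (simp_all add: r_def a_def b_def J.M.minus_eq J.M.a_assoc J.M.l_neg)
      then have "s ?x = y" unfolding s_def using vw Xz by simp
      moreover have "?x \<in> carrier ?D'"
        using vw linear_closed[OF \<rho>(1) vw(2)] linear_closed[OF e(1) wz] by simp
      ultimately show "y \<in> s ` carrier ?D'" by (metis image_eqI)
    qed
  qed
  have ker: "s (v, w) = \<zero>\<^bsub>?F n\<^esub> \<longleftrightarrow> (\<exists>u\<in>carrier J. v = \<beta> u \<and> w = \<ominus>\<^bsub>?F (k + m)\<^esub> i' u)"
    if v: "v \<in> carrier J" and w: "w \<in> carrier (?F (k + m))" for v w
  proof -
    have x: "(v, w) \<in> carrier ?D'" using v w by simp
    have aw: "a w \<in> carrier (?F k)" "\<rho> (a w) \<in> carrier J"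
      using linear_closed[OF a w] linear_closed[OF \<rho>(1) linear_closed[OF a w]] by simp_all
    have "s (v, w) = \<zero>\<^bsub>?F n\<^esub> \<longleftrightarrow> (q (r (v, w)), b w) = \<zero>\<^bsub>dsum P (?F m)\<^esub>"
    proof
      assume "(q (r (v, w)), b w) = \<zero>\<^bsub>dsum P (?F m)\<^esub>"
      then show "s (v, w) = \<zero>\<^bsub>?F n\<^esub>"
        unfolding s_def snd_conv using linear_zero[OF PF F \<psi>(1)] by metis
    next
      assume "s (v, w) = \<zero>\<^bsub>?F n\<^esub>"
      then have "\<psi> (q (r (v, w)), b w) = \<psi> \<zero>\<^bsub>dsum P (?F m)\<^esub>"
        unfolding s_def snd_conv using linear_zero[OF PF F \<psi>(1)] by metis
      moreover have "\<zero>\<^bsub>dsum P (?F m)\<^esub> \<in> carrier (dsum P (?F m))"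
        by (rule PF.M.zero_closed)
      ultimately show "(q (r (v, w)), b w) = \<zero>\<^bsub>dsum P (?F m)\<^esub>"
        using \<psi>(2) linear_closed[OF s_in x] unfolding bij_betw_def snd_conv by (metis inj_onD)
    qed
    also have "\<dots> \<longleftrightarrow> r (v, w) \<in> S \<and> b w = \<zero>\<^bsub>?F m\<^esub>"
      using q0[OF linear_closed[OF r x]] by simp
    also have "\<dots> \<longleftrightarrow> (\<exists>u\<in>carrier J. v = \<beta> u \<and> w = \<ominus>\<^bsub>?F (k + m)\<^esub> i' u)"
    proof
      assume "r (v, w) \<in> S \<and> b w = \<zero>\<^bsub>?F m\<^esub>"
      then obtain u where u: "u \<in> carrier J" "v \<oplus>\<^bsub>J\<^esub> \<rho> (a w) = \<alpha> u" "a w = \<ominus>\<^bsub>?F k\<^esub> i u"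
        and bw: "b w = \<zero>\<^bsub>?F m\<^esub>" by (auto simp: r_def S_def simp del: free_rmod_simps)
      note iu = linear_closed[OF lin u(1)]
      have "e' w = e' (\<ominus>\<^bsub>?F (k + m)\<^esub> i' u)"
        using linear_neg[OF F F a linear_closed[OF i' u(1)]] linear_neg[OF F F b linear_closed[OF i' u(1)]]
          ai'[OF u(1)] u(3) bw neg0
        unfolding a_def b_def by (intro prod_eqI) simp_all
      then have "w = \<ominus>\<^bsub>?F (k + m)\<^esub> i' u"
        using ee'[OF w] ee'[OF FKM.M.a_inv_closed[OF linear_closed[OF i' u(1)]]] by metis
      moreover have "\<rho> (a w) = \<ominus>\<^bsub>J\<^esub> (\<beta> u \<ominus>\<^bsub>J\<^esub> \<alpha> u)"
        unfolding u(3) using linear_neg[OF F M \<rho>(1) iu] \<rho>(2)[OF u(1)] by simp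
      then have "v \<ominus>\<^bsub>J\<^esub> (\<beta> u \<ominus>\<^bsub>J\<^esub> \<alpha> u) = \<alpha> u" using u(2) by (simp add: J.M.minus_eq)
      then have "v \<ominus>\<^bsub>J\<^esub> (\<beta> u \<ominus>\<^bsub>J\<^esub> \<alpha> u) \<oplus>\<^bsub>J\<^esub> (\<beta> u \<ominus>\<^bsub>J\<^esub> \<alpha> u) = \<beta> u"
        using cJ[OF u(1)] by (simp add: J.M.minus_eq J.M.a_comm[of "\<beta> u"] J.M.r_neg2)
      then have "v = \<beta> u"
        using v cJ[OF u(1)] by (simp add: J.M.minus_eq J.M.a_assoc J.M.l_neg)
      ultimately show "\<exists>u\<in>carrier J. v = \<beta> u \<and> w = \<ominus>\<^bsub>?F (k + m)\<^esub> i' u" using u by blast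
    next
      assume "\<exists>u\<in>carrier J. v = \<beta> u \<and> w = \<ominus>\<^bsub>?F (k + m)\<^esub> i' u"
      then obtain u where u: "u \<in> carrier J" "v = \<beta> u" "w = \<ominus>\<^bsub>?F (k + m)\<^esub> i' u" by blast
      note iu = linear_closed[OF lin u(1)] and i'u = linear_closed[OF i' u(1)]
      have aw: "a w = \<ominus>\<^bsub>?F k\<^esub> i u"
        unfolding u(3) using linear_neg[OF F F a i'u] ai'[OF u(1)] by simp
      have bw: "b w = \<zero>\<^bsub>?F m\<^esub>"
        unfolding u(3) using linear_neg[OF F F b i'u] ai'[OF u(1)] neg0 by simp
      have "\<rho> (a w) = \<ominus>\<^bsub>J\<^esub> (\<beta> u \<ominus>\<^bsub>J\<^esub> \<alpha> u)"
        unfolding aw using linear_neg[OF F M \<rho>(1) iu] \<rho>(2)[OF u(1)] by simp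
      then have "v \<oplus>\<^bsub>J\<^esub> \<rho> (a w) = \<alpha> u"
        using u cJ[OF u(1)] by (simp add: J.M.minus_eq J.M.minus_add J.M.r_neg2)
      then show "r (v, w) \<in> S \<and> b w = \<zero>\<^bsub>?F m\<^esub>"
        using aw bw u(1) by (auto simp: r_def S_def simp del: free_rmod_simps)
    qed
    finally show ?thesis .
  qed
  have ext: "\<exists>\<Theta>. linear ZG (?F (k + m)) (reg ZG) \<Theta> \<and> (\<forall>v\<in>carrier J. \<Theta> (i' v) = \<theta> v)"
    if "linear ZG J (reg ZG) \<theta>" for \<theta>
  proof -
    obtain \<Theta> where \<Theta>: "linear ZG (?F k) (reg ZG) \<Theta>" "\<And>v. v \<in> carrier J \<Longrightarrow> \<Theta> (i v) = \<theta> v"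
      using swan_embedding_extend[OF M i \<open>linear ZG J (reg ZG) \<theta>\<close>] by blast
    show ?thesis
      using linear_comp[OF a \<Theta>(1)] \<Theta>(2) ai' by (intro exI[of _ "\<lambda>w. \<Theta> (a w)"]) simp
  qed
  show thesis by (rule that[OF i' ext s surj ker])
qed

end

section \<open>The ring of integers of the \<open>p\<close>-th cyclotomic field\<close>

definition ip :: "int poly \<Rightarrow> complex \<Rightarrow> complex"
  where "ip q z = poly (map_poly of_int q) z"

lemma ip_0 [simp]: "ip 0 z = 0"
  by (simp add: ip_def)

lemma ip_pCons [simp]: "ip (pCons a q) z = of_int a + z * ip q z"
  by (simp add: ip_def of_int_hom.map_poly_pCons_hom)

lemma ip_1 [simp]: "ip 1 z = 1"
  by (simp add: ip_def)

lemma ip_add: "ip (q + r) z = ip q z + ip r z"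
  by (simp add: ip_def of_int_poly_hom.hom_add)

lemma ip_mult: "ip (q * r) z = ip q z * ip r z"
  by (simp add: ip_def of_int_poly_hom.hom_mult)

lemma ip_uminus: "ip (- q) z = - ip q z"
  by (simp add: ip_def of_int_poly_hom.hom_uminus)

lemma ip_minus: "ip (q - r) z = ip q z - ip r z"
  by (simp add: ip_def of_int_poly_hom.hom_minus)

lemma ip_smult: "ip (smult a q) z = of_int a * ip q z"
  by (simp add: ip_def map_poly_smult)

lemma ip_monom: "ip (monom a k) z = of_int a * z ^ k"
  by (simp add: ip_def map_poly_monom poly_monom)

lemma ip_sum: "ip (\<Sum>k\<in>A. f k) z = (\<Sum>k\<in>A. ip (f k) z)"
  by (induction A rule: infinite_finite_induct) (auto simp: ip_add)

lemma ip_altdef: "ip q z = (\<Sum>k\<le>degree q. of_int (coeff q k) * z ^ k)"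
  by (simp add: ip_def poly_altdef coeff_map_poly degree_map_poly)

lemma ip_pcompose: "ip (pcompose q r) z = ip q (ip r z)"
  by (induction q) (auto simp: pcompose_pCons ip_add ip_mult)

section \<open>Eisenstein's criterion and the minimal polynomial of \<zeta> - 1\<close>

lemma eisenstein:
  fixes Q S :: "int poly"
  assumes p: "prime p" and lc: "\<not> p dvd lead_coeff (Q * S)"
    and low: "\<And>i. i < degree (Q * S) \<Longrightarrow> p dvd coeff (Q * S) i" and c0: "\<not> p\<^sup>2 dvd coeff (Q * S) 0"
  shows "degree Q = 0 \<or> degree S = 0"
proof -
  have aux: "degree S = 0" if *: "\<not> p dvd lead_coeff (Q * S)"
    "\<And>i. i < degree (Q * S) \<Longrightarrow> p dvd coeff (Q * S) i" "p dvd coeff Q 0" "\<not> p dvd coeff S 0"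
    for Q S :: "int poly"
  proof (rule ccontr)
    assume "degree S \<noteq> 0"
    have nz: "Q \<noteq> 0" "S \<noteq> 0" using *(1) by auto
    then have deg: "degree Q < degree (Q * S)" using \<open>degree S \<noteq> 0\<close> by (simp add: degree_mult_eq)
    have "\<not> p dvd lead_coeff Q" using *(1) by (auto simp: lead_coeff_mult)
    \<comment> \<open>The lowest coefficient of \<open>Q\<close> that is not divisible by p. Modulo
      p the product has at this place just that coefficient times the constant term of
      \<open>S\<close>.\<close>
    define i where "i = (LEAST i. \<not> p dvd coeff Q i)"
    have i: "\<not> p dvd coeff Q i" unfolding i_def using \<open>\<not> p dvd lead_coeff Q\<close> by (rule LeastI)
    have i_le: "i \<le> degree Q" unfolding i_def using \<open>\<not> p dvd lead_coeff Q\<close> by (rule Least_le)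
    have less: "p dvd coeff Q j" if "j < i" for j using not_less_Least[of j] that unfolding i_def by blast
    have "coeff (Q * S) i = (\<Sum>j<i. coeff Q j * coeff S (i - j)) + coeff Q i * coeff S 0"
      by (simp add: coeff_mult lessThan_Suc_atMost[symmetric])
    moreover have "p dvd (\<Sum>j<i. coeff Q j * coeff S (i - j))"
      using less by (intro dvd_sum) auto
    moreover have "p dvd coeff (Q * S) i" using *(2) i_le deg by simp
    ultimately have "p dvd coeff Q i * coeff S 0" by (simp add: dvd_add_right_iff)
    then show False using i *(4) p by (simp add: prime_dvd_mult_iff)
  qed
  show ?thesis
  proof (cases "degree (Q * S) = 0")
    case True
    then show ?thesis using lc by (cases "Q = 0 \<or> S = 0") (auto simp: degree_mult_eq)
  next
    case False
    then have "p dvd coeff Q 0 * coeff S 0" using low[of 0] by (simp add: coeff_mult_0)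
    moreover have "\<not> (p dvd coeff Q 0 \<and> p dvd coeff S 0)"
      using c0 mult_dvd_mono[of p "coeff Q 0" p "coeff S 0"] by (auto simp: coeff_mult_0 power2_eq_square)
    ultimately consider "p dvd coeff Q 0" "\<not> p dvd coeff S 0" | "p dvd coeff S 0" "\<not> p dvd coeff Q 0"
      using p by (auto simp: prime_dvd_mult_iff)
    then show ?thesis
    proof cases
      case 1
      have "degree S = 0" by (rule aux[of Q S]) (use lc low 1 in auto)
      then show ?thesis by simp
    next
      case 2 then show ?thesis using aux[of S Q] lc low by (simp add: mult.commute)
    qed
  qed
qed

locale cyclotomic =
  fixes p :: nat
  assumes prime_p: "prime p" and odd_p: "odd p"
begin

abbreviation \<zeta> :: complex where "\<zeta> \<equiv> zeta p"
abbreviation \<pi> :: complex where "\<pi> \<equiv> zeta p - 1"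

lemma p_ge_3: "p \<ge> 3"
  using prime_ge_2_nat[OF prime_p] odd_p by (cases "p = 2") auto

lemma zeta_pow_p: "\<zeta> ^ p = 1"
  using p_ge_3 by (simp add: zeta_def Complex.DeMoivre cis_2pi)

lemma zeta_neq_0: "\<zeta> \<noteq> 0"
  by (simp add: zeta_def)

lemma zeta_neq_1: "\<zeta> \<noteq> 1"
proof
  assume "\<zeta> = 1"
  then have "sin (2 * pi / real p) = 0" "cos (2 * pi / real p) = 1"
    by (auto simp: zeta_def complex_eq_iff)
  moreover have "0 < 2 * pi / real p" "2 * pi / real p < pi"
    using p_ge_3 pi_gt_zero by (auto simp: field_simps)
  ultimately show False using sin_gt_zero[of "2 * pi / real p"] by simp
qed

lemma zeta_pow_mod: "\<zeta> ^ (k mod p) = \<zeta> ^ k"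
proof -
  have "\<zeta> ^ k = (\<zeta> ^ p) ^ (k div p) * \<zeta> ^ (k mod p)"
    by (metis power_add power_mult mult_div_mod_eq)
  then show ?thesis by (simp add: zeta_pow_p)
qed

lemma zeta_pow_cong: "[k = l] (mod p) \<Longrightarrow> \<zeta> ^ k = \<zeta> ^ l"
  by (metis cong_def zeta_pow_mod)

lemma zeta_pow_eq_1_iff: "\<zeta> ^ k = 1 \<longleftrightarrow> p dvd k"
proof
  assume *: "\<zeta> ^ k = 1"
  show "p dvd k"
  proof (rule ccontr)
    assume "\<not> p dvd k"
    then have "coprime k p" using prime_p by (metis coprime_commute prime_imp_coprime)
    then obtain x where x: "[k * x = Suc 0] (mod p)" using cong_solve_coprime_nat by blast
    have "\<zeta> = \<zeta> ^ (k * x)" using zeta_pow_cong[OF x] by simp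
    also have "\<dots> = 1" using * by (simp add: power_mult)
    finally show False using zeta_neq_1 by simp
  qed
next
  assume "p dvd k" then show "\<zeta> ^ k = 1" by (elim dvdE) (simp add: power_mult zeta_pow_p)
qed

lemma zeta_pow_eq_iff: "\<zeta> ^ k = \<zeta> ^ l \<longleftrightarrow> [k = l] (mod p)"
proof
  have *: "[k = l] (mod p)" if "\<zeta> ^ k = \<zeta> ^ l" "l \<le> k" for k l
  proof -
    have "\<zeta> ^ (k - l) * \<zeta> ^ l = 1 * \<zeta> ^ l" using that by (simp add: power_add[symmetric])
    then have "\<zeta> ^ (k - l) = 1" using zeta_neq_0 by simp
    then have "p dvd k - l" by (simp add: zeta_pow_eq_1_iff)
    then show ?thesis using that(2) by (simp add: cong_altdef_nat)
  qed
  show "[k = l] (mod p)" if "\<zeta> ^ k = \<zeta> ^ l"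
    using *[of k l] *[of l k] that by (cases "l \<le> k") (auto intro: cong_sym)
qed (rule zeta_pow_cong)

text \<open>The cyclotomic polynomial in the shifted variable, \<open>((1 + z)^p - 1) / z\<close>,
  given by its coefficients so that its Eisenstein shape is visible.\<close>

definition E :: "int poly" where "E = (\<Sum>k<p. monom (int (p choose Suc k)) k)"

lemma coeff_E: "coeff E k = (if k < p then int (p choose Suc k) else 0)"
  by (simp add: E_def coeff_sum)

lemma degree_E: "degree E = p - 1"
proof (rule antisym)
  show "degree E \<le> p - 1" by (rule degree_le) (auto simp: coeff_E)
  show "p - 1 \<le> degree E" using p_ge_3 by (intro le_degree) (auto simp: coeff_E)
qed

lemma lead_coeff_E: "lead_coeff E = 1"
  using p_ge_3 by (simp add: degree_E coeff_E)

lemma E_0: "coeff E 0 = int p"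
  using p_ge_3 by (simp add: coeff_E)

lemma p_dvd_coeff_E: "k < p - 1 \<Longrightarrow> int p dvd coeff E k"
  using dvd_choose_prime[of "Suc k" p] prime_p by (auto simp: coeff_E)

lemma E_neq_0: "E \<noteq> 0"
  using lead_coeff_E by auto

lemma ip_E: "ip E z * z = (1 + z) ^ p - 1"
proof -
  have "(1 + z) ^ p = (\<Sum>k\<le>p. of_nat (p choose k) * z ^ k)"
    using binomial_ring[of z 1 p] by (simp add: add.commute)
  also have "\<dots> = 1 + (\<Sum>k<p. of_nat (p choose Suc k) * z ^ Suc k)"
    by (simp add: sum.atMost_shift)
  finally show ?thesis
    by (simp add: E_def ip_sum ip_monom sum_distrib_right mult.assoc mult.commute[of z])
qed

lemma ip_E_root: "\<omega> ^ p = 1 \<Longrightarrow> \<omega> \<noteq> 1 \<Longrightarrow> ip E (\<omega> - 1) = 0"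
  using ip_E[of "\<omega> - 1"] by simp

text \<open>A polynomial of least degree that vanishes at \<pi> divides a nonzero integral multiple
  of \<open>E\<close>, by pseudo-division. Passing to primitive parts, as in the lemma of Gauss,
  yields a proper factorisation of \<open>E\<close> up to sign, against Eisenstein.\<close>

lemma min_degree:
  assumes q: "q \<noteq> 0" "ip q \<pi> = 0"
  shows "p - 1 \<le> degree q"
proof (rule ccontr)
  assume "\<not> p - 1 \<le> degree q"
  define P where "P r \<longleftrightarrow> r \<noteq> 0 \<and> ip r \<pi> = 0" for r
  obtain q0 where q0: "P q0" "\<And>r. P r \<Longrightarrow> degree q0 \<le> degree r"
    using ex_has_least_nat[of P q degree] q unfolding P_def by blast
  have d: "degree q0 < p - 1" using q0(2)[of q] q \<open>\<not> p - 1 \<le> degree q\<close> by (simp add: P_def)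
  have q0': "q0 \<noteq> 0" "ip q0 \<pi> = 0" using q0(1) by (auto simp: P_def)
  obtain s r where sr: "pseudo_divmod E q0 = (s, r)" by (cases "pseudo_divmod E q0") blast
  define c where "c = lead_coeff q0 ^ (Suc (degree E) - degree q0)"
  have c: "c \<noteq> 0" using q0' by (simp add: c_def)
  have eq: "smult c E = q0 * s + r" and r: "r = 0 \<or> degree r < degree q0"
    using pseudo_divmod[OF q0'(1) sr] by (auto simp: c_def)
  have "ip E \<pi> = 0" by (rule ip_E_root[OF zeta_pow_p zeta_neq_1])
  then have "ip r \<pi> = 0"
    using arg_cong[OF eq, of "\<lambda>q. ip q \<pi>"] q0' by (simp add: ip_smult ip_add ip_mult)
  have "r = 0"
  proof (rule ccontr)
    assume "r \<noteq> 0"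
    then have "degree q0 \<le> degree r" using \<open>ip r \<pi> = 0\<close> by (intro q0(2)) (simp add: P_def)
    then show False using r \<open>r \<noteq> 0\<close> by simp
  qed
  then have eq: "smult c E = q0 * s" using eq by simp
  have "content E dvd lead_coeff E" by (rule content_dvd_coeff)
  then have cont: "content E = 1" by (metis normalize_content is_unit_normalize lead_coeff_E)
  define Q where "Q = primitive_part q0"
  define S where "S = primitive_part s"
  have QS: "Q * S = smult (unit_factor c) E"
    using arg_cong[OF eq, of primitive_part] cont
    by (simp add: Q_def S_def primitive_part_mult primitive_part_smult primitive_part_prim)
  have u: "unit_factor c = 1 \<or> unit_factor c = -1" using c by (auto simp: sgn_if)
  have "degree Q = 0 \<or> degree S = 0"
  proof (rule eisenstein[of "int p"])
    show "prime (int p)" using prime_p by simp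
    have "\<not> int p dvd 1" using p_ge_3 by simp
    then show "\<not> int p dvd lead_coeff (Q * S)"
      unfolding QS using u lead_coeff_E by auto
    show "int p dvd coeff (Q * S) i" if "i < degree (Q * S)" for i
      using that u p_dvd_coeff_E[of i] unfolding QS by (auto simp: degree_E)
    have "\<not> (int p)\<^sup>2 dvd int p"
      using p_ge_3 by (simp add: power2_eq_square)
    then show "\<not> (int p)\<^sup>2 dvd coeff (Q * S) 0"
      unfolding QS using u by (auto simp: E_0)
  qed
  moreover have "degree Q \<noteq> 0"
  proof
    assume "degree Q = 0"
    then have "degree q0 = 0" by (simp add: Q_def)
    then obtain a where "q0 = [:a:]" by (metis degree_eq_zeroE)
    then show False using q0' by simp
  qed
  moreover have "degree S \<noteq> 0"
  proof
    assume "degree S = 0"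
    moreover have "Q \<noteq> 0" "S \<noteq> 0" using QS u E_neq_0 by auto
    ultimately have "degree (Q * S) = degree Q" by (simp add: degree_mult_eq)
    then show False using d u unfolding QS by (auto simp: degree_E Q_def)
  qed
  ultimately show False by blast
qed

lemma E_divmod:
  obtains s r where "q = E * s + r" "r = 0 \<or> degree r < p - 1"
proof -
  obtain s r where "pseudo_divmod q E = (s, r)" by (cases "pseudo_divmod q E") blast
  from pseudo_divmod[OF E_neq_0 this] show thesis
    using that lead_coeff_E by (simp add: degree_E)
qed

lemma ip_eq_0_imp_dvd: "ip q \<pi> = 0 \<Longrightarrow> E dvd q"
proof -
  assume q: "ip q \<pi> = 0"
  obtain s r where sr: "q = E * s + r" "r = 0 \<or> degree r < p - 1" by (rule E_divmod) blast
  have "ip r \<pi> = 0" using q ip_E_root[OF zeta_pow_p zeta_neq_1] unfolding sr(1) by (simp add: ip_add ip_mult)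
  then have "r = 0" using min_degree[of r] sr(2) by (metis not_le)
  then show ?thesis using sr(1) by simp
qed

text \<open>Substitution of 1 + X, which turns polynomials in \<zeta> into polynomials in \<zeta> -
  1, the variable in which \<open>E\<close> is Eisenstein.\<close>

definition sh :: "int poly \<Rightarrow> int poly" where "sh q = pcompose q [:1, 1:]"

lemma ip_sh: "ip (sh q) (z - 1) = ip q z"
  by (simp add: sh_def ip_pcompose)

lemma coeff_sh_0: "coeff (sh q) 0 = poly q 1"
  using poly_pcompose[of q "[:1, 1:]" 0] by (simp add: sh_def poly_0_coeff_0)

text \<open>After the shift, a relation satisfied by \<zeta> is a multiple of \<open>E\<close>, and
  \<open>E\<close> vanishes at \<omega> - 1 for every nontrivial p-th root of unity
  \<omega>.\<close>

lemma ip_conj_root: "ip q \<zeta> = 0 \<Longrightarrow> \<omega> ^ p = 1 \<Longrightarrow> \<omega> \<noteq> 1 \<Longrightarrow> ip q \<omega> = 0"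
  using ip_eq_0_imp_dvd[of "sh q"] ip_E_root[of \<omega>]
  by (metis dvdE ip_mult ip_sh mult_zero_left)

abbreviation ZZ :: "complex set" where "ZZ \<equiv> carrier (Z_zeta p)"

lemma ZZ_iff: "z \<in> ZZ \<longleftrightarrow> (\<exists>q. z = ip q \<zeta>)"
  by (auto simp: Z_zeta_def ip_def)

lemma ip_ZZ [simp]: "ip q \<zeta> \<in> ZZ"
  by (auto simp: ZZ_iff)

lemma ZZ_ip_closed: "z \<in> ZZ \<Longrightarrow> ip q z \<in> ZZ"
  unfolding ZZ_iff by (metis ip_pcompose)

lemma ZZ_add: "z \<in> ZZ \<Longrightarrow> w \<in> ZZ \<Longrightarrow> z + w \<in> ZZ"
  unfolding ZZ_iff by (metis ip_add)

lemma ZZ_mult: "z \<in> ZZ \<Longrightarrow> w \<in> ZZ \<Longrightarrow> z * w \<in> ZZ"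
  unfolding ZZ_iff by (metis ip_mult)

lemma ZZ_uminus: "z \<in> ZZ \<Longrightarrow> - z \<in> ZZ"
  unfolding ZZ_iff by (metis ip_uminus)

lemma ZZ_diff: "z \<in> ZZ \<Longrightarrow> w \<in> ZZ \<Longrightarrow> z - w \<in> ZZ"
  unfolding ZZ_iff by (metis ip_minus)

lemma ZZ_of_int: "of_int a \<in> ZZ"
  unfolding ZZ_iff by (rule exI[of _ "[:a:]"]) simp

lemma ZZ_0: "0 \<in> ZZ" and ZZ_1: "1 \<in> ZZ"
  using ZZ_of_int[of 0] ZZ_of_int[of 1] by simp_all

lemma ZZ_zeta: "\<zeta> \<in> ZZ"
  unfolding ZZ_iff by (rule exI[of _ "[:0, 1:]"]) simp

lemma ZZ_pi: "\<pi> \<in> ZZ"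
  by (intro ZZ_diff ZZ_zeta ZZ_1)

lemma ZZ_power: "z \<in> ZZ \<Longrightarrow> z ^ k \<in> ZZ"
  by (induction k) (auto simp: ZZ_1 ZZ_mult)

lemma ZZ_sum: "(\<And>k. k \<in> A \<Longrightarrow> f k \<in> ZZ) \<Longrightarrow> (\<Sum>k\<in>A. f k) \<in> ZZ"
  by (induction A rule: infinite_finite_induct) (auto simp: ZZ_0 ZZ_add)

lemma additive_ZZ_eq:
  fixes F H :: "complex \<Rightarrow> complex"
  assumes F: "\<And>u v. u \<in> ZZ \<Longrightarrow> v \<in> ZZ \<Longrightarrow> F (u + v) = F u + F v"
    and H: "\<And>u v. u \<in> ZZ \<Longrightarrow> v \<in> ZZ \<Longrightarrow> H (u + v) = H u + H v"
    and eq: "\<And>k. F (\<zeta> ^ k) = H (\<zeta> ^ k)" and z: "z \<in> ZZ"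
  shows "F z = H z"
proof -
  have *: "T (of_int a * w) = of_int a * T w"
    if T: "\<And>u v. u \<in> ZZ \<Longrightarrow> v \<in> ZZ \<Longrightarrow> T (u + v) = T u + T v" and w: "w \<in> ZZ"
    for T :: "complex \<Rightarrow> complex" and a w
  proof (induction a rule: int_induct[of _ 0])
    case base then show ?case using T[of 0 0] by (simp add: ZZ_0)
  next
    case (step1 i)
    then show ?case using T[of "of_int i * w" w] w by (simp add: ZZ_mult ZZ_of_int distrib_right)
  next
    case (step2 i)
    then show ?case using T[of "of_int (i - 1) * w" w] w ZZ_mult[OF ZZ_of_int[of "i - 1"] w]
      by (simp add: algebra_simps)
  qed
  have **: "T (\<Sum>k\<in>A. of_int (c k) * \<zeta> ^ k) = (\<Sum>k\<in>A. of_int (c k) * T (\<zeta> ^ k))"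
    if T: "\<And>u v. u \<in> ZZ \<Longrightarrow> v \<in> ZZ \<Longrightarrow> T (u + v) = T u + T v" and A: "finite A"
    for T :: "complex \<Rightarrow> complex" and c and A :: "nat set"
    using A
  proof (induction A)
    case empty then show ?case using T[of 0 0] by (simp add: ZZ_0)
  next
    case (insert k A)
    have "T (of_int (c k) * \<zeta> ^ k + (\<Sum>k\<in>A. of_int (c k) * \<zeta> ^ k)) =
        T (of_int (c k) * \<zeta> ^ k) + T (\<Sum>k\<in>A. of_int (c k) * \<zeta> ^ k)"
      by (rule T) (intro ZZ_sum ZZ_mult ZZ_of_int ZZ_power ZZ_zeta)+
    then show ?case using insert *[of T, OF T ZZ_power[OF ZZ_zeta]] by simp
  qed
  obtain q where q: "z = ip q \<zeta>" using z by (auto simp: ZZ_iff)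
  show ?thesis
    unfolding q ip_altdef using **[of F, OF F] **[of H, OF H] eq by simp
qed

section \<open>The Galois action on \<int>[\<zeta>]\<close>

definition gal :: "nat \<Rightarrow> complex \<Rightarrow> complex"
  where "gal k z = ip (SOME q. z = ip q \<zeta>) (\<zeta> ^ k)"

text \<open>Polynomials that agree at \<zeta> agree at its conjugates, so the polynomial chosen in
  \<open>gal\<close> does not matter. All properties of the Galois maps follow from this evaluation
  rule.\<close>

lemma gal_ip:
  assumes "\<not> p dvd k" shows "gal k (ip q \<zeta>) = ip q (\<zeta> ^ k)"
proof -
  define r where "r = (SOME r. ip q \<zeta> = ip r \<zeta>)"
  have "ip q \<zeta> = ip r \<zeta>" unfolding r_def by (rule someI[of _ q]) simp
  then have "ip (r - q) \<zeta> = 0" by (simp add: ip_minus)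
  moreover have "(\<zeta> ^ k) ^ p = 1"
    by (simp add: power_mult[symmetric] zeta_pow_eq_1_iff)
  moreover have "\<zeta> ^ k \<noteq> 1" using assms zeta_pow_eq_1_iff by simp
  ultimately have "ip (r - q) (\<zeta> ^ k) = 0" by (rule ip_conj_root)
  then show ?thesis by (simp add: gal_def r_def[symmetric] ip_minus)
qed

lemma gal_cong: "[k = l] (mod p) \<Longrightarrow> gal k z = gal l z"
  using zeta_pow_cong by (simp add: gal_def)

lemma gal_ZZ: "z \<in> ZZ \<Longrightarrow> gal k z \<in> ZZ"
  by (simp add: gal_def ZZ_ip_closed ZZ_power ZZ_zeta)

lemma gal_add: "\<not> p dvd k \<Longrightarrow> z \<in> ZZ \<Longrightarrow> w \<in> ZZ \<Longrightarrow> gal k (z + w) = gal k z + gal k w"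
  unfolding ZZ_iff by (elim exE) (simp add: ip_add[symmetric] gal_ip)

lemma gal_mult: "\<not> p dvd k \<Longrightarrow> z \<in> ZZ \<Longrightarrow> w \<in> ZZ \<Longrightarrow> gal k (z * w) = gal k z * gal k w"
  unfolding ZZ_iff by (elim exE) (simp add: ip_mult[symmetric] gal_ip)

lemma gal_zeta_pow: "\<not> p dvd k \<Longrightarrow> gal k (\<zeta> ^ s) = \<zeta> ^ (s * k)"
  using gal_ip[of k "monom 1 s"] by (simp add: ip_monom power_mult[symmetric] mult.commute)

lemma gal_zeta: "\<not> p dvd k \<Longrightarrow> gal k \<zeta> = \<zeta> ^ k"
  using gal_zeta_pow[of k 1] by simp

lemma gal_of_int: "\<not> p dvd k \<Longrightarrow> gal k (of_int a) = of_int a"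
  using gal_ip[of k "[:a:]"] by simp

lemma gal_1: "\<not> p dvd k \<Longrightarrow> gal k 1 = 1"
  using gal_of_int[of k 1] by simp

lemma gal_of_int_mult: "\<not> p dvd k \<Longrightarrow> z \<in> ZZ \<Longrightarrow> gal k (of_int a * z) = of_int a * gal k z"
  by (simp add: gal_mult ZZ_of_int gal_of_int)

lemma gal_power: "\<not> p dvd k \<Longrightarrow> z \<in> ZZ \<Longrightarrow> gal k (z ^ i) = gal k z ^ i"
  by (induction i) (auto simp: gal_1 gal_mult ZZ_power)

lemma gal_gal:
  assumes "\<not> p dvd k" "\<not> p dvd l" "z \<in> ZZ" shows "gal k (gal l z) = gal (k * l) z"
proof -
  obtain q where q: "z = ip q \<zeta>" using assms by (auto simp: ZZ_iff)
  have kl: "\<not> p dvd k * l" using assms prime_p by (simp add: prime_dvd_mult_iff)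
  have "gal l z = ip (pcompose q (monom 1 l)) \<zeta>" using assms by (simp add: q gal_ip ip_pcompose ip_monom)
  then have "gal k (gal l z) = ip (pcompose q (monom 1 l)) (\<zeta> ^ k)" using gal_ip[OF assms(1)] by simp
  then show ?thesis
    using gal_ip[OF kl, of q] by (simp add: q ip_pcompose ip_monom power_mult)
qed

lemma gal_id: "z \<in> ZZ \<Longrightarrow> [k = 1] (mod p) \<Longrightarrow> gal k z = z"
proof -
  assume z: "z \<in> ZZ" and k: "[k = 1] (mod p)"
  obtain q where q: "z = ip q \<zeta>" using z by (auto simp: ZZ_iff)
  have "\<not> p dvd 1" using p_ge_3 by simp
  then show ?thesis using gal_cong[OF k, of z] gal_ip[of 1 q] by (simp add: q)
qed

subsection \<open>Coordinates with respect to the powers of \<open>\<zeta> - 1\<close>\<close>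

text \<open>Identifies row vectors with the ideal (\<zeta> - 1)\<int>[\<zeta>]; under it R(i)
  becomes the ideal generated by \<open>\<pi>^i\<close>.\<close>

definition ev :: "(nat \<Rightarrow> int) \<Rightarrow> complex"
  where "ev r = (\<Sum>k\<in>{1..p - 1}. of_int (r k) * \<pi> ^ k)"

definition rows :: "(nat \<Rightarrow> int) set"
  where "rows = {r. \<forall>j. j \<notin> {1..p - 1} \<longrightarrow> r j = 0}"

definition row_poly :: "(nat \<Rightarrow> int) \<Rightarrow> int poly"
  where "row_poly r = (\<Sum>k<p - 1. monom (r (Suc k)) k)"

lemma coeff_row_poly: "coeff (row_poly r) k = (if k < p - 1 then r (Suc k) else 0)"
  by (simp add: row_poly_def coeff_sum)

lemma ev_row_poly: "ev r = \<pi> * ip (row_poly r) \<pi>"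
proof -
  have "ev r = (\<Sum>k<p - 1. of_int (r (Suc k)) * \<pi> ^ Suc k)"
    unfolding ev_def by (rule sum.reindex_bij_witness[of _ Suc "\<lambda>k. k - 1"]) auto
  then show ?thesis
    by (simp add: row_poly_def ip_sum ip_monom sum_distrib_left mult.left_commute)
qed

lemma pi_neq_0: "\<pi> \<noteq> 0"
  using zeta_neq_1 by simp

lemma ip_pi_ZZ: "ip q \<pi> \<in> ZZ"
  by (rule ZZ_ip_closed[OF ZZ_pi])

lemma ev_ZZ: "ev r \<in> ZZ"
  by (simp add: ev_row_poly ZZ_mult ZZ_pi ip_pi_ZZ)

text \<open>
  The Eisenstein property of the minimal polynomial \<open>E\<close> of \<open>\<zeta> - 1\<close> makes multiples of
  \<open>(\<zeta> - 1)\<^sup>j\<close> triangular modulo \<open>p\<close>.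
\<close>

lemma ev_coords_mod:
  assumes eq: "ev r = \<pi> ^ j * ip q \<zeta>" and j: "j \<in> {1..p - 1}"
  shows "k \<in> {1..<j} \<Longrightarrow> int p dvd r k" and "[r j = poly q 1] (mod int p)"
proof -
  let ?d = "monom 1 (j - 1) * sh q - row_poly r"
  have "\<pi> * ip ?d \<pi> = \<pi> ^ j * ip (sh q) \<pi> - ev r"
    using j by (cases j) (simp_all add: ev_row_poly ip_minus ip_mult ip_monom algebra_simps)
  then have "ip ?d \<pi> = 0" using eq pi_neq_0 ip_sh[of q \<zeta>] by simp
  then obtain t where t: "?d = E * t" using ip_eq_0_imp_dvd by blast
  have dvd: "int p dvd coeff ?d k" if "k < p - 1" for k
    unfolding t coeff_mult using that by (intro dvd_sum dvd_mult2 p_dvd_coeff_E) auto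
  show "int p dvd r k" if "k \<in> {1..<j}" for k
  proof -
    have "k - 1 < p - 1" "\<not> j - 1 \<le> k - 1" "Suc (k - 1) = k" using that j by auto
    then show ?thesis using dvd[of "k - 1"] by (simp add: coeff_monom_mult coeff_row_poly)
  qed
  have j': "j - 1 < p - 1" "Suc (j - 1) = j" using j by auto
  have "coeff ?d (j - 1) = poly q 1 - r j"
    using j' by (simp add: coeff_monom_mult coeff_row_poly coeff_sh_0)
  then show "[r j = poly q 1] (mod int p)"
    using dvd[OF j'(1)] by (simp add: cong_iff_dvd_diff dvd_diff_commute)
qed

lemma ev_inj: "ev r = ev s \<Longrightarrow> k \<in> {1..p - 1} \<Longrightarrow> r k = s k"
proof -
  assume eq: "ev r = ev s" and k: "k \<in> {1..p - 1}"
  have "ip (row_poly r - row_poly s) \<pi> = 0"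
    using eq pi_neq_0 by (simp add: ev_row_poly ip_minus)
  moreover have "degree (row_poly r - row_poly s) < p - 1"
    using p_ge_3 by (intro degree_lessI) (auto simp: coeff_row_poly)
  ultimately have "row_poly r - row_poly s = 0" using min_degree by (metis not_le)
  then have "coeff (row_poly r) (k - 1) = coeff (row_poly s) (k - 1)" by simp
  then show ?thesis using k by (auto simp: coeff_row_poly split: if_splits)
qed

lemma ev_inj_rows: "r \<in> rows \<Longrightarrow> s \<in> rows \<Longrightarrow> ev r = ev s \<Longrightarrow> r = s"
proof
  fix k assume "r \<in> rows" "s \<in> rows" "ev r = ev s"
  then show "r k = s k" using ev_inj[of r s k] by (cases "k \<in> {1..p - 1}") (auto simp: rows_def)
qed

lemma ev_ex: "z \<in> ZZ \<Longrightarrow> \<exists>r\<in>rows. ev r = \<pi> * z"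
proof -
  assume "z \<in> ZZ"
  then obtain q where q: "z = ip q \<zeta>" by (auto simp: ZZ_iff)
  obtain s t where st: "sh q = E * s + t" "t = 0 \<or> degree t < p - 1" by (rule E_divmod) blast
  have z: "z = ip t \<pi>"
    using ip_sh[of q \<zeta>] ip_E_root[OF zeta_pow_p zeta_neq_1] unfolding st(1) q by (simp add: ip_add ip_mult)
  define r where "r k = (if k \<in> {1..p - 1} then coeff t (k - 1) else 0)" for k
  have "row_poly r = t"
  proof (rule poly_eqI)
    fix k show "coeff (row_poly r) k = coeff t k"
      using st(2) by (auto simp: coeff_row_poly r_def coeff_eq_0)
  qed
  then show ?thesis using z by (intro bexI[of _ r]) (auto simp: ev_row_poly rows_def r_def)
qed

lemma ev_add: "ev (\<lambda>k. r k + s k) = ev r + ev s"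
  by (simp add: ev_def distrib_right sum.distrib)

lemma ev_scale: "ev (\<lambda>k. a * r k) = of_int a * ev r"
  by (simp add: ev_def sum_distrib_left mult.assoc)

lemma ev_unit: "j \<in> {1..p - 1} \<Longrightarrow> ev (\<lambda>k. if k = j then 1 else 0) = \<pi> ^ j"
proof -
  assume j: "j \<in> {1..p - 1}"
  have "ev (\<lambda>k. if k = j then 1 else 0) = (\<Sum>k\<in>{1..p - 1}. if k = j then \<pi> ^ k else 0)"
    unfolding ev_def by (intro sum.cong) auto
  then show ?thesis using j by simp
qed

text \<open>From \<open>E(\<pi>) = 0\<close> comes \<open>p = - \<pi> q(\<pi>)\<close>. The constant
  term of \<open>q\<close> is the binomial coefficient of p over 2, divisible by p since p is odd,
  so \<pi> divides \<open>q(\<pi>)\<close> as well. The exponent 2 is the one that fits R(2), the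
  ideal generated by \<open>\<pi>^2\<close>.\<close>

lemma p_eq_pi_mult: obtains u where "u \<in> ZZ" "of_nat p = \<pi>\<^sup>2 * u"
proof -
  define q where "q = (\<Sum>k<p - 1. monom (coeff E (Suc k)) k)"
  have "ip E \<pi> = of_int (coeff E 0) + \<pi> * ip q \<pi>"
  proof -
    have "{..p - 1} = {..<Suc (p - 1)}" by (rule lessThan_Suc_atMost[symmetric])
    then have "ip E \<pi> = of_int (coeff E 0) + (\<Sum>k<p - 1. of_int (coeff E (Suc k)) * \<pi> ^ Suc k)"
      by (simp only: ip_altdef degree_E sum.lessThan_Suc_shift) simp
    then show ?thesis by (simp add: q_def ip_sum ip_monom sum_distrib_left mult.left_commute)
  qed
  then have 1: "of_nat p = - (\<pi> * ip q \<pi>)"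
    using ip_E_root[OF zeta_pow_p zeta_neq_1] by (simp add: E_0 eq_neg_iff_add_eq_0)
  have "int p dvd coeff q 0" using p_dvd_coeff_E[of 1] p_ge_3 by (simp add: q_def coeff_sum)
  then obtain a where a: "coeff q 0 = int p * a" by (elim dvdE) blast
  obtain b q' where q': "q = pCons b q'" by (cases q) blast
  have "ip q \<pi> = of_nat p * of_int a + \<pi> * ip q' \<pi>" using a q' by simp
  also have "\<dots> = \<pi> * (ip q' \<pi> - ip q \<pi> * of_int a)" unfolding 1 by (simp add: algebra_simps)
  finally have "ip q \<pi> = \<pi> * (ip q' \<pi> - ip q \<pi> * of_int a)" .
  then have "of_nat p = \<pi>\<^sup>2 * - (ip q' \<pi> - ip q \<pi> * of_int a)"
    unfolding 1 power2_eq_square by (metis (no_types, lifting) mult.assoc mult_minus_right)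
  then show thesis
    by (rule that[rotated]) (intro ZZ_uminus ZZ_diff ZZ_mult ip_pi_ZZ ZZ_of_int)
qed

end

section \<open>Presented groups\<close>

lemma word_class_eq_iff: "word_class rels u = word_class rels v \<longleftrightarrow> word_eq rels u v"
proof
  assume "word_class rels u = word_class rels v"
  then have "v \<in> word_class rels u" by (simp add: word_class_def word_eq_refl)
  then show "word_eq rels u v" by (simp add: word_class_def)
next
  assume "word_eq rels u v"
  then show "word_class rels u = word_class rels v"
    unfolding word_class_def by (blast intro: word_eq_trans word_eq_sym)
qed

lemma presented_group_simps [simp]:
  "carrier (presented_group rels) = range (word_class rels)"
  "\<one>\<^bsub>presented_group rels\<^esub> = word_class rels []"
  by (simp_all add: presented_group_def)

lemma presented_group_mult [simp]:
  "word_class rels u \<otimes>\<^bsub>presented_group rels\<^esub> word_class rels v = word_class rels (u @ v)"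
proof -
  have eq: "word_class rels (u' @ v') = word_class rels (u @ v)"
    if "u' \<in> word_class rels u" "v' \<in> word_class rels v" for u' v'
    using that by (simp add: word_class_eq_iff) (auto simp: word_class_def intro: word_eq_append word_eq_sym)
  have "(\<Union>u'\<in>word_class rels u. \<Union>v'\<in>word_class rels v. word_class rels (u' @ v')) =
      (\<Union>u'\<in>word_class rels u. \<Union>v'\<in>word_class rels v. word_class rels (u @ v))"
    by (intro SUP_cong refl eq)
  moreover have "word_class rels u \<noteq> {}" "word_class rels v \<noteq> {}"
    by (auto simp: word_class_def intro: word_eq_refl)
  ultimately show ?thesis by (simp add: presented_group_def)
qed

lemma word_eq_inverse: "word_eq rels (map (\<lambda>(s, b). (s, \<not> b)) (rev w) @ w) []"
proof (induction w)
  case (Cons a w)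
  obtain s b where a: "a = (s, b)" by (cases a) blast
  let ?v = "map (\<lambda>(s, b). (s, \<not> b)) (rev w)"
  have "word_eq rels [(s, \<not> b), (s, \<not> \<not> b)] []" by (rule word_eq_cancel)
  then have "word_eq rels ([(s, \<not> b), (s, b)] @ w) ([] @ w)"
    by (intro word_eq_append word_eq_refl) simp
  then have "word_eq rels (?v @ [(s, \<not> b), (s, b)] @ w) (?v @ w)"
    by (intro word_eq_append word_eq_refl) simp
  then show ?case using Cons a by (auto intro: word_eq_trans)
qed (simp add: word_eq_refl)

lemma group_presented_group: "group (presented_group rels)"
proof (rule groupI)
  fix g assume "g \<in> carrier (presented_group rels)"
  then obtain w where w: "g = word_class rels w" by auto
  show "\<exists>h\<in>carrier (presented_group rels). h \<otimes>\<^bsub>presented_group rels\<^esub> g = \<one>\<^bsub>presented_group rels\<^esub>"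
    by (rule bexI[of _ "word_class rels (map (\<lambda>(s, b). (s, \<not> b)) (rev w))"])
      (auto simp: w word_class_eq_iff word_eq_inverse)
qed auto

locale metacyclic = cyclotomic +
  fixes m :: int
  assumes ord_m: "ord (int p) m = p - 1"
begin

section \<open>Galois sums\<close>

text \<open>\<open>m0\<close> represents m modulo p, and \<open>m1\<close> its inverse by Fermat;
  both are natural numbers because group powers and \<open>gal\<close> take natural exponents. As y
  acts by the inverse of \<sigma>, it is \<open>m1\<close> that governs the action.\<close>

definition m0 :: nat where "m0 = nat (m mod int p)"
definition m1 :: nat where "m1 = m0 ^ (p - 2)"

lemma cong_m0: "[m = int m0] (mod int p)"
  using p_ge_3 by (simp add: m0_def cong_def)

lemma coprime_m: "coprime (int p) m"
  using ord_m p_ge_3 by (auto simp: ord_def split: if_splits)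

lemma not_dvd_m0: "\<not> p dvd m0"
proof
  assume "p dvd m0"
  then have "int p dvd m" using cong_m0 cong_dvd_iff by (metis int_dvd_int_iff cong_sym cong_def dvd_eq_mod_eq_0)
  then have "is_unit (int p)" using coprime_m by (meson coprime_common_divisor dvd_refl)
  then show False using p_ge_3 by simp
qed

lemma not_dvd_power: "\<not> p dvd a \<Longrightarrow> \<not> p dvd a ^ k"
  using prime_dvd_power[OF prime_p] by blast

lemma not_dvd_m1: "\<not> p dvd m1"
  unfolding m1_def by (rule not_dvd_power[OF not_dvd_m0])

lemma m0_power: "[m0 ^ (p - 1) = 1] (mod p)"
  by (rule fermat_theorem[OF prime_p not_dvd_m0])

lemma m0_m1: "[m0 * m1 = 1] (mod p)"
proof -
  have "Suc (p - 2) = p - 1" using p_ge_3 by simp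
  then have "m0 * m1 = m0 ^ (p - 1)" unfolding m1_def by (metis power_Suc)
  then show ?thesis using m0_power by simp
qed

lemma m0_m1_power: "[m0 ^ j * m1 ^ j = 1] (mod p)"
  using cong_pow[OF m0_m1, of j] by (simp add: power_mult_distrib)

lemma m0_power_neq_1: assumes "0 < d" "d < p - 1" shows "\<not> [m0 ^ d = 1] (mod p)"
proof
  assume "[m0 ^ d = 1] (mod p)"
  then have "[int m0 ^ d = 1] (mod int p)" by (metis cong_int_iff of_nat_1 of_nat_power)
  then have "[m ^ d = 1] (mod int p)" using cong_pow[OF cong_m0, of d] cong_trans by blast
  moreover have "d < (LEAST d. d > 0 \<and> [m ^ d = 1] (mod int p))"
    using ord_m coprime_m assms(2) by (simp add: ord_def)
  ultimately show False using not_less_Least[of d "\<lambda>d. d > 0 \<and> [m ^ d = 1] (mod int p)"] assms(1) by blast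
qed

lemma m1_power_inj:
  assumes "[m1 ^ j = m1 ^ k] (mod p)" "j < p - 1" "k < p - 1" shows "j = k"
proof -
  have *: "j = k" if c: "[m1 ^ j = m1 ^ k] (mod p)" and jk: "j \<le> k" "k < p - 1" for j k
  proof (rule ccontr)
    assume "j \<noteq> k"
    have "[m0 ^ k * m1 ^ j = m0 ^ k * m1 ^ k] (mod p)" by (rule cong_mult[OF cong_refl c])
    then have 1: "[m0 ^ k * m1 ^ j = 1] (mod p)" using m0_m1_power cong_trans by blast
    have "m0 ^ k * m1 ^ j = m0 ^ (k - j) * (m0 ^ j * m1 ^ j)"
      using jk by (simp add: power_add[symmetric] mult.assoc[symmetric])
    moreover have "[m0 ^ (k - j) * (m0 ^ j * m1 ^ j) = m0 ^ (k - j) * 1] (mod p)"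
      by (rule cong_mult[OF cong_refl m0_m1_power])
    ultimately have "[m0 ^ (k - j) = 1] (mod p)" using 1 by (metis cong_sym cong_trans mult.right_neutral)
    moreover have "0 < k - j" "k - j < p - 1" using jk \<open>j \<noteq> k\<close> by auto
    ultimately show False using m0_power_neq_1 by blast
  qed
  show ?thesis
  proof (cases "j \<le> k")
    case True then show ?thesis using *[OF assms(1) True assms(3)] by simp
  next
    case False then show ?thesis using *[OF cong_sym[OF assms(1)] _ assms(2)] by simp
  qed
qed

lemma m1_power_bij: "bij_betw (\<lambda>j. m1 ^ j mod p) {..<p - 1} {1..p - 1}"
proof -
  have inj: "inj_on (\<lambda>j. m1 ^ j mod p) {..<p - 1}"
    by (rule inj_onI, rule m1_power_inj) (simp_all add: cong_def)
  have sub: "(\<lambda>j. m1 ^ j mod p) ` {..<p - 1} \<subseteq> {1..p - 1}"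
  proof clarify
    fix j
    have "m1 ^ j mod p \<noteq> 0" using not_dvd_power[OF not_dvd_m1, of j] by (simp add: dvd_eq_mod_eq_0)
    moreover have "m1 ^ j mod p < p" using p_ge_3 by simp
    ultimately show "m1 ^ j mod p \<in> {1..p - 1}" by simp
  qed
  have "card ((\<lambda>j. m1 ^ j mod p) ` {..<p - 1}) = card {1..p - 1}"
    unfolding card_image[OF inj] by simp
  then have "(\<lambda>j. m1 ^ j mod p) ` {..<p - 1} = {1..p - 1}"
    by (intro card_subset_eq sub) simp_all
  with inj show ?thesis by (simp add: bij_betw_def)
qed

lemma root_sum:
  fixes \<omega> :: complex
  assumes "\<omega> ^ p = 1" shows "(\<Sum>t<p. \<omega> ^ t) = (if \<omega> = 1 then of_nat p else 0)"
  using assms by (simp add: geometric_sum)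

text \<open>This is the trace of a p-th root of unity: since m has order p - 1, the exponents
  \<open>m1 ^ j\<close> run through all nonzero residues modulo p.\<close>

lemma galois_sum:
  fixes \<omega> :: complex
  assumes w: "\<omega> ^ p = 1" shows "(\<Sum>j<p - 1. \<omega> ^ (m1 ^ j)) = (if \<omega> = 1 then of_nat p else 0) - 1"
proof -
  have md: "\<omega> ^ (k mod p) = \<omega> ^ k" for k
  proof -
    have "\<omega> ^ k = (\<omega> ^ p) ^ (k div p) * \<omega> ^ (k mod p)" by (metis power_add power_mult mult_div_mod_eq)
    then show ?thesis using w by simp
  qed
  have "(\<Sum>j<p - 1. \<omega> ^ (m1 ^ j)) = (\<Sum>j<p - 1. \<omega> ^ (m1 ^ j mod p))"
    by (simp add: md)
  also have "\<dots> = (\<Sum>t\<in>{1..p - 1}. \<omega> ^ t)"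
    by (rule sum.reindex_bij_betw[OF m1_power_bij])
  also have "\<dots> = (\<Sum>t<p. \<omega> ^ t) - 1"
  proof -
    have "{..<p} = insert 0 {1..p - 1}" using p_ge_3 by auto
    then show ?thesis by simp
  qed
  finally show ?thesis using root_sum[OF w] by simp
qed

lemma gal_m1_power:
  "z \<in> ZZ \<Longrightarrow> gal m1 z = z \<Longrightarrow> gal (m1 ^ j) z = z"
proof (induction j)
  case 0
  then show ?case by (simp add: gal_id)
next
  case (Suc j)
  then have "gal m1 (gal (m1 ^ j) z) = gal (m1 ^ Suc j) z"
    by (subst gal_gal) (auto simp: not_dvd_m1 not_dvd_power)
  then show ?case using Suc by simp
qed

text \<open>For an invariant z the product is its trace, and the trace of an integral polynomial in
  \<zeta> is an integer by \<open>galois_sum\<close>.\<close>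

lemma gal_fixed_rational:
  assumes z: "z \<in> ZZ" and fxd: "gal m1 z = z" obtains n :: int where "of_nat (p - 1) * z = of_int n"
proof -
  obtain q where q: "z = ip q \<zeta>" using z by (auto simp: ZZ_iff)
  have "of_nat (p - 1) * z = (\<Sum>j<p - 1. gal (m1 ^ j) z)"
    by (simp add: gal_m1_power[OF z fxd])
  also have "\<dots> = (\<Sum>j<p - 1. \<Sum>s\<le>degree q. of_int (coeff q s) * (\<zeta> ^ s) ^ (m1 ^ j))"
    unfolding q gal_ip[OF not_dvd_power[OF not_dvd_m1]]
    by (simp add: ip_altdef power_mult[symmetric] mult.commute)
  also have "\<dots> = (\<Sum>s\<le>degree q. of_int (coeff q s) * (\<Sum>j<p - 1. (\<zeta> ^ s) ^ (m1 ^ j)))"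
    by (subst sum.swap) (simp add: sum_distrib_left)
  also have "\<dots> = (\<Sum>s\<le>degree q. of_int (coeff q s) * of_int ((if \<zeta> ^ s = 1 then int p else 0) - 1))"
  proof (intro sum.cong refl)
    fix s
    have "(\<zeta> ^ s) ^ p = 1" by (simp add: power_mult[symmetric] zeta_pow_eq_1_iff)
    from galois_sum[OF this] show "of_int (coeff q s) * (\<Sum>j<p - 1. (\<zeta> ^ s) ^ (m1 ^ j)) =
        of_int (coeff q s) * of_int ((if \<zeta> ^ s = 1 then int p else 0) - 1)" by simp
  qed
  also have "\<dots> = of_int (\<Sum>s\<le>degree q. coeff q s * ((if \<zeta> ^ s = 1 then int p else 0) - 1))"
    by simp
  finally show thesis by (rule that)
qed

subsection \<open>The automorphism \<open>\<sigma>\<close>\<close>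

lemma zeta_powi_m: "\<zeta> powi m = \<zeta> ^ m0"
proof -
  have "m = int m0 + int p * (m div int p)"
    using p_ge_3 by (simp add: m0_def)
  then have "\<zeta> powi m = \<zeta> powi int m0 * (\<zeta> powi int p) powi (m div int p)"
    using zeta_neq_0 by (metis power_int_add power_int_mult)
  then show ?thesis by (simp add: power_int_of_nat zeta_pow_p)
qed

lemma gal_m0_m1: "z \<in> ZZ \<Longrightarrow> gal m0 (gal m1 z) = z" and gal_m1_m0: "z \<in> ZZ \<Longrightarrow> gal m1 (gal m0 z) = z"
  using m0_m1 by (simp_all add: gal_gal not_dvd_m0 not_dvd_m1 gal_id mult.commute)

lemma gal_bij: "bij_betw (gal m0) ZZ ZZ"
  by (rule bij_betw_byWitness[of _ "gal m1"]) (auto simp: gal_m0_m1 gal_m1_m0 gal_ZZ)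

lemma Z_zeta_simps [simp]:
  "monoid.mult (Z_zeta p) = (*)" "\<one>\<^bsub>Z_zeta p\<^esub> = 1" "\<zero>\<^bsub>Z_zeta p\<^esub> = 0" "add (Z_zeta p) = (+)"
  by (simp_all add: Z_zeta_def)

text \<open>A ring automorphism is determined by its values on the powers of \<zeta>, and
  extensionality settles the values elsewhere; so the definite description has exactly this
  solution.\<close>

lemma sigma_eq: "sigma p m = restrict (gal m0) ZZ"
  unfolding sigma_def
proof (rule the_equality)
  have "restrict (gal m0) ZZ \<in> Ring.ring_hom (Z_zeta p) (Z_zeta p)"
    by (rule ring_hom_memI)
      (auto simp: gal_ZZ gal_mult gal_add gal_1 not_dvd_m0 ZZ_mult ZZ_add ZZ_1)
  then show "restrict (gal m0) ZZ \<in> ring_iso (Z_zeta p) (Z_zeta p) \<and>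
      restrict (gal m0) ZZ \<in> extensional ZZ \<and> restrict (gal m0) ZZ \<zeta> = \<zeta> powi m"
    using gal_bij by (simp add: ring_iso_def ZZ_zeta gal_zeta not_dvd_m0 zeta_powi_m)
next
  fix s assume s: "s \<in> ring_iso (Z_zeta p) (Z_zeta p) \<and> s \<in> extensional ZZ \<and> s \<zeta> = \<zeta> powi m"
  then have hom: "s \<in> Ring.ring_hom (Z_zeta p) (Z_zeta p)" by (simp add: ring_iso_def)
  have add: "s (u + v) = s u + s v" and mult: "s (u * v) = s u * s v" if "u \<in> ZZ" "v \<in> ZZ" for u v
    using ring_hom_add[OF hom that] ring_hom_mult[OF hom that] by simp_all
  have "s 1 = 1" using ring_hom_one[OF hom] by simp
  then have pow: "s (\<zeta> ^ k) = \<zeta> ^ (k * m0)" for k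
    using s by (induction k) (auto simp: mult ZZ_zeta ZZ_power zeta_powi_m power_add)
  show "s = restrict (gal m0) ZZ"
  proof (rule extensionalityI[of _ ZZ])
    fix z assume z: "z \<in> ZZ"
    have "s z = gal m0 z"
      by (rule additive_ZZ_eq[OF add _ _ z]) (simp_all add: gal_add not_dvd_m0 pow gal_zeta_pow)
    then show "s z = restrict (gal m0) ZZ z" using z by simp
  qed (use s in auto)
qed

lemma sigma_app: "v \<in> ZZ \<Longrightarrow> sigma p m v = gal m0 v"
  by (simp add: sigma_eq)

lemma inv_sigma: "v \<in> ZZ \<Longrightarrow> inv_into ZZ (sigma p m) v = gal m1 v"
  by (rule inv_into_f_eq)
    (use gal_bij in \<open>auto simp: sigma_eq bij_betw_def gal_ZZ gal_m0_m1 inj_on_def\<close>)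

subsection \<open>Words acting on \<open>\<int>[\<zeta>]\<close>\<close>

abbreviation wact :: "complex \<Rightarrow> gen word \<Rightarrow> complex"
  where "wact \<equiv> foldl (letter_act p m)"

lemma inverse_zeta: "inverse \<zeta> = \<zeta> ^ (p - 1)"
proof -
  have "\<zeta> * \<zeta> ^ (p - 1) = 1"
    using zeta_pow_p p_ge_3 by (metis power_Suc Suc_diff_1 not_gr_zero not_numeral_le_zero)
  then show ?thesis by (rule inverse_unique)
qed

lemma letter_act_ZZ: "v \<in> ZZ \<Longrightarrow> letter_act p m v a \<in> ZZ"
  by (cases "(p, m, v, a)" rule: letter_act.cases)
    (auto simp: ZZ_mult ZZ_zeta inverse_zeta ZZ_power inv_sigma gal_ZZ sigma_app)

lemma letter_act_add: "v \<in> ZZ \<Longrightarrow> w \<in> ZZ \<Longrightarrow> letter_act p m (v + w) a = letter_act p m v a + letter_act p m w a"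
  by (cases "(p, m, v, a)" rule: letter_act.cases)
    (auto simp: distrib_right inv_sigma gal_add not_dvd_m1 not_dvd_m0 sigma_app ZZ_add)

lemma letter_act_cancel: "v \<in> ZZ \<Longrightarrow> letter_act p m (letter_act p m v (s, b)) (s, \<not> b) = v"
  by (cases s; cases b) (auto simp: zeta_neq_0 inv_sigma sigma_app gal_ZZ gal_m0_m1 gal_m1_m0)

lemma wact_ZZ: "v \<in> ZZ \<Longrightarrow> wact v u \<in> ZZ"
  by (induction u arbitrary: v) (auto simp: letter_act_ZZ)

lemma wact_add: "v \<in> ZZ \<Longrightarrow> w \<in> ZZ \<Longrightarrow> wact (v + w) u = wact v u + wact w u"
  by (induction u arbitrary: v w) (auto simp: letter_act_ZZ letter_act_add)

lemma wact_X: "wact v (replicate k (X, True)) = v * \<zeta> ^ k"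
  by (induction k arbitrary: v) (auto simp: mult.assoc)

lemma wact_X': "wact v (replicate k (X, False)) = v * inverse \<zeta> ^ k"
  by (induction k arbitrary: v) (auto simp: mult.assoc)

lemma wact_Y: "v \<in> ZZ \<Longrightarrow> wact v (replicate k (Y, True)) = gal (m1 ^ k) v"
proof (induction k arbitrary: v)
  case 0 then show ?case by (simp add: gal_id)
next
  case (Suc k)
  then show ?case by (simp add: inv_sigma gal_ZZ gal_gal not_dvd_m1 not_dvd_power mult.commute)
qed

abbreviation rels where "rels \<equiv> metacyclic_rels p m"

lemma wact_word_eq: "word_eq rels u w \<Longrightarrow> v \<in> ZZ \<Longrightarrow> wact v u = wact v w"
proof (induction arbitrary: v rule: word_eq.induct)
  case (word_eq_append u u' w w')
  then show ?case by (simp add: wact_ZZ)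
next
  case (word_eq_cancel s b)
  then show ?case by (simp add: letter_act_cancel)
next
  case (word_eq_rel u w)
  have rel2: "wact v (word_pow Y (int p - 1)) = v"
  proof -
    have "word_pow Y (int p - 1) = replicate (p - 1) (Y, True)"
      using p_ge_3 by (simp add: word_pow_def nat_diff_distrib)
    moreover have "[m1 ^ (p - 1) = 1] (mod p)" by (rule fermat_theorem[OF prime_p not_dvd_m1])
    ultimately show ?thesis using word_eq_rel.prems by (simp add: wact_Y gal_id)
  qed
  have rel1: "wact v (word_pow X (int p)) = v"
    by (simp add: word_pow_def wact_X zeta_pow_p)
  \<comment> \<open>Both sides are \<open>gal m1 v * \<zeta>\<close>: applying \<open>gal m1\<close>
    to the m-th power of \<zeta> gives back \<zeta>, because \<open>m0 * m1\<close> is 1 modulo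
    p.\<close>
  have rel3: "wact v (word_pow Y 1 @ word_pow X 1) = wact v (word_pow X m @ word_pow Y 1)"
  proof -
    have "wact v (word_pow X m) = v * \<zeta> powi m"
      by (cases "m \<ge> 0") (auto simp: word_pow_def wact_X wact_X' power_int_def)
    then have 1: "wact v (word_pow X m) = v * \<zeta> ^ m0" by (simp add: zeta_powi_m)
    have Y1: "word_pow Y 1 = [(Y, True)]" by (simp add: word_pow_def)
    have "wact v (word_pow X m @ word_pow Y 1) = gal m1 (v * \<zeta> ^ m0)"
      unfolding foldl_append 1 Y1 using word_eq_rel.prems by (simp add: inv_sigma ZZ_mult ZZ_power ZZ_zeta)
    also have "\<dots> = gal m1 v * \<zeta> ^ (m0 * m1)"
      using word_eq_rel.prems by (simp add: gal_mult not_dvd_m1 ZZ_power ZZ_zeta gal_zeta_pow)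
    also have "\<zeta> ^ (m0 * m1) = \<zeta>" using zeta_pow_cong[OF m0_m1] by simp
    finally show ?thesis using word_eq_rel.prems by (simp add: word_pow_def inv_sigma)
  qed
  show ?case using word_eq_rel.hyps rel1 rel2 rel3 by (auto simp: metacyclic_rels_def)
qed auto

section \<open>The group \<open>G(p, p - 1)\<close>\<close>

abbreviation G where "G \<equiv> G_group p m"

lemma group_G: "group G"
  unfolding G_group_def by (rule group_presented_group)

sublocale G: group G by (rule group_G)

definition xg where "xg = word_class rels [(X, True)]"
definition yg where "yg = word_class rels [(Y, True)]"

abbreviation gact where "gact \<equiv> group_act p m"

lemma gact_class: "v \<in> ZZ \<Longrightarrow> gact v (word_class rels u) = wact v u"
proof -
  assume v: "v \<in> ZZ"
  have "(SOME w. w \<in> word_class rels u) \<in> word_class rels u"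
    by (rule someI[of _ u]) (simp add: word_class_def word_eq_refl)
  then have "word_eq rels u (SOME w. w \<in> word_class rels u)" by (simp add: word_class_def)
  then show ?thesis unfolding group_act_def using wact_word_eq[OF _ v] by metis
qed

lemma G_carrier: "g \<in> carrier G \<longleftrightarrow> (\<exists>u. g = word_class rels u)"
  by (auto simp: G_group_def)

lemma G_mult: "word_class rels u \<otimes>\<^bsub>G\<^esub> word_class rels w = word_class rels (u @ w)"
  by (simp add: G_group_def)

lemma G_one: "\<one>\<^bsub>G\<^esub> = word_class rels []"
  by (simp add: G_group_def)

lemma xg_closed [simp]: "xg \<in> carrier G" and yg_closed [simp]: "yg \<in> carrier G"
  by (auto simp: G_carrier xg_def yg_def)

lemma gact_ZZ: "v \<in> ZZ \<Longrightarrow> g \<in> carrier G \<Longrightarrow> gact v g \<in> ZZ"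
  by (auto simp: G_carrier gact_class wact_ZZ)

lemma gact_add: "v \<in> ZZ \<Longrightarrow> w \<in> ZZ \<Longrightarrow> g \<in> carrier G \<Longrightarrow> gact (v + w) g = gact v g + gact w g"
  by (auto simp: G_carrier gact_class wact_add ZZ_add)

lemma gact_mult: "v \<in> ZZ \<Longrightarrow> g \<in> carrier G \<Longrightarrow> h \<in> carrier G \<Longrightarrow> gact v (g \<otimes>\<^bsub>G\<^esub> h) = gact (gact v g) h"
  by (auto simp: G_carrier gact_class wact_ZZ G_mult)

lemma gact_one: "v \<in> ZZ \<Longrightarrow> gact v \<one>\<^bsub>G\<^esub> = v"
  by (simp add: G_one gact_class)

lemma xg_pow: "xg [^]\<^bsub>G\<^esub> k = word_class rels (replicate k (X, True))" for k :: nat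
  by (induction k) (simp_all add: G_one xg_def G_mult replicate_append_same)

lemma yg_pow: "yg [^]\<^bsub>G\<^esub> k = word_class rels (replicate k (Y, True))" for k :: nat
  by (induction k) (simp_all add: G_one yg_def G_mult replicate_append_same)

lemma rel_eq: "(u, w) \<in> rels \<Longrightarrow> word_class rels u = word_class rels w"
  by (simp add: word_class_eq_iff word_eq_rel)

lemma xg_pow_p: "xg [^]\<^bsub>G\<^esub> p = \<one>\<^bsub>G\<^esub>"
  using rel_eq[of "word_pow X (int p)" "[]"]
  by (simp add: xg_pow G_one metacyclic_rels_def word_pow_def)

lemma yg_pow_p: "yg [^]\<^bsub>G\<^esub> (p - 1) = \<one>\<^bsub>G\<^esub>"
  using rel_eq[of "word_pow Y (int p - 1)" "[]"] p_ge_3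
  by (simp add: yg_pow G_one metacyclic_rels_def word_pow_def nat_diff_distrib)

lemma pow_cong:
  fixes k l n :: nat
  assumes "g \<in> carrier G" "g [^]\<^bsub>G\<^esub> n = \<one>\<^bsub>G\<^esub>" "[k = l] (mod n)"
  shows "g [^]\<^bsub>G\<^esub> k = g [^]\<^bsub>G\<^esub> l"
proof -
  have "g [^]\<^bsub>G\<^esub> k = g [^]\<^bsub>G\<^esub> (k mod n)" for k
  proof -
    have "g [^]\<^bsub>G\<^esub> k = g [^]\<^bsub>G\<^esub> (n * (k div n) + k mod n)" by simp
    also have "\<dots> = (g [^]\<^bsub>G\<^esub> n) [^]\<^bsub>G\<^esub> (k div n) \<otimes>\<^bsub>G\<^esub> g [^]\<^bsub>G\<^esub> (k mod n)"
      using assms(1) by (simp only: G.nat_pow_mult[symmetric] G.nat_pow_pow)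
    finally show ?thesis using assms by simp
  qed
  then show ?thesis using assms(3) by (metis cong_def)
qed

lemma inv_xg: "inv\<^bsub>G\<^esub> xg = xg [^]\<^bsub>G\<^esub> (p - 1)"
proof -
  have "xg [^]\<^bsub>G\<^esub> (p - 1) \<otimes>\<^bsub>G\<^esub> xg = xg [^]\<^bsub>G\<^esub> Suc (p - 1)" by simp
  also have "Suc (p - 1) = p" using p_ge_3 by simp
  finally show ?thesis by (intro G.inv_equality) (simp_all add: xg_pow_p)
qed

lemma inv_yg: "inv\<^bsub>G\<^esub> yg = yg [^]\<^bsub>G\<^esub> (p - 2)"
proof -
  have "yg [^]\<^bsub>G\<^esub> (p - 2) \<otimes>\<^bsub>G\<^esub> yg = yg [^]\<^bsub>G\<^esub> Suc (p - 2)" by simp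
  also have "Suc (p - 2) = p - 1" using p_ge_3 by simp
  finally show ?thesis by (intro G.inv_equality) (simp_all add: yg_pow_p del: One_nat_def)
qed

text \<open>The defining relation with m replaced by its natural residue. For negative m the word
  consists of inverse letters, and these are rewritten by \<open>x^-1 = x^(p-1)\<close>.\<close>

lemma yg_xg: "yg \<otimes>\<^bsub>G\<^esub> xg = xg [^]\<^bsub>G\<^esub> m0 \<otimes>\<^bsub>G\<^esub> yg"
proof -
  have inv_class: "word_class rels [(X, False)] = xg [^]\<^bsub>G\<^esub> (p - 1)"
  proof -
    have "word_class rels [(X, False)] \<otimes>\<^bsub>G\<^esub> xg = \<one>\<^bsub>G\<^esub>"
      using word_eq_cancel[of rels X False] by (simp add: xg_def G_mult G_one word_class_eq_iff)
    then have "inv\<^bsub>G\<^esub> xg = word_class rels [(X, False)]"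
      by (intro G.inv_equality xg_closed) (auto simp: G_carrier)
    then show ?thesis by (simp add: inv_xg)
  qed
  have neg: "word_class rels (replicate k (X, False)) = xg [^]\<^bsub>G\<^esub> ((p - 1) * k)" for k
  proof (induction k)
    case (Suc k)
    have "word_class rels (replicate (Suc k) (X, False)) =
        word_class rels [(X, False)] \<otimes>\<^bsub>G\<^esub> word_class rels (replicate k (X, False))"
      by (simp add: G_mult)
    then show ?case using Suc inv_class by (simp add: G.nat_pow_mult)
  qed (simp add: G_one)
  have "word_class rels (word_pow X m) = xg [^]\<^bsub>G\<^esub> m0"
  proof (cases "m \<ge> 0")
    case True
    have "[nat m = m0] (mod p)" using cong_m0 True by (metis cong_int_iff int_nat_eq)
    then have "xg [^]\<^bsub>G\<^esub> nat m = xg [^]\<^bsub>G\<^esub> m0" by (rule pow_cong[OF xg_closed xg_pow_p])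
    moreover have "word_pow X m = replicate (nat m) (X, True)" using True by (simp add: word_pow_def)
    ultimately show ?thesis by (simp only: xg_pow)
  next
    case False
    have "[int ((p - 1) * nat (- m)) = (int p - 1) * (- m)] (mod int p)"
      using False p_ge_3 by (simp add: of_nat_diff)
    moreover have "[(int p - 1) * (- m) = m] (mod int p)"
      by (simp add: cong_iff_dvd_diff algebra_simps)
    ultimately have "[(p - 1) * nat (- m) = m0] (mod p)"
      using cong_m0 by (metis cong_int_iff cong_trans)
    then show ?thesis
      using False pow_cong[OF xg_closed xg_pow_p] neg[of "nat (- m)"] by (simp add: word_pow_def)
  qed
  moreover have "yg \<otimes>\<^bsub>G\<^esub> xg = word_class rels (word_pow X m) \<otimes>\<^bsub>G\<^esub> yg"
  proof -
    have "(word_pow Y 1 @ word_pow X 1, word_pow X m @ word_pow Y 1) \<in> rels"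
      by (simp add: metacyclic_rels_def)
    moreover have "word_pow s 1 = [(s, True)]" for s :: gen by (simp add: word_pow_def)
    ultimately show ?thesis unfolding xg_def yg_def G_mult by (metis rel_eq)
  qed
  ultimately show ?thesis by simp
qed

lemma yg_xg_pow: "yg \<otimes>\<^bsub>G\<^esub> xg [^]\<^bsub>G\<^esub> k = xg [^]\<^bsub>G\<^esub> (m0 * k) \<otimes>\<^bsub>G\<^esub> yg" for k :: nat
proof (induction k)
  case (Suc k)
  have "yg \<otimes>\<^bsub>G\<^esub> xg [^]\<^bsub>G\<^esub> Suc k = (yg \<otimes>\<^bsub>G\<^esub> xg [^]\<^bsub>G\<^esub> k) \<otimes>\<^bsub>G\<^esub> xg" by (simp add: G.m_assoc)
  also have "\<dots> = xg [^]\<^bsub>G\<^esub> (m0 * k) \<otimes>\<^bsub>G\<^esub> (yg \<otimes>\<^bsub>G\<^esub> xg)" using Suc by (simp add: G.m_assoc)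
  also have "\<dots> = xg [^]\<^bsub>G\<^esub> (m0 * k + m0) \<otimes>\<^bsub>G\<^esub> yg"
    by (simp add: yg_xg G.m_assoc[symmetric] G.nat_pow_mult)
  finally show ?case by (simp add: add.commute)
qed simp

lemma xg_pow_yg: "xg [^]\<^bsub>G\<^esub> k \<otimes>\<^bsub>G\<^esub> yg = yg \<otimes>\<^bsub>G\<^esub> xg [^]\<^bsub>G\<^esub> (m1 * k)" for k :: nat
proof -
  have "[m0 * (m1 * k) = k] (mod p)"
    using cong_mult[OF m0_m1 cong_refl[of k]] by (simp add: mult.assoc)
  then show ?thesis
    using pow_cong[OF xg_closed xg_pow_p] by (simp add: yg_xg_pow)
qed

lemma xg_pow_yg_pow: "xg [^]\<^bsub>G\<^esub> k \<otimes>\<^bsub>G\<^esub> yg [^]\<^bsub>G\<^esub> j = yg [^]\<^bsub>G\<^esub> j \<otimes>\<^bsub>G\<^esub> xg [^]\<^bsub>G\<^esub> (m1 ^ j * k)" for j k :: nat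
proof (induction j)
  case (Suc j)
  have "xg [^]\<^bsub>G\<^esub> k \<otimes>\<^bsub>G\<^esub> yg [^]\<^bsub>G\<^esub> Suc j = (xg [^]\<^bsub>G\<^esub> k \<otimes>\<^bsub>G\<^esub> yg [^]\<^bsub>G\<^esub> j) \<otimes>\<^bsub>G\<^esub> yg"
    by (simp add: G.m_assoc)
  also have "\<dots> = yg [^]\<^bsub>G\<^esub> j \<otimes>\<^bsub>G\<^esub> (xg [^]\<^bsub>G\<^esub> (m1 ^ j * k) \<otimes>\<^bsub>G\<^esub> yg)" using Suc by (simp add: G.m_assoc)
  also have "\<dots> = yg [^]\<^bsub>G\<^esub> Suc j \<otimes>\<^bsub>G\<^esub> xg [^]\<^bsub>G\<^esub> (m1 ^ Suc j * k)"
    by (simp add: xg_pow_yg G.m_assoc[symmetric] mult.assoc)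
  finally show ?case .
qed simp

section \<open>Normal forms y^j x^i and the order of the group\<close>

definition nf :: "nat \<Rightarrow> nat \<Rightarrow> gen word set"
  where "nf j i = yg [^]\<^bsub>G\<^esub> j \<otimes>\<^bsub>G\<^esub> xg [^]\<^bsub>G\<^esub> i"

lemma nf_closed [simp]: "nf j i \<in> carrier G"
  by (simp add: nf_def)

lemma nf_cong: "[j = j'] (mod (p - 1)) \<Longrightarrow> [i = i'] (mod p) \<Longrightarrow> nf j i = nf j' i'"
  unfolding nf_def
  using pow_cong[OF xg_closed xg_pow_p, of i i'] pow_cong[OF yg_closed yg_pow_p, of j j'] by simp

lemma yg_pow_nf: "yg [^]\<^bsub>G\<^esub> k \<otimes>\<^bsub>G\<^esub> nf j i = nf (k + j) i" for k :: nat
  by (simp add: nf_def G.m_assoc[symmetric] G.nat_pow_mult)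

lemma xg_pow_nf: "xg [^]\<^bsub>G\<^esub> k \<otimes>\<^bsub>G\<^esub> nf j i = nf j (m1 ^ j * k + i)" for k :: nat
proof -
  have "xg [^]\<^bsub>G\<^esub> k \<otimes>\<^bsub>G\<^esub> nf j i = (xg [^]\<^bsub>G\<^esub> k \<otimes>\<^bsub>G\<^esub> yg [^]\<^bsub>G\<^esub> j) \<otimes>\<^bsub>G\<^esub> xg [^]\<^bsub>G\<^esub> i"
    by (simp add: nf_def G.m_assoc)
  then show ?thesis by (simp add: xg_pow_yg_pow nf_def G.m_assoc G.nat_pow_mult)
qed

text \<open>A word is absorbed letter by letter from the left: a power of y merges directly, a power
  of x is first moved past the power of y, and inverses are positive powers.\<close>

lemma nf_ex: "g \<in> carrier G \<Longrightarrow> \<exists>j<p - 1. \<exists>i<p. g = nf j i"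
proof -
  assume "g \<in> carrier G"
  then obtain u where u: "g = word_class rels u" by (auto simp: G_carrier)
  have "\<exists>j i. word_class rels u = nf j i"
  proof (induction u)
    case Nil
    show ?case by (rule exI[of _ 0], rule exI[of _ 0]) (simp add: nf_def G_one[symmetric])
  next
    case (Cons a u)
    then obtain j i where ji: "word_class rels u = nf j i" by blast
    obtain s b where a: "a = (s, b)" by (cases a) blast
    have inv: "word_class rels [(s, False)] = inv\<^bsub>G\<^esub> word_class rels [(s, True)]"
    proof -
      have "word_class rels [(s, False)] \<otimes>\<^bsub>G\<^esub> word_class rels [(s, True)] = \<one>\<^bsub>G\<^esub>"
        using word_eq_cancel[of rels s False] by (simp add: G_mult G_one word_class_eq_iff)
      then show ?thesis by (intro G.inv_equality[symmetric]) (auto simp: G_carrier)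
    qed
    have "word_class rels (a # u) = word_class rels [a] \<otimes>\<^bsub>G\<^esub> nf j i"
      using ji G_mult[of "[a]" u] by simp
    moreover have "\<exists>k::nat. word_class rels [a] = xg [^]\<^bsub>G\<^esub> k \<or> word_class rels [a] = yg [^]\<^bsub>G\<^esub> k"
    proof (cases s)
      case X
      then show ?thesis
        using inv inv_xg a by (cases b) (auto simp: xg_def[symmetric] intro: exI[of _ 1] exI[of _ "p - 1"])
    next
      case Y
      then show ?thesis
        using inv inv_yg a by (cases b) (auto simp: yg_def[symmetric] intro: exI[of _ 1] exI[of _ "p - 2"])
    qed
    ultimately show ?case using xg_pow_nf yg_pow_nf by metis
  qed
  then obtain j i where "g = nf j i" using u by blast
  then have "g = nf (j mod (p - 1)) (i mod p)" by (simp add: nf_cong[of j "j mod (p - 1)" i "i mod p"] cong_def)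
  moreover have "j mod (p - 1) < p - 1" "i mod p < p" using p_ge_3 by auto
  ultimately show ?thesis by blast
qed

lemma gact_xg_pow: "v \<in> ZZ \<Longrightarrow> gact v (xg [^]\<^bsub>G\<^esub> i) = v * \<zeta> ^ i" for i :: nat
  by (simp add: xg_pow gact_class wact_X)

lemma gact_yg_pow: "v \<in> ZZ \<Longrightarrow> gact v (yg [^]\<^bsub>G\<^esub> j) = gal (m1 ^ j) v" for j :: nat
  by (simp add: yg_pow gact_class wact_Y)

lemma gact_nf: "v \<in> ZZ \<Longrightarrow> gact v (nf j i) = gal (m1 ^ j) v * \<zeta> ^ i"
  by (simp add: nf_def gact_mult gact_yg_pow gact_xg_pow gal_ZZ)

text \<open>The presentation alone does not exclude a collapse; the action on \<int>[\<zeta>] does.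
  The image of 1 reveals i, and the image of \<zeta> then reveals j.\<close>

lemma nf_inj:
  assumes "nf j i = nf j' i'" "j < p - 1" "j' < p - 1" "i < p" "i' < p" shows "j = j'" "i = i'"
proof -
  have 1: "gal (m1 ^ j) v * \<zeta> ^ i = gal (m1 ^ j') v * \<zeta> ^ i'" if "v \<in> ZZ" for v
    using gact_nf[OF that, of j i] gact_nf[OF that, of j' i'] assms(1) by simp
  note nd = not_dvd_power[OF not_dvd_m1]
  have zi: "\<zeta> ^ i = \<zeta> ^ i'" using 1[OF ZZ_1] by (simp add: gal_1 nd)
  then show "i = i'" using assms by (simp add: zeta_pow_eq_iff cong_less_modulus_unique_nat)
  have "\<zeta> ^ (m1 ^ j) = \<zeta> ^ (m1 ^ j')" using 1[OF ZZ_zeta] zi zeta_neq_0 by (simp add: gal_zeta nd)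
  then show "j = j'" using m1_power_inj assms by (simp add: zeta_pow_eq_iff)
qed

lemma nf_bij: "bij_betw (\<lambda>(j, i). nf j i) ({..<p - 1} \<times> {..<p}) (carrier G)"
  unfolding bij_betw_def
proof
  show "inj_on (\<lambda>(j, i). nf j i) ({..<p - 1} \<times> {..<p})"
    by (rule inj_onI) (use nf_inj in auto)
  show "(\<lambda>(j, i). nf j i) ` ({..<p - 1} \<times> {..<p}) = carrier G"
    using nf_ex by (force simp: image_iff)
qed

lemma finite_G: "finite (carrier G)"
  using bij_betw_finite[OF nf_bij] by simp

sublocale G: fin_group G
  by unfold_locales (rule finite_G)

lemma sum_G: "(\<Sum>g\<in>carrier G. u g) = (\<Sum>j<p - 1. \<Sum>i<p. u (nf j i))"
  using sum.reindex_bij_betw[OF nf_bij, of u] by (simp add: sum.cartesian_product case_prod_unfold)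

text \<open>
  If \<open>\<Phi>\<close> is a coordinate functional, this writes the multiple \<open>p \<Phi>(w) v\<close> of \<open>v\<close> as the value at \<open>v\<close> of a
  map through \<open>\<Lambda>\<close>.
\<close>

lemma trace_formula:
  fixes \<Phi> :: "complex \<Rightarrow> int"
  assumes \<Phi>: "\<And>u v. u \<in> ZZ \<Longrightarrow> v \<in> ZZ \<Longrightarrow> \<Phi> (u + v) = \<Phi> u + \<Phi> v" and v: "v \<in> ZZ" and w: "w \<in> ZZ"
  shows "(\<Sum>g\<in>carrier G. of_int (\<Phi> (gact v (inv\<^bsub>G\<^esub> g))) * gact w g) = of_nat p * of_int (\<Phi> w) * v"
proof -
  let ?S = "\<lambda>v w. \<Sum>g\<in>carrier G. of_int (\<Phi> (gact v (inv\<^bsub>G\<^esub> g))) * gact w g"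
  have addv: "?S (u + v) w = ?S u w + ?S v w" if "u \<in> ZZ" "v \<in> ZZ" for u v w
    using that by (simp add: gact_add \<Phi> gact_ZZ distrib_right sum.distrib)
  have addw: "?S v (u + w) = ?S v u + ?S v w" if "u \<in> ZZ" "w \<in> ZZ" for u v w
    using that by (simp add: gact_add distrib_left sum.distrib)
  have \<Phi>0: "\<Phi> 0 = 0" using \<Phi>[of 0 0] by (simp add: ZZ_0)
  have basis: "?S (\<zeta> ^ s) (\<zeta> ^ t) = of_nat p * of_int (\<Phi> (\<zeta> ^ t)) * \<zeta> ^ s" for s t
  proof -
    have nd: "\<not> p dvd m1 ^ j" "\<not> p dvd m0 ^ j" for j
      using not_dvd_power not_dvd_m0 not_dvd_m1 by auto
    \<comment> \<open>For fixed j the summation variable i is replaced by the exponent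
      \<open>l = (s - i) m^j\<close> of \<zeta>^s acted on by the inverse of y^j x^i; among natural
      numbers \<open>p - 1\<close> plays the role of -1. Then \<zeta>^t acted on by y^j x^i becomes
      \<open>\<zeta>^s (\<zeta>^(t - l))^(m1^j)\<close>.\<close>
    have inner: "(\<Sum>i<p. of_int (\<Phi> (gact (\<zeta> ^ s) (inv\<^bsub>G\<^esub> nf j i))) * gact (\<zeta> ^ t) (nf j i)) =
        (\<Sum>l<p. of_int (\<Phi> (\<zeta> ^ l)) * (\<zeta> ^ s * (\<zeta> ^ (t + (p - 1) * l)) ^ (m1 ^ j)))" for j
    proof (rule sum.reindex_bij_witness[of _
          "\<lambda>l. (s + (p - 1) * l * m1 ^ j) mod p" "\<lambda>i. ((s + (p - 1) * i) * m0 ^ j) mod p"])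
      have pm1: "[(p - 1) * ((p - 1) * k) = k] (mod p)" for k
      proof -
        have "int (p - 1) = int p - 1" using p_ge_3 by simp
        then have "int ((p - 1) * ((p - 1) * k)) - int k = int p * (int p * int k - 2 * int k)"
          by (simp only: of_nat_mult) (simp add: algebra_simps)
        then show ?thesis by (simp add: cong_int_iff[symmetric] cong_iff_dvd_diff)
      qed
      have pm2: "[s + (p - 1) * (s + (p - 1) * k) = k] (mod p)" for k
      proof -
        have "s + (p - 1) * (s + (p - 1) * k) = p * s + (p - 1) * ((p - 1) * k)"
          using p_ge_3 by (cases p) (simp_all add: algebra_simps)
        then show ?thesis using pm1[of k] by (simp add: cong_def)
      qed
      have lin: "[s + (p - 1) * (k mod p) = s + (p - 1) * k] (mod p)" for k
        by (intro cong_add cong_mult cong_refl) (simp add: cong_def)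
      fix i assume i: "i \<in> {..<p}"
      let ?l = "((s + (p - 1) * i) * m0 ^ j) mod p"
      have lm: "[?l * m1 ^ j = s + (p - 1) * i] (mod p)"
      proof -
        have "[?l * m1 ^ j = (s + (p - 1) * i) * m0 ^ j * m1 ^ j] (mod p)"
          by (rule cong_mult) (simp_all add: cong_def)
        also have "(s + (p - 1) * i) * m0 ^ j * m1 ^ j = (s + (p - 1) * i) * (m0 ^ j * m1 ^ j)"
          by (simp add: mult.assoc)
        also have "[\<dots> = (s + (p - 1) * i) * 1] (mod p)" by (rule cong_mult[OF cong_refl m0_m1_power])
        finally show ?thesis by simp
      qed
      have bck: "[s + (p - 1) * ?l * m1 ^ j = i] (mod p)"
      proof -
        have "[s + (p - 1) * (?l * m1 ^ j) = s + (p - 1) * (s + (p - 1) * i)] (mod p)"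
          by (rule cong_add[OF cong_refl cong_mult[OF cong_refl lm]])
        then show ?thesis using pm2[of i] by (metis cong_trans mult.assoc)
      qed
      then show "(s + (p - 1) * ?l * m1 ^ j) mod p = i"
        using i by (simp add: cong_def)
      show "?l \<in> {..<p}" using p_ge_3 by simp
      have inv: "inv\<^bsub>G\<^esub> nf j i = xg [^]\<^bsub>G\<^esub> ((p - 1) * i) \<otimes>\<^bsub>G\<^esub> yg [^]\<^bsub>G\<^esub> ((p - 2) * j)"
        by (simp add: nf_def G.inv_mult_group G.nat_pow_inv[symmetric] inv_xg inv_yg G.nat_pow_pow)
      have m1p: "[m1 ^ ((p - 2) * j) = m0 ^ j] (mod p)"
      proof -
        have "[m0 ^ j * m1 ^ j * m1 ^ ((p - 2) * j) = 1 * m1 ^ ((p - 2) * j)] (mod p)"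
          by (rule cong_mult[OF m0_m1_power cong_refl])
        moreover have "m0 ^ j * m1 ^ j * m1 ^ ((p - 2) * j) = m0 ^ j * (m1 ^ (p - 1)) ^ j"
        proof -
          have "j + (p - 2) * j = (p - 1) * j" using p_ge_3 by (metis Suc_1 Suc_diff_Suc mult_Suc Suc_le_lessD numeral_3_eq_3 less_Suc_eq_le One_nat_def plus_1_eq_Suc diff_Suc_1 le_SucI)
          then show ?thesis by (simp add: power_add[symmetric] power_mult[symmetric] mult.assoc)
        qed
        moreover have "[m0 ^ j * (m1 ^ (p - 1)) ^ j = m0 ^ j * 1 ^ j] (mod p)"
          by (intro cong_mult cong_refl cong_pow fermat_theorem[OF prime_p not_dvd_m1])
        ultimately show ?thesis by (metis cong_sym cong_trans mult.right_neutral mult_1 power_one)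
      qed
      have "gact (\<zeta> ^ s) (inv\<^bsub>G\<^esub> nf j i) = gal (m0 ^ j) (\<zeta> ^ s * \<zeta> ^ ((p - 1) * i))"
        unfolding inv using gal_cong[OF m1p]
        by (simp add: gact_mult gact_xg_pow gact_yg_pow ZZ_power ZZ_zeta ZZ_mult)
      also have "\<dots> = \<zeta> ^ ?l"
        by (simp add: power_add[symmetric] gal_zeta_pow nd zeta_pow_mod)
      finally have 1: "gact (\<zeta> ^ s) (inv\<^bsub>G\<^esub> nf j i) = \<zeta> ^ ?l" .
      have "gact (\<zeta> ^ t) (nf j i) = \<zeta> ^ (t * m1 ^ j + i)"
        by (simp add: gact_nf ZZ_power ZZ_zeta gal_zeta_pow nd power_add)
      also have "\<dots> = \<zeta> ^ (t * m1 ^ j + (s + (p - 1) * ?l * m1 ^ j))"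
        by (intro zeta_pow_cong cong_add cong_refl cong_sym[OF bck])
      also have "\<dots> = \<zeta> ^ s * (\<zeta> ^ (t + (p - 1) * ?l)) ^ (m1 ^ j)"
        by (simp add: power_add[symmetric] power_mult[symmetric] algebra_simps)
      finally show "of_int (\<Phi> (\<zeta> ^ ?l)) * (\<zeta> ^ s * (\<zeta> ^ (t + (p - 1) * ?l)) ^ (m1 ^ j)) =
          of_int (\<Phi> (gact (\<zeta> ^ s) (inv\<^bsub>G\<^esub> nf j i))) * gact (\<zeta> ^ t) (nf j i)"
        using 1 by simp
    next
      fix l assume l: "l \<in> {..<p}"
      let ?i = "(s + (p - 1) * l * m1 ^ j) mod p"
      show "?i \<in> {..<p}" using p_ge_3 by simp
      have "[(s + (p - 1) * ?i) * m0 ^ j = l] (mod p)"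
      proof -
        have a: "[s + (p - 1) * ?i = l * m1 ^ j] (mod p)"
        proof -
          have "[s + (p - 1) * ?i = s + (p - 1) * (s + (p - 1) * (l * m1 ^ j))] (mod p)"
            by (intro cong_add cong_mult cong_refl) (simp add: cong_def mult.assoc)
          moreover have "[s + (p - 1) * (s + (p - 1) * (l * m1 ^ j)) = l * m1 ^ j] (mod p)"
          proof -
            have "s + (p - 1) * (s + (p - 1) * (l * m1 ^ j)) = p * s + (p - 1) * ((p - 1) * (l * m1 ^ j))"
              using p_ge_3 by (cases p) (simp_all add: algebra_simps)
            moreover have "[(p - 1) * ((p - 1) * k) = k] (mod p)" for k
            proof -
              have "int (p - 1) = int p - 1" using p_ge_3 by simp
              then have "int ((p - 1) * ((p - 1) * k)) - int k = int p * (int p * int k - 2 * int k)"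
                by (simp only: of_nat_mult) (simp add: algebra_simps)
              then show ?thesis by (simp add: cong_int_iff[symmetric] cong_iff_dvd_diff)
            qed
            ultimately show ?thesis by (simp add: cong_def)
          qed
          ultimately show ?thesis by (rule cong_trans)
        qed
        have "[(s + (p - 1) * ?i) * m0 ^ j = l * m1 ^ j * m0 ^ j] (mod p)"
          by (rule cong_mult[OF a cong_refl])
        moreover have "[l * m1 ^ j * m0 ^ j = l * 1] (mod p)"
          using cong_mult[OF cong_refl m0_m1_power, of l j] by (simp add: mult_ac)
        ultimately show ?thesis by (metis cong_trans mult.right_neutral)
      qed
      then show "((s + (p - 1) * ?i) * m0 ^ j) mod p = l" using l by (simp add: cong_def)
    qed
    \<comment> \<open>The sum over j is now the trace of \<open>\<zeta>^(t - l)\<close>, which is p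
      - 1 if l is t modulo p and -1 otherwise.\<close>
    have "?S (\<zeta> ^ s) (\<zeta> ^ t) = (\<Sum>l<p. of_int (\<Phi> (\<zeta> ^ l)) * (\<zeta> ^ s * (\<Sum>j<p - 1. (\<zeta> ^ (t + (p - 1) * l)) ^ (m1 ^ j))))"
      unfolding sum_G inner by (subst sum.swap) (simp add: sum_distrib_left)
    also have "\<dots> = (\<Sum>l<p. of_int (\<Phi> (\<zeta> ^ l)) * (\<zeta> ^ s * ((if l = t mod p then of_nat p else 0) - 1)))"
    proof (intro sum.cong refl)
      fix l assume l: "l \<in> {..<p}"
      have "\<zeta> ^ (t + (p - 1) * l) * \<zeta> ^ l = \<zeta> ^ t"
      proof -
        have "t + (p - 1) * l + l = t + p * l" using p_ge_3 by (cases p) simp_all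
        then have "\<zeta> ^ (t + (p - 1) * l) * \<zeta> ^ l = \<zeta> ^ (t + p * l)" by (simp only: power_add[symmetric])
        then show ?thesis by (simp add: power_add power_mult zeta_pow_p)
      qed
      then have "\<zeta> ^ (t + (p - 1) * l) = 1 \<longleftrightarrow> \<zeta> ^ l = \<zeta> ^ t" using zeta_neq_0
        by (metis mult_cancel_right1 mult_cancel_right2 power_not_zero mult_1)
      also have "\<dots> \<longleftrightarrow> l = t mod p" using l by (auto simp: zeta_pow_eq_iff cong_def)
      finally have "\<zeta> ^ (t + (p - 1) * l) = 1 \<longleftrightarrow> l = t mod p" .
      moreover have "(\<zeta> ^ (t + (p - 1) * l)) ^ p = 1" by (simp add: power_mult[symmetric] zeta_pow_eq_1_iff)
      ultimately show "of_int (\<Phi> (\<zeta> ^ l)) * (\<zeta> ^ s * (\<Sum>j<p - 1. (\<zeta> ^ (t + (p - 1) * l)) ^ (m1 ^ j))) =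
          of_int (\<Phi> (\<zeta> ^ l)) * (\<zeta> ^ s * ((if l = t mod p then of_nat p else 0) - 1))"
        using galois_sum[of "\<zeta> ^ (t + (p - 1) * l)"] by simp
    qed
    also have "\<dots> = \<zeta> ^ s * ((\<Sum>l<p. if l = t mod p then of_nat p * of_int (\<Phi> (\<zeta> ^ l)) else 0) -
        of_int (\<Sum>l<p. \<Phi> (\<zeta> ^ l)))"
      unfolding of_int_sum sum_subtractf[symmetric] sum_distrib_left
      by (intro sum.cong refl) (simp add: algebra_simps)
    \<comment> \<open>The contribution of the constant -1 disappears because the powers of \<zeta>
      sum to 0.\<close>
    also have "(\<Sum>l<p. \<Phi> (\<zeta> ^ l)) = \<Phi> (\<Sum>l<p. \<zeta> ^ l)"
    proof -
      have "\<Phi> (\<Sum>l\<in>A. \<zeta> ^ l) = (\<Sum>l\<in>A. \<Phi> (\<zeta> ^ l))" if "finite A" for A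
        using that by (induction A) (auto simp: \<Phi>0 \<Phi> ZZ_power ZZ_zeta ZZ_sum)
      then show ?thesis by simp
    qed
    also have "(\<Sum>l<p. \<zeta> ^ l) = 0" using root_sum[OF zeta_pow_p] zeta_neq_1 by simp
    finally show ?thesis using p_ge_3 by (simp add: \<Phi>0 zeta_pow_mod mult_ac)
  qed
  have "?S (\<zeta> ^ s) w = of_nat p * of_int (\<Phi> w) * \<zeta> ^ s" for s
    by (rule additive_ZZ_eq[OF addw _ basis w]) (simp_all add: \<Phi> algebra_simps)
  then show ?thesis
    by (intro additive_ZZ_eq[OF addv _ _ v]) (simp_all add: algebra_simps)
qed

section \<open>The modules \<open>R(i)\<close>\<close>

abbreviation ZG where "ZG \<equiv> group_ring G"

lemma Lam_eq: "Lam p m = group_ring G"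
  by (simp add: Lam_def)

lemma gact_nf_ex:
  assumes "g \<in> carrier G" obtains j i where "j < p - 1" "i < p" "g = nf j i"
  using nf_ex[OF assms] by blast

lemma gact_of_int_mult: "v \<in> ZZ \<Longrightarrow> g \<in> carrier G \<Longrightarrow> gact (of_int a * v) g = of_int a * gact v g"
  by (elim gact_nf_ex)
    (simp add: gact_nf ZZ_mult ZZ_of_int gal_of_int_mult not_dvd_power[OF not_dvd_m1] mult.assoc)

lemma Lam_act_sum:
  "a \<in> carrier ZG \<Longrightarrow> Lam_act p m v a = (\<Sum>g\<in>carrier G. of_int (a g) * gact v g)"
  unfolding Lam_act_def
  by (rule sum.mono_neutral_left) (use finite_G in \<open>auto simp: G.ZG_carrier\<close>)

lemma Lam_act_add: "v \<in> ZZ \<Longrightarrow> w \<in> ZZ \<Longrightarrow> a \<in> carrier ZG \<Longrightarrow>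
    Lam_act p m (v + w) a = Lam_act p m v a + Lam_act p m w a"
  by (simp add: Lam_act_sum gact_add distrib_left sum.distrib)

lemma Lam_act_of_int_mult: "v \<in> ZZ \<Longrightarrow> a \<in> carrier ZG \<Longrightarrow>
    Lam_act p m (of_int k * v) a = of_int k * Lam_act p m v a"
  by (simp add: Lam_act_sum gact_of_int_mult sum_distrib_left mult.left_commute)

lemma Lam_act_setsum:
  "(\<And>k. k \<in> A \<Longrightarrow> f k \<in> ZZ) \<Longrightarrow> a \<in> carrier ZG \<Longrightarrow>
    Lam_act p m (\<Sum>k\<in>A. f k) a = (\<Sum>k\<in>A. Lam_act p m (f k) a)"
proof (induction A rule: infinite_finite_induct)
  case (insert x A)
  then show ?case by (simp add: Lam_act_add ZZ_sum)
qed (use Lam_act_of_int_mult[OF ZZ_0, of a 0] in auto)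

lemma Lam_act_add_right: "a \<in> carrier ZG \<Longrightarrow> b \<in> carrier ZG \<Longrightarrow>
    Lam_act p m v (\<lambda>g. a g + b g) = Lam_act p m v a + Lam_act p m v b"
  by (subst Lam_act_sum) (auto simp: Lam_act_sum G.ZG_carrier distrib_right sum.distrib)

lemma Lam_act_delta: "g \<in> carrier G \<Longrightarrow> Lam_act p m v (G.\<delta> g) = gact v g"
proof -
  assume g: "g \<in> carrier G"
  have d: "G.\<delta> g \<in> carrier ZG" using G.\<delta>_closed[OF g] by simp
  have "Lam_act p m v (G.\<delta> g) = (\<Sum>h\<in>carrier G. if h = g then gact v h else 0)"
    unfolding Lam_act_sum[OF d] using g by (auto simp: group_ring_elem_def intro!: sum.cong)
  then show ?thesis using g finite_G by simp
qed

lemma Lam_act_mult: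
  assumes v: "v \<in> ZZ" and a: "a \<in> carrier ZG" and b: "b \<in> carrier ZG"
  shows "Lam_act p m v (a \<otimes>\<^bsub>ZG\<^esub> b) = Lam_act p m (Lam_act p m v a) b"
proof -
  have add: "Lam_act p m v ((\<lambda>g. c g + d g) \<otimes>\<^bsub>ZG\<^esub> b) = Lam_act p m v (c \<otimes>\<^bsub>ZG\<^esub> b) + Lam_act p m v (d \<otimes>\<^bsub>ZG\<^esub> b)"
    if "c \<in> carrier ZG" "d \<in> carrier ZG" for c d
    using G.ZG.l_distr[of c d b] that b Lam_act_add_right[of "c \<otimes>\<^bsub>ZG\<^esub> b" "d \<otimes>\<^bsub>ZG\<^esub> b" v]
    by simp
  have "Lam_act p m v (a \<otimes>\<^bsub>ZG\<^esub> b) = (\<Sum>g\<in>carrier G. of_int (a g) * Lam_act p m v (G.\<delta> g \<otimes>\<^bsub>ZG\<^esub> b))"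
    by (rule G.additive_ZG[of "\<lambda>a. Lam_act p m v (a \<otimes>\<^bsub>ZG\<^esub> b)", OF add a])
  also have "\<dots> = (\<Sum>g\<in>carrier G. of_int (a g) * Lam_act p m (gact v g) b)"
  proof (intro sum.cong refl arg_cong2[of _ _ _ _ "(*)"])
    fix g assume g: "g \<in> carrier G"
    have "Lam_act p m v (G.\<delta> g \<otimes>\<^bsub>ZG\<^esub> b) = (\<Sum>h\<in>carrier G. of_int (b (inv\<^bsub>G\<^esub> g \<otimes>\<^bsub>G\<^esub> h)) * gact v h)"
      using g b G.ZG.m_closed[of "G.\<delta> g" b] by (subst Lam_act_sum) (auto simp: G.\<delta>_mult intro!: sum.cong)
    also have "\<dots> = (\<Sum>k\<in>carrier G. of_int (b (inv\<^bsub>G\<^esub> g \<otimes>\<^bsub>G\<^esub> (g \<otimes>\<^bsub>G\<^esub> k))) * gact v (g \<otimes>\<^bsub>G\<^esub> k))"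
      by (rule G.sum_left_translate[OF g, symmetric])
    also have "\<dots> = Lam_act p m (gact v g) b"
      using b g v by (auto simp: Lam_act_sum gact_mult G.m_assoc[symmetric] intro!: sum.cong)
    finally show "Lam_act p m v (G.\<delta> g \<otimes>\<^bsub>ZG\<^esub> b) = Lam_act p m (gact v g) b" .
  qed
  also have "\<dots> = Lam_act p m (Lam_act p m v a) b"
    unfolding Lam_act_sum[OF a] using v b
    by (simp add: Lam_act_setsum Lam_act_of_int_mult ZZ_mult ZZ_of_int gact_ZZ)
  finally show ?thesis .
qed

text \<open>x is sent to 1 and y to t. For \<open>t = m1 ^ j\<close> the reduction modulo p is a
  character of the group, the one by which it acts on \<pi>^j modulo \<pi>^(j+1).\<close>

definition psi :: "nat \<Rightarrow> (gen word set \<Rightarrow> int) \<Rightarrow> int"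
  where "psi t a = (\<Sum>j<p - 1. \<Sum>i<p. a (nf j i) * int t ^ j)"

text \<open>The cofactor 1 + \<zeta> + ... + \<zeta>^(k-1) has residue k modulo \<pi>; this is where
  the characters y \<mapsto> \<open>m1 ^ j\<close> come from.\<close>

lemma gal_pi: "\<not> p dvd k \<Longrightarrow> gal k \<pi> = \<pi> * ip (\<Sum>i<k. monom 1 i) \<zeta>"
  using gal_add[of k \<zeta> "of_int (-1)"] power_diff_1_eq[of \<zeta> k]
  by (simp add: ZZ_zeta ZZ_of_int gal_zeta gal_of_int ip_sum ip_monom del: of_int_minus)
    (simp add: gal_of_int[of k "-1", simplified] mult.commute)

text \<open>Here \<open>poly q 1\<close> is the residue of \<open>ip q \<zeta>\<close> modulo \<open>\<pi>\<close>.\<close>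

lemma Lam_act_pi_power:
  assumes a: "a \<in> carrier ZG"
  obtains q where "Lam_act p m (\<pi> ^ j) a = \<pi> ^ j * ip q \<zeta>" "poly q 1 = psi (m1 ^ j) a"
proof
  let ?Q = "\<lambda>k i. (\<Sum>t<m1 ^ k. monom 1 t) ^ j * monom 1 i :: int poly"
  let ?q = "\<Sum>k<p - 1. \<Sum>i<p. smult (a (nf k i)) (?Q k i)"
  have pow: "ip (r ^ n) z = ip r z ^ n" for r n z by (induction n) (simp_all add: ip_mult)
  have g: "gact (\<pi> ^ j) (nf k i) = \<pi> ^ j * ip (?Q k i) \<zeta>" for k i
    by (simp add: gact_nf ZZ_power ZZ_pi gal_power not_dvd_power[OF not_dvd_m1] gal_pi power_mult_distrib
        ip_mult pow ip_monom mult.assoc)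
  show "Lam_act p m (\<pi> ^ j) a = \<pi> ^ j * ip ?q \<zeta>"
    unfolding Lam_act_sum[OF a] sum_G g ip_sum ip_smult sum_distrib_left by (simp only: mult.left_commute)
  show "poly ?q 1 = psi (m1 ^ j) a"
    by (simp add: psi_def poly_sum poly_monom mult.commute power_mult[symmetric])
qed

text \<open>The image of \<pi>^j stays in the ideal generated by \<pi>, so it has coordinates by
  \<open>ev_ex\<close>, and they are unique by \<open>ev_inj\<close>. Hence the definite description
  of the matrix has a value.\<close>

lemma lam_mat_props:
  assumes a: "a \<in> carrier ZG"
  shows lam_mat_outside: "j \<notin> {1..p - 1} \<or> k \<notin> {1..p - 1} \<Longrightarrow> lam_mat p m a j k = 0"
    and ev_lam_mat: "j \<in> {1..p - 1} \<Longrightarrow> ev (lam_mat p m a j) = Lam_act p m (\<pi> ^ j) a"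
proof -
  let ?P = "\<lambda>L. (\<forall>j k. j \<notin> {1..p - 1} \<or> k \<notin> {1..p - 1} \<longrightarrow> L j k = 0) \<and>
    (\<forall>j\<in>{1..p - 1}. Lam_act p m (\<pi> ^ j) a = (\<Sum>k\<in>{1..p - 1}. of_int (L j k) * \<pi> ^ k))"
  have "\<exists>r\<in>rows. ev r = Lam_act p m (\<pi> ^ j) a" if j: "j \<in> {1..p - 1}" for j
  proof -
    obtain q where q: "Lam_act p m (\<pi> ^ j) a = \<pi> ^ j * ip q \<zeta>" using Lam_act_pi_power[OF a] by blast
    have "\<pi> ^ j = \<pi> * \<pi> ^ (j - 1)" using j by (cases j) auto
    then show ?thesis using ev_ex[of "\<pi> ^ (j - 1) * ip q \<zeta>"] q ZZ_power ZZ_pi ZZ_mult by (simp add: mult.assoc)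
  qed
  then obtain R where R: "\<And>j. j \<in> {1..p - 1} \<Longrightarrow> R j \<in> rows" "\<And>j. j \<in> {1..p - 1} \<Longrightarrow> ev (R j) = Lam_act p m (\<pi> ^ j) a"
    by metis
  let ?L = "\<lambda>j. if j \<in> {1..p - 1} then R j else (\<lambda>k. 0)"
  have PL: "?P ?L" using R by (auto simp: rows_def ev_def)
  have "?P (lam_mat p m a)"
    unfolding lam_mat_def
  proof (rule theI[of ?P, OF PL])
    fix L assume L: "?P L"
    show "L = ?L"
    proof (intro ext)
      fix j k show "L j k = ?L j k"
      proof (cases "j \<in> {1..p - 1} \<and> k \<in> {1..p - 1}")
        case True
        then have "ev (L j) = ev (R j)" using L R(2) by (simp add: ev_def)
        then show ?thesis using True ev_inj by simp
      qed (use L PL in auto)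
    qed
  qed
  then show "j \<notin> {1..p - 1} \<or> k \<notin> {1..p - 1} \<Longrightarrow> lam_mat p m a j k = 0"
    and "j \<in> {1..p - 1} \<Longrightarrow> ev (lam_mat p m a j) = Lam_act p m (\<pi> ^ j) a"
    by (auto simp: ev_def)
qed

text \<open>The action preserves the filtration by powers of \<pi>, which forces triangularity
  modulo p; the diagonal records the action on its layers.\<close>

lemma lam_mat_triangular:
  assumes "a \<in> carrier ZG" "j \<in> {1..p - 1}"
  shows "k < j \<Longrightarrow> int p dvd lam_mat p m a j k" and "[lam_mat p m a j j = psi (m1 ^ j) a] (mod int p)"
proof -
  obtain q where q: "Lam_act p m (\<pi> ^ j) a = \<pi> ^ j * ip q \<zeta>" "poly q 1 = psi (m1 ^ j) a"
    by (rule Lam_act_pi_power[OF assms(1), of j]) blast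
  have eq: "ev (lam_mat p m a j) = \<pi> ^ j * ip q \<zeta>" using ev_lam_mat[OF assms] q(1) by simp
  show "[lam_mat p m a j j = psi (m1 ^ j) a] (mod int p)"
    using ev_coords_mod(2)[OF eq assms(2)] q(2) by simp
  show "int p dvd lam_mat p m a j k" if "k < j"
    using ev_coords_mod(1)[OF eq assms(2), of k] that lam_mat_outside[OF assms(1), of j k]
    by (cases "k = 0") auto
qed

definition ract :: "(nat \<Rightarrow> int) \<Rightarrow> (gen word set \<Rightarrow> int) \<Rightarrow> nat \<Rightarrow> int"
  where "ract r a = (\<lambda>k. \<Sum>j\<in>{1..p - 1}. r j * lam_mat p m a j k)"

lemma ract_rows: "a \<in> carrier ZG \<Longrightarrow> ract r a \<in> rows"
  by (simp add: ract_def rows_def lam_mat_outside)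

lemma ev_ract: "a \<in> carrier ZG \<Longrightarrow> ev (ract r a) = Lam_act p m (ev r) a"
proof -
  assume a: "a \<in> carrier ZG"
  have "ev (ract r a) = (\<Sum>j\<in>{1..p - 1}. of_int (r j) * ev (lam_mat p m a j))"
    unfolding ev_def ract_def of_int_sum sum_distrib_right sum_distrib_left
    by (subst sum.swap) (simp add: mult.assoc)
  also have "\<dots> = (\<Sum>j\<in>{1..p - 1}. of_int (r j) * Lam_act p m (\<pi> ^ j) a)"
    by (simp add: ev_lam_mat[OF a])
  also have "\<dots> = Lam_act p m (ev r) a"
    unfolding ev_def using a
    by (simp add: Lam_act_setsum Lam_act_of_int_mult ZZ_mult ZZ_of_int ZZ_power ZZ_pi)
  finally show ?thesis .
qed

lemma R_row_simps [simp]: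
  "\<zero>\<^bsub>R_row p m i\<^esub> = (\<lambda>k. 0)" "r \<oplus>\<^bsub>R_row p m i\<^esub> s = (\<lambda>k. r k + s k)"
  "r \<triangleleft>\<^bsub>R_row p m i\<^esub> a = ract r a"
  by (simp_all add: R_row_def ract_def)

lemma R_row_carrier: "r \<in> carrier (R_row p m i) \<longleftrightarrow> r \<in> rows \<and> (\<forall>j<i. int p dvd r j)"
  by (auto simp: R_row_def rows_def)

lemma right_module_R_row: "right_module ZG (R_row p m i)"
proof (rule right_moduleI)
  show "ring ZG" by (rule G.ring_ZG)
  fix r assume r: "r \<in> carrier (R_row p m i)"
  then have rr: "r \<in> rows" by (simp add: R_row_carrier)
  show "\<exists>w\<in>carrier (R_row p m i). w \<oplus>\<^bsub>R_row p m i\<^esub> r = \<zero>\<^bsub>R_row p m i\<^esub>"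
    using r by (intro bexI[of _ "\<lambda>k. - r k"]) (auto simp: R_row_carrier rows_def)
  show "r \<triangleleft>\<^bsub>R_row p m i\<^esub> \<one>\<^bsub>ZG\<^esub> = r"
    by (rule ev_inj_rows) (simp_all add: ract_rows rr ev_ract Lam_act_delta gact_one ev_ZZ)
  fix a assume a: "a \<in> carrier ZG"
  have "int p dvd ract r a k" if "k < i" for k
    unfolding ract_def
  proof (rule dvd_sum)
    fix j assume "j \<in> {1..p - 1}"
    then show "int p dvd r j * lam_mat p m a j k"
      using r that lam_mat_triangular(1)[OF a, of j k] by (cases "j < i") (auto simp: R_row_carrier)
  qed
  then show "r \<triangleleft>\<^bsub>R_row p m i\<^esub> a \<in> carrier (R_row p m i)"
    using a by (simp add: R_row_carrier ract_rows)
  fix b assume b: "b \<in> carrier ZG"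
  show "r \<triangleleft>\<^bsub>R_row p m i\<^esub> (a \<otimes>\<^bsub>ZG\<^esub> b) = r \<triangleleft>\<^bsub>R_row p m i\<^esub> a \<triangleleft>\<^bsub>R_row p m i\<^esub> b"
    by (rule ev_inj_rows) (simp_all add: ract_rows ev_ract Lam_act_mult ev_ZZ a b)
  have ab: "(\<lambda>g. a g + b g) \<in> carrier ZG" using a b by (simp add: G.ZG_carrier)
  have "ract r (\<lambda>g. a g + b g) = (\<lambda>k. ract r a k + ract r b k)"
  proof (rule ev_inj_rows)
    show "(\<lambda>k. ract r a k + ract r b k) \<in> rows"
      using ract_rows[OF a, of r] ract_rows[OF b, of r] by (simp add: rows_def)
  qed (simp_all add: ract_rows ab ev_ract ev_add Lam_act_add_right a b)
  then show "r \<triangleleft>\<^bsub>R_row p m i\<^esub> (a \<oplus>\<^bsub>ZG\<^esub> b) = r \<triangleleft>\<^bsub>R_row p m i\<^esub> a \<oplus>\<^bsub>R_row p m i\<^esub> r \<triangleleft>\<^bsub>R_row p m i\<^esub> b"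
    by simp
qed (auto simp: R_row_carrier rows_def ract_def distrib_right sum.distrib)

abbreviation unit_row :: "nat \<Rightarrow> nat \<Rightarrow> int" where "unit_row j \<equiv> (\<lambda>k. if k = j then 1 else 0)"

lemma unit_row_rows: "j \<in> {1..p - 1} \<Longrightarrow> unit_row j \<in> rows"
  by (auto simp: rows_def)

lemma two_le: "2 \<in> {1..p - 1}" "1 \<in> {1..p - 1}"
  using p_ge_3 by auto

lemma unit_row_R: "unit_row 2 \<in> carrier (R_row p m 2)" "unit_row 1 \<in> carrier (R_row p m 1)"
  using unit_row_rows two_le by (auto simp: R_row_carrier)

definition xpoly :: "int poly \<Rightarrow> gen word set \<Rightarrow> int"
  where "xpoly q = (\<lambda>g. \<Sum>s\<le>degree q. coeff q s * G.\<delta> (xg [^]\<^bsub>G\<^esub> s) g)"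

lemma xpoly_closed: "xpoly q \<in> carrier ZG"
  unfolding G.ZG_carrier xpoly_def
  by (auto simp: group_ring_elem_def intro!: sum.neutral)

lemma Lam_act_xpoly:
  assumes v: "v \<in> ZZ" shows "Lam_act p m v (xpoly q) = v * ip q \<zeta>"
proof -
  have "Lam_act p m v (xpoly q) = (\<Sum>g\<in>carrier G. of_int (xpoly q g) * gact v g)"
    by (rule Lam_act_sum[OF xpoly_closed])
  also have "\<dots> = (\<Sum>s\<le>degree q. of_int (coeff q s) * (\<Sum>g\<in>carrier G. of_int (G.\<delta> (xg [^]\<^bsub>G\<^esub> s) g) * gact v g))"
    unfolding xpoly_def of_int_sum sum_distrib_right sum_distrib_left
    by (subst sum.swap) (simp add: mult.assoc)
  also have "\<dots> = (\<Sum>s\<le>degree q. of_int (coeff q s) * (v * \<zeta> ^ s))"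
  proof (intro sum.cong refl arg_cong2[of _ _ _ _ "(*)"])
    fix s
    show "(\<Sum>g\<in>carrier G. of_int (G.\<delta> (xg [^]\<^bsub>G\<^esub> s) g) * gact v g) = v * \<zeta> ^ s"
      using Lam_act_delta[of "xg [^]\<^bsub>G\<^esub> s" v] Lam_act_sum[of "G.\<delta> (xg [^]\<^bsub>G\<^esub> s)" v] v
      by (simp add: gact_xg_pow)
  qed
  finally show ?thesis by (simp add: ip_altdef sum_distrib_left mult.left_commute)
qed

text \<open>The first entry is a multiple of p = \<pi>^2 u and so, like the others, contributes a
  multiple of \<pi>^2. Hence \<pi>^2 generates, and polynomials in x alone suffice as
  coefficients.\<close>

lemma R2_generated:
  assumes r: "r \<in> carrier (R_row p m 2)"
  obtains q where "r = ract (unit_row 2) (xpoly q)"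
proof -
  obtain u where u: "u \<in> ZZ" "of_nat p = \<pi>\<^sup>2 * u" by (rule p_eq_pi_mult) blast
  have "int p dvd r 1" using r by (simp add: R_row_carrier)
  then obtain t where t: "r 1 = int p * t" by (elim dvdE) blast
  have split: "{1..p - 1} = insert 1 {2..p - 1}" using p_ge_3 by auto
  have "ev r = of_int (r 1) * \<pi> + (\<Sum>k\<in>{2..p - 1}. of_int (r k) * \<pi> ^ k)"
    unfolding ev_def split by simp
  also have "\<dots> = \<pi>\<^sup>2 * (u * of_int t * \<pi> + (\<Sum>k\<in>{2..p - 1}. of_int (r k) * \<pi> ^ (k - 2)))"
  proof -
    have pk: "\<pi> ^ k = \<pi>\<^sup>2 * \<pi> ^ (k - 2)" if "k \<in> {2..p - 1}" for k
      using that by (metis power_add le_add_diff_inverse atLeastAtMost_iff)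
    have "(\<Sum>k\<in>{2..p - 1}. of_int (r k) * \<pi> ^ k) = \<pi>\<^sup>2 * (\<Sum>k\<in>{2..p - 1}. of_int (r k) * \<pi> ^ (k - 2))"
      unfolding sum_distrib_left by (intro sum.cong refl) (metis pk mult.left_commute)
    then show ?thesis using u(2) t by (simp add: algebra_simps)
  qed
  finally have e: "ev r = \<pi>\<^sup>2 * (u * of_int t * \<pi> + (\<Sum>k\<in>{2..p - 1}. of_int (r k) * \<pi> ^ (k - 2)))" .
  have "u * of_int t * \<pi> + (\<Sum>k\<in>{2..p - 1}. of_int (r k) * \<pi> ^ (k - 2)) \<in> ZZ"
    by (intro ZZ_add ZZ_mult ZZ_sum ZZ_power ZZ_of_int ZZ_pi u)
  then obtain q where q: "ev r = \<pi>\<^sup>2 * ip q \<zeta>" using e by (auto simp: ZZ_iff)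
  have "r = ract (unit_row 2) (xpoly q)"
    by (rule ev_inj_rows)
      (use r q two_le in \<open>simp_all add: R_row_carrier ract_rows xpoly_closed ev_ract ev_unit Lam_act_xpoly ZZ_power ZZ_pi\<close>)
  then show thesis by (rule that)
qed

subsection \<open>Null maps between the row modules\<close>

definition evinv :: "complex \<Rightarrow> nat \<Rightarrow> int"
  where "evinv z = (SOME r. r \<in> rows \<and> ev r = z)"

lemma evinv_ev: "r \<in> rows \<Longrightarrow> evinv (ev r) = r"
  unfolding evinv_def by (rule some_equality) (auto intro: ev_inj_rows)

lemma evinv_mult:
  assumes "z \<in> ZZ" shows "evinv (\<pi> * z) \<in> rows" "ev (evinv (\<pi> * z)) = \<pi> * z"
proof -
  obtain r where "r \<in> rows" "ev r = \<pi> * z" using ev_ex[OF assms] by blast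
  then show "evinv (\<pi> * z) \<in> rows" "ev (evinv (\<pi> * z)) = \<pi> * z"
    using evinv_ev[of r] by auto
qed

lemma row_trace:
  assumes r: "r \<in> rows" and k: "k \<in> {1..p - 1}"
  shows "(\<Sum>g\<in>carrier G. of_int (ract r (G.\<delta> (inv\<^bsub>G\<^esub> g)) k) * gact (\<pi> ^ k) g) = of_nat p * ev r"
proof -
  obtain u where u: "u \<in> ZZ" "of_nat p = \<pi>\<^sup>2 * u" by (rule p_eq_pi_mult) blast
  \<comment> \<open>The trace formula wants a functional on all of \<int>[\<zeta>], but coordinates
    exist only for multiples of \<pi>. So \<Phi> is the k-th coordinate of p z, and the extra factor
    p is cancelled at the end.\<close>
  define \<Phi> where "\<Phi> z = evinv (\<pi> * (\<pi> * u * z)) k" for z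
  have pz: "of_nat p * z = \<pi> * (\<pi> * u * z)" for z
    unfolding u(2) by (simp add: power2_eq_square mult.assoc)
  have cl: "\<pi> * u * z \<in> ZZ" if "z \<in> ZZ" for z using that u by (intro ZZ_mult ZZ_pi)
  have add: "\<Phi> (z + w) = \<Phi> z + \<Phi> w" if z: "z \<in> ZZ" and w: "w \<in> ZZ" for z w
  proof -
    have "evinv (\<pi> * (\<pi> * u * (z + w))) = (\<lambda>k. evinv (\<pi> * (\<pi> * u * z)) k + evinv (\<pi> * (\<pi> * u * w)) k)"
    proof (rule ev_inj_rows)
      show "ev (evinv (\<pi> * (\<pi> * u * (z + w)))) =
          ev (\<lambda>k. evinv (\<pi> * (\<pi> * u * z)) k + evinv (\<pi> * (\<pi> * u * w)) k)"
        unfolding ev_add evinv_mult(2)[OF cl[OF z]] evinv_mult(2)[OF cl[OF w]]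
          evinv_mult(2)[OF cl[OF ZZ_add[OF z w]]] by (simp only: distrib_left)
    qed (use evinv_mult(1)[OF cl[OF z]] evinv_mult(1)[OF cl[OF w]]
        evinv_mult(1)[OF cl[OF ZZ_add[OF z w]]] in \<open>auto simp: rows_def\<close>)
    then show ?thesis by (simp add: \<Phi>_def)
  qed
  have \<Phi>: "\<Phi> (ev s) = int p * s k" if s: "s \<in> rows" for s
  proof -
    have "\<pi> * (\<pi> * u * ev s) = ev (\<lambda>k. int p * s k)" by (simp add: ev_scale pz[symmetric])
    moreover have "(\<lambda>k. int p * s k) \<in> rows" using s by (simp add: rows_def)
    ultimately show ?thesis by (simp add: \<Phi>_def evinv_ev)
  qed
  have "of_nat p * (\<Sum>g\<in>carrier G. of_int (ract r (G.\<delta> (inv\<^bsub>G\<^esub> g)) k) * gact (\<pi> ^ k) g) =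
      (\<Sum>g\<in>carrier G. of_int (\<Phi> (gact (ev r) (inv\<^bsub>G\<^esub> g))) * gact (\<pi> ^ k) g)"
    unfolding sum_distrib_left
  proof (intro sum.cong refl)
    fix g assume g: "g \<in> carrier G"
    have d: "G.\<delta> (inv\<^bsub>G\<^esub> g) \<in> carrier ZG" using g by simp
    have "gact (ev r) (inv\<^bsub>G\<^esub> g) = ev (ract r (G.\<delta> (inv\<^bsub>G\<^esub> g)))"
      using g d by (simp add: ev_ract Lam_act_delta)
    then show "of_nat p * (of_int (ract r (G.\<delta> (inv\<^bsub>G\<^esub> g)) k) * gact (\<pi> ^ k) g) =
        of_int (\<Phi> (gact (ev r) (inv\<^bsub>G\<^esub> g))) * gact (\<pi> ^ k) g"
      using \<Phi>[OF ract_rows[OF d]] by simp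
  qed
  also have "\<dots> = of_nat p * of_int (\<Phi> (\<pi> ^ k)) * ev r"
    by (rule trace_formula[OF add ev_ZZ]) (auto simp: ZZ_power ZZ_pi)
  also have "\<Phi> (\<pi> ^ k) = int p"
    using \<Phi>[OF unit_row_rows[OF k]] k by (simp add: ev_unit)
  finally show ?thesis using p_ge_3 by simp
qed

text \<open>Here \<open>c * f\<close> is the hat of the k-th coordinate at r, and the trace formula
  evaluates \<pi>^k acted on by it as p r. With \<open>c = 1\<close> this makes multiplication by p
  null, with \<open>c = p\<close> the inclusion into R(1).\<close>

lemma ract_hat:
  assumes "r \<in> rows" "k \<in> {1..p - 1}" "f \<in> carrier ZG"
    and "\<And>g. g \<in> carrier G \<Longrightarrow> c * f g = ract r (G.\<delta> (inv\<^bsub>G\<^esub> g)) k"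
  shows "c * ract (unit_row k) f l = int p * r l"
proof -
  have "of_int c * ev (ract (unit_row k) f) = (\<Sum>g\<in>carrier G. of_int (c * f g) * gact (\<pi> ^ k) g)"
    using assms(2,3) by (simp add: ev_ract ev_unit Lam_act_sum sum_distrib_left mult.assoc)
  also have "\<dots> = of_nat p * ev r"
    using row_trace[OF assms(1,2)] assms(4) by simp
  finally have "ev (\<lambda>l. c * ract (unit_row k) f l) = ev (\<lambda>l. int p * r l)" by (simp add: ev_scale)
  then have "(\<lambda>l. c * ract (unit_row k) f l) = (\<lambda>l. int p * r l)"
    using assms(1) ract_rows[OF assms(3), of "unit_row k"] by (intro ev_inj_rows) (auto simp: rows_def)
  then show ?thesis by (rule fun_cong)
qed

lemma nullmap_p_R2: "nullmap ZG (R_row p m 2) (R_row p m 2) (\<lambda>r k. int p * r k)"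
proof -
  let ?R = "R_row p m 2"
  note M = right_module_R_row[of 2]
  have lin: "linear (ZG) ?R (reg (ZG)) (G.hat ?R (\<lambda>r. r 2))"
    by (rule G.linear_hat[OF M]) simp
  have "nullmap ZG ?R ?R (\<lambda>r. unit_row 2 \<triangleleft>\<^bsub>?R\<^esub> G.hat ?R (\<lambda>r. r 2) r)"
    using lin by (intro nullmap_reg[OF G.ring_ZG right_module_R_row _ linear_act_map[OF right_module_R_row unit_row_R(1)]])
      simp
  then show ?thesis
  proof (rule nullmap_cong)
    fix r assume r: "r \<in> carrier ?R"
    have f: "G.hat ?R (\<lambda>r. r 2) r \<in> carrier ZG" using linear_closed[OF lin r] by simp
    have "1 * ract (unit_row 2) (G.hat ?R (\<lambda>r. r 2) r) l = int p * r l" for l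
      by (rule ract_hat[OF _ two_le(1) f]) (use r in \<open>auto simp: R_row_carrier G.hat_def\<close>)
    then show "(\<lambda>k. int p * r k) = unit_row 2 \<triangleleft>\<^bsub>?R\<^esub> G.hat ?R (\<lambda>r. r 2) r" by auto
  qed
qed

text \<open>On R(2) the first coordinate is divisible by p, and using its quotient by p removes the
  factor p of the trace formula. The price is that the value \<open>unit_row 1\<close> at the
  generator lies in R(1) only.\<close>

lemma nullmap_inclusion: "nullmap ZG (R_row p m 2) (R_row p m 1) (\<lambda>r. r)"
proof -
  let ?R = "R_row p m 2"
  let ?\<phi> = "\<lambda>r. r 1 div int p"
  note M = right_module_R_row[of 2]
  have lin: "linear (ZG) ?R (reg (ZG)) (G.hat ?R ?\<phi>)"
    by (rule G.linear_hat[OF M]) (auto simp: R_row_carrier div_plus_div_distrib_dvd_left)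
  have "nullmap ZG ?R (R_row p m 1) (\<lambda>r. unit_row 1 \<triangleleft>\<^bsub>R_row p m 1\<^esub> G.hat ?R ?\<phi> r)"
    using lin by (intro nullmap_reg[OF G.ring_ZG right_module_R_row _ linear_act_map[OF right_module_R_row unit_row_R(2)]])
      simp
  then show ?thesis
  proof (rule nullmap_cong)
    fix r assume r: "r \<in> carrier ?R"
    have f: "G.hat ?R ?\<phi> r \<in> carrier ZG" using linear_closed[OF lin r] by simp
    have "int p * ract (unit_row 1) (G.hat ?R ?\<phi> r) l = int p * r l" for l
    proof (rule ract_hat[OF _ two_le(2) f])
      show "r \<in> rows" using r by (simp add: R_row_carrier)
      fix g assume g: "g \<in> carrier G"
      then have "ract r (G.\<delta> (inv\<^bsub>G\<^esub> g)) \<in> carrier ?R"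
        using right_module.act_closed[OF right_module_R_row r, of "G.\<delta> (inv\<^bsub>G\<^esub> g)"] by simp
      then have "int p dvd ract r (G.\<delta> (inv\<^bsub>G\<^esub> g)) 1" by (simp add: R_row_carrier)
      then show "int p * G.hat ?R ?\<phi> r g = ract r (G.\<delta> (inv\<^bsub>G\<^esub> g)) 1" using g by (simp add: G.hat_def)
    qed
    then show "r = unit_row 1 \<triangleleft>\<^bsub>R_row p m 1\<^esub> G.hat ?R ?\<phi> r" using p_ge_3 by (auto simp: fun_eq_iff)
  qed
qed

text \<open>
  With \<open>\<theta> = u h(\<pi>\<^sup>2)\<close>, where \<open>p = \<pi>\<^sup>2 u\<close>, a homomorphism \<open>h\<close> is multiplication by \<open>\<theta> / p\<close>, and
  \<open>\<theta>\<close> is fixed by the Galois group.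
\<close>

lemma R2_hom_scalar:
  assumes h: "linear ZG (R_row p m 2) (R_row p m 1) h"
  obtains c :: int where "\<And>r. r \<in> carrier (R_row p m 2) \<Longrightarrow> h r = (\<lambda>k. c * r k)"
proof -
  let ?e = "unit_row 2"
  obtain u where u: "u \<in> ZZ" "of_nat p = \<pi>\<^sup>2 * u" by (rule p_eq_pi_mult) blast
  define \<eta> where "\<eta> = ev (h ?e)"
  have \<eta>: "\<eta> \<in> ZZ" by (simp add: \<eta>_def ev_ZZ)
  have he: "h ?e \<in> rows" using linear_closed[OF h unit_row_R(1)] by (simp add: R_row_carrier)
  have ev_h: "ev (h (ract ?e a)) = Lam_act p m \<eta> a" if "a \<in> carrier ZG" for a
    using linear_act[OF h unit_row_R(1) that] that by (simp add: ev_ract \<eta>_def)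
  have pi2: "ev ?e = \<pi>\<^sup>2" using ev_unit[OF two_le(1)] .
  have yd: "G.\<delta> yg \<in> carrier ZG" by simp
  have gact_yg: "gact v yg = gal m1 v" if "v \<in> ZZ" for v
    using gact_yg_pow[OF that, of 1] by simp
  \<comment> \<open>The factor by which \<open>gal m1\<close> changes \<pi>^2.\<close>
  define w where "w = (ip (\<Sum>i<m1. monom 1 i) \<zeta>)\<^sup>2"
  have w: "w \<in> ZZ" by (simp add: w_def ZZ_power)
  have galp: "gal m1 (\<pi>\<^sup>2) = \<pi>\<^sup>2 * w"
    by (simp add: gal_power ZZ_pi not_dvd_m1 gal_pi w_def power_mult_distrib)
  have "ract ?e (G.\<delta> yg) \<in> carrier (R_row p m 2)"
    using right_module.act_closed[OF right_module_R_row unit_row_R(1) yd] by simp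
  \<comment> \<open>On \<pi>^2 the element y acts like a polynomial q in x. A homomorphism carries
    this identity over to \<eta>, which therefore changes by the same factor \<open>w\<close> under
    \<open>gal m1\<close>.\<close>
  then obtain q where q: "ract ?e (G.\<delta> yg) = ract ?e (xpoly q)" by (rule R2_generated) blast
  have "gal m1 (\<pi>\<^sup>2) = \<pi>\<^sup>2 * ip q \<zeta>"
    using arg_cong[OF q, of ev] by (simp add: ev_ract yd xpoly_closed pi2 Lam_act_delta gact_yg Lam_act_xpoly ZZ_power ZZ_pi)
  then have wq: "w = ip q \<zeta>" using galp pi_neq_0 by simp
  have "gal m1 \<eta> = \<eta> * w"
    using ev_h[OF yd] ev_h[OF xpoly_closed, of q] \<eta> q
    by (simp add: Lam_act_delta gact_yg Lam_act_xpoly wq)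
  note gal_eta = this
  have "gal m1 (of_nat p) = of_nat p" using gal_of_int[OF not_dvd_m1, of "int p"] by simp
  moreover have "gal m1 (of_nat p) = \<pi>\<^sup>2 * w * gal m1 u"
    unfolding u(2) gal_mult[OF not_dvd_m1 ZZ_power[OF ZZ_pi] u(1)] galp ..
  ultimately have pe: "\<pi>\<^sup>2 * w * gal m1 u = \<pi>\<^sup>2 * u" using u(2) by metis
  have "\<pi>\<^sup>2 * gal m1 (u * \<eta>) = (\<pi>\<^sup>2 * w * gal m1 u) * \<eta>"
    unfolding gal_mult[OF not_dvd_m1 u(1) \<eta>] gal_eta by (simp only: mult_ac)
  then have "\<pi>\<^sup>2 * gal m1 (u * \<eta>) = \<pi>\<^sup>2 * (u * \<eta>)" unfolding pe by (simp only: mult.assoc)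
  then have "gal m1 (u * \<eta>) = u * \<eta>" using pi_neq_0 by simp
  then obtain n where n: "of_nat (p - 1) * (u * \<eta>) = of_int n"
    using gal_fixed_rational[OF ZZ_mult[OF u(1) \<eta>]] by blast
  have "of_nat (p - 1) * (of_nat p * \<eta>) = \<pi>\<^sup>2 * (of_nat (p - 1) * (u * \<eta>))"
    unfolding u(2) by (simp add: mult_ac)
  also have "\<dots> = of_int n * ev ?e" using n pi2 by (simp add: mult.commute)
  finally have "ev (\<lambda>k. (int (p - 1) * int p) * h ?e k) = ev (\<lambda>k. n * ?e k)"
    by (simp only: ev_scale \<eta>_def of_int_mult of_int_of_nat_eq mult.assoc)
  then have "(\<lambda>k. (int (p - 1) * int p) * h ?e k) = (\<lambda>k. n * ?e k)"
    using he unit_row_rows[OF two_le(1)] by (intro ev_inj_rows) (auto simp: rows_def)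
  note eq = this
  \<comment> \<open>A nonzero integral multiple of \<open>h ?e\<close> is a multiple of
    \<open>unit_row 2\<close>. So the other entries vanish, and the rational scalar is the integer
    \<open>h ?e 2\<close>.\<close>
  have "h ?e k = 0" if "k \<noteq> 2" for k
    using fun_cong[OF eq, of k] that p_ge_3 by simp
  then have he2: "h ?e = (\<lambda>k. h ?e 2 * ?e k)" by auto
  have "h r = (\<lambda>k. h ?e 2 * r k)" if r: "r \<in> carrier (R_row p m 2)" for r
  proof -
    obtain q where q: "r = ract ?e (xpoly q)" using R2_generated[OF r] .
    have "h r = ract (h ?e) (xpoly q)"
      using linear_act[OF h unit_row_R(1) xpoly_closed, of q] q by simp
    also have "\<dots> = (\<lambda>k. h ?e 2 * ract ?e (xpoly q) k)"
      by (subst he2) (simp add: ract_def sum_distrib_left mult.assoc)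
    finally show ?thesis using q by simp
  qed
  then show thesis by (rule that)
qed

end

context fin_group
begin

section \<open>Linear combinations and polynomials in a group element\<close>

lemma ZG_zero_closed [simp]: "(\<lambda>g. 0) \<in> carrier ZG"
  by (simp add: ZG_carrier)

lemma lincomb_closed: "(\<And>k. k \<in> K \<Longrightarrow> a k \<in> carrier ZG) \<Longrightarrow> (\<lambda>g. \<Sum>k\<in>K. n k * a k g) \<in> carrier ZG"
  by (simp add: ZG_carrier)

lemma lincomb_mult:
  assumes a: "\<And>k. k \<in> K \<Longrightarrow> a k \<in> carrier ZG" and c: "c \<in> carrier ZG"
  shows "(\<lambda>g. \<Sum>k\<in>K. n k * a k g) \<otimes>\<^bsub>ZG\<^esub> c = (\<lambda>g. \<Sum>k\<in>K. n k * (a k \<otimes>\<^bsub>ZG\<^esub> c) g)"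
proof
  fix g
  have "(\<Sum>h\<in>carrier G. (\<Sum>k\<in>K. n k * a k h) * c (inv h \<otimes> g)) =
      (\<Sum>k\<in>K. n k * (\<Sum>h\<in>carrier G. a k h * c (inv h \<otimes> g)))"
    by (simp add: sum_distrib_left sum_distrib_right mult.assoc) (rule sum.swap)
  then show "((\<lambda>g. \<Sum>k\<in>K. n k * a k g) \<otimes>\<^bsub>ZG\<^esub> c) g = (\<Sum>k\<in>K. n k * (a k \<otimes>\<^bsub>ZG\<^esub> c) g)"
    using ZG_mult[OF lincomb_closed[of K a n, OF a] c] ZG_mult[OF a c] by simp
qed

lemma mult_lincomb:
  assumes a: "\<And>k. k \<in> K \<Longrightarrow> a k \<in> carrier ZG" and c: "c \<in> carrier ZG"
  shows "c \<otimes>\<^bsub>ZG\<^esub> (\<lambda>g. \<Sum>k\<in>K. n k * a k g) = (\<lambda>g. \<Sum>k\<in>K. n k * (c \<otimes>\<^bsub>ZG\<^esub> a k) g)"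
proof
  fix g
  have "(\<Sum>h\<in>carrier G. c h * (\<Sum>k\<in>K. n k * a k (inv h \<otimes> g))) =
      (\<Sum>k\<in>K. n k * (\<Sum>h\<in>carrier G. c h * a k (inv h \<otimes> g)))"
    by (simp add: sum_distrib_left mult.left_commute) (rule sum.swap)
  then show "(c \<otimes>\<^bsub>ZG\<^esub> (\<lambda>g. \<Sum>k\<in>K. n k * a k g)) g = (\<Sum>k\<in>K. n k * (c \<otimes>\<^bsub>ZG\<^esub> a k) g)"
    using ZG_mult[OF c lincomb_closed[of K a n, OF a]] ZG_mult[OF c a] by simp
qed

lemma plus_mult:
  "a \<in> carrier ZG \<Longrightarrow> b \<in> carrier ZG \<Longrightarrow> c \<in> carrier ZG \<Longrightarrow>
    (\<lambda>g. a g + b g) \<otimes>\<^bsub>ZG\<^esub> c = (\<lambda>g. (a \<otimes>\<^bsub>ZG\<^esub> c) g + (b \<otimes>\<^bsub>ZG\<^esub> c) g)"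
  using ZG.l_distr[of a b c] by simp

lemma mult_plus:
  "a \<in> carrier ZG \<Longrightarrow> b \<in> carrier ZG \<Longrightarrow> c \<in> carrier ZG \<Longrightarrow>
    c \<otimes>\<^bsub>ZG\<^esub> (\<lambda>g. a g + b g) = (\<lambda>g. (c \<otimes>\<^bsub>ZG\<^esub> a) g + (c \<otimes>\<^bsub>ZG\<^esub> b) g)"
  using ZG.r_distr[of a b c] by simp

lemma minus_mult:
  "a \<in> carrier ZG \<Longrightarrow> b \<in> carrier ZG \<Longrightarrow> c \<in> carrier ZG \<Longrightarrow>
    (\<lambda>g. a g - b g) \<otimes>\<^bsub>ZG\<^esub> c = (\<lambda>g. (a \<otimes>\<^bsub>ZG\<^esub> c) g - (b \<otimes>\<^bsub>ZG\<^esub> c) g)"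
  using plus_mult[of "\<lambda>g. a g - b g" b c] by (simp add: ZG_carrier fun_eq_iff)

lemma scale_mult:
  "a \<in> carrier ZG \<Longrightarrow> c \<in> carrier ZG \<Longrightarrow> (\<lambda>g. k * a g) \<otimes>\<^bsub>ZG\<^esub> c = (\<lambda>g. k * (a \<otimes>\<^bsub>ZG\<^esub> c) g)"
  using lincomb_mult[of "{()}" "\<lambda>_. a" c "\<lambda>_. k"] by simp

lemma mult_scale:
  "a \<in> carrier ZG \<Longrightarrow> c \<in> carrier ZG \<Longrightarrow> c \<otimes>\<^bsub>ZG\<^esub> (\<lambda>g. k * a g) = (\<lambda>g. k * (c \<otimes>\<^bsub>ZG\<^esub> a) g)"
  using mult_lincomb[of "{()}" "\<lambda>_. a" c "\<lambda>_. k"] by simp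

lemma ZG_scale_closed: "a \<in> carrier ZG \<Longrightarrow> (\<lambda>g. k * a g) \<in> carrier ZG"
  and ZG_plus_closed: "a \<in> carrier ZG \<Longrightarrow> b \<in> carrier ZG \<Longrightarrow> (\<lambda>g. a g + b g) \<in> carrier ZG"
  and ZG_minus_closed: "a \<in> carrier ZG \<Longrightarrow> b \<in> carrier ZG \<Longrightarrow> (\<lambda>g. a g - b g) \<in> carrier ZG"
  by (simp_all add: ZG_carrier)

lemma right_ideal_simps [simp]:
  "\<zero>\<^bsub>right_ideal ZG z\<^esub> = (\<lambda>g. 0)" "v \<oplus>\<^bsub>right_ideal ZG z\<^esub> w = (\<lambda>g. v g + w g)"
  "v \<triangleleft>\<^bsub>right_ideal ZG z\<^esub> a = v \<otimes>\<^bsub>ZG\<^esub> a"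
  by (simp_all add: right_ideal_def)

lemma right_ideal_carrier: "b \<in> carrier (right_ideal ZG z) \<longleftrightarrow> (\<exists>a\<in>carrier ZG. b = z \<otimes>\<^bsub>ZG\<^esub> a)"
  by (auto simp: right_ideal_def)

lemma linear_right_ideal:
  assumes z: "z \<in> carrier ZG" shows "linear ZG (reg ZG) (right_ideal ZG z) (\<lambda>a. z \<otimes>\<^bsub>ZG\<^esub> a)"
  by (rule linearI) (auto simp: z right_ideal_carrier mult_plus ZG.m_assoc)

lemma right_module_right_ideal:
  assumes z: "z \<in> carrier ZG" shows "right_module ZG (right_ideal ZG z)"
proof (rule right_module_surj[OF right_module_reg[OF ring_ZG] linear_right_ideal[OF z]])
  show "carrier (right_ideal ZG z) \<subseteq> (\<lambda>a. z \<otimes>\<^bsub>ZG\<^esub> a) ` carrier (reg ZG)"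
    by (auto simp: right_ideal_carrier)
  show "\<zero>\<^bsub>right_ideal ZG z\<^esub> = z \<otimes>\<^bsub>ZG\<^esub> \<zero>\<^bsub>reg ZG\<^esub>" using ZG.r_null[OF z] by simp
qed

definition \<epsilon> :: "('g \<Rightarrow> int) \<Rightarrow> int"
  where "\<epsilon> a = (\<Sum>g\<in>carrier G. a g)"

lemma \<epsilon>_mult:
  assumes a: "a \<in> carrier ZG" and b: "b \<in> carrier ZG"
  shows "\<epsilon> (a \<otimes>\<^bsub>ZG\<^esub> b) = \<epsilon> a * \<epsilon> b"
proof -
  have "\<epsilon> (a \<otimes>\<^bsub>ZG\<^esub> b) = (\<Sum>h\<in>carrier G. a h * (\<Sum>g\<in>carrier G. b (inv h \<otimes> g)))"
    unfolding \<epsilon>_def ZG_mult[OF a b] by (simp add: sum_distrib_left) (rule sum.swap)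
  also have "\<dots> = (\<Sum>h\<in>carrier G. a h * \<epsilon> b)"
    unfolding \<epsilon>_def by (intro sum.cong refl arg_cong2[of _ _ _ _ "(*)"] sum_left_translate) simp
  finally show ?thesis unfolding \<epsilon>_def by (simp add: sum_distrib_right)
qed

text \<open>Evaluation of an integral polynomial at a group element. It is multiplicative, so
  identities between powers of x or of y can be proved in the polynomial ring.\<close>

definition gpoly :: "'g \<Rightarrow> int poly \<Rightarrow> 'g \<Rightarrow> int"
  where "gpoly x q = (\<lambda>g. \<Sum>s\<le>degree q. coeff q s * \<delta> (x [^] s) g)"

lemma gpoly_altdef: "degree q \<le> n \<Longrightarrow> gpoly x q = (\<lambda>g. \<Sum>s\<le>n. coeff q s * \<delta> (x [^] s) g)"
  unfolding gpoly_def by (intro ext sum.mono_neutral_left) (auto simp: coeff_eq_0)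

lemma gpoly_closed [simp]: "x \<in> carrier G \<Longrightarrow> gpoly x q \<in> carrier ZG"
  unfolding gpoly_def by (rule lincomb_closed) simp

lemma gpoly_add: "gpoly x (q + r) = (\<lambda>g. gpoly x q g + gpoly x r g)"
proof -
  let ?n = "max (degree q) (degree r)"
  have "degree (q + r) \<le> ?n" by (rule degree_add_le_max)
  then show ?thesis
    by (simp add: gpoly_altdef[of "q + r" ?n] gpoly_altdef[of q ?n] gpoly_altdef[of r ?n]
        distrib_right sum.distrib)
qed

lemma gpoly_diff: "gpoly x (q - r) = (\<lambda>g. gpoly x q g - gpoly x r g)"
  using gpoly_add[of x "q - r" r] by (simp add: fun_eq_iff)

lemma gpoly_0 [simp]: "gpoly x 0 = (\<lambda>g. 0)"
  by (simp add: gpoly_def)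

lemma gpoly_sum: "finite K \<Longrightarrow> gpoly x (\<Sum>k\<in>K. q k) = (\<lambda>g. \<Sum>k\<in>K. gpoly x (q k) g)"
  by (induction K rule: finite_induct) (simp_all add: gpoly_add)

lemma gpoly_monom: "gpoly x (monom c k) = (\<lambda>g. c * \<delta> (x [^] k) g)"
proof
  fix g
  have "gpoly x (monom c k) g = (\<Sum>s\<le>k. if s = k then c * \<delta> (x [^] s) g else 0)"
    unfolding gpoly_altdef[OF degree_monom_le] by (intro sum.cong) auto
  then show "gpoly x (monom c k) g = c * \<delta> (x [^] k) g" by simp
qed

lemma gpoly_const: "gpoly x [:c:] = (\<lambda>g. c * \<delta> \<one> g)"
  using gpoly_monom[of x c 0] by (simp add: monom_0)

lemma gpoly_mult:
  assumes x: "x \<in> carrier G"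
  shows "gpoly x (q * r) = gpoly x q \<otimes>\<^bsub>ZG\<^esub> gpoly x r"
proof -
  have m: "gpoly x (monom c k * monom d l) = gpoly x (monom c k) \<otimes>\<^bsub>ZG\<^esub> gpoly x (monom d l)" for c d k l
    using x by (simp add: mult_monom gpoly_monom scale_mult mult_scale ZG_scale_closed \<delta>_\<delta> nat_pow_mult mult.assoc)
  have r: "gpoly x (monom c k * r) = gpoly x (monom c k) \<otimes>\<^bsub>ZG\<^esub> gpoly x r" for c k
  proof -
    have "gpoly x (monom c k * r) = gpoly x (\<Sum>l\<le>degree r. monom c k * monom (coeff r l) l)"
      by (subst (1) poly_as_sum_of_monoms[of r, symmetric]) (simp add: sum_distrib_left)
    also have "\<dots> = (\<lambda>g. \<Sum>l\<le>degree r. 1 * (gpoly x (monom c k) \<otimes>\<^bsub>ZG\<^esub> gpoly x (monom (coeff r l) l)) g)"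
      by (simp add: gpoly_sum m)
    also have "\<dots> = gpoly x (monom c k) \<otimes>\<^bsub>ZG\<^esub> gpoly x (\<Sum>l\<le>degree r. monom (coeff r l) l)"
      unfolding gpoly_sum[OF finite_atMost]
      using mult_lincomb[of "{..degree r}" "\<lambda>l. gpoly x (monom (coeff r l) l)" "gpoly x (monom c k)" "\<lambda>_. 1"] x by simp
    finally show ?thesis unfolding poly_as_sum_of_monoms .
  qed
  have "gpoly x (q * r) = gpoly x (\<Sum>l\<le>degree q. monom (coeff q l) l * r)"
    by (subst (1) poly_as_sum_of_monoms[of q, symmetric]) (simp add: sum_distrib_right)
  also have "\<dots> = (\<lambda>g. \<Sum>l\<le>degree q. 1 * (gpoly x (monom (coeff q l) l) \<otimes>\<^bsub>ZG\<^esub> gpoly x r) g)"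
    by (simp add: gpoly_sum r)
  also have "\<dots> = gpoly x (\<Sum>l\<le>degree q. monom (coeff q l) l) \<otimes>\<^bsub>ZG\<^esub> gpoly x r"
    unfolding gpoly_sum[OF finite_atMost]
    using lincomb_mult[of "{..degree q}" "\<lambda>l. gpoly x (monom (coeff q l) l)" "gpoly x r" "\<lambda>_. 1"] x by simp
  finally show ?thesis unfolding poly_as_sum_of_monoms .
qed

lemma \<epsilon>_gpoly: "x \<in> carrier G \<Longrightarrow> \<epsilon> (gpoly x q) = poly q 1"
proof -
  assume x: "x \<in> carrier G"
  have "\<epsilon> (gpoly x q) = (\<Sum>s\<le>degree q. coeff q s * (\<Sum>g\<in>carrier G. \<delta> (x [^] s) g))"
    unfolding \<epsilon>_def gpoly_def by (simp add: sum_distrib_left) (rule sum.swap)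
  also have "\<dots> = (\<Sum>s\<le>degree q. coeff q s)"
    using fin x by (simp add: group_ring_elem_def)
  finally show ?thesis by (simp add: poly_altdef)
qed

section \<open>Homomorphisms out of finite free modules\<close>

abbreviation unit_vec :: "nat \<Rightarrow> nat \<Rightarrow> 'g \<Rightarrow> int"
  where "unit_vec i \<equiv> (\<lambda>j. if j = i then \<one>\<^bsub>ZG\<^esub> else \<zero>\<^bsub>ZG\<^esub>)"

lemma unit_vec_closed: "i < n \<Longrightarrow> unit_vec i \<in> carrier (free_rmod ZG {..<n})"
  using ZG.one_closed ZG.zero_closed by (simp add: free_rmod_carrier_finite del: ZG_simps)

text \<open>Expansion along the unit vectors, read through an additive functional so that the result
  is a sum of integers instead of a sum inside \<open>M\<close>. The induction runs over the
  truncations of \<open>w\<close>.\<close>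

lemma linear_free_expand:
  fixes T :: "'b \<Rightarrow> int"
  assumes M: "right_module ZG M" and f: "linear ZG (free_rmod ZG {..<n::nat}) M f"
    and T: "\<And>v w. v \<in> carrier M \<Longrightarrow> w \<in> carrier M \<Longrightarrow> T (v \<oplus>\<^bsub>M\<^esub> w) = T v + T w"
    and w: "w \<in> carrier (free_rmod ZG {..<n})"
  shows "T (f w) = (\<Sum>i<n. T (f (unit_vec i) \<triangleleft>\<^bsub>M\<^esub> w i))"
proof -
  let ?F = "free_rmod ZG {..<n}"
  interpret M: right_module ZG M by fact
  note F = right_module_free[OF ring_ZG, of "{..<n}"]
  have wi: "w i \<in> carrier ZG" for i by (rule free_rmod_in_ring[OF ring_ZG w])
  have T0: "T \<zero>\<^bsub>M\<^esub> = 0" using T[of "\<zero>\<^bsub>M\<^esub>" "\<zero>\<^bsub>M\<^esub>"] by simp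
  let ?u = "\<lambda>k j. if j < k then w j else \<zero>\<^bsub>ZG\<^esub>"
  have "T (f (?u k)) = (\<Sum>i<k. T (f (unit_vec i) \<triangleleft>\<^bsub>M\<^esub> w i))" if "k \<le> n" for k
    using that
  proof (induction k)
    case 0
    then show ?case using linear_zero[OF F M f] T0 by simp
  next
    case (Suc k)
    then have k: "k < n" by simp
    have u: "?u k \<in> carrier ?F" using k wi ZG.zero_closed by (simp add: free_rmod_carrier_finite del: ZG_simps)
    note e = unit_vec_closed[OF k]
    have ew: "unit_vec k \<triangleleft>\<^bsub>?F\<^esub> w k \<in> carrier ?F" by (rule right_module.act_closed[OF F e wi])
    have "?u (Suc k) = ?u k \<oplus>\<^bsub>?F\<^esub> (unit_vec k \<triangleleft>\<^bsub>?F\<^esub> w k)"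
    proof
      fix j
      have "\<one>\<^bsub>ZG\<^esub> \<otimes>\<^bsub>ZG\<^esub> w k = w k" "\<zero>\<^bsub>ZG\<^esub> \<otimes>\<^bsub>ZG\<^esub> w k = \<zero>\<^bsub>ZG\<^esub>"
        using wi by (rule ZG.l_one, rule ZG.l_null)
      then show "?u (Suc k) j = (?u k \<oplus>\<^bsub>?F\<^esub> (unit_vec k \<triangleleft>\<^bsub>?F\<^esub> w k)) j"
        by (cases "j = k") auto
    qed
    then have "f (?u (Suc k)) = f (?u k) \<oplus>\<^bsub>M\<^esub> f (unit_vec k) \<triangleleft>\<^bsub>M\<^esub> w k"
      using linear_add[OF f u ew] linear_act[OF f e wi] by simp
    then show ?case
      using Suc.IH k T[OF linear_closed[OF f u] M.act_closed[OF linear_closed[OF f e] wi]] by simp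
  qed
  from this[of n, OF order_refl] have "T (f (?u n)) = (\<Sum>i<n. T (f (unit_vec i) \<triangleleft>\<^bsub>M\<^esub> w i))" .
  moreover have "?u n = w"
    using w by (auto simp: free_rmod_carrier_finite)
  ultimately show ?thesis by (simp only:)
qed

lemma linear_free_ex:
  assumes M: "right_module ZG M" and c: "\<And>i. i < n \<Longrightarrow> c i \<in> carrier M"
  obtains f where "linear ZG (free_rmod ZG {..<n::nat}) M f" "\<And>i. i < n \<Longrightarrow> f (unit_vec i) = c i"
proof -
  interpret M: right_module ZG M by fact
  let ?F = "free_rmod ZG {..<n}"
  have "\<exists>f. linear ZG ?F M f \<and> (\<forall>i<n. f (unit_vec i) = (if i < k then c i else \<zero>\<^bsub>M\<^esub>))" if "k \<le> n" for k
    using that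
  proof (induction k)
    case 0
    then show ?case using linear_zero_map[OF M, of ?F] by auto
  next
    case (Suc k)
    then obtain f where f: "linear ZG ?F M f" "\<forall>i<n. f (unit_vec i) = (if i < k then c i else \<zero>\<^bsub>M\<^esub>)" by auto
    have ck: "c k \<in> carrier M" using c Suc.prems by simp
    let ?f = "\<lambda>w. f w \<oplus>\<^bsub>M\<^esub> c k \<triangleleft>\<^bsub>M\<^esub> w k"
    have "linear ZG ?F M ?f"
      by (rule linear_plus[OF M f(1) linear_comp[OF linear_coord[OF ring_ZG] linear_act_map[OF M ck]]])
    moreover have "?f (unit_vec i) = (if i < Suc k then c i else \<zero>\<^bsub>M\<^esub>)" if "i < n" for i
    proof -
      have "c k \<triangleleft>\<^bsub>M\<^esub> \<one>\<^bsub>ZG\<^esub> = c k" "c k \<triangleleft>\<^bsub>M\<^esub> \<zero>\<^bsub>ZG\<^esub> = \<zero>\<^bsub>M\<^esub>"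
        using M.act_one[OF ck] M.act_zero_right[OF ck] by auto
      moreover have "f (unit_vec i) = (if i < k then c i else \<zero>\<^bsub>M\<^esub>)" using f(2) that by blast
      ultimately show ?thesis using c[OF that] ck by (cases "i < k"; cases "i = k") (simp_all del: ZG_simps)
    qed
    ultimately show ?case by blast
  qed
  from this[of n] obtain f where "linear ZG ?F M f" "\<forall>i<n. f (unit_vec i) = (if i < n then c i else \<zero>\<^bsub>M\<^esub>)" by blast
  then show thesis using that[of f] by auto
qed

end

context metacyclic
begin

section \<open>The module \<open>[y - 1)\<close>\<close>

abbreviation rmul :: "(gen word set \<Rightarrow> int) \<Rightarrow> (gen word set \<Rightarrow> int) \<Rightarrow> gen word set \<Rightarrow> int" (infixl "\<star>" 70)
  where "a \<star> b \<equiv> a \<otimes>\<^bsub>group_ring G\<^esub> b"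

abbreviation "ypoly \<equiv> G.gpoly yg"

text \<open>y - 1, followed by the norm elements of <y> and <x>.\<close>

definition b1 where "b1 = ypoly [:-1, 1:]"
definition Sy where "Sy = ypoly (\<Sum>j<p - 1. monom 1 j)"
definition Sx where "Sx = G.gpoly xg (\<Sum>i<p. monom 1 i)"

abbreviation B where "B \<equiv> right_ideal ZG b1"

lemma b1_closed [simp]: "b1 \<in> carrier ZG" and Sy_closed [simp]: "Sy \<in> carrier ZG"
  and Sx_closed [simp]: "Sx \<in> carrier ZG"
  by (simp_all add: b1_def Sy_def Sx_def)

lemma mul_closed [simp]: "a \<in> carrier ZG \<Longrightarrow> b \<in> carrier ZG \<Longrightarrow> a \<star> b \<in> carrier ZG"
  by (rule G.ZG_mult_closed)

lemma mul_assoc: "a \<in> carrier ZG \<Longrightarrow> b \<in> carrier ZG \<Longrightarrow> c \<in> carrier ZG \<Longrightarrow> (a \<star> b) \<star> c = a \<star> (b \<star> c)"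
  by (rule G.ZG.m_assoc)

lemma B_carrier: "b \<in> carrier B \<longleftrightarrow> (\<exists>a\<in>carrier ZG. b = b1 \<star> a)"
  by (rule G.right_ideal_carrier)

lemma b1_mem: "b1 \<in> carrier B"
  unfolding B_carrier using G.ZG.r_one[OF b1_closed] G.ZG.one_closed by (metis)

lemma b1_mul_mem: "a \<in> carrier ZG \<Longrightarrow> b1 \<star> a \<in> carrier B"
  unfolding B_carrier by blast

lemma B_in_ZG: "b \<in> carrier B \<Longrightarrow> b \<in> carrier ZG"
  unfolding B_carrier by auto

lemma linear_left: "c \<in> carrier ZG \<Longrightarrow> linear ZG (reg ZG) (reg ZG) (\<lambda>a. c \<star> a)"
  using linear_act_map[OF right_module_reg[OF G.ring_ZG], of c] by simp

lemma linear_b1: "linear ZG (reg ZG) B (\<lambda>a. b1 \<star> a)"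
  by (rule G.linear_right_ideal[OF b1_closed])

lemma right_module_B: "right_module ZG B"
  by (rule G.right_module_right_ideal[OF b1_closed])

lemma linear_B_reg: "linear ZG B (reg ZG) (\<lambda>b. b)"
  by (rule linearI) (auto simp: B_in_ZG)

lemma B_neg: "b \<in> carrier B \<Longrightarrow> \<ominus>\<^bsub>B\<^esub> b = (\<lambda>g. - b g)"
  using linear_neg[OF right_module_B right_module_reg[OF G.ring_ZG] linear_B_reg, of b] G.ZG_neg[OF B_in_ZG]
  by (simp add: a_inv_def reg_def rmod_of_def m_inv_def)

lemma ypoly_mult: "ypoly (q * r) = ypoly q \<star> ypoly r"
  by (rule G.gpoly_mult) simp

lemma ypoly_comm: "ypoly q \<star> ypoly r = ypoly r \<star> ypoly q"
  by (simp add: ypoly_mult[symmetric] mult.commute)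

lemma geom_poly: "[:-1, 1:] * (\<Sum>j<n. monom 1 j) = monom 1 n - (1 :: int poly)"
proof (induction n)
  case (Suc n)
  then show ?case by (simp add: distrib_left monom_Suc)
qed (simp add: monom_0 one_pCons)

lemma ypoly_monom: "ypoly (monom 1 k) = G.\<delta> (yg [^]\<^bsub>G\<^esub> k)"
  by (simp add: G.gpoly_monom)

lemma ypoly_one: "ypoly 1 = G.\<delta> \<one>\<^bsub>G\<^esub>"
  using ypoly_monom[of 0] by (simp add: monom_0 one_pCons)

lemma Sy_eq: "Sy = (\<lambda>g. \<Sum>s<p - 1. G.\<delta> (yg [^]\<^bsub>G\<^esub> s) g)"
  and Sx_eq: "Sx = (\<lambda>g. \<Sum>s<p. G.\<delta> (xg [^]\<^bsub>G\<^esub> s) g)"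
  unfolding Sy_def Sx_def G.gpoly_sum[OF finite_lessThan] G.gpoly_monom by simp_all

lemma b1_Sy: "b1 \<star> Sy = (\<lambda>g. 0)" and Sy_b1: "Sy \<star> b1 = (\<lambda>g. 0)"
proof -
  show "b1 \<star> Sy = (\<lambda>g. 0)"
    unfolding b1_def Sy_def ypoly_mult[symmetric] geom_poly G.gpoly_diff ypoly_monom yg_pow_p ypoly_one
    by simp
  then show "Sy \<star> b1 = (\<lambda>g. 0)" unfolding b1_def Sy_def by (simp only: ypoly_comm)
qed

lemma Sy_B: "b \<in> carrier B \<Longrightarrow> Sy \<star> b = (\<lambda>g. 0)"
  using mul_assoc[OF Sy_closed b1_closed] Sy_b1 G.ZG.l_null by (auto simp: B_carrier)

lemma ypoly_root:
  assumes "poly q 1 = 0" obtains r where "ypoly q = b1 \<star> ypoly r"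
proof -
  have "[:-1, 1:] dvd q" using assms by (simp add: poly_eq_0_iff_dvd)
  then obtain r where "q = [:-1, 1:] * r" by blast
  then have "ypoly q = b1 \<star> ypoly r" unfolding b1_def by (simp only: ypoly_mult)
  then show thesis by (rule that)
qed

lemma inv_y_nf: "s \<le> j \<Longrightarrow> inv\<^bsub>G\<^esub> (yg [^]\<^bsub>G\<^esub> s) \<otimes>\<^bsub>G\<^esub> nf j i = nf (j - s) i" for s :: nat
  using yg_pow_nf[of s "j - s" i] by (simp add: G.inv_solve_left')

lemma inv_y_nf_0: "inv\<^bsub>G\<^esub> yg \<otimes>\<^bsub>G\<^esub> nf 0 i = nf (p - 2) i"
proof -
  have "nf 0 i = nf (p - 1) i" by (rule nf_cong) (simp_all add: cong_def)
  then show ?thesis using inv_y_nf[of 1 "p - 1" i] p_ge_3 by (simp add: numeral_2_eq_2)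
qed

lemma b1_mul: 
  assumes "c \<in> carrier ZG" "g \<in> carrier G" shows "(b1 \<star> c) g = c (inv\<^bsub>G\<^esub> yg \<otimes>\<^bsub>G\<^esub> g) - c g"
proof -
  have "b1 = (\<lambda>g. G.\<delta> yg g - G.\<delta> \<one>\<^bsub>G\<^esub> g)"
    using G.gpoly_diff[of yg "monom 1 1" 1] ypoly_monom[of 1] ypoly_one
    by (simp add: b1_def monom_Suc one_pCons)
  then have "b1 \<star> c = (\<lambda>g. (G.\<delta> yg \<star> c) g - (G.\<delta> \<one>\<^bsub>G\<^esub> \<star> c) g)"
    using assms(1) by (simp add: G.minus_mult)
  then show ?thesis using assms G.\<delta>_mult[of yg c g] G.\<delta>_mult[of "\<one>\<^bsub>G\<^esub>" c g] by simp
qed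

text \<open>Evaluation at exponent p - 2 lets the left translates by y^-s, for s < p - 1, run
  through the exponents p - 2, ..., 0 without reduction modulo p - 1.\<close>

lemma Sy_mul:
  assumes "c \<in> carrier ZG" shows "(Sy \<star> c) (nf (p - 2) i) = (\<Sum>j<p - 1. c (nf j i))"
proof -
  have "(Sy \<star> c) (nf (p - 2) i) = (\<Sum>s<p - 1. (G.\<delta> (yg [^]\<^bsub>G\<^esub> s) \<star> c) (nf (p - 2) i))"
    using G.lincomb_mult[of "{..<p - 1}" "\<lambda>s. G.\<delta> (yg [^]\<^bsub>G\<^esub> s)" c "\<lambda>_. 1"] assms
    by (simp add: Sy_eq del: One_nat_def)
  also have "\<dots> = (\<Sum>s<p - 1. c (nf (p - 1 - Suc s) i))"
  proof (rule sum.cong[OF refl])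
    fix s assume "s \<in> {..<p - 1}"
    then have "s \<le> p - 2" "p - 2 - s = p - 1 - Suc s" by auto
    then show "(G.\<delta> (yg [^]\<^bsub>G\<^esub> s) \<star> c) (nf (p - 2) i) = c (nf (p - 1 - Suc s) i)"
      using assms G.\<delta>_mult[of "yg [^]\<^bsub>G\<^esub> s" c "nf (p - 2) i"] by (simp add: inv_y_nf)
  qed
  also have "\<dots> = (\<Sum>j<p - 1. c (nf j i))" by (rule sum.nat_diff_reindex)
  finally show ?thesis .
qed

text \<open>Exactness of left multiplication by y - 1 followed by that by the norm of y; it turns
  membership in the ideal into an equation.\<close>

lemma B_iff: "b \<in> carrier B \<longleftrightarrow> b \<in> carrier ZG \<and> Sy \<star> b = (\<lambda>g. 0)"
proof
  assume "b \<in> carrier ZG \<and> Sy \<star> b = (\<lambda>g. 0)"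
  then have b: "b \<in> carrier ZG" and zero: "(\<Sum>j<p - 1. b (nf j i)) = 0" for i
    using Sy_mul[of b i] by simp_all
  let ?idx = "inv_into ({..<p - 1} \<times> {..<p}) (\<lambda>(j, i). nf j i)"
  \<comment> \<open>A primitive of \<open>b\<close> along the orbits of y: left multiplication by y
    - 1 takes differences of neighbours, and the vanishing of the total sum closes the cycle at j =
    0.\<close>
  define \<mu> where "\<mu> g = (if g \<in> carrier G then case ?idx g of (j, i) \<Rightarrow> - (\<Sum>l\<le>j. b (nf l i)) else 0)" for g
  have \<mu>: "\<mu> (nf j i) = - (\<Sum>l\<le>j. b (nf l i))" if "j < p - 1" "i < p" for j i
  proof -
    have "?idx (nf j i) = (j, i)"
      using inv_into_f_f[OF bij_betw_imp_inj_on[OF nf_bij], of "(j, i)"] that by simp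
    then show ?thesis by (simp add: \<mu>_def)
  qed
  have \<mu>c: "\<mu> \<in> carrier ZG" by (simp add: G.ZG_carrier \<mu>_def)
  have "b = b1 \<star> \<mu>"
  proof
    fix g
    show "b g = (b1 \<star> \<mu>) g"
    proof (cases "g \<in> carrier G")
      case True
      then obtain j i where ji: "j < p - 1" "i < p" "g = nf j i" using nf_ex by blast
      show ?thesis
      proof (cases j)
        case 0
        have e: "{..p - 2} = {..<p - 1}" using p_ge_3 by auto
        have "\<mu> (nf (p - 2) i) = 0" using \<mu>[of "p - 2" i] ji p_ge_3 zero[of i] by (simp add: e)
        then show ?thesis using ji 0 \<mu>[of 0 i] b1_mul[OF \<mu>c, of "nf 0 i"] by (simp add: inv_y_nf_0)
      next
        case (Suc j')
        then show ?thesis using ji \<mu>[of j i] \<mu>[of j' i] b1_mul[OF \<mu>c, of "nf j i"] inv_y_nf[of 1 j i] by simp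
      qed
    qed (simp add: G.ZG_outside[OF b] G.ZG_outside[OF mul_closed[OF b1_closed \<mu>c]])
  qed
  then show "b \<in> carrier B" using \<mu>c by (auto simp: B_carrier)
qed (simp add: B_in_ZG Sy_B)

text \<open>A kernel is pure, since division by d can be cancelled from the equation that defines
  it.\<close>

lemma B_pure:
  assumes b: "b \<in> carrier B" and d: "d \<noteq> 0" "\<And>g. g \<in> carrier G \<Longrightarrow> d dvd b g"
  obtains b' where "b' \<in> carrier B" "b = (\<lambda>g. d * b' g)"
proof
  let ?b = "\<lambda>g. b g div d"
  have bR: "b \<in> carrier ZG" by (rule B_in_ZG[OF b])
  then have c: "?b \<in> carrier ZG" by (simp add: G.ZG_carrier)
  show e: "b = (\<lambda>g. d * ?b g)"
  proof
    fix g show "b g = d * ?b g" using d(2)[of g] G.ZG_outside[OF bR, of g] by (cases "g \<in> carrier G") auto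
  qed
  have "(\<lambda>g. d * (Sy \<star> ?b) g) = (\<lambda>g. 0)"
    using Sy_B[OF b] e G.mult_scale[OF c Sy_closed, of d] by simp
  then have "Sy \<star> ?b = (\<lambda>g. 0)" using d(1) by (simp add: fun_eq_iff)
  then show "?b \<in> carrier B" using c by (simp add: B_iff)
qed

text \<open>An element killed by y - 1 from the left is constant on the orbits of left
  multiplication by y, each of which has p - 1 elements.\<close>

lemma b1_mul_eq_0:
  assumes c: "c \<in> carrier ZG" "b1 \<star> c = (\<lambda>g. 0)" shows "int (p - 1) dvd G.\<epsilon> c"
proof -
  have eq: "c (nf j i) = c (nf 0 i)" if "j < p - 1" for i j
    using that
  proof (induction j)
    case (Suc j)
    then show ?case using b1_mul[OF c(1), of "nf (Suc j) i"] inv_y_nf[of 1 "Suc j" i] c(2) by simp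
  qed simp
  have "(\<Sum>j<p - 1. \<Sum>i<p. c (nf j i)) = (\<Sum>j<p - 1. \<Sum>i<p. c (nf 0 i))"
    by (intro sum.cong refl eq) simp
  then have "G.\<epsilon> c = int (p - 1) * (\<Sum>i<p. c (nf 0 i))" by (simp add: G.\<epsilon>_def sum_G del: One_nat_def)
  then show ?thesis by simp
qed

section \<open>Endomorphisms of \<open>[y - 1)\<close> modulo null maps\<close>

lemma linear_scale:
  assumes f: "linear ZG B B f" and b: "b \<in> carrier B"
  shows "f (\<lambda>g. k * b g) = (\<lambda>g. k * f b g)"
  using linear_act[OF f b G.zs_closed[of k]] G.mult_zs[of _ k] B_in_ZG b linear_closed[OF f b] by simp

lemma linear_scale_B: "linear ZG B B (\<lambda>b g. k * b g)"
proof (rule linearI)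
  fix b assume b: "b \<in> carrier B"
  show "(\<lambda>g. k * b g) \<in> carrier B"
    using right_module.act_closed[OF right_module_B b G.zs_closed[of k]] G.mult_zs[OF B_in_ZG[OF b], of k] by simp
  show "(\<lambda>g. k * (b \<triangleleft>\<^bsub>B\<^esub> a) g) = (\<lambda>g. k * b g) \<triangleleft>\<^bsub>B\<^esub> a" if "a \<in> carrier ZG" for a
    using that b by (simp add: G.scale_mult B_in_ZG)
qed (simp add: distrib_left)

lemma B_scale_closed: "b \<in> carrier B \<Longrightarrow> (\<lambda>g. k * b g) \<in> carrier B"
  by (rule linear_closed[OF linear_scale_B])

lemma nullmap_B_lin:
  assumes "nullmap ZG M B f" "nullmap ZG M B h"
  shows "nullmap ZG M B (\<lambda>v g. x * f v g + y * h v g)"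
  using nullmap_plus[OF G.ring_ZG right_module_B nullmap_comp_left[OF assms(1) linear_scale_B, of x]
      nullmap_comp_left[OF assms(2) linear_scale_B, of y]] by simp

text \<open>The elements whose left multiplication is a null endomorphism of \<open>B\<close>. They
  serve as a congruence for computing in \<Lambda>: they are closed under integral combinations and
  contain (y - 1)\<Lambda> and \<Lambda>\<open>Sy\<close>.\<close>

definition null_elems where "null_elems = {e \<in> carrier ZG. nullmap ZG B B (\<lambda>b. e \<star> b)}"

lemma null_elems_lin:
  assumes "e \<in> null_elems" "e' \<in> null_elems"
  shows "(\<lambda>g. x * e g + y * e' g) \<in> null_elems"
proof -
  have e: "e \<in> carrier ZG" "e' \<in> carrier ZG" using assms by (simp_all add: null_elems_def)
  have "nullmap ZG B B (\<lambda>b g. x * (e \<star> b) g + y * (e' \<star> b) g)"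
    using assms by (intro nullmap_B_lin) (simp_all add: null_elems_def)
  then have "nullmap ZG B B (\<lambda>b. (\<lambda>g. x * e g + y * e' g) \<star> b)"
    by (rule nullmap_cong) (simp add: e G.plus_mult G.scale_mult G.ZG_scale_closed B_in_ZG)
  then show ?thesis using e by (simp add: null_elems_def G.ZG_plus_closed G.ZG_scale_closed)
qed

lemma null_elems_zero: "(\<lambda>g. 0) \<in> null_elems"
proof -
  have "nullmap ZG B B (\<lambda>b. (\<lambda>g. 0) \<star> b)"
    by (rule nullmap_cong[OF nullmap_zero[OF G.ring_ZG right_module_B]])
      (use G.ZG.l_null in \<open>simp add: B_in_ZG\<close>)
  then show ?thesis by (simp add: null_elems_def)
qed

lemma null_elems_sum:
  "finite K \<Longrightarrow> (\<And>k. k \<in> K \<Longrightarrow> e k \<in> null_elems) \<Longrightarrow> (\<lambda>g. \<Sum>k\<in>K. e k g) \<in> null_elems"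
proof (induction K rule: finite_induct)
  case (insert k K)
  then show ?case using null_elems_lin[of "e k" "\<lambda>g. \<Sum>k\<in>K. e k g" 1 1] by simp
qed (simp add: null_elems_zero)

lemma null_elems_b1:
  assumes c: "c \<in> carrier ZG" shows "b1 \<star> c \<in> null_elems"
proof -
  have "nullmap ZG B B (\<lambda>b. b1 \<star> (c \<star> b))"
    by (rule nullmap_reg[OF G.ring_ZG right_module_B linear_comp[OF linear_B_reg linear_left[OF c]] linear_b1])
  then have "nullmap ZG B B (\<lambda>b. (b1 \<star> c) \<star> b)"
    by (rule nullmap_cong) (simp add: mul_assoc c B_in_ZG)
  then show ?thesis using c by (simp add: null_elems_def)
qed

lemma null_elems_Sy:
  assumes c: "c \<in> carrier ZG" shows "c \<star> Sy \<in> null_elems"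
proof -
  have "nullmap ZG B B (\<lambda>b. (c \<star> Sy) \<star> b)"
    by (rule nullmap_cong[OF nullmap_zero[OF G.ring_ZG right_module_B]])
      (use G.ZG.r_null[OF c] in \<open>simp add: mul_assoc c B_in_ZG Sy_B\<close>)
  then show ?thesis using c by (simp add: null_elems_def)
qed

text \<open>Modulo (y - 1)\<Lambda> a polynomial in y standing on the left may be replaced by its
  value at 1.\<close>

lemma null_elems_ypoly:
  assumes c: "c \<in> carrier ZG" shows "(\<lambda>g. (ypoly q \<star> c) g - poly q 1 * c g) \<in> null_elems"
proof -
  obtain r where r: "ypoly (q - [:poly q 1:]) = b1 \<star> ypoly r"
    by (rule ypoly_root[of "q - [:poly q 1:]"]) simp_all
  have "(\<lambda>g. (ypoly q \<star> c) g - poly q 1 * c g) = ypoly (q - [:poly q 1:]) \<star> c"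
    using G.ZG.l_one[OF c] c
    by (simp add: G.gpoly_diff G.gpoly_const G.minus_mult G.scale_mult G.ZG_scale_closed)
  then show ?thesis
    using null_elems_b1[of "ypoly r \<star> c"] c by (simp add: r mul_assoc)
qed

text \<open>\<open>Sy\<close> is congruent to its value p - 1 at y = 1, and \<open>Sy\<close>
  annihilates \<open>B\<close>.\<close>

lemma null_elems_order: "(\<lambda>g. int (p - 1) * G.\<delta> \<one>\<^bsub>G\<^esub> g) \<in> null_elems"
proof -
  let ?q = "\<Sum>j<p - 1. monom 1 j :: int poly" and ?d = "G.\<delta> \<one>\<^bsub>G\<^esub>"
  have d: "?d \<in> carrier ZG" and one: "c \<star> ?d = c" "?d \<star> c = c" if "c \<in> carrier ZG" for c
    using G.ZG.r_one[OF that] G.ZG.l_one[OF that] by simp_all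
  have q1: "poly ?q 1 = int (p - 1)" by (simp add: poly_sum poly_monom)
  have 1: "(\<lambda>g. Sy g - int (p - 1) * ?d g) \<in> null_elems"
    using null_elems_ypoly[of ?d ?q, OF G.\<delta>_closed[OF G.one_closed]] one(1)[OF Sy_closed] unfolding q1 Sy_def[symmetric] by (simp only:)
  have 2: "Sy \<in> null_elems" using null_elems_Sy[of ?d] one(2)[OF Sy_closed] by simp
  show ?thesis using null_elems_lin[OF 1 2, of "-1" 1] by simp
qed

lemma conj_x: "yg [^]\<^bsub>G\<^esub> (p - 1 - j) \<otimes>\<^bsub>G\<^esub> (xg \<otimes>\<^bsub>G\<^esub> yg [^]\<^bsub>G\<^esub> j) = xg [^]\<^bsub>G\<^esub> (m1 ^ j mod p)" if "j < p - 1" for j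
proof -
  have "xg \<otimes>\<^bsub>G\<^esub> yg [^]\<^bsub>G\<^esub> j = nf j (m1 ^ j)" using xg_pow_yg_pow[of 1 j] by (simp add: nf_def)
  then have "yg [^]\<^bsub>G\<^esub> (p - 1 - j) \<otimes>\<^bsub>G\<^esub> (xg \<otimes>\<^bsub>G\<^esub> yg [^]\<^bsub>G\<^esub> j) = nf (p - 1) (m1 ^ j)"
    using that by (simp add: yg_pow_nf)
  also have "\<dots> = nf 0 (m1 ^ j mod p)" by (rule nf_cong) (simp_all add: cong_def)
  finally show ?thesis by (simp add: nf_def)
qed

text \<open>\<open>Sx - 1\<close> is the sum of the conjugates y^-j x y^j. In each the power of y on
  the left may be dropped, which leaves \<open>x Sy\<close>, and this kills \<open>B\<close>. Thus
  \<open>Sx\<close> acts on \<open>B\<close> as the identity up to null maps.\<close>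

lemma null_elems_Sx: "(\<lambda>g. Sx g - G.\<delta> \<one>\<^bsub>G\<^esub> g) \<in> null_elems"
proof -
  let ?e = "\<lambda>j. G.\<delta> (xg \<otimes>\<^bsub>G\<^esub> yg [^]\<^bsub>G\<^esub> j)"
  have "(\<lambda>g. G.\<delta> (xg [^]\<^bsub>G\<^esub> (m1 ^ j mod p)) g - ?e j g) \<in> null_elems" if "j < p - 1" for j
    using null_elems_ypoly[of "?e j" "monom 1 (p - 1 - j)"] conj_x[OF that]
    by (simp add: ypoly_monom G.\<delta>_\<delta> poly_monom)
  then have "(\<lambda>g. \<Sum>j<p - 1. G.\<delta> (xg [^]\<^bsub>G\<^esub> (m1 ^ j mod p)) g - ?e j g) \<in> null_elems"
    by (intro null_elems_sum) auto
  then have 1: "(\<lambda>g. (\<Sum>j<p - 1. G.\<delta> (xg [^]\<^bsub>G\<^esub> (m1 ^ j mod p)) g) - (\<Sum>j<p - 1. ?e j g)) \<in> null_elems"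
    by (simp only: sum_subtractf)
  have "G.\<delta> xg \<star> Sy = (\<lambda>g. \<Sum>j<p - 1. ?e j g)"
    using G.mult_lincomb[of "{..<p - 1}" "\<lambda>s. G.\<delta> (yg [^]\<^bsub>G\<^esub> s)" "G.\<delta> xg" "\<lambda>_. 1"]
    by (simp add: Sy_eq G.\<delta>_\<delta> del: One_nat_def)
  then have 2: "(\<lambda>g. \<Sum>j<p - 1. ?e j g) \<in> null_elems" using null_elems_Sy[of "G.\<delta> xg"] by simp
  have "Sx g - G.\<delta> \<one>\<^bsub>G\<^esub> g = (\<Sum>j<p - 1. G.\<delta> (xg [^]\<^bsub>G\<^esub> (m1 ^ j mod p)) g)" for g
  proof -
    have "(\<Sum>j<p - 1. G.\<delta> (xg [^]\<^bsub>G\<^esub> (m1 ^ j mod p)) g) = (\<Sum>i\<in>{1..p - 1}. G.\<delta> (xg [^]\<^bsub>G\<^esub> i) g)"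
      by (rule sum.reindex_bij_betw[OF m1_power_bij])
    moreover have "{..<p} = insert 0 {1..p - 1}" using p_ge_3 by auto
    ultimately show ?thesis by (simp add: Sx_eq)
  qed
  then show ?thesis using null_elems_lin[OF 1 2, of 1 1] by simp
qed

lemma null_elems_ypoly_Sx: "(\<lambda>g. (ypoly q \<star> Sx) g - poly q 1 * G.\<delta> \<one>\<^bsub>G\<^esub> g) \<in> null_elems"
  using null_elems_lin[OF null_elems_ypoly[OF Sx_closed, of q] null_elems_Sx, of 1 "poly q 1"]
  by (simp add: right_diff_distrib)

lemma xg_Sx: "G.\<delta> (xg [^]\<^bsub>G\<^esub> i) \<star> Sx = Sx" for i :: nat
proof -
  have 1: "G.\<delta> (xg [^]\<^bsub>G\<^esub> i) \<star> Sx = (\<lambda>g. \<Sum>s<p. G.\<delta> (xg [^]\<^bsub>G\<^esub> (i + s)) g)"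
    using G.mult_lincomb[of "{..<p}" "\<lambda>s. G.\<delta> (xg [^]\<^bsub>G\<^esub> s)" "G.\<delta> (xg [^]\<^bsub>G\<^esub> i)" "\<lambda>_. 1"]
    by (simp add: Sx_eq G.\<delta>_\<delta> G.nat_pow_mult)
  have "(\<Sum>s<p. G.\<delta> (xg [^]\<^bsub>G\<^esub> (i + s)) g) = (\<Sum>s<p. G.\<delta> (xg [^]\<^bsub>G\<^esub> s) g)" for g
  proof (induction i)
    case (Suc i)
    have "G.\<delta> (xg [^]\<^bsub>G\<^esub> (i + p)) g = G.\<delta> (xg [^]\<^bsub>G\<^esub> i) g"
      by (simp add: G.nat_pow_mult[symmetric] xg_pow_p del: G.nat_pow_mult)
    then have "(\<Sum>s<p. G.\<delta> (xg [^]\<^bsub>G\<^esub> (i + Suc s)) g) = (\<Sum>s<p. G.\<delta> (xg [^]\<^bsub>G\<^esub> (i + s)) g)"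
      using sum.lessThan_Suc[of "\<lambda>s. G.\<delta> (xg [^]\<^bsub>G\<^esub> (i + s)) g" p]
        sum.lessThan_Suc_shift[of "\<lambda>s. G.\<delta> (xg [^]\<^bsub>G\<^esub> (i + s)) g" p] by simp
    then show ?case using Suc by simp
  qed simp
  then show ?thesis unfolding 1 by (simp add: Sx_eq)
qed

lemma Sx_yg: "Sx \<star> G.\<delta> yg = G.\<delta> yg \<star> Sx"
proof
  fix g
  have 1: "(Sx \<star> G.\<delta> yg) g = (\<Sum>s<p. G.\<delta> (nf 1 (m1 * s mod p)) g)"
  proof -
    have "Sx \<star> G.\<delta> yg = (\<lambda>g. \<Sum>s<p. (G.\<delta> (xg [^]\<^bsub>G\<^esub> s) \<star> G.\<delta> yg) g)"
      using G.lincomb_mult[of "{..<p}" "\<lambda>s. G.\<delta> (xg [^]\<^bsub>G\<^esub> s)" "G.\<delta> yg" "\<lambda>_. 1"]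
      by (simp add: Sx_eq)
    moreover have "xg [^]\<^bsub>G\<^esub> s \<otimes>\<^bsub>G\<^esub> yg = nf 1 (m1 * s mod p)" for s :: nat
      using xg_pow_yg[of s] nf_cong[of 1 1 "m1 * s" "m1 * s mod p"] by (simp add: nf_def cong_def)
    ultimately show ?thesis by (simp add: G.\<delta>_\<delta>)
  qed
  have 2: "(G.\<delta> yg \<star> Sx) g = (\<Sum>s<p. G.\<delta> (nf 1 s) g)"
    using G.mult_lincomb[of "{..<p}" "\<lambda>s. G.\<delta> (xg [^]\<^bsub>G\<^esub> s)" "G.\<delta> yg" "\<lambda>_. 1"]
    by (simp add: Sx_eq G.\<delta>_\<delta> nf_def)
  have "bij_betw (\<lambda>s. m1 * s mod p) {..<p} {..<p}"
  proof -
    have "inj_on (\<lambda>s. m1 * s mod p) {..<p}"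
    proof (rule inj_onI)
      fix s t assume st: "s \<in> {..<p}" "t \<in> {..<p}" "m1 * s mod p = m1 * t mod p"
      have "coprime m1 p" using prime_p not_dvd_m1 by (metis coprime_commute prime_imp_coprime)
      then have "[s = t] (mod p)" using st(3) by (simp add: cong_def[symmetric] cong_mult_lcancel_nat)
      then show "s = t" using st by (simp add: cong_def)
    qed
    moreover have "(\<lambda>s. m1 * s mod p) ` {..<p} \<subseteq> {..<p}" using p_ge_3 by auto
    ultimately show ?thesis by (simp add: bij_betw_def endo_inj_surj)
  qed
  from sum.reindex_bij_betw[OF this, of "\<lambda>s. G.\<delta> (nf 1 s) g"] show "(Sx \<star> G.\<delta> yg) g = (G.\<delta> yg \<star> Sx) g"
    unfolding 1 2 .
qed

lemma b1_eq: "b1 = (\<lambda>g. G.\<delta> yg g - G.\<delta> \<one>\<^bsub>G\<^esub> g)"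
  using G.gpoly_diff[of yg "monom 1 1" 1] ypoly_monom[of 1] ypoly_one
  by (simp add: b1_def monom_Suc one_pCons)

lemma Sx_b1: "Sx \<star> b1 = b1 \<star> Sx"
  using G.mult_plus[of "G.\<delta> yg" "\<lambda>g. -1 * G.\<delta> \<one>\<^bsub>G\<^esub> g" Sx] G.ZG.l_one[OF Sx_closed] G.ZG.r_one[OF Sx_closed]
  by (simp add: b1_eq G.minus_mult Sx_yg G.mult_scale[where k = "-1", simplified] G.ZG_scale_closed[where k = "-1", simplified])

text \<open>As x \<open>Sx\<close> = \<open>Sx\<close>, only the image of c in \<int>[<y>] matters,
  and the polynomial displays this image.\<close>

lemma mul_Sx:
  assumes c: "c \<in> carrier ZG"
  shows "c \<star> Sx = ypoly (\<Sum>j<p - 1. monom (\<Sum>i<p. c (nf j i)) j) \<star> Sx"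
proof
  fix g
  have nf: "G.\<delta> (nf j i) \<star> Sx = G.\<delta> (yg [^]\<^bsub>G\<^esub> j) \<star> Sx" for j i
    using mul_assoc[of "G.\<delta> (yg [^]\<^bsub>G\<^esub> j)" "G.\<delta> (xg [^]\<^bsub>G\<^esub> i)" Sx] by (simp add: nf_def G.\<delta>_\<delta> xg_Sx)
  have "(c \<star> Sx) g = (\<Sum>h\<in>carrier G. of_int (c h) * (G.\<delta> h \<star> Sx) g)"
    by (rule G.additive_ZG[of "\<lambda>c. (c \<star> Sx) g", OF _ c]) (simp add: G.plus_mult)
  also have "\<dots> = (\<Sum>j<p - 1. (\<Sum>i<p. c (nf j i)) * (G.\<delta> (yg [^]\<^bsub>G\<^esub> j) \<star> Sx) g)"
    by (simp add: sum_G nf sum_distrib_right)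
  also have "\<dots> = (ypoly (\<Sum>j<p - 1. monom (\<Sum>i<p. c (nf j i)) j) \<star> Sx) g"
    using G.lincomb_mult[of "{..<p - 1}" "\<lambda>s. G.\<delta> (yg [^]\<^bsub>G\<^esub> s)" Sx "\<lambda>j. \<Sum>i<p. c (nf j i)"]
    by (simp add: G.gpoly_sum G.gpoly_monom del: One_nat_def)
  finally show "(c \<star> Sx) g = (ypoly (\<Sum>j<p - 1. monom (\<Sum>i<p. c (nf j i)) j) \<star> Sx) g" .
qed

lemma nullmap_order_B: "nullmap ZG B B (\<lambda>b g. int (p - 1) * b g)"
proof -
  have "nullmap ZG B B (\<lambda>b. (\<lambda>g. int (p - 1) * G.\<delta> \<one>\<^bsub>G\<^esub> g) \<star> b)"
    using null_elems_order unfolding null_elems_def by blast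
  then show ?thesis
    by (rule nullmap_cong) (use G.ZG.l_one in \<open>simp add: G.scale_mult B_in_ZG\<close>)
qed

lemma null_elems_scalar:
  assumes "(\<lambda>g. e g - k * G.\<delta> \<one>\<^bsub>G\<^esub> g) \<in> null_elems" "e \<in> carrier ZG"
  shows "nullmap ZG B B (\<lambda>b g. (e \<star> b) g - k * b g)"
proof -
  have "nullmap ZG B B (\<lambda>b. (\<lambda>g. e g - k * G.\<delta> \<one>\<^bsub>G\<^esub> g) \<star> b)"
    using assms(1) by (simp add: null_elems_def)
  then show ?thesis
    by (rule nullmap_cong)
      (use G.ZG.l_one in \<open>simp add: assms(2) G.minus_mult G.scale_mult B_in_ZG G.ZG_scale_closed\<close>)
qed

text \<open>d sends \<open>b1 a\<close> to \<open>b1 c a\<close>, where c need not commute with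
  \<open>b1\<close>. Since \<open>Sx\<close> acts as the identity up to null maps, d may be studied
  on multiples of \<open>Sx\<close>. There c becomes a polynomial q in y, which commutes with
  \<open>b1\<close> and acts as q(1) up to null maps.\<close>

lemma B_end_scalar:
  assumes d: "linear ZG B B d"
  obtains k where "nullmap ZG B B (\<lambda>b g. d b g - k * b g)"
proof -
  obtain c where c: "c \<in> carrier ZG" "d b1 = b1 \<star> c" using linear_closed[OF d b1_mem] by (auto simp: B_carrier)
  define q :: "int poly" where "q = (\<Sum>j<p - 1. monom (\<Sum>i<p. c (nf j i)) j)"
  have cS: "c \<star> Sx = ypoly q \<star> Sx" unfolding q_def by (rule mul_Sx[OF c(1)])
  have SB: "Sx \<star> b \<in> carrier B" and dS: "d (Sx \<star> b) = (ypoly q \<star> Sx) \<star> b" if b: "b \<in> carrier B" for b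
  proof -
    obtain a where a: "a \<in> carrier ZG" "b = b1 \<star> a" using b by (auto simp: B_carrier)
    have Sb: "Sx \<star> b = b1 \<star> (Sx \<star> a)" using a Sx_b1 by (simp add: mul_assoc[symmetric])
    then show "Sx \<star> b \<in> carrier B" using a(1) by (simp add: b1_mul_mem)
    have "d (Sx \<star> b) = (b1 \<star> c) \<star> (Sx \<star> a)"
      using linear_act[OF d b1_mem, of "Sx \<star> a"] a(1) c(2) by (simp add: Sb)
    also have "\<dots> = b1 \<star> ((c \<star> Sx) \<star> a)" using a(1) c(1) by (simp add: mul_assoc)
    also have "\<dots> = (b1 \<star> ypoly q) \<star> (Sx \<star> a)" using a(1) by (simp add: cS mul_assoc)
    also have "\<dots> = ypoly q \<star> (b1 \<star> (Sx \<star> a))" using a(1) by (simp add: b1_def ypoly_comm[of _ q] mul_assoc)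
    also have "\<dots> = (ypoly q \<star> Sx) \<star> b" using a b by (simp add: Sb[symmetric] mul_assoc B_in_ZG)
    finally show "d (Sx \<star> b) = (ypoly q \<star> Sx) \<star> b" .
  qed
  have 1: "nullmap ZG B B (\<lambda>b g. (Sx \<star> b) g - 1 * b g)"
    by (rule null_elems_scalar) (use null_elems_Sx in simp_all)
  have dd: "d (\<lambda>g. (Sx \<star> b) g - 1 * b g) = (\<lambda>g. d (Sx \<star> b) g - d b g)" if b: "b \<in> carrier B" for b
    using linear_add[OF d SB[OF b] B_scale_closed[OF b, of "-1"]] linear_scale[OF d b, of "-1"] by simp
  have 2: "nullmap ZG B B (\<lambda>b g. ((ypoly q \<star> Sx) \<star> b) g - poly q 1 * b g)"
    by (rule null_elems_scalar[OF null_elems_ypoly_Sx]) simp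
  from nullmap_B_lin[OF nullmap_comp_left[OF 1 d] 2, of "-1" 1]
  have "nullmap ZG B B (\<lambda>b g. d b g - poly q 1 * b g)"
    by (rule nullmap_cong) (simp only: dd dS, simp)
  then show thesis by (rule that)
qed

text \<open>A factorisation through a free module gives \<open>k b1 = b1 c\<close> with c built from
  the coordinates of \<open>P b1\<close>. As \<open>b1 Sy = 0\<close>, these coordinates are killed
  by \<open>Sy\<close> on the right, so they and c have augmentation 0. But \<open>c - k\<close> is
  killed by \<open>b1\<close>, so its augmentation -k is divisible by p - 1.\<close>

lemma nullmap_scalar_B:
  assumes "nullmap ZG B B (\<lambda>b g. k * b g)" shows "int (p - 1) dvd k"
proof -
  obtain n :: nat and P Q where P: "linear ZG B (free_rmod ZG {..<n}) P"
    and Q: "linear ZG (free_rmod ZG {..<n}) B Q" and PQ: "\<And>b. b \<in> carrier B \<Longrightarrow> (\<lambda>g. k * b g) = Q (P b)"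
    using assms by (rule nullmapE) blast
  let ?e = "G.unit_vec" and ?w = "P b1"
  have w: "?w \<in> carrier (free_rmod ZG {..<n})" by (rule linear_closed[OF P b1_mem])
  have wi: "?w i \<in> carrier ZG" for i by (rule free_rmod_in_ring[OF G.ring_ZG w])
  have "?e i \<in> carrier (free_rmod ZG {..<n})" if "i < n" for i
    using that by (rule G.unit_vec_closed)
  then have "\<forall>i. \<exists>h. h \<in> carrier ZG \<and> (i < n \<longrightarrow> Q (?e i) = b1 \<star> h)"
    using linear_closed[OF Q] b1_closed by (metis B_carrier)
  then obtain h where h: "\<And>i. h i \<in> carrier ZG" "\<And>i. i < n \<Longrightarrow> Q (?e i) = b1 \<star> h i" by metis
  define c where "c = (\<lambda>g. \<Sum>i<n. 1 * (h i \<star> ?w i) g)"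
  have c: "c \<in> carrier ZG" unfolding c_def by (rule G.lincomb_closed) (simp add: h wi)
  have "(\<lambda>g. k * b1 g) = (\<lambda>g. \<Sum>i<n. (Q (?e i) \<star> ?w i) g)"
    using PQ[OF b1_mem] G.linear_free_expand[OF right_module_reg[OF G.ring_ZG] linear_comp[OF Q linear_B_reg], of "\<lambda>v. v _" ?w]
    by (auto simp: w fun_eq_iff)
  also have "\<dots> = (\<lambda>g. \<Sum>i<n. (b1 \<star> (h i \<star> ?w i)) g)"
    by (intro ext sum.cong refl) (simp only: lessThan_iff h mul_assoc b1_closed wi)
  also have "\<dots> = b1 \<star> c"
    using G.mult_lincomb[of "{..<n}" "\<lambda>i. h i \<star> ?w i" b1 "\<lambda>_. 1"] h wi by (simp add: c_def)
  finally have bc: "b1 \<star> c = (\<lambda>g. k * b1 g)" by simp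
  have "b1 \<star> (\<lambda>g. c g - k * G.\<delta> \<one>\<^bsub>G\<^esub> g) = (\<lambda>g. (b1 \<star> c) g - k * b1 g)"
    using G.mult_plus[of c "\<lambda>g. - k * G.\<delta> \<one>\<^bsub>G\<^esub> g" b1] G.mult_scale[of "G.\<delta> \<one>\<^bsub>G\<^esub>" b1 "- k"]
      G.ZG.r_one[OF b1_closed] c G.ZG_scale_closed[of "G.\<delta> \<one>\<^bsub>G\<^esub>" "- k"] by simp
  then have "int (p - 1) dvd G.\<epsilon> (\<lambda>g. c g - k * G.\<delta> \<one>\<^bsub>G\<^esub> g)"
    using c by (intro b1_mul_eq_0) (simp_all add: bc G.ZG_minus_closed G.ZG_scale_closed)
  also have "G.\<epsilon> (\<lambda>g. c g - k * G.\<delta> \<one>\<^bsub>G\<^esub> g) = G.\<epsilon> c - k"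
    using finite_G by (simp add: G.\<epsilon>_def sum_subtractf group_ring_elem_def sum_distrib_left[symmetric])
  finally have 1: "int (p - 1) dvd G.\<epsilon> c - k" .
  have "G.\<epsilon> (?w i) = 0" for i
  proof -
    have "?w i \<star> Sy = (\<lambda>g. 0)"
      using linear_act[OF P b1_mem Sy_closed] linear_zero[OF right_module_B right_module_free[OF G.ring_ZG] P]
      by (simp add: b1_Sy fun_eq_iff)
    then have "G.\<epsilon> (?w i) * G.\<epsilon> Sy = 0" using G.\<epsilon>_mult[OF wi[of i] Sy_closed] by (simp add: G.\<epsilon>_def)
    moreover have "G.\<epsilon> Sy = int (p - 1)" by (simp add: Sy_def G.\<epsilon>_gpoly poly_sum poly_monom)
    ultimately show ?thesis using p_ge_3 by simp
  qed
  then have "G.\<epsilon> (h i \<star> ?w i) = 0" for i using G.\<epsilon>_mult[OF h(1) wi] by simp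
  moreover have "G.\<epsilon> c = (\<Sum>i<n. G.\<epsilon> (h i \<star> ?w i))" unfolding c_def G.\<epsilon>_def by simp (rule sum.swap)
  ultimately show ?thesis using 1 by simp
qed

lemma ypoly_cyclic:
  assumes "[k = l] (mod (p - 1))" shows "ypoly (monom 1 k) = ypoly (monom 1 l)"
  unfolding ypoly_monom using pow_cong[OF yg_closed yg_pow_p assms] by simp

lemma monom_sum_power: "(\<Sum>t<s. monom 1 (r * t)) * (monom 1 r - 1) = (monom 1 (r * s) - 1 :: int poly)"
proof (induction s)
  case (Suc s)
  have "monom 1 (r * s) * (monom 1 r - 1) = (monom 1 (r * Suc s) - monom 1 (r * s) :: int poly)"
    by (simp add: right_diff_distrib mult_monom add.commute)
  then show ?case using Suc by (simp add: distrib_right)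
qed (simp add: monom_0 one_pCons)

text \<open>
  The automorphism is left multiplication by \<open>1 + y + \<dots> + y\<^bsup>r-1\<^esup>\<close>; if \<open>r s\<close> is \<open>1\<close> modulo
  the order of \<open>y\<close>, its inverse is left multiplication by \<open>1 + y\<^sup>r + \<dots> + y\<^bsup>r(s-1)\<^esup>\<close>.
\<close>

lemma B_automorphism:
  assumes k: "coprime k (int (p - 1))"
  obtains \<tau> \<tau>' where "linear ZG B B \<tau>" "linear ZG B B \<tau>'" "\<And>b. b \<in> carrier B \<Longrightarrow> \<tau>' (\<tau> b) = b"
    "\<And>b. b \<in> carrier B \<Longrightarrow> \<tau> (\<tau>' b) = b" "nullmap ZG B B (\<lambda>b g. \<tau> b g - k * b g)"
proof -
  define r where "r = nat (k mod int (p - 1))"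
  have N: "p - 1 > 1" using p_ge_3 by simp
  have r: "int r = k mod int (p - 1)" using N by (simp add: r_def)
  have "coprime (int r) (int (p - 1))" using k N unfolding r by (simp del: One_nat_def add: coprime_mod_left_iff)
  then have "coprime r (p - 1)" by (simp only: coprime_int_iff)
  then obtain s where s: "[r * s = 1] (mod (p - 1))" by (metis One_nat_def cong_solve_coprime_nat)
  define u v :: "int poly" where "u = (\<Sum>j<r. monom 1 j)" and "v = (\<Sum>t<s. monom 1 (r * t))"
  \<comment> \<open>The two factors are inverse to each other on \<open>B\<close>, that is after
    multiplication by y - 1, where their product telescopes to y^(rs) - 1.\<close>
  have uv: "ypoly (v * u * [:-1, 1:]) = b1"
  proof -
    have "v * u * [:-1, 1:] = v * ([:-1, 1:] * u)" by (simp only: mult_ac)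
    also have "\<dots> = monom 1 (r * s) - 1" unfolding u_def v_def geom_poly by (rule monom_sum_power)
    finally have "ypoly (v * u * [:-1, 1:]) = ypoly (monom 1 (r * s) - 1)" by simp
    also have "\<dots> = ypoly (monom 1 1 - 1)" by (simp only: G.gpoly_diff ypoly_cyclic[OF s])
    also have "monom 1 1 - 1 = ([:-1, 1:] :: int poly)" by (simp add: monom_Suc one_pCons)
    finally show ?thesis by (simp add: b1_def)
  qed
  have act: "ypoly q \<star> (b1 \<star> a) = ypoly (q * [:-1, 1:]) \<star> a" if "a \<in> carrier ZG" for q a
    using that by (simp only: b1_def ypoly_mult mul_assoc G.gpoly_closed yg_closed)
  have L: "linear ZG B B (\<lambda>b. ypoly q \<star> b)" for q
  proof (rule linearI)
    fix b assume b: "b \<in> carrier B"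
    then obtain a where a: "a \<in> carrier ZG" "b = b1 \<star> a" unfolding B_carrier by blast
    have "ypoly q \<star> b = b1 \<star> (ypoly q \<star> a)"
      using a by (simp add: b1_def ypoly_comm[of q] mul_assoc[symmetric])
    then show "ypoly q \<star> b \<in> carrier B" using a(1) by (simp add: b1_mul_mem)
    show "ypoly q \<star> (b \<triangleleft>\<^bsub>B\<^esub> c) = ypoly q \<star> b \<triangleleft>\<^bsub>B\<^esub> c" if "c \<in> carrier ZG" for c
      using that b by (simp add: mul_assoc B_in_ZG)
  qed (simp add: G.mult_plus B_in_ZG)
  have inverse: "ypoly q \<star> (ypoly q' \<star> b) = b" if q: "q * q' = v * u" and b: "b \<in> carrier B" for q q' b
  proof -
    obtain a where a: "a \<in> carrier ZG" "b = b1 \<star> a" using b unfolding B_carrier by blast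
    have "ypoly q \<star> (ypoly q' \<star> b) = ypoly (q * q') \<star> b" using b by (simp add: ypoly_mult mul_assoc B_in_ZG)
    then show ?thesis unfolding q a(2) act[OF a(1)] uv .
  qed
  have "nullmap ZG B B (\<lambda>b g. (ypoly u \<star> b) g - poly u 1 * b g)"
    using null_elems_ypoly[of "G.\<delta> \<one>\<^bsub>G\<^esub>" u] G.ZG.r_one[of "ypoly u"]
    by (intro null_elems_scalar) simp_all
  moreover have "poly u 1 = int r" by (simp add: u_def poly_sum poly_monom)
  ultimately have 1: "nullmap ZG B B (\<lambda>b g. (ypoly u \<star> b) g - int r * b g)" by simp
  \<comment> \<open>Left multiplication by \<open>u\<close> acts as r = u(1), and r differs from k
    by a multiple of p - 1, which is null on \<open>B\<close>.\<close>
  obtain t where t: "int r = k + int (p - 1) * t"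
    using cong_iff_lin[of k "int r" "int (p - 1)"] r by (auto simp: cong_def mult.commute)
  from nullmap_B_lin[OF 1 nullmap_order_B, of 1 t]
  have "nullmap ZG B B (\<lambda>b g. (ypoly u \<star> b) g - k * b g)"
    by (rule nullmap_cong) (simp only: t, simp add: algebra_simps)
  then show thesis
    using that[OF L L inverse inverse] by (simp add: mult.commute)
qed

text \<open>f and h act as integers k and l up to null maps, and \<open>nullmap_scalar_B\<close>
  gives k l = 1 modulo p - 1. So k is a unit there, and the automorphism realising it represents the
  class of f.\<close>

lemma B_unit:
  assumes f: "linear ZG B B f" and h: "linear ZG B B h" and null: "nullmap ZG B B (\<lambda>b g. h (f b) g - b g)"
  obtains \<tau> \<tau>' where "linear ZG B B \<tau>" "linear ZG B B \<tau>'" "\<And>b. b \<in> carrier B \<Longrightarrow> \<tau>' (\<tau> b) = b"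
    "\<And>b. b \<in> carrier B \<Longrightarrow> \<tau> (\<tau>' b) = b" "nullmap ZG B B (\<lambda>b g. f b g - \<tau> b g)"
proof -
  obtain k where k: "nullmap ZG B B (\<lambda>b g. f b g - k * b g)" by (rule B_end_scalar[OF f]) blast
  obtain l where l: "nullmap ZG B B (\<lambda>b g. h b g - l * b g)" by (rule B_end_scalar[OF h]) blast
  have hf: "h (\<lambda>g. f b g - k * b g) = (\<lambda>g. h (f b) g - k * h b g)" if b: "b \<in> carrier B" for b
    using linear_add[OF h linear_closed[OF f b] B_scale_closed[OF b, of "- k"]] linear_scale[OF h b, of "- k"] by simp
  note n1 = nullmap_comp_left[OF k h]
  from nullmap_B_lin[OF n1 l, of 1 k] have n2: "nullmap ZG B B (\<lambda>b g. h (f b) g - k * l * b g)"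
    by (rule nullmap_cong) (simp only: hf, simp add: algebra_simps)
  from nullmap_B_lin[OF n2 null, of "-1" 1] have "nullmap ZG B B (\<lambda>b g. (k * l - 1) * b g)"
    by (rule nullmap_cong) (simp add: algebra_simps)
  then have "int (p - 1) dvd k * l - 1" by (rule nullmap_scalar_B)
  then have "[k * l = 1] (mod int (p - 1))" by (simp only: cong_iff_dvd_diff)
  then have "coprime k (int (p - 1))" using coprime_iff_invertible_int by blast
  then obtain \<tau> \<tau>' where t: "linear ZG B B \<tau>" "linear ZG B B \<tau>'" "\<And>b. b \<in> carrier B \<Longrightarrow> \<tau>' (\<tau> b) = b"
    "\<And>b. b \<in> carrier B \<Longrightarrow> \<tau> (\<tau>' b) = b" "nullmap ZG B B (\<lambda>b g. \<tau> b g - k * b g)"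
    by (rule B_automorphism) blast
  from nullmap_B_lin[OF k t(5), of 1 "-1"] have "nullmap ZG B B (\<lambda>b g. f b g - \<tau> b g)"
    by (rule nullmap_cong) simp
  then show thesis using that[OF t(1-4)] by blast
qed

section \<open>The module \<open>R(2) \<oplus> [y - 1)\<close>\<close>

abbreviation R2 where "R2 \<equiv> R_row p m 2"

lemma ract_zs:
  assumes r: "r \<in> rows" shows "ract r (G.zs k) = (\<lambda>l. k * r l)"
proof (rule ev_inj_rows)
  have "Lam_act p m (ev r) (G.zs k) = (\<Sum>g\<in>carrier G. of_int (k * G.\<delta> \<one>\<^bsub>G\<^esub> g) * gact (ev r) g)"
    by (simp add: Lam_act_sum) (simp add: G.zs_def)
  also have "\<dots> = of_int k * Lam_act p m (ev r) (G.\<delta> \<one>\<^bsub>G\<^esub>)"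
    by (simp add: Lam_act_sum sum_distrib_left mult.assoc)
  finally show "ev (ract r (G.zs k)) = ev (\<lambda>l. k * r l)"
    by (simp add: ev_ract ev_scale Lam_act_delta gact_one ev_ZZ)
  show "ract r (G.zs k) \<in> rows" by (simp add: ract_rows)
  show "(\<lambda>l. k * r l) \<in> rows" using r by (simp add: rows_def)
qed

lemma R_row_scale_closed: "r \<in> carrier (R_row p m i) \<Longrightarrow> (\<lambda>l. k * r l) \<in> carrier (R_row p m i)"
  by (auto simp: R_row_carrier rows_def)

lemma R_row_neg: "r \<in> carrier (R_row p m i) \<Longrightarrow> \<ominus>\<^bsub>R_row p m i\<^esub> r = (\<lambda>l. - r l)"
proof -
  assume r: "r \<in> carrier (R_row p m i)"
  interpret R: right_module ZG "R_row p m i" by (rule right_module_R_row)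
  show ?thesis
    by (rule R.M.minus_equality) (use r R_row_scale_closed[OF r, of "-1"] in simp_all)
qed

lemma linear_R_row_scale: "linear ZG (R_row p m i) (R_row p m i) (\<lambda>r l. k * r l)"
proof (rule linearI)
  show "(\<lambda>l. k * (r \<triangleleft>\<^bsub>R_row p m i\<^esub> a) l) = (\<lambda>l. k * r l) \<triangleleft>\<^bsub>R_row p m i\<^esub> a"
    if "r \<in> carrier (R_row p m i)" "a \<in> carrier ZG" for r a
    by (simp add: ract_def sum_distrib_left mult.assoc)
qed (simp_all add: R_row_scale_closed distrib_left)

lemma nullmap_R2_B:
  assumes f: "linear ZG R2 B f" shows "nullmap ZG R2 B f"
proof -
  have "f (\<lambda>l. int p * r l) = (\<lambda>g. int p * f r g)" if r: "r \<in> carrier R2" for r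
    using linear_act[OF f r G.zs_closed[of "int p"]] r linear_closed[OF f r]
    by (simp add: ract_zs R_row_carrier G.mult_zs B_in_ZG)
  then have "nullmap ZG R2 B (\<lambda>r g. int p * f r g)"
    by (intro nullmap_cong[OF nullmap_comp_left[OF nullmap_p_R2 f]]) simp
  from nullmap_B_lin[OF this nullmap_comp_right[OF nullmap_order_B f], of 1 "-1"] show ?thesis
    by (rule nullmap_cong) (use p_ge_3 in \<open>simp add: of_nat_diff left_diff_distrib\<close>)
qed

lemma nullmap_R2_lin:
  assumes "nullmap ZG M R2 f" "nullmap ZG M R2 h"
  shows "nullmap ZG M R2 (\<lambda>v g. x * f v g + y * h v g)"
  using nullmap_plus[OF G.ring_ZG right_module_R_row nullmap_comp_left[OF assms(1) linear_R_row_scale, of x]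
      nullmap_comp_left[OF assms(2) linear_R_row_scale, of y]] by simp

lemma nullmap_B_R2:
  assumes f: "linear ZG B R2 f" shows "nullmap ZG B R2 f"
proof -
  have "f (\<lambda>g. int (p - 1) * b g) = (\<lambda>l. int (p - 1) * f b l)" if b: "b \<in> carrier B" for b
    using linear_act[OF f b G.zs_closed[of "int (p - 1)"]] b linear_closed[OF f b]
    by (simp add: ract_zs R_row_carrier G.mult_zs B_in_ZG)
  then have "nullmap ZG B R2 (\<lambda>b l. int (p - 1) * f b l)"
    by (intro nullmap_cong[OF nullmap_comp_left[OF nullmap_order_B f]]) simp
  from nullmap_R2_lin[OF nullmap_comp_right[OF nullmap_p_R2 f] this, of 1 "-1"] show ?thesis
    by (rule nullmap_cong) (use p_ge_3 in \<open>simp add: of_nat_diff left_diff_distrib\<close>)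
qed

abbreviation J where "J \<equiv> dsum R2 B"

lemma right_module_J: "right_module ZG J"
  by (rule right_module_dsum[OF right_module_R_row right_module_B])

text \<open>The coordinates are the row entries and the group coefficients. The first row entry is
  divided by p, since on R(2) it takes only values in p\<int> and the image would otherwise fail to
  be pure.\<close>

lemma J_embedding: "\<exists>n i. swan_embedding ZG J n i"
proof -
  obtain e where e: "bij_betw e {..<card (carrier G)} (carrier G)"
    using ex_bij_betw_nat_finite[OF finite_G] by (auto simp: atLeast0LessThan)
  define \<phi> :: "nat \<Rightarrow> (nat \<Rightarrow> int) \<times> (gen word set \<Rightarrow> int) \<Rightarrow> int" where
    "\<phi> k v = (if k = 0 then fst v 1 div int p else if k < p - 1 then fst v (Suc k) else snd v (e (k - (p - 1))))" for k v
  let ?n = "p - 1 + card (carrier G)"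
  have rows1: "r \<in> carrier R2 \<Longrightarrow> int p dvd r 1" for r by (simp add: R_row_carrier)
  \<comment> \<open>Injectivity and purity both pass from the coordinates to all entries, once for
    vanishing and once for divisibility; hence the predicate.\<close>
  have all_r: "P (r 1)" "\<And>l. l \<in> {2..p - 1} \<Longrightarrow> P (r l)" "\<And>g. g \<in> carrier G \<Longrightarrow> P (b g)"
    if *: "\<And>k. k < ?n \<Longrightarrow> P (\<phi> k (r, b))" and r1: "P (r 1 div int p) \<Longrightarrow> P (r 1)" for P r b
  proof -
    show "P (r 1)" using *[of 0] p_ge_3 r1 by (simp add: \<phi>_def)
    show "P (r l)" if l: "l \<in> {2..p - 1}" for l
    proof -
      have "l - 1 < ?n" "\<phi> (l - 1) (r, b) = r l" using l by (auto simp: \<phi>_def)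
      then show ?thesis using *[of "l - 1"] by simp
    qed
    fix g assume "g \<in> carrier G"
    then obtain k where k: "k < card (carrier G)" "g = e k" using e by (auto simp: bij_betw_def)
    then have "k + (p - 1) < ?n" "\<phi> (k + (p - 1)) (r, b) = b g" using p_ge_3 by (auto simp: \<phi>_def)
    then show "P (b g)" using *[of "k + (p - 1)"] by simp
  qed
  have "\<exists>i. swan_embedding ZG J ?n i"
  proof (rule G.swan_embedding_exists[OF right_module_J, of \<phi>])
    fix k v w assume "v \<in> carrier J" "w \<in> carrier J"
    then show "\<phi> k (v \<oplus>\<^bsub>J\<^esub> w) = \<phi> k v + \<phi> k w"
      using rows1 by (cases v; cases w) (auto simp: \<phi>_def div_plus_div_distrib_dvd_left)
  next
    fix v assume v: "v \<in> carrier J" and z: "\<And>k. k < ?n \<Longrightarrow> \<phi> k v = 0"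
    obtain r b where rb: "v = (r, b)" "r \<in> carrier R2" "b \<in> carrier B" using v by auto
    have 0: "r 1 = 0" "\<And>l. l \<in> {2..p - 1} \<Longrightarrow> r l = 0" "\<And>g. g \<in> carrier G \<Longrightarrow> b g = 0"
    proof -
      have *: "\<phi> k (r, b) = 0" if "k < ?n" for k using z[OF that] by (simp add: rb(1))
      have **: "r 1 div int p = 0 \<Longrightarrow> r 1 = 0" using rows1[OF rb(2)] by (metis dvd_div_eq_0_iff)
      show "r 1 = 0" using all_r(1)[of "\<lambda>x. x = 0" r b] * ** by blast
      show "r l = 0" if "l \<in> {2..p - 1}" for l using all_r(2)[of "\<lambda>x. x = 0" r b l] * ** that by blast
      show "b g = 0" if "g \<in> carrier G" for g using all_r(3)[of "\<lambda>x. x = 0" r b g] * ** that by blast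
    qed
    have "r l = 0" for l
      using rb(2) 0(1) 0(2)[of l] by (cases "l = 1"; cases "l \<in> {2..p - 1}") (auto simp: R_row_carrier rows_def)
    moreover have "b g = 0" for g using 0(3)[of g] G.ZG_outside[OF B_in_ZG[OF rb(3)], of g] by blast
    ultimately show "v = \<zero>\<^bsub>J\<^esub>" by (auto simp: rb(1))
  next
    fix v d assume v: "v \<in> carrier J" and d: "d \<noteq> 0" and dd: "\<And>k. k < ?n \<Longrightarrow> d dvd \<phi> k v"
    obtain r b where rb: "v = (r, b)" "r \<in> carrier R2" "b \<in> carrier B" using v by auto
    \<comment> \<open>Divisibility of the first coordinate gives this stronger statement, which
      keeps the quotient by d inside R(2).\<close>
    have r1: "d * int p dvd r 1" using dd[of 0] rows1[OF rb(2)] p_ge_3 rb(1) by (auto simp: \<phi>_def dvd_def)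
    have 1: "d dvd r 1" "\<And>l. l \<in> {2..p - 1} \<Longrightarrow> d dvd r l" "\<And>g. g \<in> carrier G \<Longrightarrow> d dvd b g"
      by (rule all_r[of "\<lambda>x. d dvd x" r b]; use dd r1 in \<open>auto simp: rb(1) dest: dvd_mult_left\<close>)+
    obtain b' where b': "b' \<in> carrier B" "b = (\<lambda>g. d * b' g)" using B_pure[OF rb(3) d 1(3)] by blast
    let ?r = "\<lambda>l. r l div d"
    have rl: "d * ?r l = r l" for l
      using rb(2) 1(1) 1(2)[of l] by (cases "l = 1"; cases "l \<in> {2..p - 1}") (auto simp: R_row_carrier rows_def)
    have "?r \<in> carrier R2"
    proof -
      have "int p dvd ?r 1" using r1 d rl[of 1] by (metis dvd_times_left_cancel_iff)
      then have "int p dvd ?r l" if "l < 2" for l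
        using that rb(2) by (cases "l = 1") (auto simp: R_row_carrier rows_def less_2_cases_iff)
      then show ?thesis using rb(2) by (auto simp: R_row_carrier rows_def)
    qed
    moreover have "ract ?r (G.zs d) = r"
      using ract_zs[of ?r d] \<open>?r \<in> carrier R2\<close> rl by (simp add: R_row_carrier)
    ultimately show "\<exists>u\<in>carrier J. v = u \<triangleleft>\<^bsub>J\<^esub> G.zs d"
      using b' by (intro bexI[of _ "(?r, b')"]) (auto simp: rb(1) G.mult_zs B_in_ZG)
  qed
  then show ?thesis by blast
qed

sublocale J: swan_lattice "G_group p m" J "(unit_row 2, \<lambda>g. 0)" "(\<lambda>l. 0, b1)"
proof (intro swan_lattice.intro gen_module.intro swan_lattice_axioms.intro G.fin_group_axioms
    G.ring_ZG right_module_J G.ZG_one_neq_zero J_embedding)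
  have z: "(\<lambda>g. 0) \<in> carrier B" "(\<lambda>l. 0) \<in> carrier R2"
    by (auto simp: B_iff R_row_carrier rows_def G.ZG.r_null[OF Sy_closed, simplified])
  then show "(unit_row 2, \<lambda>g. 0) \<in> carrier J" "(\<lambda>l. 0, b1) \<in> carrier J"
    using unit_row_R(1) b1_mem by simp_all
  show "\<forall>v\<in>carrier J. \<exists>a\<in>carrier ZG. \<exists>b\<in>carrier ZG.
      v = (unit_row 2, \<lambda>g. 0) \<triangleleft>\<^bsub>J\<^esub> a \<oplus>\<^bsub>J\<^esub> (\<lambda>l. 0, b1) \<triangleleft>\<^bsub>J\<^esub> b"
  proof
    fix v assume "v \<in> carrier J"
    then obtain r c where v: "v = (r, c)" "r \<in> carrier R2" "c \<in> carrier B" by auto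
    obtain q where q: "r = ract (unit_row 2) (xpoly q)" using R2_generated[OF v(2)] by blast
    obtain b where b: "b \<in> carrier ZG" "c = b1 \<star> b" using v(3) unfolding B_carrier by blast
    have "ract (\<lambda>l. 0) b = (\<lambda>l. 0)" by (simp add: ract_def)
    moreover have "(\<lambda>g. 0) \<star> xpoly q = (\<lambda>g. 0)" using G.ZG.l_null[OF xpoly_closed] by simp
    ultimately show "\<exists>a\<in>carrier ZG. \<exists>b\<in>carrier ZG.
        v = (unit_row 2, \<lambda>g. 0) \<triangleleft>\<^bsub>J\<^esub> a \<oplus>\<^bsub>J\<^esub> (\<lambda>l. 0, b1) \<triangleleft>\<^bsub>J\<^esub> b"
      using q b xpoly_closed by (intro bexI[of _ "xpoly q"] bexI[of _ b]) (simp_all add: v(1))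
  qed
qed

lemma J_minus:
  assumes "r \<in> carrier R2" "r' \<in> carrier R2" "b \<in> carrier B" "b' \<in> carrier B"
  shows "(r, b) \<ominus>\<^bsub>J\<^esub> (r', b') = (\<lambda>l. r l - r' l, \<lambda>g. b g - b' g)"
  using assms by (simp add: a_minus_def dsum_neg[OF right_module_R_row right_module_B] R_row_neg B_neg)

lemma nullmap_Pair:
  assumes f: "nullmap ZG M R2 f" and h: "nullmap ZG M B h"
  shows "nullmap ZG M J (\<lambda>v. (f v, h v))"
proof -
  have "nullmap ZG M J (\<lambda>v. (f v, \<zero>\<^bsub>B\<^esub>) \<oplus>\<^bsub>J\<^esub> (\<zero>\<^bsub>R2\<^esub>, h v))"
    by (rule nullmap_plus[OF G.ring_ZG right_module_J nullmap_comp_left[OF f linear_inl[OF right_module_B]]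
          nullmap_comp_left[OF h linear_inr[OF right_module_R_row]]])
  then show ?thesis by simp
qed

definition diag where "diag a \<tau> = (\<lambda>v\<in>carrier J. (\<lambda>l. a * fst v l, \<tau> (snd v)))"

lemma linear_diag:
  assumes "linear ZG B B \<tau>"
  shows "linear ZG J J (\<lambda>v. (\<lambda>l. a * fst v l, \<tau> (snd v)))"
  by (rule linear_Pair[OF linear_comp[OF linear_fst linear_R_row_scale] linear_comp[OF linear_snd assms]])

lemma diag_rhom: "linear ZG B B \<tau> \<Longrightarrow> diag a \<tau> \<in> rhom ZG J J"
  using restrict_rhom[OF right_module_J linear_diag[of \<tau> a]] by (simp only: diag_def)

lemma diag_app: "r \<in> carrier R2 \<Longrightarrow> b \<in> carrier B \<Longrightarrow> diag a \<tau> (r, b) = (\<lambda>l. a * r l, \<tau> b)"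
  by (simp add: diag_def)

lemma unit_class_diag:
  assumes c: "c \<in> carrier (der_aut ZG J)"
  obtains a \<tau> \<tau>' where "linear ZG B B \<tau>" "linear ZG B B \<tau>'" "\<And>b. b \<in> carrier B \<Longrightarrow> \<tau>' (\<tau> b) = b"
    "\<And>b. b \<in> carrier B \<Longrightarrow> \<tau> (\<tau>' b) = b" "c = der_map ZG J (diag a \<tau>)"
proof -
  obtain f h where f: "f \<in> rhom ZG J J" and h: "h \<in> rhom ZG J J" and cf: "c = der_map ZG J f"
    and null: "nullmap ZG J J (\<lambda>v. h (f v) \<ominus>\<^bsub>J\<^esub> v)"
    using J.der_autD[OF c] by blast
  note fl = rhom_linear[OF f] and hl = rhom_linear[OF h]
  note inl = linear_inl[OF right_module_B, of R2] and inr = linear_inr[OF right_module_R_row[of 2], of B]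
  let ?f11 = "\<lambda>r. fst (f (r, \<zero>\<^bsub>B\<^esub>))" and ?f21 = "\<lambda>r. snd (f (r, \<zero>\<^bsub>B\<^esub>))"
  let ?f12 = "\<lambda>b. fst (f (\<zero>\<^bsub>R2\<^esub>, b))" and ?f22 = "\<lambda>b. snd (f (\<zero>\<^bsub>R2\<^esub>, b))"
  let ?h21 = "\<lambda>r. snd (h (r, \<zero>\<^bsub>B\<^esub>))" and ?h22 = "\<lambda>b. snd (h (\<zero>\<^bsub>R2\<^esub>, b))"
  have f11: "linear ZG R2 R2 ?f11" and f21: "linear ZG R2 B ?f21"
    by (rule linear_comp[OF linear_comp[OF inl fl] linear_fst], rule linear_comp[OF linear_comp[OF inl fl] linear_snd])
  have f12: "linear ZG B R2 ?f12" and f22: "linear ZG B B ?f22"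
    by (rule linear_comp[OF linear_comp[OF inr fl] linear_fst], rule linear_comp[OF linear_comp[OF inr fl] linear_snd])
  have h21: "linear ZG R2 B ?h21" and h22: "linear ZG B B ?h22"
    by (rule linear_comp[OF linear_comp[OF inl hl] linear_snd], rule linear_comp[OF linear_comp[OF inr hl] linear_snd])
  have z: "(\<lambda>l. 0) \<in> carrier R2" "(\<lambda>g. 0) \<in> carrier B"
    using J.v1 J.v2 by simp_all
  have split_rb: "k (r, b) = k (r, \<zero>\<^bsub>B\<^esub>) \<oplus>\<^bsub>J\<^esub> k (\<zero>\<^bsub>R2\<^esub>, b)"
    if "linear ZG J J k" "r \<in> carrier R2" "b \<in> carrier B" for k r b
    using linear_add[OF that(1), of "(r, \<zero>\<^bsub>B\<^esub>)" "(\<zero>\<^bsub>R2\<^esub>, b)"] that(2,3) z by simp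
  have comps: "fst (k (r, b)) = (\<lambda>l. fst (k (r, \<zero>\<^bsub>B\<^esub>)) l + fst (k (\<zero>\<^bsub>R2\<^esub>, b)) l)"
    "snd (k (r, b)) = (\<lambda>g. snd (k (r, \<zero>\<^bsub>B\<^esub>)) g + snd (k (\<zero>\<^bsub>R2\<^esub>, b)) g)"
    if "linear ZG J J k" "r \<in> carrier R2" "b \<in> carrier B" for k r b
    using split_rb[OF that] by (cases "k (r, \<zero>\<^bsub>B\<^esub>)"; cases "k (\<zero>\<^bsub>R2\<^esub>, b)"; simp)+
  \<comment> \<open>\<open>R2_hom_scalar\<close> speaks of maps into R(1), so the block on R(2) is
    followed by the inclusion.\<close>
  have incl: "linear ZG R2 (R_row p m 1) (\<lambda>r. r)"
    using nullmap_linear[OF right_module_R_row nullmap_inclusion] .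
  obtain a where a: "\<And>r. r \<in> carrier R2 \<Longrightarrow> ?f11 r = (\<lambda>l. a * r l)"
    using R2_hom_scalar[OF linear_comp[OF f11 incl]] by blast
  have "nullmap ZG B B (\<lambda>b. snd (h (f (\<zero>\<^bsub>R2\<^esub>, b)) \<ominus>\<^bsub>J\<^esub> (\<zero>\<^bsub>R2\<^esub>, b)))"
    by (rule nullmap_comp_left[OF nullmap_comp_right[OF null inr] linear_snd])
  then have 1: "nullmap ZG B B (\<lambda>b g. snd (h (f (\<zero>\<^bsub>R2\<^esub>, b))) g - b g)"
  proof (rule nullmap_cong)
    fix b assume b: "b \<in> carrier B"
    have "h (f (\<zero>\<^bsub>R2\<^esub>, b)) \<in> carrier J" using b z by (intro linear_closed[OF hl] linear_closed[OF fl]) simp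
    then show "(\<lambda>g. snd (h (f (\<zero>\<^bsub>R2\<^esub>, b))) g - b g) = snd (h (f (\<zero>\<^bsub>R2\<^esub>, b)) \<ominus>\<^bsub>J\<^esub> (\<zero>\<^bsub>R2\<^esub>, b))"
      using b z by (cases "h (f (\<zero>\<^bsub>R2\<^esub>, b))") (simp add: J_minus)
  qed
  \<comment> \<open>The part of the composite that passes through R(2) is null, so the blocks of f
    and h on \<open>B\<close> are inverse up to null maps by themselves.\<close>
  have 2: "nullmap ZG B B (\<lambda>b. ?h21 (?f12 b))"
    by (rule nullmap_comp_right[OF nullmap_R2_B[OF h21] f12])
  from nullmap_B_lin[OF 1 2, of 1 "-1"] have "nullmap ZG B B (\<lambda>b g. ?h22 (?f22 b) g - b g)"
  proof (rule nullmap_cong)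
    fix b assume b: "b \<in> carrier B"
    have "f (\<zero>\<^bsub>R2\<^esub>, b) = (?f12 b, ?f22 b)" by simp
    then have "snd (h (f (\<zero>\<^bsub>R2\<^esub>, b))) = (\<lambda>g. ?h21 (?f12 b) g + ?h22 (?f22 b) g)"
      using comps(2)[OF hl linear_closed[OF f12 b] linear_closed[OF f22 b]] by simp
    then show "(\<lambda>g. ?h22 (?f22 b) g - b g) =
        (\<lambda>g. 1 * (snd (h (f (\<zero>\<^bsub>R2\<^esub>, b))) g - b g) + - 1 * ?h21 (?f12 b) g)" by simp
  qed
  from B_unit[OF f22 h22 this] obtain \<tau> \<tau>' where t: "linear ZG B B \<tau>" "linear ZG B B \<tau>'"
    "\<And>b. b \<in> carrier B \<Longrightarrow> \<tau>' (\<tau> b) = b" "\<And>b. b \<in> carrier B \<Longrightarrow> \<tau> (\<tau>' b) = b"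
    and n: "nullmap ZG B B (\<lambda>b g. ?f22 b g - \<tau> b g)" by blast
  have "nullmap ZG J B (\<lambda>v. ?f21 (fst v))" "nullmap ZG J B (\<lambda>v g. ?f22 (snd v) g - \<tau> (snd v) g)"
    by (rule nullmap_comp_right[OF nullmap_R2_B[OF f21] linear_fst], rule nullmap_comp_right[OF n linear_snd])
  from nullmap_B_lin[OF this, of 1 1]
  have n1: "nullmap ZG J B (\<lambda>v g. ?f21 (fst v) g + (?f22 (snd v) g - \<tau> (snd v) g))" by simp
  have n2: "nullmap ZG J R2 (\<lambda>v. ?f12 (snd v))"
    by (rule nullmap_comp_right[OF nullmap_B_R2[OF f12] linear_snd])
  from nullmap_Pair[OF n2 n1] have "nullmap ZG J J (\<lambda>v. f v \<ominus>\<^bsub>J\<^esub> diag a \<tau> v)"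
  proof (rule nullmap_cong)
    fix v assume "v \<in> carrier J"
    then obtain r b where v: "v = (r, b)" and r: "r \<in> carrier R2" and b: "b \<in> carrier B" by auto
    have fv: "f v = (\<lambda>l. a * r l + ?f12 b l, \<lambda>g. ?f21 r g + ?f22 b g)"
      using comps[OF fl r b] a[OF r] by (simp add: v prod_eq_iff)
    have "f v \<in> carrier J" unfolding v using r b by (intro linear_closed[OF fl]) simp
    then have "f v \<ominus>\<^bsub>J\<^esub> diag a \<tau> v = (\<lambda>l. a * r l + ?f12 b l - a * r l, \<lambda>g. ?f21 r g + ?f22 b g - \<tau> b g)"
      unfolding fv unfolding v diag_app[OF r b]
      using R_row_scale_closed[OF r] linear_closed[OF t(1) b] by (subst J_minus) auto
    then show "f v \<ominus>\<^bsub>J\<^esub> diag a \<tau> v = (?f12 (snd v), \<lambda>g. ?f21 (fst v) g + (?f22 (snd v) g - \<tau> (snd v) g))"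
      by (simp add: v algebra_simps)
  qed
  then have "c = der_map ZG J (diag a \<tau>)"
    unfolding cf using J.der_map_eq_iff[OF f diag_rhom[OF t(1)]] by simp
  with t show thesis by (rule that)
qed

text \<open>e is 1 or -1, so \<open>diag e \<tau>\<close> has the inverse
  \<open>diag e \<tau>'\<close>; it differs from \<open>diag a \<tau>\<close> by a multiple of p on
  R(2), which is null.\<close>

lemma diag_class_lift:
  assumes t: "linear ZG B B \<tau>" "linear ZG B B \<tau>'" "\<And>b. b \<in> carrier B \<Longrightarrow> \<tau>' (\<tau> b) = b"
    "\<And>b. b \<in> carrier B \<Longrightarrow> \<tau> (\<tau>' b) = b" and a: "int p dvd a - e" and e: "e * e = 1"
  shows "der_map ZG J (diag a \<tau>) \<in> der_map ZG J ` carrier (rmod_aut ZG J)"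
proof -
  obtain s where s: "a = e + int p * s" using a by (metis add.commute diff_add_cancel dvdE)
  have ee: "e * (e * x) = x" for x using e by (simp add: mult.assoc[symmetric])
  have "restrict (\<lambda>v. (\<lambda>l. e * fst v l, \<tau> (snd v))) (carrier J) \<in> carrier (rmod_aut ZG J)"
    by (rule J.rmod_autI[OF linear_diag[OF t(1)] linear_diag[OF t(2), of e]]) (auto simp: ee t(3,4))
  then have "diag e \<tau> \<in> carrier (rmod_aut ZG J)" by (simp only: diag_def)
  moreover have "nullmap ZG J J (\<lambda>v. diag a \<tau> v \<ominus>\<^bsub>J\<^esub> diag e \<tau> v)"
  proof (rule nullmap_cong)
    have "nullmap ZG J R2 (\<lambda>v l. s * (int p * fst v l))"
      by (rule nullmap_comp_right[OF nullmap_comp_left[OF nullmap_p_R2 linear_R_row_scale] linear_fst])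
    from nullmap_Pair[OF this nullmap_zero[OF G.ring_ZG right_module_B]]
    show "nullmap ZG J J (\<lambda>v. (\<lambda>l. s * (int p * fst v l), \<zero>\<^bsub>B\<^esub>))" .
    fix v assume "v \<in> carrier J"
    then obtain r b where v: "v = (r, b)" and r: "r \<in> carrier R2" and b: "b \<in> carrier B" by auto
    show "diag a \<tau> v \<ominus>\<^bsub>J\<^esub> diag e \<tau> v = (\<lambda>l. s * (int p * fst v l), \<zero>\<^bsub>B\<^esub>)"
      unfolding v diag_app[OF r b] using R_row_scale_closed[OF r] linear_closed[OF t(1) b]
      by (subst J_minus) (simp_all add: r b, simp add: s algebra_simps)
  qed
  ultimately show ?thesis using J.der_map_eq_iff[OF diag_rhom[OF t(1)] diag_rhom[OF t(1)], of a e] by blast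
qed

end

section \<open>Integral matrices\<close>

text \<open>Pairs (j, i) are coded as j N + i. All block matrices below are indexed in this
  way.\<close>

lemma sum_div_mod:
  fixes f :: "nat \<Rightarrow> nat \<Rightarrow> 'a :: comm_monoid_add"
  assumes "0 < N"
  shows "(\<Sum>c<n * N. f (c div N) (c mod N)) = (\<Sum>j<n. \<Sum>i<N. f j i)"
proof -
  have "(\<Sum>j<n. \<Sum>i<N. f j i) = (\<Sum>(j, i)\<in>{..<n} \<times> {..<N}. f j i)" by (rule sum.cartesian_product)
  also have "\<dots> = (\<Sum>c<n * N. f (c div N) (c mod N))"
  proof (rule sum.reindex_bij_witness[of _ "\<lambda>c. (c div N, c mod N)" "\<lambda>(j, i). j * N + i"], goal_cases)
    case (2 a)
    obtain j i where a: "a = (j, i)" by (cases a) blast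
    then have ji: "j < n" "i < N" using 2 by auto
    then have "j * N + i < Suc j * N" by simp
    also have "\<dots> \<le> n * N" using ji by (intro mult_le_mono1) simp
    finally show ?case by (simp add: a)
  qed (use assms in \<open>auto simp: less_mult_imp_div_less\<close>)
  finally show ?thesis by simp
qed

text \<open>Only block preserving permutations contribute to the determinant modulo \<open>d\<close>.\<close>

lemma det_cong_triangular:
  fixes A B :: "int mat" and b :: "nat \<Rightarrow> nat"
  assumes A: "A \<in> carrier_mat n n" and B: "B \<in> carrier_mat n n"
    and low: "\<And>i j. i < n \<Longrightarrow> j < n \<Longrightarrow> b j < b i \<Longrightarrow> d dvd A $$ (i, j) \<and> d dvd B $$ (i, j)"
    and diag: "\<And>i j. i < n \<Longrightarrow> j < n \<Longrightarrow> b j = b i \<Longrightarrow> [A $$ (i, j) = B $$ (i, j)] (mod d)"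
  shows "[det A = det B] (mod d)"
  unfolding det_def'[OF A] det_def'[OF B]
proof (intro cong_sum cong_mult cong_refl)
  fix \<pi> assume "\<pi> \<in> {\<pi>. \<pi> permutes {0..<n}}"
  then have \<pi>: "\<pi> permutes {0..<n}" by simp
  have \<pi>n: "\<pi> i < n" if "i < n" for i using permutes_in_image[OF \<pi>, of i] that by simp
  show "[(\<Prod>i = 0..<n. A $$ (i, \<pi> i)) = (\<Prod>i = 0..<n. B $$ (i, \<pi> i))] (mod d)"
  proof (cases "\<exists>i<n. b (\<pi> i) < b i")
    case True
    then obtain i where i: "i \<in> {0..<n}" "b (\<pi> i) < b i" by auto
    have "d dvd (\<Prod>i = 0..<n. A $$ (i, \<pi> i))" "d dvd (\<Prod>i = 0..<n. B $$ (i, \<pi> i))"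
      using low[of i "\<pi> i"] i \<pi>n[of i] by (auto intro!: dvd_prod_eqI dvd_trans[OF _ dvd_prodI[OF finite_atLeastLessThan i(1)]])
    then show ?thesis by (simp add: cong_def)
  next
    case False
    \<comment> \<open>A permutation preserves the sum of the block numbers, so one that lowers no
      block number preserves each of them.\<close>
    have s: "(\<Sum>i = 0..<n. b (\<pi> i)) = (\<Sum>i = 0..<n. b i)" by (rule sum.permute[OF \<pi>, symmetric, unfolded comp_def])
    have "b (\<pi> i) = b i" if "i < n" for i
    proof (rule ccontr)
      assume "b (\<pi> i) \<noteq> b i"
      then have "(\<Sum>i = 0..<n. b i) < (\<Sum>i = 0..<n. b (\<pi> i))"
        using False that by (intro sum_strict_mono_ex1) (force simp: not_less order_less_le)+
      then show False using s by simp
    qed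
    then show ?thesis using \<pi>n diag by (intro cong_prod) auto
  qed
qed

lemma det_unimodular:
  fixes A :: "int mat"
  assumes "A \<in> carrier_mat n n" "B \<in> carrier_mat n n" "A * B = 1\<^sub>m n"
  shows "\<bar>det A\<bar> = 1"
proof -
  have "det A * det B = 1" using det_mult[OF assms(1,2)] assms(3) by simp
  then show ?thesis by (auto simp: zmult_eq_1_iff)
qed

lemma right_inverse_mat:
  fixes M :: "nat \<Rightarrow> nat \<Rightarrow> int"
  assumes "\<And>y. \<exists>x. \<forall>r<k. (\<Sum>c<q. M r c * x c) = y r"
  obtains Y where "\<And>r r'. r < k \<Longrightarrow> r' < k \<Longrightarrow> (\<Sum>c<q. M r c * Y c r') = (if r = r' then 1 else 0)"
proof -
  have "\<forall>r'. \<exists>x. \<forall>r<k. (\<Sum>c<q. M r c * x c) = (if r = r' then 1 else 0)" by (intro allI assms)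
  then obtain x where "\<forall>r'. \<forall>r<k. (\<Sum>c<q. M r c * x r' c) = (if r = r' then 1 else 0)" by metis
  then show thesis using that[of "\<lambda>c r'. x r' c"] by simp
qed

lemma det_surj:
  fixes M :: "nat \<Rightarrow> nat \<Rightarrow> int"
  assumes "\<And>y. \<exists>x. \<forall>r<k. (\<Sum>c<k. M r c * x c) = y r"
  shows "\<bar>det (mat k k (\<lambda>(r, c). M r c))\<bar> = 1"
proof -
  obtain Y where Y: "\<And>r r'. r < k \<Longrightarrow> r' < k \<Longrightarrow> (\<Sum>c<k. M r c * Y c r') = (if r = r' then 1 else 0)"
    using right_inverse_mat[where M = M, OF assms] by blast
  show ?thesis
  proof (rule det_unimodular)
    show "mat k k (\<lambda>(r, c). M r c) * mat k k (\<lambda>(r, c). Y r c) = 1\<^sub>m k"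
      using Y by (intro eq_matI) (auto simp: scalar_prod_def atLeast0LessThan)
  qed simp_all
qed

text \<open>Both sides of \<open>k = q\<close> are the trace of \<open>M Y\<close>, where \<open>Y\<close> is the inverse of \<open>M\<close>.\<close>

lemma bijective_square:
  fixes M :: "nat \<Rightarrow> nat \<Rightarrow> int"
  assumes surj: "\<And>y. \<exists>x. \<forall>r<k. (\<Sum>c<q. M r c * x c) = y r"
    and inj: "\<And>x c. (\<And>r. r < k \<Longrightarrow> (\<Sum>c<q. M r c * x c) = 0) \<Longrightarrow> c < q \<Longrightarrow> x c = 0"
  shows "k = q"
proof -
  obtain Y where Y: "\<And>r r'. r < k \<Longrightarrow> r' < k \<Longrightarrow> (\<Sum>c<q. M r c * Y c r') = (if r = r' then 1 else 0)"
    using right_inverse_mat[where M = M, OF surj] by blast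
  have YM: "(\<Sum>r<k. Y c r * M r c') = (if c = c' then 1 else 0)" if c: "c < q" "c' < q" for c c'
  proof -
    \<comment> \<open>A column of \<open>Y M - 1\<close>. It lies in the kernel of \<open>M\<close>
      because \<open>M Y = 1\<close>, so injectivity makes \<open>Y\<close> a left inverse
      too.\<close>
    let ?x = "\<lambda>c. (\<Sum>r<k. Y c r * M r c') - (if c = c' then 1 else 0)"
    have "(\<Sum>c<q. M r c * ?x c) = 0" if r: "r < k" for r
    proof -
      have "(\<Sum>c<q. M r c * (\<Sum>r'<k. Y c r' * M r' c')) = (\<Sum>r'<k. (\<Sum>c<q. M r c * Y c r') * M r' c')"
        by (simp add: sum_distrib_left sum_distrib_right mult.assoc) (rule sum.swap)
      also have "\<dots> = (\<Sum>r'<k. if r' = r then M r' c' else 0)"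
        using Y[OF r] by (intro sum.cong) auto
      also have "\<dots> = M r c'" using r by simp
      finally have "(\<Sum>c<q. M r c * (\<Sum>r'<k. Y c r' * M r' c')) = M r c'" .
      moreover have "(\<Sum>c<q. M r c * (if c = c' then 1 else 0)) = M r c'"
        using c(2) by (simp add: if_distrib[of "\<lambda>x. _ * x"] cong: if_cong)
      ultimately show ?thesis by (simp add: right_diff_distrib sum_subtractf)
    qed
    then have "?x c = 0" using inj[of ?x c] c(1) by blast
    then show ?thesis by simp
  qed
  have "int k = (\<Sum>r<k. \<Sum>c<q. M r c * Y c r)" using Y by simp
  also have "\<dots> = (\<Sum>c<q. \<Sum>r<k. Y c r * M r c)" by (subst sum.swap) (simp add: mult.commute)
  also have "\<dots> = int q" using YM by simp
  finally show ?thesis by simp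
qed

section \<open>Lattices with coordinates\<close>

text \<open>
  The coordinates of an element with respect to a \<open>\<int>\<close>-basis are \<open>\<kappa> w \<beta>\<close> with \<open>\<beta> < N\<close>, and
  \<open>a\<close> acts on row vectors by the matrix \<open>L a\<close>.
\<close>

locale lattice_rep = fin_group G for G :: "'g monoid" (structure) +
  fixes W :: "('g \<Rightarrow> int, 'w) rmodule" and \<kappa> :: "'w \<Rightarrow> nat \<Rightarrow> int"
    and L :: "('g \<Rightarrow> int) \<Rightarrow> nat \<Rightarrow> nat \<Rightarrow> int" and N :: nat
  assumes W: "right_module (group_ring G) W" and N: "0 < N"
    and \<kappa>_add: "\<And>w w' \<beta>. w \<in> carrier W \<Longrightarrow> w' \<in> carrier W \<Longrightarrow> \<kappa> (w \<oplus>\<^bsub>W\<^esub> w') \<beta> = \<kappa> w \<beta> + \<kappa> w' \<beta>"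
    and \<kappa>_act: "\<And>w a \<beta>. w \<in> carrier W \<Longrightarrow> a \<in> carrier (group_ring G) \<Longrightarrow> \<beta> < N \<Longrightarrow>
      \<kappa> (w \<triangleleft>\<^bsub>W\<^esub> a) \<beta> = (\<Sum>\<alpha><N. \<kappa> w \<alpha> * L a \<alpha> \<beta>)"
    and \<kappa>_surj: "\<And>r. \<exists>w\<in>carrier W. \<forall>\<beta><N. \<kappa> w \<beta> = r \<beta>"
    and \<kappa>_inj: "\<And>w w'. w \<in> carrier W \<Longrightarrow> w' \<in> carrier W \<Longrightarrow> (\<And>\<beta>. \<beta> < N \<Longrightarrow> \<kappa> w \<beta> = \<kappa> w' \<beta>) \<Longrightarrow> w = w'"
begin

text \<open>Identifies Hom(\<Lambda>^n, W) with the integral vectors of length n N: one block of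
  coordinates for the image of each unit vector.\<close>

definition coords :: "((nat \<Rightarrow> 'g \<Rightarrow> int) \<Rightarrow> 'w) \<Rightarrow> nat \<Rightarrow> int"
  where "coords \<phi> c = \<kappa> (\<phi> (unit_vec (c div N))) (c mod N)"

text \<open>The linear form on these vectors that evaluates a homomorphism at \<open>f\<close> and
  takes coordinate \<beta>, see \<open>coord_expand\<close>.\<close>

definition row :: "(nat \<Rightarrow> 'g \<Rightarrow> int) \<Rightarrow> nat \<Rightarrow> nat \<Rightarrow> int"
  where "row f \<beta> c = L (f (c div N)) (c mod N) \<beta>"

lemma coord_expand:
  assumes \<phi>: "linear ZG (free_rmod ZG {..<n::nat}) W \<phi>" and f: "f \<in> carrier (free_rmod ZG {..<n})"
    and \<beta>: "\<beta> < N"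
  shows "\<kappa> (\<phi> f) \<beta> = (\<Sum>c<n * N. row f \<beta> c * coords \<phi> c)"
proof -
  have "\<kappa> (\<phi> f) \<beta> = (\<Sum>j<n. \<kappa> (\<phi> (unit_vec j) \<triangleleft>\<^bsub>W\<^esub> f j) \<beta>)"
    by (rule linear_free_expand[OF W \<phi>, of "\<lambda>w. \<kappa> w \<beta>"]) (simp_all add: \<kappa>_add f)
  also have "\<dots> = (\<Sum>j<n. \<Sum>\<alpha><N. \<kappa> (\<phi> (unit_vec j)) \<alpha> * L (f j) \<alpha> \<beta>)"
    using linear_closed[OF \<phi> unit_vec_closed] free_rmod_in_ring[OF ring_ZG f] \<beta>
    by (intro sum.cong refl \<kappa>_act) auto
  also have "\<dots> = (\<Sum>c<n * N. row f \<beta> c * coords \<phi> c)"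
    unfolding row_def coords_def by (subst sum_div_mod[OF N]) (simp add: mult.commute)
  finally show ?thesis .
qed

lemma coords_ex:
  obtains \<phi> where "linear ZG (free_rmod ZG {..<n::nat}) W \<phi>" "\<And>c. c < n * N \<Longrightarrow> coords \<phi> c = x c"
proof -
  have "\<forall>j. \<exists>w. w \<in> carrier W \<and> (\<forall>\<beta><N. \<kappa> w \<beta> = x (j * N + \<beta>))"
    using \<kappa>_surj[of "\<lambda>\<beta>. x (j * N + \<beta>)" for j] by blast
  then obtain w where w: "\<And>j. w j \<in> carrier W" "\<And>j \<beta>. \<beta> < N \<Longrightarrow> \<kappa> (w j) \<beta> = x (j * N + \<beta>)" by metis
  obtain \<phi> where \<phi>: "linear ZG (free_rmod ZG {..<n}) W \<phi>" "\<And>i. i < n \<Longrightarrow> \<phi> (unit_vec i) = w i"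
    using linear_free_ex[OF W, of n w] w(1) by blast
  have "coords \<phi> c = x c" if "c < n * N" for c
    using that N by (simp add: coords_def \<phi>(2) less_mult_imp_div_less w(2))
  with \<phi>(1) show thesis by (rule that)
qed

lemma coords_zero:
  assumes \<phi>: "linear ZG (free_rmod ZG {..<n::nat}) W \<phi>" and z: "\<And>c. c < n * N \<Longrightarrow> coords \<phi> c = 0"
    and f: "f \<in> carrier (free_rmod ZG {..<n})"
  shows "\<phi> f = \<zero>\<^bsub>W\<^esub>"
proof -
  interpret W: right_module ZG W by (rule W)
  have "\<kappa> \<zero>\<^bsub>W\<^esub> \<beta> = 0" for \<beta> using \<kappa>_add[of "\<zero>\<^bsub>W\<^esub>" "\<zero>\<^bsub>W\<^esub>" \<beta>] by simp
  then show ?thesis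
    using z by (intro \<kappa>_inj linear_closed[OF \<phi> f]) (simp_all add: coord_expand[OF \<phi> f])
qed

end

section \<open>The presentation of a trivial Swan class\<close>

text \<open>The data that \<open>swan_trivialD\<close> delivers for the representative
  \<open>diag a \<tau>\<close>: an exact sequence together with the extension property of
  \<open>i\<close>.\<close>

locale diag_presentation = metacyclic +
  fixes a :: int and \<tau> \<tau>' :: "(gen word set \<Rightarrow> int) \<Rightarrow> gen word set \<Rightarrow> int" and l n :: nat
    and i :: "(nat \<Rightarrow> int) \<times> (gen word set \<Rightarrow> int) \<Rightarrow> nat \<Rightarrow> gen word set \<Rightarrow> int"
    and s :: "((nat \<Rightarrow> int) \<times> (gen word set \<Rightarrow> int)) \<times> (nat \<Rightarrow> gen word set \<Rightarrow> int) \<Rightarrow> nat \<Rightarrow> gen word set \<Rightarrow> int"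
  assumes \<tau>: "linear ZG B B \<tau>" "linear ZG B B \<tau>'" "\<And>b. b \<in> carrier B \<Longrightarrow> \<tau>' (\<tau> b) = b"
      "\<And>b. b \<in> carrier B \<Longrightarrow> \<tau> (\<tau>' b) = b"
    and i: "linear ZG J (free_rmod ZG {..<l}) i"
    and i_ext: "\<And>\<theta>. linear ZG J (reg ZG) \<theta> \<Longrightarrow>
      \<exists>\<Theta>. linear ZG (free_rmod ZG {..<l}) (reg ZG) \<Theta> \<and> (\<forall>v\<in>carrier J. \<Theta> (i v) = \<theta> v)"
    and s: "linear ZG (dsum J (free_rmod ZG {..<l})) (free_rmod ZG {..<n}) s"
    and s_surj: "s ` carrier (dsum J (free_rmod ZG {..<l})) = carrier (free_rmod ZG {..<n})"
    and s_ker: "\<And>v w. v \<in> carrier J \<Longrightarrow> w \<in> carrier (free_rmod ZG {..<l}) \<Longrightarrow>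
      s (v, w) = \<zero>\<^bsub>free_rmod ZG {..<n}\<^esub> \<longleftrightarrow>
      (\<exists>u\<in>carrier J. v = diag a \<tau> u \<and> w = \<ominus>\<^bsub>free_rmod ZG {..<l}\<^esub> i u)"
begin

abbreviation F where "F k \<equiv> free_rmod ZG {..<k::nat}"

lemma right_module_F: "right_module ZG (F k)"
  by (rule right_module_free[OF G.ring_ZG])

lemma diag_closed: "u \<in> carrier J \<Longrightarrow> diag a \<tau> u \<in> carrier J"
  by (rule linear_closed[OF rhom_linear[OF diag_rhom[OF \<tau>(1)]]])

lemma s_inl: "linear ZG J (F n) (\<lambda>v. s (v, \<zero>\<^bsub>F l\<^esub>))"
  by (rule linear_comp[OF linear_inl[OF right_module_F] s])

lemma s_inr: "linear ZG (F l) (F n) (\<lambda>w. s (\<zero>\<^bsub>J\<^esub>, w))"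
  by (rule linear_comp[OF linear_inr[OF right_module_J] s])

lemma s_split:
  assumes "v \<in> carrier J" "w \<in> carrier (F l)"
  shows "s (v, w) = s (v, \<zero>\<^bsub>F l\<^esub>) \<oplus>\<^bsub>F n\<^esub> s (\<zero>\<^bsub>J\<^esub>, w)"
proof -
  interpret J': right_module ZG J by (rule right_module_J)
  interpret F': right_module ZG "F l" by (rule right_module_F)
  have "(v, w) = (v, \<zero>\<^bsub>F l\<^esub>) \<oplus>\<^bsub>dsum J (F l)\<^esub> (\<zero>\<^bsub>J\<^esub>, w)"
    using J'.M.r_zero[OF assms(1)] F'.M.l_zero[OF assms(2)] by simp
  then show ?thesis
    using linear_add[OF s, of "(v, \<zero>\<^bsub>F l\<^esub>)" "(\<zero>\<^bsub>J\<^esub>, w)"] assms J'.M.zero_closed F'.M.zero_closed by simp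
qed

lemma s_diag:
  assumes u: "u \<in> carrier J" shows "s (diag a \<tau> u, \<zero>\<^bsub>F l\<^esub>) = s (\<zero>\<^bsub>J\<^esub>, i u)"
proof -
  interpret Fn: right_module ZG "F n" by (rule right_module_F)
  interpret Fl: right_module ZG "F l" by (rule right_module_F)
  have iu: "i u \<in> carrier (F l)" by (rule linear_closed[OF i u])
  have "s (diag a \<tau> u, \<ominus>\<^bsub>F l\<^esub> i u) = \<zero>\<^bsub>F n\<^esub>"
    using s_ker[OF diag_closed[OF u] Fl.M.a_inv_closed[OF iu]] u by blast
  then have "s (diag a \<tau> u, \<zero>\<^bsub>F l\<^esub>) \<oplus>\<^bsub>F n\<^esub> \<ominus>\<^bsub>F n\<^esub> s (\<zero>\<^bsub>J\<^esub>, i u) = \<zero>\<^bsub>F n\<^esub>"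
    using s_split[OF diag_closed[OF u] Fl.M.a_inv_closed[OF iu]]
      linear_neg[OF right_module_F right_module_F s_inr iu] by metis
  then show ?thesis
    using linear_closed[OF s_inl diag_closed[OF u]] linear_closed[OF s_inr iu]
    by (rule Fn.M.eq_if_minus_eq_zero[rotated 2, unfolded a_minus_def])
qed

text \<open>Exactness of Hom(-, W) at the middle term: the compatibility condition says that the map
  on J \<oplus> \<Lambda>^l vanishes on the kernel of \<open>s\<close>, so it factors through
  \<open>s\<close>.\<close>

lemma lift:
  assumes W: "right_module ZG W" and \<theta>: "linear ZG J W \<theta>" "linear ZG (F l) W \<theta>'"
    and eq: "\<And>u. u \<in> carrier J \<Longrightarrow> \<theta> (diag a \<tau> u) = \<theta>' (i u)"
  obtains \<phi> where "linear ZG (F n) W \<phi>"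
    "\<And>v. v \<in> carrier J \<Longrightarrow> \<phi> (s (v, \<zero>\<^bsub>F l\<^esub>)) = \<theta> v" "\<And>w. w \<in> carrier (F l) \<Longrightarrow> \<phi> (s (\<zero>\<^bsub>J\<^esub>, w)) = \<theta>' w"
proof -
  interpret W: right_module ZG W by (rule W)
  interpret J': right_module ZG J by (rule right_module_J)
  interpret Fl: right_module ZG "F l" by (rule right_module_F)
  have "linear ZG (dsum J (F l)) W (\<lambda>x. \<theta> (fst x) \<oplus>\<^bsub>W\<^esub> \<theta>' (snd x))"
    by (rule linear_plus[OF W linear_comp[OF linear_fst \<theta>(1)] linear_comp[OF linear_snd \<theta>(2)]])
  then obtain \<phi> where \<phi>: "linear ZG (F n) W \<phi>"
    "\<And>x. x \<in> carrier (dsum J (F l)) \<Longrightarrow> \<phi> (s x) = \<theta> (fst x) \<oplus>\<^bsub>W\<^esub> \<theta>' (snd x)"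
  proof (rule factor_through_surj[OF right_module_dsum[OF right_module_J right_module_F] right_module_F W s s_surj])
    fix x assume x: "x \<in> carrier (dsum J (F l))" "s x = \<zero>\<^bsub>F n\<^esub>"
    obtain v w where vw: "x = (v, w)" "v \<in> carrier J" "w \<in> carrier (F l)" using x(1) by (cases x) (simp del: mem_Times_iff)
    obtain u where u: "u \<in> carrier J" "v = diag a \<tau> u" "w = \<ominus>\<^bsub>F l\<^esub> i u"
      using s_ker[OF vw(2,3)] x(2) unfolding vw(1) by blast
    have iu: "i u \<in> carrier (F l)" by (rule linear_closed[OF i u(1)])
    have "\<theta> v \<oplus>\<^bsub>W\<^esub> \<theta>' w = \<zero>\<^bsub>W\<^esub>"
      unfolding u(2,3) eq[OF u(1)] linear_neg[OF right_module_F W \<theta>(2) iu]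
      by (rule W.M.r_neg[OF linear_closed[OF \<theta>(2) iu]])
    then show "\<theta> (fst x) \<oplus>\<^bsub>W\<^esub> \<theta>' (snd x) = \<zero>\<^bsub>W\<^esub>" by (simp add: vw(1))
  qed blast
  have z: "\<theta> \<zero>\<^bsub>J\<^esub> = \<zero>\<^bsub>W\<^esub>" "\<theta>' \<zero>\<^bsub>F l\<^esub> = \<zero>\<^bsub>W\<^esub>"
    by (rule linear_zero[OF right_module_J W \<theta>(1)], rule linear_zero[OF right_module_F W \<theta>(2)])
  show thesis
  proof (rule that[OF \<phi>(1)])
    show "\<phi> (s (v, \<zero>\<^bsub>F l\<^esub>)) = \<theta> v" if "v \<in> carrier J" for v
    proof -
      have "(v, \<zero>\<^bsub>F l\<^esub>) \<in> carrier (dsum J (F l))" using that Fl.M.zero_closed by simp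
      from \<phi>(2)[OF this] show ?thesis
        using W.M.r_zero[OF linear_closed[OF \<theta>(1) that]] by (simp only: fst_conv snd_conv z)
    qed
    show "\<phi> (s (\<zero>\<^bsub>J\<^esub>, w)) = \<theta>' w" if "w \<in> carrier (F l)" for w
    proof -
      have "(\<zero>\<^bsub>J\<^esub>, w) \<in> carrier (dsum J (F l))" using that J'.M.zero_closed by simp
      from \<phi>(2)[OF this] show ?thesis
        using W.M.l_zero[OF linear_closed[OF \<theta>(2) that]] by (simp only: fst_conv snd_conv z)
    qed
  qed
qed

lemma diag_apply: "u \<in> carrier J \<Longrightarrow> diag a \<tau> u = (\<lambda>k. a * fst u k, \<tau> (snd u))"
  by (simp add: diag_def)

text \<open>The rows of the matrix over \<Lambda> that describes the component \<Lambda>^l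
  \<rightarrow> \<Lambda>^n of \<open>s\<close>.\<close>

definition Amat :: "nat \<Rightarrow> nat \<Rightarrow> gen word set \<Rightarrow> int"
  where "Amat k = s (\<zero>\<^bsub>J\<^esub>, G.unit_vec k)"

lemma Amat_closed: "k < l \<Longrightarrow> Amat k \<in> carrier (F n)"
  unfolding Amat_def by (rule linear_closed[OF s_inr G.unit_vec_closed])

text \<open>Composition with \<Lambda>^l \<rightarrow> \<Lambda>^n becomes, in coordinates, the
  integral matrix obtained by applying the representation on W to the entries of
  \<open>Amat\<close>.\<close>

lemma rep_composite:
  assumes W: "lattice_rep G W \<kappa> L N" and \<phi>: "linear ZG (F n) W \<phi>" and r: "r < l * N"
  shows "lattice_rep.coords G \<kappa> N (\<lambda>w. \<phi> (s (\<zero>\<^bsub>J\<^esub>, w))) r =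
    (\<Sum>c<n * N. lattice_rep.row L N (Amat (r div N)) (r mod N) c * lattice_rep.coords G \<kappa> N \<phi> c)"
proof -
  interpret W: lattice_rep "G_group p m" W \<kappa> L N by (rule W)
  have "r div N < l" using r by (rule less_mult_imp_div_less)
  then show ?thesis
    using W.coord_expand[OF \<phi> Amat_closed, of "r div N" "r mod N"] W.N
    unfolding W.coords_def[of "\<lambda>w. \<phi> (s (\<zero>\<^bsub>J\<^esub>, w))"] by (simp add: Amat_def)
qed

end

context metacyclic
begin

section \<open>The two representations\<close>

sublocale R1: lattice_rep "G_group p m" "R_row p m 1" "\<lambda>r \<beta>. r (Suc \<beta>)"
  "\<lambda>a \<alpha> \<beta>. lam_mat p m a (Suc \<alpha>) (Suc \<beta>)" "p - 1"
proof (intro lattice_rep.intro lattice_rep_axioms.intro G.fin_group_axioms right_module_R_row)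
  show "0 < p - 1" using p_ge_3 by simp
  show "(r \<oplus>\<^bsub>R_row p m 1\<^esub> r') (Suc \<beta>) = r (Suc \<beta>) + r' (Suc \<beta>)" for r r' \<beta> by simp
  show "(r \<triangleleft>\<^bsub>R_row p m 1\<^esub> a) (Suc \<beta>) = (\<Sum>\<alpha><p - 1. r (Suc \<alpha>) * lam_mat p m a (Suc \<alpha>) (Suc \<beta>))" for r a \<beta>
    unfolding R_row_simps ract_def by (rule sum.atLeast1_atMost_eq[unfolded One_nat_def[symmetric]])
  show "\<exists>w\<in>carrier (R_row p m 1). \<forall>\<beta><p - 1. w (Suc \<beta>) = r \<beta>" for r
    by (rule bexI[of _ "\<lambda>k. if k \<in> {1..p - 1} then r (k - 1) else 0"]) (auto simp: R_row_carrier rows_def)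
  fix w w' assume w: "w \<in> carrier (R_row p m 1)" "w' \<in> carrier (R_row p m 1)"
    and eq: "\<And>\<beta>. \<beta> < p - 1 \<Longrightarrow> w (Suc \<beta>) = w' (Suc \<beta>)"
  show "w = w'"
  proof
    fix k show "w k = w' k"
      using w eq[of "k - 1"] by (cases "k \<in> {1..p - 1}") (auto simp: R_row_carrier rows_def)
  qed
qed

abbreviation WC where "WC \<equiv> right_ideal ZG Sx"

text \<open>The coefficient of y^j in the image of a in \<int>[<y>]. The index is read modulo p - 1,
  so that a difference \<beta> - \<alpha> can be written as
  \<open>\<beta> + (p - 1) - \<alpha>\<close> in the natural numbers.\<close>

definition ycoeff :: "(gen word set \<Rightarrow> int) \<Rightarrow> nat \<Rightarrow> int"
  where "ycoeff a j = (\<Sum>i<p. a (nf (j mod (p - 1)) i))"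

text \<open>Powers of x fix \<open>Sx\<close> from either side, and conjugation by y permutes the
  powers of x.\<close>

lemma Sx_central: "c \<in> carrier ZG \<Longrightarrow> Sx \<star> c = c \<star> Sx"
proof
  fix g assume c: "c \<in> carrier ZG"
  have y: "Sx \<star> G.\<delta> (yg [^]\<^bsub>G\<^esub> j) = G.\<delta> (yg [^]\<^bsub>G\<^esub> j) \<star> Sx" for j :: nat
  proof (induction j)
    case 0
    show ?case using G.ZG.r_one[OF Sx_closed] G.ZG.l_one[OF Sx_closed] by simp
  next
    case (Suc j)
    have e: "G.\<delta> (yg [^]\<^bsub>G\<^esub> Suc j) = G.\<delta> (yg [^]\<^bsub>G\<^esub> j) \<star> G.\<delta> yg" by (simp add: G.\<delta>_\<delta>)
    have "Sx \<star> G.\<delta> (yg [^]\<^bsub>G\<^esub> Suc j) = G.\<delta> (yg [^]\<^bsub>G\<^esub> j) \<star> (Sx \<star> G.\<delta> yg)"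
      unfolding e using Suc by (simp add: mul_assoc[symmetric])
    then show ?case unfolding e Sx_yg by (simp add: mul_assoc)
  qed
  have x: "Sx \<star> G.\<delta> (xg [^]\<^bsub>G\<^esub> i) = Sx" for i :: nat
    using G.gpoly_mult[OF xg_closed, of "\<Sum>i<p. monom 1 i" "monom 1 i"]
      G.gpoly_mult[OF xg_closed, of "monom 1 i" "\<Sum>i<p. monom 1 i"] xg_Sx[of i]
    by (simp add: Sx_def[symmetric] G.gpoly_monom mult.commute)
  have d: "Sx \<star> G.\<delta> (nf j i) = G.\<delta> (nf j i) \<star> Sx" for j i
  proof -
    have e: "G.\<delta> (nf j i) = G.\<delta> (yg [^]\<^bsub>G\<^esub> j) \<star> G.\<delta> (xg [^]\<^bsub>G\<^esub> i)" by (simp add: nf_def G.\<delta>_\<delta>)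
    have "Sx \<star> G.\<delta> (nf j i) = G.\<delta> (yg [^]\<^bsub>G\<^esub> j) \<star> (Sx \<star> G.\<delta> (xg [^]\<^bsub>G\<^esub> i))"
      unfolding e by (simp add: mul_assoc[symmetric] y)
    then show ?thesis unfolding e x by (simp add: mul_assoc xg_Sx)
  qed
  have "(Sx \<star> c) g = (\<Sum>h\<in>carrier G. of_int (c h) * (Sx \<star> G.\<delta> h) g)"
    by (rule G.additive_ZG[of "\<lambda>c. (Sx \<star> c) g", OF _ c]) (simp add: G.mult_plus)
  also have "\<dots> = (\<Sum>h\<in>carrier G. of_int (c h) * (G.\<delta> h \<star> Sx) g)" by (simp add: sum_G d)
  also have "\<dots> = (c \<star> Sx) g"
    by (rule G.additive_ZG[of "\<lambda>c. (c \<star> Sx) g", OF _ c, symmetric]) (simp add: G.plus_mult)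
  finally show "(Sx \<star> c) g = (c \<star> Sx) g" .
qed

lemma WC_carrier: "w \<in> carrier WC \<longleftrightarrow> (\<exists>c\<in>carrier ZG. w = c \<star> Sx)"
  by (auto simp: G.right_ideal_carrier Sx_central)

lemma WC_in_ZG: "w \<in> carrier WC \<Longrightarrow> w \<in> carrier ZG"
  by (auto simp: WC_carrier)

lemma WC_act_nf:
  assumes "w \<in> carrier WC" shows "w \<star> G.\<delta> (nf j i) = w \<star> G.\<delta> (yg [^]\<^bsub>G\<^esub> j)"
proof -
  obtain c where c: "c \<in> carrier ZG" "w = c \<star> Sx" using assms WC_carrier by blast
  have "Sx \<star> G.\<delta> (nf j i) = Sx \<star> G.\<delta> (yg [^]\<^bsub>G\<^esub> j)"
    using xg_Sx[of i] by (simp add: Sx_central nf_def G.\<delta>_\<delta>[symmetric] mul_assoc)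
  then show ?thesis using c by (simp add: mul_assoc)
qed

lemma inv_pow_nf:
  assumes "j < p - 1" "\<beta> < p - 1"
  shows "nf \<beta> 0 \<otimes>\<^bsub>G\<^esub> inv\<^bsub>G\<^esub> (yg [^]\<^bsub>G\<^esub> j) = nf ((\<beta> + (p - 1) - j) mod (p - 1)) 0"
proof -
  have "nf ((\<beta> + (p - 1) - j) mod (p - 1)) 0 \<otimes>\<^bsub>G\<^esub> yg [^]\<^bsub>G\<^esub> j = nf (\<beta> + (p - 1) - j) 0 \<otimes>\<^bsub>G\<^esub> yg [^]\<^bsub>G\<^esub> j"
    using nf_cong[of "(\<beta> + (p - 1) - j) mod (p - 1)" "\<beta> + (p - 1) - j" 0 0] by (simp add: cong_def)
  also have "\<dots> = nf (\<beta> + (p - 1)) 0" using assms by (simp add: nf_def G.nat_pow_mult)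
  also have "\<dots> = nf \<beta> 0" by (rule nf_cong) (simp_all add: cong_def)
  finally show ?thesis using G.inv_solve_right'[of "nf ((\<beta> + (p - 1) - j) mod (p - 1)) 0" "nf \<beta> 0" "yg [^]\<^bsub>G\<^esub> j"]
    by simp
qed

lemma cyclic_reflect:
  fixes \<beta> N j :: nat
  assumes "\<beta> < N" "j < N" shows "(\<beta> + N - (\<beta> + N - j) mod N) mod N = j"
proof (cases "j \<le> \<beta>")
  case True
  then have "\<beta> + N - j = (\<beta> - j) + N" by simp
  then have "(\<beta> + N - j) mod N = \<beta> - j" using assms by (metis mod_add_self2 mod_less less_imp_diff_less)
  then show ?thesis using True assms by simp
next
  case False
  then have "(\<beta> + N - j) mod N = \<beta> + N - j" using assms by simp
  then show ?thesis using False assms by simp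
qed

lemma sum_cyclic:
  fixes f :: "nat \<Rightarrow> nat \<Rightarrow> int"
  assumes "\<beta> < N"
  shows "(\<Sum>j<N. f j ((\<beta> + N - j) mod N)) = (\<Sum>\<alpha><N. f ((\<beta> + N - \<alpha>) mod N) \<alpha>)"
  by (rule sum.reindex_bij_witness[of _ "\<lambda>j. (\<beta> + N - j) mod N" "\<lambda>j. (\<beta> + N - j) mod N"])
    (use assms cyclic_reflect in auto)

text \<open>x acts trivially on multiples of \<open>Sx\<close>, so the action factors through
  \<int>[<y>] and is a cyclic convolution.\<close>

lemma WC_act:
  assumes w: "w \<in> carrier WC" and a: "a \<in> carrier ZG" and \<beta>: "\<beta> < p - 1"
  shows "(w \<star> a) (nf \<beta> 0) = (\<Sum>\<alpha><p - 1. w (nf \<alpha> 0) * ycoeff a (\<beta> + (p - 1) - \<alpha>))"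
proof -
  note wR = WC_in_ZG[OF w]
  have "(w \<star> a) (nf \<beta> 0) = (\<Sum>h\<in>carrier G. of_int (a h) * (w \<star> G.\<delta> h) (nf \<beta> 0))"
    by (rule G.additive_ZG[of "\<lambda>a. (w \<star> a) (nf \<beta> 0)", OF _ a]) (simp add: G.mult_plus wR)
  also have "\<dots> = (\<Sum>j<p - 1. (\<Sum>i<p. a (nf j i)) * (w \<star> G.\<delta> (yg [^]\<^bsub>G\<^esub> j)) (nf \<beta> 0))"
    by (simp add: sum_G WC_act_nf[OF w] sum_distrib_right)
  also have "\<dots> = (\<Sum>j<p - 1. ycoeff a j * w (nf ((\<beta> + (p - 1) - j) mod (p - 1)) 0))"
  proof (intro sum.cong refl arg_cong2[of _ _ _ _ "(*)"])
    fix j assume j: "j \<in> {..<p - 1}"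
    show "(\<Sum>i<p. a (nf j i)) = ycoeff a j" using j by (simp add: ycoeff_def)
    show "(w \<star> G.\<delta> (yg [^]\<^bsub>G\<^esub> j)) (nf \<beta> 0) = w (nf ((\<beta> + (p - 1) - j) mod (p - 1)) 0)"
      using j by (subst G.mult_\<delta>) (simp_all only: wR inv_pow_nf[OF _ \<beta>] lessThan_iff nf_closed yg_closed G.nat_pow_closed)
  qed
  also have "\<dots> = (\<Sum>\<alpha><p - 1. ycoeff a ((\<beta> + (p - 1) - \<alpha>) mod (p - 1)) * w (nf \<alpha> 0))"
    by (rule sum_cyclic[OF \<beta>])
  also have "\<dots> = (\<Sum>\<alpha><p - 1. w (nf \<alpha> 0) * ycoeff a (\<beta> + (p - 1) - \<alpha>))"
    by (simp add: ycoeff_def mult.commute)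
  finally show ?thesis .
qed

sublocale WC: lattice_rep "G_group p m" WC "\<lambda>w \<beta>. w (nf \<beta> 0)"
  "\<lambda>a \<alpha> \<beta>. ycoeff a (\<beta> + (p - 1) - \<alpha>)" "p - 1"
proof (intro lattice_rep.intro lattice_rep_axioms.intro G.fin_group_axioms G.right_module_right_ideal Sx_closed)
  show "0 < p - 1" using p_ge_3 by simp
  show "(w \<oplus>\<^bsub>WC\<^esub> w') (nf \<beta> 0) = w (nf \<beta> 0) + w' (nf \<beta> 0)" for w w' \<beta> by simp
  show "(w \<triangleleft>\<^bsub>WC\<^esub> a) (nf \<beta> 0) = (\<Sum>\<alpha><p - 1. w (nf \<alpha> 0) * ycoeff a (\<beta> + (p - 1) - \<alpha>))"
    if "w \<in> carrier WC" "a \<in> carrier ZG" "\<beta> < p - 1" for w a \<beta>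
    using WC_act[OF that] by simp
  show "\<exists>w\<in>carrier WC. \<forall>\<beta><p - 1. w (nf \<beta> 0) = r \<beta>" for r
  proof (intro bexI allI impI)
    \<comment> \<open>The polynomial in y with the prescribed coefficients. \<open>Sx\<close> is
      supported on the powers of x, so multiplying by it does not disturb the values at the powers
      of y.\<close>
    let ?c = "\<lambda>g. \<Sum>j<p - 1. r j * G.\<delta> (yg [^]\<^bsub>G\<^esub> j) g"
    have c: "?c \<in> carrier ZG" by (rule G.lincomb_closed) simp
    then show "?c \<star> Sx \<in> carrier WC" by (auto simp: WC_carrier)
    fix \<beta> assume \<beta>: "\<beta> < p - 1"
    have Sx_nf: "Sx (nf k 0) = (if k = 0 then 1 else 0)" if "k < p - 1" for k
    proof -
      have "Sx (nf k 0) = (\<Sum>s<p. if k = 0 \<and> s = 0 then 1 else 0)"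
        unfolding Sx_eq
      proof (rule sum.cong[OF refl])
        fix s assume s: "s \<in> {..<p}"
        have "nf k 0 = nf 0 s \<longleftrightarrow> k = 0 \<and> s = 0"
          using nf_inj[of k 0 0 s] that s p_ge_3 by auto
        then show "G.\<delta> (xg [^]\<^bsub>G\<^esub> s) (nf k 0) = (if k = 0 \<and> s = 0 then 1 else 0)"
          by (simp add: group_ring_elem_def nf_def)
      qed
      then show ?thesis using p_ge_3 by (cases "k = 0") auto
    qed
    have "(?c \<star> Sx) (nf \<beta> 0) = (\<Sum>j<p - 1. r j * (Sx \<star> G.\<delta> (yg [^]\<^bsub>G\<^esub> j)) (nf \<beta> 0))"
      using G.lincomb_mult[of "{..<p - 1}" "\<lambda>j. G.\<delta> (yg [^]\<^bsub>G\<^esub> j)" Sx r] by (simp add: Sx_central del: One_nat_def)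
    also have "\<dots> = (\<Sum>j<p - 1. r j * Sx (nf ((\<beta> + (p - 1) - j) mod (p - 1)) 0))"
      by (intro sum.cong refl, subst G.mult_\<delta>)
        (simp_all only: Sx_closed inv_pow_nf[OF _ \<beta>] lessThan_iff nf_closed yg_closed G.nat_pow_closed)
    also have "\<dots> = (\<Sum>\<alpha><p - 1. r ((\<beta> + (p - 1) - \<alpha>) mod (p - 1)) * Sx (nf \<alpha> 0))"
      by (rule sum_cyclic[OF \<beta>])
    also have "\<dots> = (\<Sum>\<alpha>\<in>{0}. r ((\<beta> + (p - 1) - \<alpha>) mod (p - 1)) * Sx (nf \<alpha> 0))"
      by (intro sum.mono_neutral_right) (use p_ge_3 in \<open>auto simp: Sx_nf\<close>)
    also have "\<dots> = r \<beta>"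
    proof -
      have 1: "(\<beta> + (p - 1) - 0) mod (p - 1) = \<beta>" by (simp only: diff_zero mod_add_self2 mod_less[OF \<beta>])
      have "Sx (nf 0 0) = 1" using Sx_nf[of 0] p_ge_3 by simp
      moreover have "(\<Sum>\<alpha>\<in>{0::nat}. f \<alpha>) = f 0" for f :: "nat \<Rightarrow> int" by simp
      ultimately show ?thesis by (simp only: 1 mult_1_right)
    qed
    finally show "(?c \<star> Sx) (nf \<beta> 0) = r \<beta>" .
  qed
  fix w w' assume w: "w \<in> carrier WC" "w' \<in> carrier WC"
    and eq: "\<And>\<beta>. \<beta> < p - 1 \<Longrightarrow> w (nf \<beta> 0) = w' (nf \<beta> 0)"
  have val: "v (nf j i) = v (nf j 0)" if v: "v \<in> carrier WC" for v j i
  proof -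
    have e: "nf j i \<otimes>\<^bsub>G\<^esub> inv\<^bsub>G\<^esub> (nf 0 i) = nf j 0" by (simp add: nf_def G.m_assoc)
    have "v \<star> G.\<delta> (nf 0 i) = v" using WC_act_nf[OF v, of 0 i] G.ZG.r_one[OF WC_in_ZG[OF v]] by simp
    then have "v (nf j i) = (v \<star> G.\<delta> (nf 0 i)) (nf j i)" by simp
    also have "\<dots> = v (nf j 0)" using G.mult_\<delta>[OF nf_closed WC_in_ZG[OF v] nf_closed, of 0 i j i] e by simp
    finally show ?thesis .
  qed
  show "w = w'"
  proof
    fix g
    show "w g = w' g"
    proof (cases "g \<in> carrier G")
      case True
      then obtain j i where "j < p - 1" "g = nf j i" using nf_ex by blast
      then show ?thesis using eq[of j] val[OF w(1), of j i] val[OF w(2), of j i] by simp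
    qed (simp add: G.ZG_outside[OF WC_in_ZG[OF w(1)]] G.ZG_outside[OF WC_in_ZG[OF w(2)]])
  qed
qed

text \<open>\<open>Sx\<close> kills R(2), because the powers of \<zeta> sum to 0, but it acts as p
  on \<open>WC\<close>, where p can be cancelled.\<close>

lemma hom_R2_WC:
  assumes h: "linear ZG R2 WC h" and r: "r \<in> carrier R2"
  shows "h r = (\<lambda>g. 0)"
proof -
  have rr: "r \<in> rows" using r by (simp add: R_row_carrier)
  have "(\<zeta> - 1) * (\<Sum>s<p. \<zeta> ^ s) = 0" using geometric_sum[of \<zeta> p] zeta_pow_p pi_neq_0
    by (simp add: power_diff_1_eq[symmetric])
  then have "ip (\<Sum>i<p. monom 1 i) \<zeta> = 0" using pi_neq_0 by (simp add: ip_sum ip_monom)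
  moreover have "Sx = xpoly (\<Sum>i<p. monom 1 i)" by (simp only: Sx_def G.gpoly_def xpoly_def)
  ultimately have "ev (ract r Sx) = 0"
    by (simp only: ev_ract[OF xpoly_closed] Lam_act_xpoly[OF ev_ZZ] mult_zero_right)
  then have "ev (ract r Sx) = ev (\<lambda>k. 0)" by (simp add: ev_def[of "\<lambda>k. 0"])
  then have "ract r Sx = (\<lambda>k. 0)"
    using ev_inj_rows[OF ract_rows[OF Sx_closed], of "\<lambda>k. 0"] by (simp add: rows_def)
  then have "h r \<star> Sx = (\<lambda>g. 0)"
    using linear_act[OF h r Sx_closed] linear_zero[OF right_module_R_row WC.W h] by simp
  moreover have "h r \<star> Sx = (\<lambda>g. int p * h r g)"
  proof -
    have w: "h r \<in> carrier WC" by (rule linear_closed[OF h r])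
    have "h r \<star> G.\<delta> (xg [^]\<^bsub>G\<^esub> s) = h r" for s :: nat
      using WC_act_nf[OF w, of 0 s] G.ZG.r_one[OF WC_in_ZG[OF w]] by (simp add: nf_def)
    then show ?thesis
      using G.mult_lincomb[of "{..<p}" "\<lambda>s. G.\<delta> (xg [^]\<^bsub>G\<^esub> s)" "h r" "\<lambda>_. 1"] WC_in_ZG[OF w]
      by (simp add: Sx_eq)
  qed
  ultimately show ?thesis using p_ge_3 by (simp add: fun_eq_iff)
qed

section \<open>Comparison of the determinants modulo \<open>p\<close>\<close>

lemma psi_ycoeff: "psi t a = (\<Sum>j<p - 1. ycoeff a j * int t ^ j)"
  unfolding psi_def ycoeff_def by (simp add: sum_distrib_right)

lemma m1_power_order: "[int (m1 ^ k) ^ (p - 1) = 1] (mod int p)"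
proof -
  have "[(m1 ^ k) ^ (p - 1) = 1] (mod p)"
    using fermat_theorem[OF prime_p not_dvd_power[OF not_dvd_m1]] .
  then show ?thesis using cong_int_iff by (metis of_nat_1 of_nat_power)
qed

text \<open>Modulo p the powers of t form a left eigenvector of the circulant matrix of a, with
  eigenvalue \<open>psi t a\<close>; the hypothesis on t makes its powers depend on the exponent
  modulo p - 1 only.\<close>

lemma vandermonde_act:
  assumes "\<alpha> < p - 1" and "[int t ^ (p - 1) = 1] (mod int p)"
  shows "[(\<Sum>\<beta><p - 1. int t ^ \<beta> * ycoeff a (\<beta> + (p - 1) - \<alpha>)) = int t ^ \<alpha> * psi t a] (mod int p)"
proof -
  define N where "N = p - 1"
  have \<alpha>: "\<alpha> < N" and t: "[int t ^ N = 1] (mod int p)" using assms by (simp_all only: N_def)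
  have yc: "ycoeff a (k mod N) = ycoeff a k" for k by (simp add: ycoeff_def N_def)
  have red: "[int t ^ k = int t ^ (k mod N)] (mod int p)" for k
  proof -
    have "int t ^ k = (int t ^ N) ^ (k div N) * int t ^ (k mod N)"
      by (simp only: power_mult[symmetric] power_add[symmetric] mult_div_mod_eq)
    also have "[\<dots> = 1 ^ (k div N) * int t ^ (k mod N)] (mod int p)"
      by (intro cong_mult cong_pow t cong_refl)
    finally show ?thesis by simp
  qed
  have "(\<Sum>\<beta><N. int t ^ \<beta> * ycoeff a (\<beta> + N - \<alpha>)) =
      (\<Sum>j<N. int t ^ ((\<alpha> + j) mod N) * ycoeff a j)"
  proof (rule sum.reindex_bij_witness[of _ "\<lambda>j. (\<alpha> + j) mod N" "\<lambda>\<beta>. (\<beta> + N - \<alpha>) mod N"])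
    fix \<beta> assume "\<beta> \<in> {..<N}"
    then have \<beta>: "\<beta> < N" by simp
    have "(\<alpha> + (\<beta> + N - \<alpha>) mod N) mod N = (\<alpha> + (\<beta> + N - \<alpha>)) mod N" by (rule mod_add_right_eq)
    also have "\<dots> = \<beta>" using \<beta> \<alpha> by simp
    finally show 1: "(\<alpha> + (\<beta> + N - \<alpha>) mod N) mod N = \<beta>" .
    show "int t ^ ((\<alpha> + (\<beta> + N - \<alpha>) mod N) mod N) * ycoeff a ((\<beta> + N - \<alpha>) mod N) =
        int t ^ \<beta> * ycoeff a (\<beta> + N - \<alpha>)" unfolding 1 yc ..
    show "(\<beta> + N - \<alpha>) mod N \<in> {..<N}" using \<beta> by simp
  next
    fix j assume "j \<in> {..<N}"
    then have j: "j < N" by simp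
    show "((\<alpha> + j) mod N + N - \<alpha>) mod N = j"
    proof (cases "\<alpha> + j < N")
      case False
      then have "(\<alpha> + j) mod N = \<alpha> + j - N" using \<alpha> j by (simp add: mod_if)
      then show ?thesis using False j by simp
    qed (use j in simp)
    show "(\<alpha> + j) mod N \<in> {..<N}" using j by simp
  qed
  also have "[(\<Sum>j<N. int t ^ ((\<alpha> + j) mod N) * ycoeff a j) = (\<Sum>j<N. int t ^ (\<alpha> + j) * ycoeff a j)] (mod int p)"
    by (intro cong_sum cong_mult cong_sym[OF red] cong_refl)
  also have "(\<Sum>j<N. int t ^ (\<alpha> + j) * ycoeff a j) = int t ^ \<alpha> * psi t a"
    unfolding psi_ycoeff sum_distrib_left N_def by (simp add: power_add mult_ac)
  finally show ?thesis unfolding N_def .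
qed

text \<open>The Vandermonde matrix is inverted modulo p. On the diagonal p - 1 equal terms add up to
  -(p - 1), which is 1 modulo p; this explains the sign. Off the diagonal the sum is a multiple of
  (X^N - Y^N)/(X - Y) with N = p - 1, for the two nodes X and Y, and there the numerator vanishes
  modulo p.\<close>

lemma vandermonde_inverse:
  assumes "\<rho> < p - 1" "\<gamma> < p - 1"
  shows "[(\<Sum>\<beta><p - 1. int (m1 ^ Suc \<rho>) ^ \<beta> * - (int (m1 ^ Suc \<gamma>) ^ (p - 1 - \<beta>))) = (if \<rho> = \<gamma> then 1 else 0)] (mod int p)"
proof -
  let ?x = "int (m1 ^ Suc \<rho>)" and ?y = "int (m1 ^ Suc \<gamma>)" and ?N = "p - 1"
  show ?thesis
  proof (cases "\<rho> = \<gamma>")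
    case True
    have "(\<Sum>\<beta><?N. ?x ^ \<beta> * - (?y ^ (?N - \<beta>))) = (\<Sum>\<beta><?N. - (?x ^ ?N))"
      using True by (intro sum.cong refl) (simp add: power_add[symmetric] del: of_nat_power power_Suc)
    also have "\<dots> = - (int ?N) * ?x ^ ?N" by simp
    also have "[\<dots> = - (int ?N) * 1] (mod int p)" by (intro cong_mult cong_refl m1_power_order)
    also have "[- (int ?N) * 1 = 1] (mod int p)" using p_ge_3 by (simp add: cong_iff_dvd_diff of_nat_diff)
    finally show ?thesis using True by simp
  next
    case False
    let ?S = "\<Sum>\<beta><?N. ?y ^ (?N - Suc \<beta>) * ?x ^ \<beta>"
    have "int p dvd ?x ^ ?N - ?y ^ ?N"
      using cong_trans[OF m1_power_order cong_sym[OF m1_power_order]] by (simp only: cong_iff_dvd_diff)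
    then have "int p dvd (?x - ?y) * ?S" by (simp only: power_diff_sumr2)
    moreover have "\<not> int p dvd ?x - ?y"
    proof
      assume "int p dvd ?x - ?y"
      then have "[m1 ^ Suc \<rho> = m1 ^ Suc \<gamma>] (mod p)" by (simp only: cong_iff_dvd_diff[symmetric] cong_int_iff)
      then have "[m1 ^ \<rho> = m1 ^ \<gamma>] (mod p)"
        using cong_mult_lcancel_nat[of m1 p "m1 ^ \<rho>" "m1 ^ \<gamma>"] prime_p not_dvd_m1
        by (simp add: prime_imp_coprime coprime_commute)
      then show False using m1_power_inj[of \<rho> \<gamma>] assms False by blast
    qed
    moreover have "prime (int p)" using prime_p by simp
    ultimately have "int p dvd ?S" by (meson prime_dvd_multD)
    moreover have "(\<Sum>\<beta><?N. ?x ^ \<beta> * - (?y ^ (?N - \<beta>))) = - ?y * ?S"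
      unfolding sum_distrib_left
    proof (rule sum.cong[OF refl])
      fix \<beta> assume "\<beta> \<in> {..<?N}"
      then have "?N - \<beta> = Suc (?N - Suc \<beta>)" by auto
      then show "?x ^ \<beta> * - (?y ^ (?N - \<beta>)) = - ?y * (?y ^ (?N - Suc \<beta>) * ?x ^ \<beta>)"
        by (simp del: of_nat_power)
    qed
    ultimately show ?thesis using False by (simp add: cong_0_iff)
  qed
qed

text \<open>Both determinants are compared with that of \<open>?D\<close>, which holds the character
  values of the entries. For R(1) this uses triangularity inside each block, for \<open>WC\<close>
  conjugation by the Vandermonde matrix, which diagonalises all circulants at once.\<close>

lemma det_R1_WC:
  fixes A :: "nat \<Rightarrow> nat \<Rightarrow> gen word set \<Rightarrow> int" and n :: nat
  assumes A: "\<And>k j. k < n \<Longrightarrow> j < n \<Longrightarrow> A k j \<in> carrier ZG"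
  defines "K \<equiv> n * (p - 1)"
  shows "[det (mat K K (\<lambda>(r, c). R1.row (A (r div (p - 1))) (r mod (p - 1)) c)) =
    det (mat K K (\<lambda>(r, c). WC.row (A (r div (p - 1))) (r mod (p - 1)) c))] (mod int p)"
proof -
  define N where "N = p - 1"
  \<comment> \<open>The exponent is shifted by one because the rows of R(1) are counted from
    1.\<close>
  define t :: "nat \<Rightarrow> nat" where "t \<rho> = m1 ^ Suc \<rho>" for \<rho>
  have N: "0 < N" using p_ge_3 by (simp add: N_def)
  let ?MR = "mat K K (\<lambda>(r, c). lam_mat p m (A (r div N) (c div N)) (Suc (c mod N)) (Suc (r mod N)))"
  let ?MC = "mat K K (\<lambda>(r, c). ycoeff (A (r div N) (c div N)) (r mod N + N - c mod N))"
  let ?D = "mat K K (\<lambda>(r, c). if r mod N = c mod N then psi (t (r mod N)) (A (r div N) (c div N)) else 0)"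
  let ?V = "mat K K (\<lambda>(r, c). if r div N = c div N then int (t (r mod N)) ^ (c mod N) else 0)"
  let ?U = "mat K K (\<lambda>(r, c). if r div N = c div N then - (int (t (c mod N)) ^ (N - r mod N)) else 0)"
  have K: "K = n * N" by (simp add: K_def N_def)
  have div: "r div N < n" if "r < K" for r using that unfolding K by (rule less_mult_imp_div_less)
  have md: "r mod N < N" for r using N by simp
  have jd: "(j * N + \<beta>) div N = j" "(j * N + \<beta>) mod N = \<beta>" if "\<beta> < N" for j \<beta> using that by simp_all
  have prod_mat: "(mat K K f * mat K K h) $$ (r, c) = (\<Sum>j<n. \<Sum>\<beta><N. f (r, j * N + \<beta>) * h (j * N + \<beta>, c))"
    if "r < K" "c < K" for f h :: "nat \<times> nat \<Rightarrow> int" and r c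
  proof -
    have "(mat K K f * mat K K h) $$ (r, c) = (\<Sum>e<K. f (r, e div N * N + e mod N) * h (e div N * N + e mod N, c))"
      using that by (simp add: scalar_prod_def atLeast0LessThan)
    also have "\<dots> = (\<Sum>j<n. \<Sum>\<beta><N. f (r, j * N + \<beta>) * h (j * N + \<beta>, c))"
      unfolding K by (rule sum_div_mod[OF N])
    finally show ?thesis .
  qed
  \<comment> \<open>In \<open>?MR\<close> rows and columns are exchanged with respect to
    \<open>lam_mat\<close>, so the vanishing entries modulo p are those with a larger column
    position; the block numbers have to decrease with the position.\<close>
  have R_D: "[det ?MR = det ?D] (mod int p)"
  proof (rule det_cong_triangular[where b = "\<lambda>c. N - c mod N"])
    fix r c assume rc: "r < K" "c < K"
    note Arc = A[OF div[OF rc(1)] div[OF rc(2)]]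
    have mem: "Suc (c mod N) \<in> {1..p - 1}" using md[of c] by (auto simp: N_def)
    {
      assume "N - c mod N < N - r mod N"
      then have "r mod N < c mod N" using md by simp
      then show "int p dvd ?MR $$ (r, c) \<and> int p dvd ?D $$ (r, c)"
        using lam_mat_triangular(1)[OF Arc mem, of "Suc (r mod N)"] rc by simp
    next
      assume "N - c mod N = N - r mod N"
      then have eq: "r mod N = c mod N" using md[of r] md[of c] by simp
      then show "[?MR $$ (r, c) = ?D $$ (r, c)] (mod int p)"
        using lam_mat_triangular(2)[OF Arc mem] rc by (simp add: t_def)
    }
  qed simp_all
  \<comment> \<open>With constant block numbers the comparison of determinants is a plain entrywise
    congruence.\<close>
  have "[det (?V * ?MC) = det (?D * ?V)] (mod int p)"
  proof (rule det_cong_triangular[where b = "\<lambda>_. 0"])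
    fix r c assume rc: "r < K" "c < K"
    let ?a = "A (r div N) (c div N)"
    have "(?V * ?MC) $$ (r, c) = (\<Sum>j<n. if j = r div N then
        (\<Sum>\<beta><N. int (t (r mod N)) ^ \<beta> * ycoeff (A j (c div N)) (\<beta> + N - c mod N)) else 0)"
      unfolding prod_mat[OF rc] by (intro sum.cong refl) (auto simp: jd intro!: sum.cong)
    also have "\<dots> = (\<Sum>\<beta><N. int (t (r mod N)) ^ \<beta> * ycoeff ?a (\<beta> + N - c mod N))"
      using div[OF rc(1)] by simp
    finally have 1: "(?V * ?MC) $$ (r, c) = (\<Sum>\<beta><N. int (t (r mod N)) ^ \<beta> * ycoeff ?a (\<beta> + N - c mod N))" .
    have "(?D * ?V) $$ (r, c) = (\<Sum>j<n. \<Sum>\<beta><N. if j = c div N then (if \<beta> = r mod N then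
        psi (t (r mod N)) (A (r div N) j) * int (t \<beta>) ^ (c mod N) else 0) else 0)"
      unfolding prod_mat[OF rc] by (intro sum.cong refl) (simp add: jd)
    also have "\<dots> = (\<Sum>j<n. if j = c div N then (\<Sum>\<beta><N. if \<beta> = r mod N then
        psi (t (r mod N)) (A (r div N) j) * int (t \<beta>) ^ (c mod N) else 0) else 0)"
      by (intro sum.cong refl) simp
    also have "\<dots> = (\<Sum>\<beta><N. if \<beta> = r mod N then psi (t (r mod N)) ?a * int (t \<beta>) ^ (c mod N) else 0)"
      using div[OF rc(2)] by simp
    also have "\<dots> = int (t (r mod N)) ^ (c mod N) * psi (t (r mod N)) ?a" using md by simp
    finally have 2: "(?D * ?V) $$ (r, c) = int (t (r mod N)) ^ (c mod N) * psi (t (r mod N)) ?a" .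
    show "[(?V * ?MC) $$ (r, c) = (?D * ?V) $$ (r, c)] (mod int p)"
      unfolding 1 2 unfolding N_def t_def
      by (rule vandermonde_act[OF _ m1_power_order]) (use md[of c] in \<open>simp add: N_def\<close>)
  qed (auto intro!: mult_carrier_mat[of _ K K])
  then have VC: "[det ?V * det ?MC = det ?V * det ?D] (mod int p)"
    by (simp add: det_mult[of _ K] mult.commute)
  have "[det (?V * ?U) = det (1\<^sub>m K)] (mod int p)"
  proof (rule det_cong_triangular[where b = "\<lambda>_. 0"])
    fix r c assume rc: "r < K" "c < K"
    let ?S = "\<Sum>\<beta><N. int (t (r mod N)) ^ \<beta> * - (int (t (c mod N)) ^ (N - \<beta>))"
    have "(?V * ?U) $$ (r, c) = (\<Sum>j<n. if j = r div N then (if j = c div N then ?S else 0) else 0)"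
      unfolding prod_mat[OF rc] by (intro sum.cong refl) (auto simp: jd intro!: sum.cong)
    also have "\<dots> = (if r div N = c div N then ?S else 0)"
      using div[OF rc(1)] by simp
    finally have 1: "(?V * ?U) $$ (r, c) = (if r div N = c div N then ?S else 0)" .
    have S: "[?S = (if r mod N = c mod N then 1 else 0)] (mod int p)"
      using vandermonde_inverse[of "r mod N" "c mod N"] md unfolding N_def t_def by blast
    have "r = c \<longleftrightarrow> r div N = c div N \<and> r mod N = c mod N" by (metis div_mult_mod_eq)
    then have 2: "1\<^sub>m K $$ (r, c) = (if r div N = c div N then (if r mod N = c mod N then 1 else 0) else (0 :: int))"
      using rc by simp
    show "[(?V * ?U) $$ (r, c) = 1\<^sub>m K $$ (r, c)] (mod int p)"
      unfolding 1 2 using S by simp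
  qed (auto intro!: mult_carrier_mat[of _ K K])
  then have "[det ?V * det ?U = 1] (mod int p)" by (simp add: det_mult[of _ K])
  then have "coprime (det ?V) (int p)" using coprime_iff_invertible_int by blast
  then have "[det ?MC = det ?D] (mod int p)" using VC by (simp add: cong_mult_lcancel)
  from cong_trans[OF R_D cong_sym[OF this]] show ?thesis
    unfolding N_def by (simp only: R1.row_def WC.row_def)
qed

end

context diag_presentation
begin

section \<open>Maps of the presentation into \<int>[<y>]\<close>

lemma zero_mem: "(\<lambda>k. 0) \<in> carrier R2" "(\<lambda>g. 0) \<in> carrier B"
  using J.v1 J.v2 by simp_all

lemma J_split:
  assumes "linear ZG J W \<theta>" "r \<in> carrier R2" "b \<in> carrier B"
  shows "\<theta> (r, b) = \<theta> (r, \<lambda>g. 0) \<oplus>\<^bsub>W\<^esub> \<theta> (\<lambda>k. 0, b)"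
  using linear_add[OF assms(1), of "(r, \<lambda>g. 0)" "(\<lambda>k. 0, b)"] assms(2,3) zero_mem by simp

lemma linear_R2_J: "linear ZG R2 J (\<lambda>r. (r, \<lambda>g. 0))" and linear_B_J: "linear ZG B J (\<lambda>b. (\<lambda>k. 0, b))"
  using linear_inl[OF right_module_B, of R2] linear_inr[OF right_module_R_row[of 2], of B] by simp_all

definition MC :: "nat \<Rightarrow> nat \<Rightarrow> int"
  where "MC r c = WC.row (Amat (r div (p - 1))) (r mod (p - 1)) c"
definition MR :: "nat \<Rightarrow> nat \<Rightarrow> int"
  where "MR r c = R1.row (Amat (r div (p - 1))) (r mod (p - 1)) c"

text \<open>The given map \<theta> on \<Lambda>^l is paired with the map on J that is \<theta> i
  \<tau>' on \<open>B\<close> and zero on R(2). They are compatible because \<theta> i vanishes on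
  R(2) as well.\<close>

lemma WC_lift:
  obtains \<phi> where "linear ZG (F n) WC \<phi>"
    "\<And>r. r < l * (p - 1) \<Longrightarrow> WC.coords (\<lambda>w. \<phi> (s (\<zero>\<^bsub>J\<^esub>, w))) r = y r"
proof -
  obtain \<theta> where \<theta>: "linear ZG (F l) WC \<theta>" "\<And>c. c < l * (p - 1) \<Longrightarrow> WC.coords \<theta> c = y c"
    using WC.coords_ex[of l y] by blast
  interpret W: right_module ZG WC by (rule WC.W)
  note \<theta>i = linear_comp[OF i \<theta>(1)]
  let ?\<theta> = "\<lambda>v. \<theta> (i (\<lambda>k. 0, \<tau>' (snd v)))"
  have "linear ZG J WC ?\<theta>"
    by (rule linear_comp[OF linear_comp[OF linear_snd \<tau>(2)] linear_comp[OF linear_B_J \<theta>i]])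
  then obtain \<phi> where \<phi>: "linear ZG (F n) WC \<phi>" "\<And>w. w \<in> carrier (F l) \<Longrightarrow> \<phi> (s (\<zero>\<^bsub>J\<^esub>, w)) = \<theta> w"
  proof (rule lift[OF WC.W _ \<theta>(1)])
    fix u assume u: "u \<in> carrier J"
    then obtain r b where rb: "u = (r, b)" "r \<in> carrier R2" "b \<in> carrier B" by auto
    have "\<theta> (i (r, \<lambda>g. 0)) = \<zero>\<^bsub>WC\<^esub>"
      using hom_R2_WC[OF linear_comp[OF linear_R2_J \<theta>i] rb(2)] by simp
    then have "\<theta> (i u) = \<theta> (i (\<lambda>k. 0, b))"
      unfolding rb(1) J_split[OF \<theta>i rb(2,3)] by simp
    then show "\<theta> (i (\<lambda>k. 0, \<tau>' (snd (diag a \<tau> u)))) = \<theta> (i u)"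
      unfolding diag_apply[OF u] using rb \<tau>(3) by simp
  qed blast
  have "WC.coords (\<lambda>w. \<phi> (s (\<zero>\<^bsub>J\<^esub>, w))) r = y r" if r: "r < l * (p - 1)" for r
  proof -
    have "r div (p - 1) < l" using r by (rule less_mult_imp_div_less)
    then show ?thesis using \<phi>(2)[OF G.unit_vec_closed] \<theta>(2)[OF r] by (simp only: WC.coords_def)
  qed
  with \<phi>(1) show thesis by (rule that)
qed

lemma MC_surj: "\<exists>x. \<forall>r<l * (p - 1). (\<Sum>c<n * (p - 1). MC r c * x c) = y r"
proof -
  obtain \<phi> where \<phi>: "linear ZG (F n) WC \<phi>"
    "\<And>r. r < l * (p - 1) \<Longrightarrow> WC.coords (\<lambda>w. \<phi> (s (\<zero>\<^bsub>J\<^esub>, w))) r = y r"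
    using WC_lift by blast
  have "(\<Sum>c<n * (p - 1). MC r c * WC.coords \<phi> c) = y r" if "r < l * (p - 1)" for r
    unfolding MC_def rep_composite[OF WC.lattice_rep_axioms \<phi>(1) that, symmetric] by (rule \<phi>(2)[OF that])
  then show ?thesis by blast
qed

text \<open>A map that vanishes on \<Lambda>^l also vanishes on J: on \<open>B\<close> because
  \<tau> is onto and \<open>s_diag\<close> moves its image into \<Lambda>^l, on R(2) because every
  map there is zero. Surjectivity of \<open>s\<close> then makes it zero.\<close>

lemma MC_inj:
  assumes x: "\<And>r. r < l * (p - 1) \<Longrightarrow> (\<Sum>c<n * (p - 1). MC r c * x c) = 0" and c: "c < n * (p - 1)"
  shows "x c = 0"
proof -
  interpret W: right_module ZG WC by (rule WC.W)
  obtain \<phi> where \<phi>: "linear ZG (F n) WC \<phi>" "\<And>c. c < n * (p - 1) \<Longrightarrow> WC.coords \<phi> c = x c"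
    using WC.coords_ex[of n x] by blast
  have "WC.coords (\<lambda>w. \<phi> (s (\<zero>\<^bsub>J\<^esub>, w))) r = 0" if "r < l * (p - 1)" for r
    unfolding rep_composite[OF WC.lattice_rep_axioms \<phi>(1) that]
    using x[OF that] by (simp add: \<phi>(2) MC_def del: One_nat_def)
  then have l0: "\<phi> (s (\<zero>\<^bsub>J\<^esub>, w)) = \<zero>\<^bsub>WC\<^esub>" if "w \<in> carrier (F l)" for w
    using WC.coords_zero[OF linear_comp[OF s_inr \<phi>(1)] _ that] by blast
  note s\<phi> = linear_comp[OF s_inl \<phi>(1)]
  have J0: "\<phi> (s (v, \<zero>\<^bsub>F l\<^esub>)) = \<zero>\<^bsub>WC\<^esub>" if v: "v \<in> carrier J" for v
  proof -
    obtain r b where rb: "v = (r, b)" "r \<in> carrier R2" "b \<in> carrier B" using v by auto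
    have u: "(\<lambda>k. 0, \<tau>' b) \<in> carrier J" using linear_closed[OF \<tau>(2) rb(3)] zero_mem by simp
    have "diag a \<tau> (\<lambda>k. 0, \<tau>' b) = (\<lambda>k. 0, b)" using diag_apply[OF u] \<tau>(4)[OF rb(3)] by simp
    then have "\<phi> (s ((\<lambda>k. 0, b), \<zero>\<^bsub>F l\<^esub>)) = \<zero>\<^bsub>WC\<^esub>"
      using s_diag[OF u] l0[OF linear_closed[OF i u]] by simp
    moreover have "\<phi> (s ((r, \<lambda>g. 0), \<zero>\<^bsub>F l\<^esub>)) = \<zero>\<^bsub>WC\<^esub>"
      using hom_R2_WC[OF linear_comp[OF linear_R2_J s\<phi>] rb(2)] by simp
    ultimately show ?thesis unfolding rb(1) J_split[OF s\<phi> rb(2,3)] by simp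
  qed
  have "\<phi> f = \<zero>\<^bsub>WC\<^esub>" if f: "f \<in> carrier (F n)" for f
  proof -
    have "f \<in> s ` carrier (dsum J (F l))" unfolding s_surj by (rule f)
    then obtain x where x: "f = s x" "x \<in> carrier (dsum J (F l))" by (rule imageE) blast
    obtain v w where vw: "x = (v, w)" by (cases x) blast
    then have "v \<in> carrier J" "w \<in> carrier (F l)" using x(2) by simp_all
    with vw show ?thesis
      using s_split[of v w] linear_add[OF \<phi>(1) linear_closed[OF s_inl] linear_closed[OF s_inr], of v w]
        J0[of v] l0[of w] x(1) by simp
  qed
  then have "\<phi> (G.unit_vec (c div (p - 1))) = \<zero>\<^bsub>WC\<^esub>"
    using G.unit_vec_closed[OF less_mult_imp_div_less[OF c]] by blast
  then show ?thesis using \<phi>(2)[OF c] unfolding WC.coords_def by simp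
qed

text \<open>Restriction to \<Lambda>^l is a bijection between two groups of integral vectors, of
  lengths n (p - 1) and l (p - 1).\<close>

lemma l_eq_n: "l = n"
proof -
  have "l * (p - 1) = n * (p - 1)" 
  proof (rule bijective_square[where M = MC])
    show "\<exists>x. \<forall>r<l * (p - 1). (\<Sum>c<n * (p - 1). MC r c * x c) = y r" for y by (rule MC_surj)
    fix x c assume "\<And>r. r < l * (p - 1) \<Longrightarrow> (\<Sum>c<n * (p - 1). MC r c * x c) = 0" "c < n * (p - 1)"
    then show "x c = 0" by (rule MC_inj)
  qed
  then show ?thesis using p_ge_3 by simp
qed

abbreviation K where "K \<equiv> n * (p - 1)"

lemma det_MC: "\<bar>det (mat K K (\<lambda>(r, c). MC r c))\<bar> = 1"
  by (rule det_surj) (use MC_surj l_eq_n in simp)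

section \<open>Maps of the presentation into R(1)\<close>

abbreviation e2 where "e2 \<equiv> (unit_row 2, \<lambda>g. 0 :: int)"

text \<open>A map from R(2) to R(1) is a scalar, visible as the second entry of the image of
  \<open>unit_row 2\<close>, which has index 1 when counting from 0. \<psi> computes this scalar for
  \<theta> i from the coordinates of \<theta>, and \<chi> does so for the restriction to R(2) of a
  map on \<Lambda>^n.\<close>

definition \<psi> :: "nat \<Rightarrow> int" where "\<psi> = R1.row (i e2) 1"
definition \<chi> :: "nat \<Rightarrow> int" where "\<chi> = R1.row (s (e2, \<zero>\<^bsub>F l\<^esub>)) 1"

lemma one_less: "1 < p - 1"
  using p_ge_3 by simp

lemma psi_hom:
  assumes \<theta>: "linear ZG (F l) (R_row p m 1) \<theta>" and r: "r \<in> carrier R2"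
  shows "\<theta> (i (r, \<lambda>g. 0)) = (\<lambda>k. (\<Sum>c<K. \<psi> c * R1.coords \<theta> c) * r k)"
proof -
  obtain c where c: "\<And>r. r \<in> carrier R2 \<Longrightarrow> \<theta> (i (r, \<lambda>g. 0)) = (\<lambda>k. c * r k)"
    using R2_hom_scalar[OF linear_comp[OF linear_R2_J linear_comp[OF i \<theta>]]] by blast
  have "\<theta> (i e2) 2 = c" using c[OF unit_row_R(1)] by simp
  moreover have "\<theta> (i e2) (Suc 1) = (\<Sum>c<l * (p - 1). \<psi> c * R1.coords \<theta> c)"
    unfolding \<psi>_def by (rule R1.coord_expand[OF \<theta> linear_closed[OF i J.v1] one_less])
  ultimately show ?thesis using c[OF r] l_eq_n by (simp add: numeral_2_eq_2)
qed

text \<open>A scalar z on R(2) and a map \<theta> on \<Lambda>^l come from \<Lambda>^n exactly when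
  the scalar of \<theta> i is a z. Subtracting a multiple of \<open>w0\<close>, on which \<psi> is
  1, enforces this.\<close>

lemma R1_lift:
  assumes w0: "(\<Sum>c<K. \<psi> c * w0 c) = 1"
  obtains x0 x where "(\<Sum>c<K. \<chi> c * x c) = z" "\<And>r. r < K \<Longrightarrow> w0 r * x0 + (\<Sum>c<K. MR r c * x c) = y r"
proof -
  \<comment> \<open>Solves \<psi>(y - x0 w0) = a z.\<close>
  define x0 where "x0 = (\<Sum>c<K. \<psi> c * y c) - a * z"
  obtain \<theta> where \<theta>: "linear ZG (F l) (R_row p m 1) \<theta>"
    "\<And>c. c < l * (p - 1) \<Longrightarrow> R1.coords \<theta> c = y c - w0 c * x0"
    using R1.coords_ex[of l "\<lambda>c. y c - w0 c * x0"] by blast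
  have "(\<Sum>c<K. \<psi> c * R1.coords \<theta> c) = (\<Sum>c<K. \<psi> c * y c - (\<psi> c * w0 c) * x0)"
    using \<theta>(2) l_eq_n by (intro sum.cong refl) (simp add: right_diff_distrib)
  also have "\<dots> = a * z" using w0 by (simp add: sum_subtractf sum_distrib_right[symmetric] x0_def)
  finally have \<psi>\<theta>: "(\<Sum>c<K. \<psi> c * R1.coords \<theta> c) = a * z" .
  note \<theta>i = linear_comp[OF i \<theta>(1)]
  have incl: "linear ZG R2 (R_row p m 1) (\<lambda>r. r)"
    using nullmap_linear[OF right_module_R_row nullmap_inclusion] .
  let ?\<theta> = "\<lambda>v. (\<lambda>k. z * fst v k) \<oplus>\<^bsub>R_row p m 1\<^esub> \<theta> (i (\<lambda>k. 0, \<tau>' (snd v)))"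
  have "linear ZG J (R_row p m 1) ?\<theta>"
    by (rule linear_plus[OF right_module_R_row linear_comp[OF linear_fst linear_comp[OF incl linear_R_row_scale]]
          linear_comp[OF linear_comp[OF linear_snd \<tau>(2)] linear_comp[OF linear_B_J \<theta>i]]])
  then obtain \<phi> where \<phi>: "linear ZG (F n) (R_row p m 1) \<phi>"
    "\<And>v. v \<in> carrier J \<Longrightarrow> \<phi> (s (v, \<zero>\<^bsub>F l\<^esub>)) = ?\<theta> v"
    "\<And>w. w \<in> carrier (F l) \<Longrightarrow> \<phi> (s (\<zero>\<^bsub>J\<^esub>, w)) = \<theta> w"
  proof (rule lift[OF right_module_R_row _ \<theta>(1)])
    fix u assume u: "u \<in> carrier J"
    then obtain r b where rb: "u = (r, b)" "r \<in> carrier R2" "b \<in> carrier B" by auto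
    have "\<theta> (i u) = (\<lambda>k. a * z * r k) \<oplus>\<^bsub>R_row p m 1\<^esub> \<theta> (i (\<lambda>k. 0, b))"
      unfolding rb(1) J_split[OF \<theta>i rb(2,3)] psi_hom[OF \<theta>(1) rb(2)] \<psi>\<theta> ..
    then show "?\<theta> (diag a \<tau> u) = \<theta> (i u)"
      unfolding diag_apply[OF u] using rb \<tau>(3)[OF rb(3)] by (simp add: mult_ac)
  qed blast
  show thesis
  proof (rule that[of "R1.coords \<phi>" x0])
    have "\<theta> (i (\<lambda>k. 0, \<tau>' (\<lambda>g. 0))) = (\<lambda>k. 0)"
      using linear_zero[OF right_module_B right_module_B \<tau>(2)]
        linear_zero[OF right_module_B right_module_R_row linear_comp[OF linear_B_J \<theta>i]] by simp
    then have "\<phi> (s (e2, \<zero>\<^bsub>F l\<^esub>)) (Suc 1) = z" using \<phi>(2)[OF J.v1] by (simp add: numeral_2_eq_2)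
    then show "(\<Sum>c<K. \<chi> c * R1.coords \<phi> c) = z"
      using R1.coord_expand[OF \<phi>(1) linear_closed[OF s_inl J.v1] one_less] by (simp only: \<chi>_def)
    fix r assume r: "r < K"
    then have r': "r < l * (p - 1)" by (simp only: l_eq_n)
    have "r div (p - 1) < l" using r' by (rule less_mult_imp_div_less)
    then have "R1.coords (\<lambda>w. \<phi> (s (\<zero>\<^bsub>J\<^esub>, w))) r = y r - w0 r * x0"
      using \<phi>(3)[OF G.unit_vec_closed] \<theta>(2)[OF r'] by (simp only: R1.coords_def)
    then show "w0 r * x0 + (\<Sum>c<K. MR r c * R1.coords \<phi> c) = y r"
      unfolding rep_composite[OF R1.lattice_rep_axioms \<phi>(1) r'] by (simp only: MR_def)
  qed
qed

text \<open>The inclusion of \<open>R(2)\<close> in \<open>R(1)\<close> extends along \<open>i\<close> because it is null.\<close>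

lemma w0_ex:
  obtains w0 where "(\<Sum>c<K. \<psi> c * w0 c) = 1"
proof -
  obtain k :: nat and P Q where P: "linear ZG R2 (F k) P" and Q: "linear ZG (F k) (R_row p m 1) Q"
    and PQ: "\<And>r. r \<in> carrier R2 \<Longrightarrow> r = Q (P r)"
    using nullmap_inclusion by (rule nullmapE) blast
  have "\<forall>j. \<exists>\<Theta>. linear ZG (F l) (reg ZG) \<Theta> \<and> (\<forall>v\<in>carrier J. \<Theta> (i v) = P (fst v) j)"
    by (intro allI i_ext) (rule linear_comp[OF linear_comp[OF linear_fst P] linear_coord[OF G.ring_ZG]])
  then obtain \<Theta> where \<Theta>: "\<And>j. linear ZG (F l) (reg ZG) (\<Theta> j)"
    "\<And>j v. v \<in> carrier J \<Longrightarrow> \<Theta> j (i v) = P (fst v) j" by metis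
  define P' where "P' w j = (if j < k then \<Theta> j w else \<zero>\<^bsub>ZG\<^esub>)" for w j
  have P': "linear ZG (F l) (F k) P'"
    by (rule linear_into_free[OF G.ring_ZG _ _ _ right_module_F]) (simp_all add: P'_def \<Theta>(1))
  have "P' (i v) = P (fst v)" if v: "v \<in> carrier J" for v
  proof -
    have "P (fst v) \<in> carrier (F k)" using linear_closed[OF P] v by auto
    then show ?thesis using \<Theta>(2)[OF v] by (auto simp: P'_def free_rmod_carrier_finite)
  qed
  then have "Q (P' (i e2)) = unit_row 2"
    using PQ[OF unit_row_R(1)] J.v1 by simp
  moreover have "Q (P' (i e2)) = (\<lambda>k. (\<Sum>c<K. \<psi> c * R1.coords (\<lambda>w. Q (P' w)) c) * unit_row 2 k)"
    by (rule psi_hom[OF linear_comp[OF P' Q] unit_row_R(1)])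
  ultimately have "(\<Sum>c<K. \<psi> c * R1.coords (\<lambda>w. Q (P' w)) c) = 1" by (simp add: fun_eq_iff split: if_splits)
  then show thesis by (rule that)
qed

text \<open>The relation \<open>s_diag\<close> compares two scalars on R(2): that of a map on
  \<Lambda>^n restricted to \<Lambda>^l and composed with i, and a times that of its restriction to
  R(2).\<close>

lemma psi_MR: 
  assumes c: "c < K" shows "(\<Sum>r<K. \<psi> r * MR r c) = a * \<chi> c"
proof -
  obtain \<phi> where \<phi>: "linear ZG (F n) (R_row p m 1) \<phi>"
    "\<And>c'. c' < K \<Longrightarrow> R1.coords \<phi> c' = (if c' = c then 1 else 0)"
    using R1.coords_ex[of n "\<lambda>c'. if c' = c then 1 else 0"] by blast
  have sum: "(\<Sum>c'<K. f c' * R1.coords \<phi> c') = f c" for f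
  proof -
    have "(\<Sum>c'<K. f c' * R1.coords \<phi> c') = (\<Sum>c'<K. if c' = c then f c' else 0)"
      by (intro sum.cong refl) (simp add: \<phi>(2) del: One_nat_def)
    then show ?thesis using c by simp
  qed
  note s\<phi> = linear_comp[OF s_inl \<phi>(1)] and s\<phi>' = linear_comp[OF s_inr \<phi>(1)]
  obtain d where d: "\<And>r. r \<in> carrier R2 \<Longrightarrow> \<phi> (s ((r, \<lambda>g. 0), \<zero>\<^bsub>F l\<^esub>)) = (\<lambda>k. d * r k)"
    using R2_hom_scalar[OF linear_comp[OF linear_R2_J s\<phi>]] by blast
  have "\<phi> (s (e2, \<zero>\<^bsub>F l\<^esub>)) (Suc 1) = \<chi> c"
    unfolding \<chi>_def R1.coord_expand[OF \<phi>(1) linear_closed[OF s_inl J.v1] one_less] by (rule sum)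
  then have d\<chi>: "d = \<chi> c" using d[OF unit_row_R(1)] by (simp add: numeral_2_eq_2)
  have "\<tau> (\<lambda>g. 0) = (\<lambda>g. 0)" using linear_zero[OF right_module_B right_module_B \<tau>(1)] by simp
  then have "diag a \<tau> e2 = (\<lambda>k. a * unit_row 2 k, \<lambda>g. 0)" using diag_apply[OF J.v1] by simp
  then have "\<phi> (s (diag a \<tau> e2, \<zero>\<^bsub>F l\<^esub>)) = (\<lambda>k. d * (a * unit_row 2 k))"
    using d[OF R_row_scale_closed[OF unit_row_R(1), of a]] by (simp only:)
  then have "\<phi> (s (\<zero>\<^bsub>J\<^esub>, i e2)) = (\<lambda>k. d * (a * unit_row 2 k))"
    unfolding s_diag[OF J.v1] .
  moreover have "\<phi> (s (\<zero>\<^bsub>J\<^esub>, i e2)) =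
      (\<lambda>k. (\<Sum>c<K. \<psi> c * R1.coords (\<lambda>w. \<phi> (s (\<zero>\<^bsub>J\<^esub>, w))) c) * unit_row 2 k)"
    by (rule psi_hom[OF s\<phi>' unit_row_R(1)])
  ultimately have "(\<Sum>c<K. \<psi> c * R1.coords (\<lambda>w. \<phi> (s (\<zero>\<^bsub>J\<^esub>, w))) c) = d * a"
    by (simp add: fun_eq_iff split: if_splits)
  moreover have "R1.coords (\<lambda>w. \<phi> (s (\<zero>\<^bsub>J\<^esub>, w))) r = MR r c" if "r < K" for r
    using rep_composite[OF R1.lattice_rep_axioms \<phi>(1), of r] that sum[of "MR r"]
    by (simp only: l_eq_n MR_def)
  ultimately show ?thesis by (simp add: d\<chi> mult.commute)
qed

text \<open>
  The exact sequence \<open>0 \<rightarrow> Hom(\<Lambda>\<^sup>n, W) \<rightarrow> \<int> \<oplus> Hom(\<Lambda>\<^sup>n, W) \<rightarrow> \<int> \<rightarrow> 0\<close> with \<open>W = R(1)\<close>, whose maps are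
  given by \<open>\<chi>\<close>, \<open>MR\<close> and by \<open>(a, - \<psi>)\<close>, and which is split by \<open>w0\<close>, shows that the bordered
  matrix is unimodular.
\<close>

lemma det_MR: "\<bar>det (mat K K (\<lambda>(r, c). MR r c))\<bar> = \<bar>a\<bar>"
proof -
  obtain w0 where w0: "(\<Sum>c<K. \<psi> c * w0 c) = 1" by (rule w0_ex) blast
  define T where "T r c = (case r of 0 \<Rightarrow> (case c of 0 \<Rightarrow> 0 | Suc c \<Rightarrow> \<chi> c)
    | Suc r \<Rightarrow> (case c of 0 \<Rightarrow> w0 r | Suc c \<Rightarrow> MR r c))" for r c
  have T: "\<bar>det (mat (Suc K) (Suc K) (\<lambda>(r, c). T r c))\<bar> = 1"
  proof (rule det_surj)
    fix y
    obtain x0 x where x: "(\<Sum>c<K. \<chi> c * x c) = y 0" "\<And>r. r < K \<Longrightarrow> w0 r * x0 + (\<Sum>c<K. MR r c * x c) = y (Suc r)"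
      using R1_lift[OF w0, of "y 0" "\<lambda>r. y (Suc r)"] by blast
    show "\<exists>x. \<forall>r<Suc K. (\<Sum>c<Suc K. T r c * x c) = y r"
    proof (intro exI allI impI)
      fix r assume "r < Suc K"
      then show "(\<Sum>c<Suc K. T r c * (case c of 0 \<Rightarrow> x0 | Suc c \<Rightarrow> x c)) = y r"
        unfolding sum.lessThan_Suc_shift using x by (cases r) (simp_all add: T_def del: One_nat_def)
    qed
  qed
  let ?M = "mat K K (\<lambda>(r, c). MR r c)" and ?w = "mat K 1 (\<lambda>(r, c). w0 r)"
  \<comment> \<open>Replaces the first row of the bordered matrix by a times itself minus \<psi>
    times the others. By \<open>psi_MR\<close> and the normalisation of \<open>w0\<close> the result
    is (-1, 0), so a times the determinant of the bordered matrix is minus that of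
    \<open>?M\<close>.\<close>
  let ?U = "four_block_mat (mat 1 1 (\<lambda>_. a)) (mat 1 K (\<lambda>(r, c). - \<psi> c)) (0\<^sub>m K 1) (1\<^sub>m K)"
  let ?T = "four_block_mat (0\<^sub>m 1 1) (mat 1 K (\<lambda>(r, c). \<chi> c)) ?w ?M"
  let ?P = "four_block_mat (mat 1 1 (\<lambda>_. -1)) (0\<^sub>m 1 K) ?w ?M"
  have T_eq: "mat (Suc K) (Suc K) (\<lambda>(r, c). T r c) = ?T"
    by (rule eq_matI) (auto simp: T_def four_block_mat_def Let_def split: nat.splits)
  have "?U * ?T = ?P"
  proof -
    have 1: "mat 1 1 (\<lambda>_. a) * 0\<^sub>m 1 1 + mat 1 K (\<lambda>(r, c). - \<psi> c) * ?w = mat 1 1 (\<lambda>_. -1)"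
      using w0 by (intro eq_matI) (auto simp: scalar_prod_def atLeast0LessThan sum_negf)
    have 2: "mat 1 1 (\<lambda>_. a) * mat 1 K (\<lambda>(r, c). \<chi> c) + mat 1 K (\<lambda>(r, c). - \<psi> c) * ?M = 0\<^sub>m 1 K"
      using psi_MR by (intro eq_matI) (auto simp: scalar_prod_def atLeast0LessThan sum_negf)
    have 3: "0\<^sub>m K 1 * 0\<^sub>m 1 1 + 1\<^sub>m K * ?w = ?w" "0\<^sub>m K 1 * mat 1 K (\<lambda>(r, c). \<chi> c) + 1\<^sub>m K * ?M = ?M"
      by (simp_all add: left_mult_one_mat[of _ K] left_mult_zero_mat[of _ 1])
    show ?thesis
      by (subst mult_four_block_mat[where ?nr1.0 = 1 and ?n1.0 = 1 and ?n2.0 = K and ?nr2.0 = K and ?nc1.0 = 1 and ?nc2.0 = K])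
        (simp_all only: 1 2 3 mat_carrier zero_carrier_mat one_carrier_mat)
  qed
  then have "det ?U * det ?T = det ?P"
    using det_mult[of ?U "1 + K" ?T] by (metis four_block_carrier_mat mat_carrier one_carrier_mat zero_carrier_mat)
  moreover have "det ?U = a"
    by (subst det_four_block_mat_lower_left_zero[of _ 1 _ K]) (simp_all add: det_single)
  moreover have "det ?P = - det ?M"
    by (subst det_four_block_mat_upper_right_zero[of _ 1 _ K]) (simp_all add: det_single)
  ultimately have "a * det ?T = - det ?M" by simp
  from arg_cong[OF this, of abs] have "\<bar>a\<bar> * \<bar>det ?T\<bar> = \<bar>det ?M\<bar>" by (simp only: abs_mult abs_minus_cancel)
  then show ?thesis using T unfolding T_eq by simp
qed

lemma a_cong: "int p dvd a - 1 \<or> int p dvd a + 1"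
proof -
  have "[det (mat K K (\<lambda>(r, c). MR r c)) = det (mat K K (\<lambda>(r, c). MC r c))] (mod int p)"
    unfolding MR_def MC_def
  proof (rule det_R1_WC)
    show "Amat k j \<in> carrier ZG" if "k < n" "j < n" for k j
      using free_rmod_in_ring[OF G.ring_ZG Amat_closed] that l_eq_n by simp
  qed
  then have "int p dvd det (mat K K (\<lambda>(r, c). MR r c)) - det (mat K K (\<lambda>(r, c). MC r c))"
    by (simp only: cong_iff_dvd_diff)
  moreover have "det (mat K K (\<lambda>(r, c). MC r c)) = 1 \<or> det (mat K K (\<lambda>(r, c). MC r c)) = -1"
    using det_MC by linarith
  moreover have "det (mat K K (\<lambda>(r, c). MR r c)) = a \<or> det (mat K K (\<lambda>(r, c). MR r c)) = - a"
    using det_MR by linarith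
  ultimately show ?thesis
    by (elim disjE) (auto simp: dvd_diff_commute minus_diff_commute dest: dvd_minus_iff[THEN iffD2])
qed

end

lemma (in metacyclic) full_J: "full ZG J"
proof -
  let ?z = "stable_class ZG (free_rmod ZG ({} :: nat set))"
  have ker: "kernel (der_aut ZG J) (reduced_K0 ZG) (swan ZG J) = {c \<in> carrier (der_aut ZG J). swan ZG J c = ?z}"
    by (simp add: kernel_def reduced_K0_def)
  show ?thesis
    unfolding full_def ker
  proof (intro equalityI subsetI)
    fix c assume "c \<in> der_map ZG J ` carrier (rmod_aut ZG J)"
    then obtain f where "f \<in> carrier (rmod_aut ZG J)" "c = der_map ZG J f" by blast
    then show "c \<in> {c \<in> carrier (der_aut ZG J). swan ZG J c = ?z}"
      using J.der_map_aut J.swan_der_map_aut by simp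
  next
    fix c assume "c \<in> {c \<in> carrier (der_aut ZG J). swan ZG J c = ?z}"
    then have c: "c \<in> carrier (der_aut ZG J)" "swan ZG J c = ?z" by simp_all
    obtain a \<tau> \<tau>' where \<tau>: "linear ZG B B \<tau>" "linear ZG B B \<tau>'" "\<And>b. b \<in> carrier B \<Longrightarrow> \<tau>' (\<tau> b) = b"
      "\<And>b. b \<in> carrier B \<Longrightarrow> \<tau> (\<tau>' b) = b" and ca: "c = der_map ZG J (diag a \<tau>)"
      by (rule unit_class_diag[OF c(1)]) blast
    note d = diag_rhom[OF \<tau>(1), of a]
    have "diag a \<tau> \<in> c" unfolding ca by (rule J.der_map_self[OF d])
    then obtain l n :: nat and i s where
      "linear ZG J (free_rmod ZG {..<l}) i"
      "\<And>\<theta>. linear ZG J (reg ZG) \<theta> \<Longrightarrow> \<exists>\<Theta>. linear ZG (free_rmod ZG {..<l}) (reg ZG) \<Theta> \<and> (\<forall>v\<in>carrier J. \<Theta> (i v) = \<theta> v)"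
      "linear ZG (dsum J (free_rmod ZG {..<l})) (free_rmod ZG {..<n}) s"
      "s ` carrier (dsum J (free_rmod ZG {..<l})) = carrier (free_rmod ZG {..<n})"
      "\<And>v w. v \<in> carrier J \<Longrightarrow> w \<in> carrier (free_rmod ZG {..<l}) \<Longrightarrow>
        s (v, w) = \<zero>\<^bsub>free_rmod ZG {..<n}\<^esub> \<longleftrightarrow> (\<exists>u\<in>carrier J. v = diag a \<tau> u \<and> w = \<ominus>\<^bsub>free_rmod ZG {..<l}\<^esub> i u)"
      by (rule J.swan_trivialD[OF ca d c(2)]) blast
    then interpret D: diag_presentation p m a \<tau> \<tau>' l n i s
      using \<tau> by (intro diag_presentation.intro diag_presentation_axioms.intro metacyclic_axioms) blast+
    have "int p dvd a - 1 \<or> int p dvd a - (- 1)" using D.a_cong by simp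
    then show "c \<in> der_map ZG J ` carrier (rmod_aut ZG J)"
      unfolding ca using diag_class_lift[OF \<tau>, of a 1] diag_class_lift[OF \<tau>, of a "-1"] by auto
  qed
qed

theorem theorem9:
  fixes p :: nat and m :: int
  assumes "prime p" and "odd p"
    and "ord (int p) m = p - 1"
  shows "full (Lam p m)
    (dsum (R_row p m 2)
      (right_ideal (Lam p m) (y_elem p m \<ominus>\<^bsub>Lam p m\<^esub> \<one>\<^bsub>Lam p m\<^esub>)))"
proof -
  interpret metacyclic p m by unfold_locales (fact assms)+
  have "y_elem p m = G.\<delta> yg"
    by (simp add: y_elem_def yg_def word_pow_def)
  then have "y_elem p m \<ominus>\<^bsub>ZG\<^esub> \<one>\<^bsub>ZG\<^esub> = b1"
    by (simp add: G.ZG_minus b1_eq)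
  then show ?thesis using full_J by (simp only: Lam_eq)
qed

end
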